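(* For every formal power series $L(z,\bar z,u)\colon\mathbb C^n_z\to\mathbb C^n_{\bar z}\times\mathbb C_w$ without constant terms corresponding to a strongly nondegenerate almost CR structure and every $r\in\mathbb R$, there exist unique formal power series $f(z,\bar z,u)\in\mathbb C^n$, $g(z,\bar z,u)\in\mathbb R$ and $\phi(z',\bar z',u')\in\mathbb R$ without constant and linear terms satisfying the Chern–Moser normalization $$\phi_{z'^au'^c}=0,\qquad \phi_{z'\bar z'u'^{c+1}}=0,\qquad \phi_{z'^{a+2}\bar z'u'^c}=0,$$ $$\mathbf{tr}(\phi_{z'^2\bar z'^2u'^c})=0,\qquad \mathbf{tr}^2(\phi_{z'^3\bar z'^2u'^c})=0,\qquad \mathbf{tr}^3(\phi_{z'^3\bar z'^3u'^c})=0$$ for all $a,c\ge0$ (all derivatives at $0$), and such that $g_{u^2}(0)=r$ and the almost CR structure given by $L$ admits a quasi CR embedding at $0$ as the hypersurface $M'\subset\mathbb C^n_{z'}\times\mathbb C_{w'}$ given by $$\operatorname{Im}w'=\phi(z',\bar z',\operatorname{Re}w')$$ via the map $(z,u)\mapsto(z+f(z,\bar z,u),u+g(z,\bar z,u))$, where $(z',u')$, $u'=\operatorname{Re}w'$, are regarded as intrinsic coordinates on $M'$. Furthermore, each partial derivative of $f$, $g$, $\phi$ at $0$ is given by a universal polynomial in $r$ and (finitely many) derivatives of $L$.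
   Context: Coordinates $(z,u)=(x+iy,u)\in\mathbb C^n\times\mathbb R$. The complexified tangent space at each point is identified with $\mathbb C^n_z\times\mathbb C^n_{\bar z}\times\mathbb C_w$ (coordinates $dz,d\bar z$, and $dw$ extending $du$). A formal power series $L(z,\bar z,u)=(L^{\bar z},L^w)$ with values complex-linear maps $\mathbb C^n_z\to\mathbb C^n_{\bar z}\times\mathbb C_w$ and $L(0)=0$ represents the formal hypersurface type almost CR structure whose $(1,0)$ bundle $H^{1,0}$ is the graph $(d\bar z,dw)=L(z,\bar z,u)\,dz$. The map $z'=z+f$, $u'=u+g$ transforms $L$ into the $L'=(L'^{\bar z'},L'^{w'})$ representing the transformed structure in the coordinates $(z',u')$: $$g_z+g_{\bar z}L^{\bar z}+(1+g_u)L^w=L'^{w'}(\mathrm{id}+f_z+f_{\bar z}L^{\bar z}+f_uL^w),$$ $$\bar f_z+(\mathrm{id}+\bar f_{\bar z})L^{\bar z}+\bar f_uL^w=L'^{\bar z'}(\mathrm{id}+f_z+f_{\bar z}L^{\bar z}+f_uL^w),$$ with $L'$ taken at $(z,\bar z,u)+(f,\bar f,g)(z,\bar z,u)$. The evaluation along the Euler vector field $e(z)=\sum_jz_j\frac{\partial}{\partial z_j}$ is $\tilde L:=L(z,\bar z,u)e(z)$. A quasi CR embedding at $0$ is a formal embedding as a hypersurface $M'\subset\mathbb C^n_{z'}\times\mathbb C_{w'}$ through $0$ with $T_0M'=\mathbb C^n\times\mathbb R$ such that the transformed almost CR structure on $M'$ and the CR structure induced on $M'$ by its inclusion in $\mathbb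 C^{n+1}$ have equal evaluations along the Euler vector field, with $z'$, $u'=\operatorname{Re}w'$ as coordinates on $M'$. (For $M'=\{\operatorname{Im}w'=\phi\}$ the induced structure is represented by $(0,\,i(1-i\phi_{u'})^{-1}\phi_{z'})$.) Strong nondegeneracy (at $0$): write $L^w_{\bar z}(\bar\xi;\eta)$, $L^w_z(\xi;\eta)$ for the derivatives of $L^w$ at $0$ in the direction $\bar\xi$ (in $\bar z$), resp. $\xi$ (in $z$), evaluated on $\eta\in\mathbb C^n_z$. The Levi form at $0$ is $\mathcal L(\bar\xi,\eta)=\frac1{2i}\big(L^w_{\bar z}(\bar\xi;\eta)-\overline{L^w_{\bar z}(\bar\eta;\xi)}\big)$ and the transversal component of the non-integrability tensor is $\mathcal N^w(\xi,\eta)=L^w_z(\xi;\eta)-L^w_z(\eta;\xi)$. The structure is strongly nondegenerate if $\mathcal L$ is nondegenerate and $6i\mathcal L(\bar\xi,\eta)+\mathcal N^w(\xi,\eta)=0$ for all $\eta$ implies $\xi=0$. For a formal power series $q(z,\bar z,u)$, $q_{z^a\bar z^bu^c}$ denotes the derivative at $0$ regarded as a multihomogeneous polynomial of degree $a$ in $z$, $b$ in $\bar z$, $c$ in $u$, i.e. $a!\,b!\,c!$ times the corresponding multihomogeneous component of $q$. Trace: if the Levi form at $0$ is $\mathcal L=\sum_{j,k}c_{jk}\,d\bar z_j\otimes dz_k$, then $\mathbf{tr}:=\sum_{j,k}c^{jk}\frac{\partial^2}{\partial\bar z_j\partial z_k}$, where $(c^{jk})$ is the inverse matrix of $(c_{jk})$,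 with the index convention $\sum_kc^{jk}c_{lk}=\delta_{jl}$. $\mathbf{tr}^l$ is $\mathbf{tr}$ applied $l$ times.
   Formalization: "Universal polynomial in r and derivatives of L" is proved as such a polynomial (conjugate derivatives allowed) over a nonvanishing polynomial in the Levi form and N^w at 0; no denominator is false: for Im w = c|z|²+2Re(a z² z̄), f_zz(0)=2a/c. *)

theory Defs
  imports "HOL-Analysis.Analysis" "HOL-Library.Multiset" "HOL-Library.Poly_Mapping"
begin

section \<open>Formal power series in several variables\<close>

text \<open>
  A monomial in variables of type \<open>'v\<close> is a finite multiset of variables; the formal power
  series \<open>q\<close> is the formal sum of \<open>coeff q M\<close> times the product of the members of \<open>M\<close>.
\<close>

typedef 'v mps = "UNIV :: ('v multiset \<Rightarrow> complex) set"
  morphisms coeff Mps by auto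

lemmas [simp] = Mps_inverse [OF UNIV_I]

lemma mps_eqI: "(\<And>M. coeff p M = coeff q M) \<Longrightarrow> p = q"
  by (metis coeff_inject ext)

lemma finite_multisets_bounded:
  assumes "finite S"
  shows "finite {A. set_mset A \<subseteq> S \<and> size A \<le> k}"
proof (rule finite_subset)
  show "{A. set_mset A \<subseteq> S \<and> size A \<le> k} \<subseteq> mset ` {xs. set xs \<subseteq> S \<and> length xs \<le> k}"
  proof
    fix A assume A: "A \<in> {A. set_mset A \<subseteq> S \<and> size A \<le> k}"
    obtain xs where "mset xs = A" using ex_mset by blast
    with A show "A \<in> mset ` {xs. set xs \<subseteq> S \<and> length xs \<le> k}" by (intro image_eqI[of _ _ xs]) auto
  qed
  show "finite (mset ` {xs. set xs \<subseteq> S \<and> length xs \<le> k})"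
    using finite_lists_length_le[OF assms] by simp
qed

lemma finite_submultisets [simp]: "finite {A. A \<subseteq># M}"
  by (rule finite_subset[OF _ finite_multisets_bounded[of "set_mset M" "size M"]])
    (auto dest: set_mset_mono size_mset_mono)

lemma sum_submultisets_diff:
  fixes h :: "'v multiset \<Rightarrow> 'v multiset \<Rightarrow> 'c::comm_monoid_add"
  shows "(\<Sum>A | A \<subseteq># M. h A (M - A)) = (\<Sum>(A, B) | A + B = M. h A B)"
proof (rule sum.reindex_bij_witness[where i = fst and j = "\<lambda>A. (A, M - A)"])
qed auto

lemma finite_msplits [simp]: "finite {(A, B). A + B = (M :: 'v multiset)}"
  by (rule finite_subset[where B = "{A. A \<subseteq># M} \<times> {A. A \<subseteq># M}"]) auto

instantiation mps :: (type) comm_ring_1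
begin

definition "0 = Mps (\<lambda>M. 0)"
definition "1 = Mps (\<lambda>M. if M = {#} then 1 else 0)"
definition "p + q = Mps (\<lambda>M. coeff p M + coeff q M)"
definition "- p = Mps (\<lambda>M. - coeff p M)"
definition "p - q = Mps (\<lambda>M. coeff p M - coeff q M)" for p q :: "'a mps"
definition "p * q = Mps (\<lambda>M. \<Sum>A | A \<subseteq># M. coeff p A * coeff q (M - A))"

lemma coeff_mps_times: "coeff (p * q) M = (\<Sum>(A, B) | A + B = M. coeff p A * coeff q B)"
  using sum_submultisets_diff[of "\<lambda>A B. coeff p A * coeff q B" M] by (simp add: times_mps_def)

instance
proof
  fix a b c :: "'a mps"
  show "a * b = b * a"
    unfolding times_mps_def
  proof (rule mps_eqI, simp)
    fix M
    show "(\<Sum>A | A \<subseteq># M. coeff a A * coeff b (M - A)) = (\<Sum>A | A \<subseteq># M. coeff b A * coeff a (M - A))"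
      by (rule sum.reindex_bij_witness[where i = "\<lambda>A. M - A" and j = "\<lambda>A. M - A"])
        (auto simp: double_diff subset_mset.diff_diff_right mult.commute)
  qed
  show "a * b * c = a * (b * c)"
  proof (rule mps_eqI)
    fix M
    have "coeff (a * b * c) M = (\<Sum>(D, C) | D + C = M. \<Sum>(A, B) | A + B = D. coeff a A * coeff b B * coeff c C)"
      by (auto simp: coeff_mps_times sum_distrib_right case_prod_beta intro!: sum.cong)
    also have "\<dots> = (\<Sum>((D, C), (A, B)) \<in> (SIGMA p : {(D, C). D + C = M}. {(A, B). A + B = fst p}).
        coeff a A * coeff b B * coeff c C)"
      by (subst sum.Sigma[symmetric]) (auto simp: case_prod_beta intro!: sum.cong)
    also have "\<dots> = (\<Sum>((A, E), (B, C)) \<in> (SIGMA p : {(A, E). A + E = M}. {(B, C). B + C = snd p}).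
        coeff a A * coeff b B * coeff c C)"
      by (rule sum.reindex_bij_witness
          [where i = "\<lambda>((A, E), (B, C)). ((A + B, C), (A, B))"
             and j = "\<lambda>((D, C), (A, B)). ((A, B + C), (B, C))"]) (auto simp: ac_simps)
    also have "\<dots> = (\<Sum>(A, E) | A + E = M. \<Sum>(B, C) | B + C = E. coeff a A * coeff b B * coeff c C)"
      by (subst sum.Sigma[symmetric]) (auto simp: case_prod_beta intro!: sum.cong)
    also have "\<dots> = coeff (a * (b * c)) M"
      by (auto simp: coeff_mps_times sum_distrib_left case_prod_beta mult.assoc intro!: sum.cong)
    finally show "coeff (a * b * c) M = coeff (a * (b * c)) M" .
  qed
  show "1 * a = a"
  proof (rule mps_eqI)
    fix M
    have "coeff (1 * a) M = (\<Sum>A | A \<subseteq># M. if A = {#} then coeff a M else 0)"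
      unfolding times_mps_def one_mps_def Mps_inverse[OF UNIV_I] by (rule sum.cong) auto
    also have "\<dots> = coeff a M" by (subst sum.delta) auto
    finally show "coeff (1 * a) M = coeff a M" .
  qed
  show "(a + b) * c = a * c + b * c"
    by (rule mps_eqI) (simp add: times_mps_def plus_mps_def distrib_right sum.distrib)
  show "(0 :: 'a mps) \<noteq> 1"
  proof
    assume "(0 :: 'a mps) = 1"
    then have "coeff (0 :: 'a mps) {#} = coeff (1 :: 'a mps) {#}" by (rule arg_cong)
    then show False by (simp add: zero_mps_def one_mps_def)
  qed
qed (auto intro!: mps_eqI simp: plus_mps_def zero_mps_def uminus_mps_def minus_mps_def)

end

definition mconst :: "complex \<Rightarrow> 'v mps" where
  "mconst c = Mps (\<lambda>M. if M = {#} then c else 0)"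

definition mvar :: "'v \<Rightarrow> 'v mps" where
  "mvar v = Mps (\<lambda>M. if M = {#v#} then 1 else 0)"

definition mderiv :: "'v \<Rightarrow> 'v mps \<Rightarrow> 'v mps" where
  "mderiv v q = Mps (\<lambda>M. of_nat (Suc (count M v)) * coeff q (add_mset v M))"

text \<open>The iterated partial derivative at 0 with respect to the variables in \<open>M\<close>:\<close>

definition deriv0 :: "'v multiset \<Rightarrow> 'v mps \<Rightarrow> complex" where
  "deriv0 M q = (\<Prod>v\<in>set_mset M. fact (count M v)) * coeff q M"

text \<open>
  Substitution of the series \<open>s v\<close> for the variables \<open>v\<close>. It is meaningful if every \<open>s v\<close> has
  zero constant term: then the product of \<open>s v\<close> over a monomial \<open>A\<close> has no terms of degree less
  than \<open>size A\<close>, so the truncation of the sum omits only zeros.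
\<close>

definition msubst :: "('v::finite \<Rightarrow> 'w mps) \<Rightarrow> 'v mps \<Rightarrow> 'w mps" where
  "msubst s q = Mps (\<lambda>M. \<Sum>A | size A \<le> size M. coeff q A * coeff (\<Prod>v\<in>#A. s v) M)"

lemma finite_monomials_size_le [simp]: "finite {A :: 'v::finite multiset. size A \<le> k}"
  using finite_multisets_bounded[of "UNIV :: 'v set" k] by simp

text \<open>The inverse; unique if it exists, and it exists iff the constant term is not zero.\<close>

definition minverse :: "'v mps \<Rightarrow> 'v mps" where
  "minverse q = (THE p. q * p = 1)"

definition no_constant_term :: "'v mps \<Rightarrow> bool" where
  "no_constant_term q \<longleftrightarrow> coeff q {#} = 0"

definition no_linear_terms :: "'v mps \<Rightarrow> bool" where
  "no_linear_terms q \<longleftrightarrow> (\<forall>v. coeff q {#v#} = 0)"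

lemma coeff_mult_empty: "coeff (p * q) {#} = coeff p {#} * coeff q {#}"
  by (simp add: times_mps_def)

lemma coeff_power_eq_0:
  assumes "no_constant_term x" and "size M < k"
  shows "coeff (x ^ k) M = 0"
  using assms(2)
proof (induction k arbitrary: M)
  case 0
  then show ?case by simp
next
  case (Suc k)
  have "coeff x A * coeff (x ^ k) (M - A) = 0" if "A \<subseteq># M" for A
  proof (cases "A = {#}")
    case True
    then show ?thesis using assms(1) by (simp add: no_constant_term_def)
  next
    case False
    then have "size (M - A) < k"
      using Suc.prems that
      using size_mset_mono[OF that] by (simp add: size_Diff_submset nonempty_has_size)
    then show ?thesis using Suc.IH by simp
  qed
  then show ?case
    unfolding power_Suc times_mps_def Mps_inverse[OF UNIV_I] by (intro sum.neutral) simp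
qed

lemma coeff_sum_mps: "coeff (\<Sum>i\<in>I. f i) M = (\<Sum>i\<in>I. coeff (f i) M)"
  by (induction I rule: infinite_finite_induct) (auto simp: zero_mps_def plus_mps_def)

lemma mps_inverse_exists:
  assumes "coeff q {#} \<noteq> 0"
  shows "\<exists>!p. q * p = 1"
proof -
  define c where "c = coeff q {#}"
  have c: "mconst c * mconst (inverse c) = (1 :: 'a mps)"
  proof (rule mps_eqI)
    fix M :: "'a multiset"
    have "coeff (mconst c * mconst (inverse c)) M =
        (\<Sum>A | A \<subseteq># M. if A = {#} then (if M = {#} then 1 else 0) else 0)"
      unfolding times_mps_def mconst_def Mps_inverse[OF UNIV_I]
    proof (rule sum.cong)
      show "(if A = {#} then c else 0) * (if M - A = {#} then inverse c else 0) =
          (if A = {#} then (if M = {#} then 1 else 0) else 0)" if "A \<in> {A. A \<subseteq># M}" for A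
        using assms by (cases "A = {#}") (simp_all add: c_def)
    qed simp
    also have "\<dots> = coeff 1 M" by (subst sum.delta) (auto simp: one_mps_def)
    finally show "coeff (mconst c * mconst (inverse c)) M = coeff 1 M" .
  qed
  define x where "x = 1 - mconst (inverse c) * q"
  have x: "no_constant_term x"
    using assms
    by (simp add: no_constant_term_def x_def minus_mps_def one_mps_def coeff_mult_empty mconst_def c_def)
  define y where "y = Mps (\<lambda>M. coeff (\<Sum>k\<le>size M. x ^ k) M)"
  have y: "coeff y A = coeff (\<Sum>k\<le>n. x ^ k) A" if "size A \<le> n" for A n
  proof -
    have "(\<Sum>k\<le>n. coeff (x ^ k) A) = (\<Sum>k\<le>size A. coeff (x ^ k) A)"
      using that by (intro sum.mono_neutral_right) (auto intro: coeff_power_eq_0[OF x])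
    then show ?thesis by (simp add: y_def coeff_sum_mps)
  qed
  have "(1 - x) * y = 1"
  proof (rule mps_eqI)
    fix M
    have "coeff ((1 - x) * y) M = coeff ((1 - x) * (\<Sum>k\<le>size M. x ^ k)) M"
      unfolding times_mps_def Mps_inverse[OF UNIV_I]
    proof (rule sum.cong)
      show "coeff (1 - x) A * coeff y (M - A) =
          coeff (1 - x) A * coeff (\<Sum>k\<le>size M. x ^ k) (M - A)" for A
        using y[of "M - A" "size M"] by (simp add: size_mset_mono)
    qed simp
    also have "(1 - x) * (\<Sum>k\<le>size M. x ^ k) = 1 - x ^ Suc (size M)"
      by (metis one_diff_power_eq lessThan_Suc_atMost)
    also have "coeff \<dots> M = coeff 1 M"
      using coeff_power_eq_0[OF x, of M "Suc (size M)"] by (simp add: minus_mps_def del: power_Suc)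
    finally show "coeff ((1 - x) * y) M = coeff 1 M" .
  qed
  then have "q * (mconst (inverse c) * y) = 1"
    by (simp add: x_def ac_simps)
  moreover have "p = p'" if "q * p = 1" "q * p' = 1" for p p'
    by (metis that mult.assoc mult.commute mult.right_neutral)
  ultimately show ?thesis by blast
qed

corollary mult_minverse: "coeff q {#} \<noteq> 0 \<Longrightarrow> q * minverse q = 1"
  unfolding minverse_def by (rule theI'[OF mps_inverse_exists])


section \<open>Series in \<open>z\<close>, its conjugate and \<open>u\<close>\<close>

text \<open>In comments, \<open>zb\<close> denotes the conjugate of \<open>z\<close>.\<close>

datatype 'n crvar = Z 'n | Zb 'n | U

lemma UNIV_crvar: "UNIV = insert U (range Z \<union> range Zb)"
  by (auto simp: image_iff) (metis crvar.exhaust)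

instance crvar :: (finite) finite
  by standard (simp add: UNIV_crvar)

type_synonym 'n cseries = "'n crvar mps"

fun conj_var :: "'n crvar \<Rightarrow> 'n crvar" where
  "conj_var (Z j) = Zb j"
| "conj_var (Zb j) = Z j"
| "conj_var U = U"

definition sconj :: "'n cseries \<Rightarrow> 'n cseries" where
  "sconj q = Mps (\<lambda>M. cnj (coeff q (image_mset conj_var M)))"

definition real_series :: "'n cseries \<Rightarrow> bool" where
  "real_series q \<longleftrightarrow> sconj q = q"

text \<open>\<open>multideriv a b c q\<close> is the derivative at 0 of multidegree \<open>(a, b, c)\<close> in \<open>(z, zb, u)\<close>,
  regarded as a multihomogeneous polynomial.\<close>

definition multideriv :: "nat \<Rightarrow> nat \<Rightarrow> nat \<Rightarrow> 'n cseries \<Rightarrow> 'n cseries" where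
  "multideriv a b c q = Mps (\<lambda>M.
     if size (filter_mset (\<lambda>v. v \<in> range Z) M) = a \<and>
        size (filter_mset (\<lambda>v. v \<in> range Zb) M) = b \<and> count M U = c
     then fact a * fact b * fact c * coeff q M else 0)"

definition euler :: "'n cseries ^ 'n" where
  "euler = (\<chi> j. mvar (Z j))"


section \<open>Almost CR structures\<close>

text \<open>
  The components of \<open>L\<close>: a matrix (row index in \<open>zb\<close>-space, column index in \<open>z\<close>-space) and a
  row vector. The \<open>(1,0)\<close> bundle is given by \<open>d zb = Lzb dz\<close>, \<open>dw = Lw dz\<close>.
\<close>

record 'n cr_rep =
  Lzb :: "'n cseries ^ 'n ^ 'n"
  Lw :: "'n cseries ^ 'n"

definition almost_cr :: "'n::finite cr_rep \<Rightarrow> bool" where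
  "almost_cr L \<longleftrightarrow>
     (\<forall>j k. no_constant_term (Lzb L $ j $ k)) \<and> (\<forall>k. no_constant_term (Lw L $ k))"

text \<open>The map \<open>(z, u) \<mapsto> (z + f, u + g)\<close>, complexified, as a substitution:\<close>

fun shift :: "'n::finite cseries ^ 'n \<Rightarrow> 'n cseries \<Rightarrow> 'n crvar \<Rightarrow> 'n cseries" where
  "shift f g (Z j) = mvar (Z j) + f $ j"
| "shift f g (Zb j) = mvar (Zb j) + sconj (f $ j)"
| "shift f g U = mvar U + g"

definition formal_diffeo :: "'n::finite cseries ^ 'n \<Rightarrow> 'n cseries \<Rightarrow> bool" where
  "formal_diffeo f g \<longleftrightarrow> real_series g \<and> (\<forall>v. no_constant_term (shift f g v)) \<and>
     invertible ((\<chi> v w. coeff (shift f g v) {#w#}) :: complex ^ 'n crvar ^ 'n crvar)"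

text \<open>The row vector \<open>q\<^sub>z + q\<^sub>z\<^sub>b Lzb + q\<^sub>u Lw\<close>:\<close>

definition dH :: "'n::finite cr_rep \<Rightarrow> 'n cseries \<Rightarrow> 'n cseries ^ 'n" where
  "dH L q = (\<chi> k. mderiv (Z k) q + (\<Sum>j\<in>UNIV. mderiv (Zb j) q * Lzb L $ j $ k)
                 + mderiv U q * Lw L $ k)"

definition transforms_to ::
  "'n::finite cseries ^ 'n \<Rightarrow> 'n cseries \<Rightarrow> 'n cr_rep \<Rightarrow> 'n cr_rep \<Rightarrow> bool" where
  "transforms_to f g L L' \<longleftrightarrow>
     (let J = (\<chi> m. axis m 1 + dH L (f $ m)) :: 'n cseries ^ 'n ^ 'n in
      dH L g + Lw L = (\<chi> m. msubst (shift f g) (Lw L' $ m)) v* J \<and>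
      (\<chi> j. dH L (sconj (f $ j)) + Lzb L $ j)
        = (\<chi> j m. msubst (shift f g) (Lzb L' $ j $ m)) ** J)"

text \<open>
  The structure induced on \<open>Im w = \<phi>(z, zb, Re w)\<close> by its inclusion: \<open>(1,0)\<close> vectors annihilate
  \<open>d zb\<close> and the differential \<open>du - i d\<phi>\<close> of the conjugate of \<open>w\<close>, so
  \<open>(1 - i \<phi>\<^sub>u) du = i \<phi>\<^sub>z dz\<close> on them. The field \<open>Lw\<close> represents \<open>du\<close>.
\<close>

definition induced :: "'n::finite cseries \<Rightarrow> 'n cr_rep" where
  "induced \<phi> = \<lparr>Lzb = 0,
     Lw = (\<chi> k. mconst \<i> * minverse (1 - mconst \<i> * mderiv U \<phi>) * mderiv (Z k) \<phi>)\<rparr>"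

definition euler_eval :: "'n::finite cr_rep \<Rightarrow> ('n cseries ^ 'n) \<times> 'n cseries" where
  "euler_eval L = (Lzb L *v euler, \<Sum>k\<in>UNIV. Lw L $ k * euler $ k)"

definition quasi_CR_embedding ::
  "'n::finite cr_rep \<Rightarrow> 'n cseries ^ 'n \<Rightarrow> 'n cseries \<Rightarrow> 'n cseries \<Rightarrow> bool" where
  "quasi_CR_embedding L f g \<phi> \<longleftrightarrow>
     formal_diffeo f g \<and>
     real_series \<phi> \<and> no_constant_term \<phi> \<and> no_linear_terms \<phi> \<and>
     (\<exists>L'. almost_cr L' \<and> transforms_to f g L L' \<and> euler_eval L' = euler_eval (induced \<phi>))"


section \<open>Strong nondegeneracy\<close>

text \<open>\<open>Lw_zb L \<xi> \<eta>\<close> is the derivative of \<open>L\<^sup>w\<close> at 0 in the direction of the conjugate of \<open>\<xi>\<close>,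
  evaluated on \<open>\<eta>\<close>; it is conjugate linear in \<open>\<xi>\<close>, and so is \<open>levi L \<xi> \<eta>\<close>.\<close>

definition Lw_zb :: "'n::finite cr_rep \<Rightarrow> complex ^ 'n \<Rightarrow> complex ^ 'n \<Rightarrow> complex" where
  "Lw_zb L \<xi> \<eta> = (\<Sum>k\<in>UNIV. \<Sum>j\<in>UNIV. coeff (Lw L $ k) {#Zb j#} * cnj (\<xi> $ j) * \<eta> $ k)"

definition Lw_z :: "'n::finite cr_rep \<Rightarrow> complex ^ 'n \<Rightarrow> complex ^ 'n \<Rightarrow> complex" where
  "Lw_z L \<xi> \<eta> = (\<Sum>k\<in>UNIV. \<Sum>j\<in>UNIV. coeff (Lw L $ k) {#Z j#} * \<xi> $ j * \<eta> $ k)"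

definition levi :: "'n::finite cr_rep \<Rightarrow> complex ^ 'n \<Rightarrow> complex ^ 'n \<Rightarrow> complex" where
  "levi L \<xi> \<eta> = 1 / (2 * \<i>) * (Lw_zb L \<xi> \<eta> - cnj (Lw_zb L \<eta> \<xi>))"

definition Nw :: "'n::finite cr_rep \<Rightarrow> complex ^ 'n \<Rightarrow> complex ^ 'n \<Rightarrow> complex" where
  "Nw L \<xi> \<eta> = Lw_z L \<xi> \<eta> - Lw_z L \<eta> \<xi>"

definition strongly_nondegenerate :: "'n::finite cr_rep \<Rightarrow> bool" where
  "strongly_nondegenerate L \<longleftrightarrow>
     (\<forall>\<xi>. (\<forall>\<eta>. levi L \<xi> \<eta> = 0) \<longrightarrow> \<xi> = 0) \<and>
     (\<forall>\<xi>. (\<forall>\<eta>. 6 * \<i> * levi L \<xi> \<eta> + Nw L \<xi> \<eta> = 0) \<longrightarrow> \<xi> = 0)"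


section \<open>Chern-Moser normalization\<close>

definition levi_matrix :: "'n::finite cr_rep \<Rightarrow> complex ^ 'n ^ 'n" where
  "levi_matrix L = (\<chi> j k. levi L (axis j 1) (axis k 1))"

text \<open>The convention \<open>\<Sum>\<^sub>k c\<^sup>j\<^sup>k c\<^sub>l\<^sub>k = \<delta>\<^sub>j\<^sub>l\<close> makes \<open>(c\<^sup>j\<^sup>k)\<close> the inverse of the transposed matrix.\<close>

definition tr :: "'n::finite cr_rep \<Rightarrow> 'n cseries \<Rightarrow> 'n cseries" where
  "tr L q = (\<Sum>j\<in>UNIV. \<Sum>k\<in>UNIV.
     mconst (matrix_inv (transpose (levi_matrix L)) $ j $ k) * mderiv (Zb j) (mderiv (Z k) q))"

definition chern_moser :: "'n::finite cr_rep \<Rightarrow> 'n cseries \<Rightarrow> bool" where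
  "chern_moser L \<phi> \<longleftrightarrow> (\<forall>a c.
     multideriv a 0 c \<phi> = 0 \<and>
     multideriv 1 1 (c + 1) \<phi> = 0 \<and>
     multideriv (a + 2) 1 c \<phi> = 0 \<and>
     tr L (multideriv 2 2 c \<phi>) = 0 \<and>
     (tr L ^^ 2) (multideriv 3 2 c \<phi>) = 0 \<and>
     (tr L ^^ 3) (multideriv 3 3 c \<phi>) = 0)"

definition normalizing ::
  "'n::finite cr_rep \<Rightarrow> real \<Rightarrow> 'n cseries ^ 'n \<Rightarrow> 'n cseries \<Rightarrow> 'n cseries \<Rightarrow> bool" where
  "normalizing L r f g \<phi> \<longleftrightarrow>
     (\<forall>j. no_constant_term (f $ j) \<and> no_linear_terms (f $ j)) \<and>
     real_series g \<and> no_constant_term g \<and> no_linear_terms g \<and>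
     real_series \<phi> \<and> no_constant_term \<phi> \<and> no_linear_terms \<phi> \<and>
     chern_moser L \<phi> \<and>
     deriv0 {#U, U#} g = of_real r \<and>
     quasi_CR_embedding L f g \<phi>"


section \<open>Universal expressions\<close>

text \<open>Complex polynomials in indeterminates of type \<open>'x\<close>, again with multisets as monomials:\<close>

type_synonym 'x cpoly = "'x multiset \<Rightarrow>\<^sub>0 complex"

definition poly_eval :: "'x cpoly \<Rightarrow> ('x \<Rightarrow> complex) \<Rightarrow> complex" where
  "poly_eval P \<rho> = (\<Sum>m\<in>Poly_Mapping.keys P. Poly_Mapping.lookup P m * (\<Prod>x\<in>#m. \<rho> x))"

text \<open>
  Since \<open>L\<close> is complex valued and the transformation rule involves conjugates, ``polynomial in the
  derivatives of \<open>L\<close>'' means a polynomial in these derivatives and their conjugates.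
\<close>

datatype 'n jet_var =
    Param
  | DLzb 'n 'n "'n crvar multiset"
  | DLzb_cnj 'n 'n "'n crvar multiset"
  | DLw 'n "'n crvar multiset"
  | DLw_cnj 'n "'n crvar multiset"

fun jet_value :: "'n::finite cr_rep \<Rightarrow> real \<Rightarrow> 'n jet_var \<Rightarrow> complex" where
  "jet_value L r Param = of_real r"
| "jet_value L r (DLzb j k M) = deriv0 M (Lzb L $ j $ k)"
| "jet_value L r (DLzb_cnj j k M) = cnj (deriv0 M (Lzb L $ j $ k))"
| "jet_value L r (DLw k M) = deriv0 M (Lw L $ k)"
| "jet_value L r (DLw_cnj k M) = cnj (deriv0 M (Lw L $ k))"

datatype 'n tensor_var = Levi 'n 'n | Nij 'n 'n | Nij_cnj 'n 'n

fun tensor_value :: "'n::finite cr_rep \<Rightarrow> 'n tensor_var \<Rightarrow> complex" where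
  "tensor_value L (Levi j k) = levi L (axis j 1) (axis k 1)"
| "tensor_value L (Nij j k) = Nw L (axis j 1) (axis k 1)"
| "tensor_value L (Nij_cnj j k) = cnj (Nw L (axis j 1) (axis k 1))"

text \<open>
  A quantity \<open>F\<close> attached to the normalization is universal if it is given by one polynomial in
  \<open>r\<close> and finitely many derivatives of \<open>L\<close>, the same for all \<open>L\<close> and \<open>r\<close>, up to a denominator that
  is itself a universal polynomial in the components of the Levi form and of the transversal
  non-integrability tensor at 0 only and vanishes for no strongly nondegenerate structure. Thus
  once these two tensors are given, \<open>F\<close> is a polynomial in \<open>r\<close> and the derivatives of \<open>L\<close>.
  The denominator cannot be dispensed with: already in the real hypersurface
  \<open>Im w = c z zb + 2 Re (a z\<^sup>2 zb)\<close> of \<open>\<complex>\<^sup>2\<close> the derivative \<open>f\<^sub>z\<^sub>z(0)\<close> is \<open>2 a / c\<close>.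
\<close>

definition universal ::
  "('n::finite cseries ^ 'n \<Rightarrow> 'n cseries \<Rightarrow> 'n cseries \<Rightarrow> complex) \<Rightarrow> bool" where
  "universal F \<longleftrightarrow> (\<exists>(P :: 'n jet_var cpoly) (Q :: 'n tensor_var cpoly).
     (\<forall>L. almost_cr L \<longrightarrow> strongly_nondegenerate L \<longrightarrow> poly_eval Q (tensor_value L) \<noteq> 0) \<and>
     (\<forall>L r f g \<phi>. almost_cr L \<longrightarrow> strongly_nondegenerate L \<longrightarrow> normalizing L r f g \<phi> \<longrightarrow>
        F f g \<phi> = poly_eval P (jet_value L r) / poly_eval Q (tensor_value L)))"

end

theory Submission
  imports Defs
begin

text \<open>
  Describe the normalizing map by its inverse \<open>z = z' + F\<close>, \<open>u = u' + G\<close>, and let \<open>V\<close> be the field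
  \<open>e + \<theta> \<partial>\<^sub>u\<close> on \<open>M'\<close> of type \<open>(1,0)\<close> over the Euler field. The embedding condition becomes
  \<open>V (conj F) = Lzb (z + V F)\<close>, \<open>\<theta> + V G = Lw (z + V F)\<close>, with \<open>L\<close> taken at the image point. With
  weight 1 for \<open>z\<close>, \<open>zb\<close> and weight 2 for \<open>u\<close>, the part of lowest weight of these equations is
  linear in \<open>F\<close> and \<open>W = G + \<i> \<phi>\<close> and only involves the first derivatives of \<open>Lw\<close>. Sorted by
  bidegree in \<open>(z, zb)\<close>, the linear equations together with the Chern--Moser conditions are solved
  one component after the other, by inverting the operators \<open>tr\<^sup>k h\<^sup>k\<close> by means of
  \<open>[tr, h] = n + e + eb\<close>, where \<open>h\<close> is the Levi form. Strong nondegeneracy enters in bidegree \<open>(3,2)\<close>,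
  where the linear form \<open>N(\<xi>, z) + 6 \<i> \<L>(\<xi>, z)\<close> has to be prescribed. The remaining terms raise
  the weight, so that the solution is the fixed point of a contraction. All operators involved
  preserve the series with universal coefficients, and hence so does the fixed point.
\<close>

section \<open>Formal power series\<close>

text \<open>With the inverse map only the known \<open>L\<close> is taken at a moved point, and
  \<open>\<phi>\<close> is never composed with an unknown map. The structure \<open>L'\<close> can
  be eliminated because the condition concerns a single direction. The weight is dictated by the
  model field \<open>e + \<i> h \<partial>u\<close>: both summands preserve it, and every inversion
  is neutral, since \<open>tr\<close> and \<open>\<partial>u\<close> lower the weight by 2 while
  \<open>h\<close> and integration in \<open>u\<close> raise it by 2. So \<open>F\<close> stays
  exactly one weight below \<open>W\<close>. The integrations leave finitely many constants: those
  of \<open>F\<close> are excluded with the constant and linear terms, and of the coefficients of 1,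
  u and u^2 in the real part of \<open>W\<close> only the last remains free; it carries
  \<open>r\<close>. In bidegree (3,2) the combination N(\<xi>, z) + 6 i \<L>(\<xi>, z) is what is
  left after the lower components have been eliminated; this is the origin of the 6 i. It is only
  real linear in \<xi>, so it is inverted after complexification. The determinants of that
  complexification and of the Levi matrix are, up to numerical factors, the only source of
  denominators.\<close>

lemma coeff_0 [simp]: "coeff 0 M = 0"
  by (simp add: zero_mps_def)

lemma coeff_plus [simp]: "coeff (p + q) M = coeff p M + coeff q M"
  by (simp add: plus_mps_def)

lemma coeff_minus [simp]: "coeff (p - q) M = coeff p M - coeff q M"
  by (simp add: minus_mps_def)

lemma coeff_uminus [simp]: "coeff (- p) M = - coeff p M"
  by (simp add: uminus_mps_def)

lemma coeff_1: "coeff 1 M = (if M = {#} then 1 else 0)"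
  by (simp add: one_mps_def)

lemma coeff_mconst: "coeff (mconst c) M = (if M = {#} then c else 0)"
  by (simp add: mconst_def)

lemma coeff_mvar: "coeff (mvar v) M = (if M = {#v#} then 1 else 0)"
  by (simp add: mvar_def)

lemma coeff_mderiv: "coeff (mderiv v q) M = of_nat (Suc (count M v)) * coeff q (add_mset v M)"
  by (simp add: mderiv_def)

lemma coeff_times: "coeff (p * q) M = (\<Sum>A | A \<subseteq># M. coeff p A * coeff q (M - A))"
  by (simp add: times_mps_def)

lemma mps_eq_iff: "p = q \<longleftrightarrow> (\<forall>M. coeff p M = coeff q M)"
  using mps_eqI by blast

text \<open>Scalars are kept apart from constant series, so that they are collected by
  simplification and linear identities can be checked coefficient by coefficient.\<close>

definition csmul :: "complex \<Rightarrow> 'v mps \<Rightarrow> 'v mps" (infixr "\<cdot>" 75) where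
  "c \<cdot> q = Mps (\<lambda>M. c * coeff q M)"

lemma coeff_csmul [simp]: "coeff (c \<cdot> q) M = c * coeff q M"
  by (simp add: csmul_def)

lemma mconst_times: "mconst c * q = c \<cdot> q"
proof (rule mps_eqI)
  fix M
  have "coeff (mconst c * q) M = (\<Sum>A | A \<subseteq># M. if A = {#} then c * coeff q M else 0)"
    unfolding coeff_times coeff_mconst by (rule sum.cong) auto
  also have "\<dots> = c * coeff q M" by (subst sum.delta) auto
  finally show "coeff (mconst c * q) M = coeff (c \<cdot> q) M" by simp
qed

lemma csmul_mult_left [simp]: "(c \<cdot> p) * q = c \<cdot> (p * q)"
  by (simp add: mconst_times[symmetric] mult.assoc)

lemma csmul_mult_right [simp]: "p * (c \<cdot> q) = c \<cdot> (p * q)"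
  by (simp add: mconst_times[symmetric] mult.left_commute)

lemma csmul_csmul [simp]: "a \<cdot> (b \<cdot> q) = (a * b) \<cdot> q"
  and csmul_0 [simp]: "0 \<cdot> q = 0"
  and csmul_zero [simp]: "a \<cdot> (0 :: 'v mps) = 0"
  and csmul_1 [simp]: "1 \<cdot> q = q"
  and csmul_add: "a \<cdot> (p + q) = a \<cdot> p + a \<cdot> q"
  and csmul_diff: "a \<cdot> (p - q) = a \<cdot> p - a \<cdot> q"
  and csmul_minus: "a \<cdot> (- q) = - (a \<cdot> q)"
  and csmul_uminus: "(- a) \<cdot> q = - (a \<cdot> q)"
  and csmul_add_left: "(a + b) \<cdot> q = a \<cdot> q + b \<cdot> q"
  and csmul_diff_left: "(a - b) \<cdot> q = a \<cdot> q - b \<cdot> q"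
  by (rule mps_eqI; simp add: algebra_simps)+

lemma csmul_sum: "a \<cdot> (\<Sum>i\<in>I. f i) = (\<Sum>i\<in>I. a \<cdot> f i)"
  by (rule mps_eqI) (simp add: coeff_sum_mps sum_distrib_left)

lemma coeff_mvar_times: "coeff (mvar v * q) M = (if v \<in># M then coeff q (M - {#v#}) else 0)"
proof -
  have "coeff (mvar v * q) M = (\<Sum>A | A \<subseteq># M. if A = {#v#} then coeff q (M - {#v#}) else 0)"
    unfolding coeff_times coeff_mvar by (rule sum.cong) auto
  also have "\<dots> = (if v \<in># M then coeff q (M - {#v#}) else 0)"
    by (subst sum.delta) auto
  finally show ?thesis .
qed

lemma mderiv_add: "mderiv v (p + q) = mderiv v p + mderiv v q"
  and mderiv_diff: "mderiv v (p - q) = mderiv v p - mderiv v q"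
  and mderiv_minus: "mderiv v (- q) = - mderiv v q"
  and mderiv_csmul [simp]: "mderiv v (c \<cdot> q) = c \<cdot> mderiv v q"
  and mderiv_0 [simp]: "mderiv v 0 = 0"
  by (rule mps_eqI; simp add: coeff_mderiv algebra_simps)+

lemma mderiv_sum: "mderiv v (\<Sum>i\<in>I. f i) = (\<Sum>i\<in>I. mderiv v (f i))"
  by (induction I rule: infinite_finite_induct) (auto simp: mderiv_add)

lemma mderiv_mvar: "mderiv v (mvar w) = (if v = w then 1 else 0)"
  by (rule mps_eqI) (auto simp: coeff_mderiv coeff_mvar coeff_1 add_mset_eq_single)

lemma mderiv_1 [simp]: "mderiv v 1 = 0"
  by (rule mps_eqI) (auto simp: coeff_mderiv coeff_1)

lemma mderiv_commute: "mderiv v (mderiv w q) = mderiv w (mderiv v q)"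
  by (rule mps_eqI) (auto simp: coeff_mderiv add_mset_commute)

text \<open>One factor \<open>v\<close> is moved out of \<open>A\<close>; splittings in which
  \<open>v\<close> does not occur in \<open>A\<close> are annihilated by \<open>count A v\<close>.
  Applied to either factor of a product it yields one half of the product rule.\<close>

lemma sum_splits_count:
  fixes h :: "'v multiset \<Rightarrow> 'v multiset \<Rightarrow> complex"
  shows "(\<Sum>(A, B) | A + B = add_mset v M. of_nat (count A v) * h A B) =
    (\<Sum>(A, B) | A + B = M. of_nat (Suc (count A v)) * h (add_mset v A) B)"
proof -
  have "(\<Sum>(A, B) | A + B = add_mset v M. of_nat (count A v) * h A B) =
     (\<Sum>(A, B) | A + B = add_mset v M \<and> v \<in># A. of_nat (count A v) * h A B)"
    by (rule sum.mono_neutral_right) (auto simp: not_in_iff)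
  also have "\<dots> = (\<Sum>(A, B) | A + B = M. of_nat (Suc (count A v)) * h (add_mset v A) B)"
    by (rule sum.reindex_bij_witness[where i = "\<lambda>(A, B). (add_mset v A, B)"
          and j = "\<lambda>(A, B). (A - {#v#}, B)"]) auto
  finally show ?thesis .
qed

lemma mderiv_mult: "mderiv v (p * q) = mderiv v p * q + p * mderiv v q"
proof (rule mps_eqI)
  fix M
  have "coeff (mderiv v (p * q)) M =
     (\<Sum>(A, B) | A + B = add_mset v M. of_nat (count (A + B) v) * (coeff p A * coeff q B))"
    unfolding coeff_mderiv coeff_mps_times sum_distrib_left
  proof (rule sum.cong)
    fix x assume "x \<in> {(A, B). A + B = add_mset v M}"
    then have "fst x + snd x = add_mset v M" by auto
    then have "count (fst x + snd x) v = Suc (count M v)" by simp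
    then show "of_nat (Suc (count M v)) * (case x of (A, B) \<Rightarrow> coeff p A * coeff q B) =
       (case x of (A, B) \<Rightarrow> of_nat (count (A + B) v) * (coeff p A * coeff q B))"
      by (simp only: case_prod_beta)
  qed simp
  also have "\<dots> = (\<Sum>(A, B) | A + B = add_mset v M. of_nat (count A v) * (coeff p A * coeff q B))
      + (\<Sum>(A, B) | A + B = add_mset v M. of_nat (count B v) * (coeff p A * coeff q B))"
    by (simp add: sum.distrib[symmetric] case_prod_beta algebra_simps)
  also have "(\<Sum>(A, B) | A + B = add_mset v M. of_nat (count B v) * (coeff p A * coeff q B))
     = (\<Sum>(A, B) | A + B = add_mset v M. of_nat (count A v) * (coeff p B * coeff q A))"
    by (rule sum.reindex_bij_witness[where i = "\<lambda>(A, B). (B, A)" and j = "\<lambda>(A, B). (B, A)"])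
      (auto simp: add.commute)
  also have "\<dots> = (\<Sum>(A, B) | A + B = M. of_nat (Suc (count A v)) * (coeff p B * coeff q (add_mset v A)))"
    by (rule sum_splits_count[where h = "\<lambda>A B. coeff p B * coeff q A"])
  also have "\<dots> = (\<Sum>(A, B) | A + B = M. of_nat (Suc (count B v)) * (coeff p A * coeff q (add_mset v B)))"
    by (rule sum.reindex_bij_witness[where i = "\<lambda>(A, B). (B, A)" and j = "\<lambda>(A, B). (B, A)"])
      (auto simp: add.commute)
  also have "(\<Sum>(A, B) | A + B = add_mset v M. of_nat (count A v) * (coeff p A * coeff q B))
     = (\<Sum>(A, B) | A + B = M. of_nat (Suc (count A v)) * (coeff p (add_mset v A) * coeff q B))"
    by (rule sum_splits_count[where h = "\<lambda>A B. coeff p A * coeff q B"])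
  also have "\<dots> = coeff (mderiv v p * q) M"
    unfolding coeff_mps_times coeff_mderiv by (rule sum.cong) (auto simp: mult_ac)
  also have "(\<Sum>(A, B) | A + B = M. of_nat (Suc (count B v)) * (coeff p A * coeff q (add_mset v B))) =
      coeff (p * mderiv v q) M"
    unfolding coeff_mps_times coeff_mderiv by (rule sum.cong) (auto simp: mult_ac)
  finally show "coeff (mderiv v (p * q)) M = coeff (mderiv v p * q + p * mderiv v q) M"
    by simp
qed

subsection \<open>Weights\<close>

definition wt :: "('v \<Rightarrow> nat) \<Rightarrow> 'v multiset \<Rightarrow> nat" where
  "wt \<omega> M = (\<Sum>v\<in>#M. \<omega> v)"

lemma wt_simps [simp]:
  "wt \<omega> {#} = 0" "wt \<omega> (add_mset v M) = \<omega> v + wt \<omega> M" "wt \<omega> (A + B) = wt \<omega> A + wt \<omega> B"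
  by (simp_all add: wt_def)

lemma wt_1 [simp]: "wt (\<lambda>_. Suc 0) M = size M"
  by (induction M) auto

lemma size_le_wt: "(\<And>v. 0 < \<omega> v) \<Longrightarrow> size M \<le> wt \<omega> M"
proof (induction M)
  case (add v M)
  have "size M \<le> wt \<omega> M" by (rule add.IH) (rule add.prems)
  moreover have "Suc 0 \<le> \<omega> v" by (rule Suc_leI) (rule add.prems)
  ultimately show ?case by simp
qed simp

text \<open>The filtration by weight; for constant weight 1 it is the order of vanishing. Series are
  proved equal by showing that their difference lies in every step of the filtration.\<close>

definition wge :: "('v \<Rightarrow> nat) \<Rightarrow> nat \<Rightarrow> 'v mps \<Rightarrow> bool" where
  "wge \<omega> k q \<longleftrightarrow> (\<forall>M. wt \<omega> M < k \<longrightarrow> coeff q M = 0)"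

lemma wgeI: "(\<And>M. wt \<omega> M < k \<Longrightarrow> coeff q M = 0) \<Longrightarrow> wge \<omega> k q"
  by (simp add: wge_def)

lemma wgeD: "wge \<omega> k q \<Longrightarrow> wt \<omega> M < k \<Longrightarrow> coeff q M = 0"
  by (simp add: wge_def)

lemma wge_mono: "wge \<omega> k q \<Longrightarrow> j \<le> k \<Longrightarrow> wge \<omega> j q"
  by (auto simp: wge_def)

lemma wge_0 [simp]: "wge \<omega> 0 q"
  and wge_zero [simp]: "wge \<omega> k 0"
  by (auto simp: wge_def)

lemma wge_add: "wge \<omega> k p \<Longrightarrow> wge \<omega> k q \<Longrightarrow> wge \<omega> k (p + q)"
  and wge_diff: "wge \<omega> k p \<Longrightarrow> wge \<omega> k q \<Longrightarrow> wge \<omega> k (p - q)"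
  and wge_minus: "wge \<omega> k p \<Longrightarrow> wge \<omega> k (- p)"
  and wge_csmul: "wge \<omega> k p \<Longrightarrow> wge \<omega> k (c \<cdot> p)"
  by (auto simp: wge_def)

lemma wge_sum: "(\<And>i. i \<in> I \<Longrightarrow> wge \<omega> k (f i)) \<Longrightarrow> wge \<omega> k (\<Sum>i\<in>I. f i)"
  by (auto simp: wge_def coeff_sum_mps)

lemma wge_mult:
  assumes "wge \<omega> j p" "wge \<omega> k q"
  shows "wge \<omega> (j + k) (p * q)"
proof (rule wgeI)
  fix M assume M: "wt \<omega> M < j + k"
  have "coeff p A * coeff q B = 0" if "A + B = M" for A B
  proof -
    have "wt \<omega> A < j \<or> wt \<omega> B < k" using M that by auto
    then show ?thesis using assms by (auto simp: wge_def)
  qed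
  then show "coeff (p * q) M = 0"
    by (auto simp: coeff_mps_times intro!: sum.neutral)
qed

lemma wge_mult': "wge \<omega> j p \<Longrightarrow> wge \<omega> k q \<Longrightarrow> l \<le> j + k \<Longrightarrow> wge \<omega> l (p * q)"
  using wge_mono wge_mult by blast

lemma wge_mvar: "wge \<omega> (\<omega> v) (mvar v)"
  by (auto simp: wge_def coeff_mvar)

lemma wge_mderiv: "wge \<omega> k q \<Longrightarrow> wge \<omega> (k - \<omega> v) (mderiv v q)"
  by (auto simp: wge_def coeff_mderiv)

lemma wge_eq_0: "(\<And>k. wge \<omega> k q) \<Longrightarrow> q = 0"
  by (rule mps_eqI) (metis coeff_0 lessI wgeD)

lemma wge_prod_mset:
  assumes "\<And>v. wge \<omega> (\<omega>' v) (s v)"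
  shows "wge \<omega> (wt \<omega>' A) (\<Prod>v\<in>#A. s v)"
  by (induction A) (auto intro: wge_mult assms)

lemma mult_diff_split: "a * b - c * d = (a - c) * b + c * (b - d)" for a :: "'a::comm_ring"
  by (simp add: algebra_simps)

text \<open>Telescoping: the factors are exchanged one at a time, and each exchange leaves a product
  in which one factor is a difference of excess weight \<open>m\<close>.\<close>

lemma wge_prod_mset_diff:
  assumes "\<And>v. wge \<omega> (\<omega>' v) (s v)" "\<And>v. wge \<omega> (\<omega>' v) (t v)" "\<And>v. wge \<omega> (\<omega>' v + m) (s v - t v)"
  shows "wge \<omega> (wt \<omega>' A + m) ((\<Prod>v\<in>#A. s v) - (\<Prod>v\<in>#A. t v))"
proof (induction A)
  case (add v A)
  have "wge \<omega> (\<omega>' v + m + wt \<omega>' A) ((s v - t v) * (\<Prod>v\<in>#A. s v))"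
    by (intro wge_mult wge_prod_mset assms)
  moreover have "wge \<omega> (\<omega>' v + (wt \<omega>' A + m)) (t v * ((\<Prod>v\<in>#A. s v) - (\<Prod>v\<in>#A. t v)))"
    by (intro wge_mult add assms)
  ultimately show ?case
    by (simp add: mult_diff_split[of "s v"] wge_add ac_simps)
qed auto

lemma no_constant_term_iff_wge: "no_constant_term q \<longleftrightarrow> wge (\<lambda>_. Suc 0) 1 q"
  by (auto simp: no_constant_term_def wge_def)

lemma no_linear_terms_iff_wge:
  "no_constant_term q \<and> no_linear_terms q \<longleftrightarrow> wge (\<lambda>_. Suc 0) 2 q"
proof -
  have "(\<forall>M. size M < 2 \<longrightarrow> coeff q M = 0) \<longleftrightarrow> coeff q {#} = 0 \<and> (\<forall>v. coeff q {#v#} = 0)"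
    by (auto simp: less_Suc_eq numeral_2_eq_2) (metis size_1_singleton_mset One_nat_def)
  then show ?thesis by (simp add: no_constant_term_def no_linear_terms_def wge_def)
qed

lemma no_constant_term_wge: "wge \<omega> k q \<Longrightarrow> 0 < k \<Longrightarrow> no_constant_term q"
  by (auto simp: no_constant_term_def wge_def)

subsection \<open>Substitution\<close>

abbreviation (input) nct :: "('v \<Rightarrow> 'w mps) \<Rightarrow> bool" where
  "nct s \<equiv> (\<forall>v. no_constant_term (s v))"

lemma coeff_prod_eq_0:
  assumes "nct s" "size M < size A"
  shows "coeff (\<Prod>v\<in>#A. s v) M = 0"
  using wge_prod_mset[of "\<lambda>_. Suc 0" "\<lambda>_. Suc 0" s A] assms
  by (auto simp: no_constant_term_iff_wge wge_def)

lemma coeff_msubst: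
  fixes s :: "'v::finite \<Rightarrow> 'w mps"
  assumes "nct s" "finite X" "{A. size A \<le> size M} \<subseteq> X"
  shows "coeff (msubst s q) M = (\<Sum>A\<in>X. coeff q A * coeff (\<Prod>v\<in>#A. s v) M)"
  unfolding msubst_def Mps_inverse[OF UNIV_I]
  by (rule sum.mono_neutral_left)
    (use assms in \<open>auto intro!: coeff_prod_eq_0[OF assms(1)] simp: not_le\<close>)

text \<open>In degree at most \<open>k\<close> a substitution without constant terms only sees the
  terms of \<open>q\<close> of degree at most \<open>k\<close>. The truncation is a finite sum,
  which reduces identities for substitutions to monomials.\<close>

definition poly_part :: "nat \<Rightarrow> ('v::finite \<Rightarrow> 'w mps) \<Rightarrow> 'v mps \<Rightarrow> 'w mps" where
  "poly_part k s q = (\<Sum>A | size A \<le> k. coeff q A \<cdot> (\<Prod>v\<in>#A. s v))"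

lemma coeff_msubst_poly_part:
  "nct s \<Longrightarrow> size M \<le> k \<Longrightarrow> coeff (msubst s q) M = coeff (poly_part k s q) M"
  by (subst coeff_msubst[where X = "{A. size A \<le> k}"]) (auto simp: poly_part_def coeff_sum_mps)

lemma coeff_prod_mvar: "coeff (\<Prod>v\<in>#A. mvar v) M = (if M = A then 1 else 0)"
  by (induction A arbitrary: M) (auto simp: coeff_1 coeff_mvar_times)

lemma coeff_poly_part_mvar:
  fixes q :: "'v::finite mps"
  shows "coeff (poly_part k mvar q) M = (if size M \<le> k then coeff q M else 0)"
  unfolding poly_part_def coeff_sum_mps coeff_csmul coeff_prod_mvar
  by (auto simp: if_distrib cong: if_cong)

lemma coeff_msubst_cong:
  assumes "\<And>A. size A \<le> size M \<Longrightarrow> coeff p A = coeff q A"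
  shows "coeff (msubst s p) M = coeff (msubst s q) M"
  unfolding msubst_def using assms by (auto intro: sum.cong)

lemma msubst_add: "msubst s (p + q) = msubst s p + msubst s q"
  and msubst_diff: "msubst s (p - q) = msubst s p - msubst s q"
  and msubst_csmul: "msubst s (c \<cdot> q) = c \<cdot> msubst s q"
  and msubst_0 [simp]: "msubst s 0 = 0"
  by (rule mps_eqI; simp add: msubst_def algebra_simps sum.distrib sum_subtractf sum_distrib_left)+

lemma msubst_sum: "msubst s (\<Sum>i\<in>I. f i) = (\<Sum>i\<in>I. msubst s (f i))"
  by (induction I rule: infinite_finite_induct) (auto simp: msubst_add)

lemma msubst_monomial:
  assumes "nct s"
  shows "msubst s (\<Prod>v\<in>#A. mvar v) = (\<Prod>v\<in>#A. s v)"
proof (rule mps_eqI)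
  fix M
  show "coeff (msubst s (\<Prod>v\<in>#A. mvar v)) M = coeff (\<Prod>v\<in>#A. s v) M"
    by (subst coeff_msubst[OF assms, where X = "insert A {A. size A \<le> size M}"])
      (auto simp: coeff_prod_mvar if_distrib[of "\<lambda>x. x * _"] cong: if_cong)
qed

lemma msubst_mvar [simp]: "nct s \<Longrightarrow> msubst s (mvar v) = s v"
  using msubst_monomial[of s "{#v#}"] by simp

lemma msubst_1 [simp]: "nct s \<Longrightarrow> msubst s 1 = 1"
  using msubst_monomial[of s "{#}"] by simp

lemma msubst_id [simp]: "msubst mvar q = q"
  by (rule mps_eqI) (auto simp: msubst_def coeff_prod_mvar if_distrib cong: if_cong)

text \<open>In degree \<open>size M\<close> only the truncations of \<open>p\<close> and
  \<open>q\<close> matter. In their product, pairs of monomials of larger total degree contribute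
  nothing, because the substituted series have no constant term.\<close>

lemma msubst_mult:
  fixes s :: "'v::finite \<Rightarrow> 'w mps"
  assumes "nct s"
  shows "msubst s (p * q) = msubst s p * msubst s q"
proof (rule mps_eqI)
  fix M :: "'w multiset"
  let ?k = "size M"
  have "coeff (poly_part ?k s p * poly_part ?k s q) M = coeff (msubst s p * msubst s q) M"
    unfolding coeff_times
    by (rule sum.cong) (auto simp: coeff_msubst_poly_part[OF assms, of _ ?k] size_mset_mono size_Diff_submset)
  moreover have "poly_part ?k s p * poly_part ?k s q = (\<Sum>(A, B) \<in> {A. size A \<le> ?k} \<times> {B. size B \<le> ?k}.
     (coeff p A * coeff q B) \<cdot> (\<Prod>v\<in>#A + B. s v))"
    by (simp add: poly_part_def sum_product sum.cartesian_product mult.commute)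
  moreover have "coeff \<dots> M = (\<Sum>(A, B) \<in> {A. size A \<le> ?k} \<times> {B. size B \<le> ?k}.
     coeff p A * coeff q B * coeff (\<Prod>v\<in>#A + B. s v) M)"
    by (simp add: coeff_sum_mps case_prod_beta)
  moreover have "\<dots> = (\<Sum>(A, B) | size (A + B) \<le> ?k.
     coeff p A * coeff q B * coeff (\<Prod>v\<in>#A + B. s v) M)"
    by (rule sum.mono_neutral_right)
      (auto simp: not_le simp del: image_mset_union intro!: coeff_prod_eq_0[OF assms])
  moreover have "\<dots> = (\<Sum>(C, (A, B)) \<in> (SIGMA C : {C. size C \<le> ?k}. {(A, B). A + B = C}).
     coeff p A * coeff q B * coeff (\<Prod>v\<in>#C. s v) M)"
    by (rule sum.reindex_bij_witness[where i = snd and j = "\<lambda>(A, B). (A + B, (A, B))"]) auto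
  moreover have "\<dots> = coeff (msubst s (p * q)) M"
    by (subst sum.Sigma[symmetric])
      (auto simp: msubst_def coeff_mps_times sum_distrib_right case_prod_beta intro!: sum.cong)
  ultimately show "coeff (msubst s (p * q)) M = coeff (msubst s p * msubst s q) M" by metis
qed

lemma msubst_prod_mset: "nct s \<Longrightarrow> msubst s (\<Prod>v\<in>#A. t v) = (\<Prod>v\<in>#A. msubst s (t v))"
  by (induction A) (auto simp: msubst_mult)

lemma no_constant_term_msubst:
  "no_constant_term q \<Longrightarrow> no_constant_term (msubst s q)"
  by (simp add: no_constant_term_def msubst_def)

lemma coeff_msubst_empty: "coeff (msubst s q) {#} = coeff q {#}"
  by (simp add: msubst_def coeff_1)

lemma msubst_msubst:
  fixes s :: "'v::finite \<Rightarrow> 'w mps" and t :: "'u::finite \<Rightarrow> 'v mps"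
  assumes "nct s" "nct t"
  shows "msubst s (msubst t q) = msubst (\<lambda>v. msubst s (t v)) q"
proof (rule mps_eqI)
  fix M :: "'w multiset"
  let ?k = "size M"
  have "coeff (msubst s (msubst t q)) M = coeff (msubst s (poly_part ?k t q)) M"
    by (rule coeff_msubst_cong) (simp add: coeff_msubst_poly_part[OF assms(2)])
  also have "msubst s (poly_part ?k t q) = poly_part ?k (\<lambda>v. msubst s (t v)) q"
    by (simp add: poly_part_def msubst_sum msubst_csmul msubst_prod_mset[OF assms(1)])
  also have "coeff \<dots> M = coeff (msubst (\<lambda>v. msubst s (t v)) q) M"
    using assms(2) by (intro coeff_msubst_poly_part[symmetric]) (auto intro: no_constant_term_msubst)
  finally show "coeff (msubst s (msubst t q)) M = coeff (msubst (\<lambda>v. msubst s (t v)) q) M" .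
qed

lemma mderiv_prod_mset:
  fixes s :: "'v::finite \<Rightarrow> 'w mps"
  assumes "nct s"
  shows "mderiv v (\<Prod>w\<in>#A. s w) =
    (\<Sum>w\<in>UNIV. msubst s (mderiv w (\<Prod>w\<in>#A. mvar w)) * mderiv v (s w))"
proof (induction A)
  case (add a A)
  have "(\<Sum>w\<in>UNIV. msubst s (mderiv w (\<Prod>w\<in>#add_mset a A. mvar w)) * mderiv v (s w)) =
    (\<Sum>w\<in>UNIV. (if w = a then (\<Prod>w\<in>#A. s w) * mderiv v (s w) else 0)) +
    s a * (\<Sum>w\<in>UNIV. msubst s (mderiv w (\<Prod>w\<in>#A. mvar w)) * mderiv v (s w))"
    unfolding sum_distrib_left sum.distrib[symmetric]
    by (rule sum.cong) (auto simp: mderiv_mult mderiv_mvar msubst_add msubst_mult msubst_monomial assms algebra_simps)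
  then show ?case using add by (simp add: mderiv_mult mult.commute)
qed auto

lemma mderiv_msubst:
  fixes s :: "'v::finite \<Rightarrow> 'w mps"
  assumes "nct s"
  shows "mderiv v (msubst s q) = (\<Sum>w\<in>UNIV. msubst s (mderiv w q) * mderiv v (s w))"
proof (rule mps_eqI)
  fix M :: "'w multiset"
  \<comment> \<open>One degree more than \<open>size M\<close>, because the derivative takes the
    coefficient of the substitution at \<open>add_mset v M\<close>.\<close>
  let ?q = "poly_part (Suc (size M)) mvar q"
  have q: "coeff q A = coeff ?q A" if "size A \<le> Suc (size M)" for A
    using that by (simp add: coeff_poly_part_mvar)
  have "coeff (mderiv v (msubst s q)) M = coeff (mderiv v (msubst s ?q)) M"
    unfolding coeff_mderiv by (rule arg_cong2[where f = times, OF refl], rule coeff_msubst_cong) (simp add: q)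
  also have "mderiv v (msubst s ?q) = (\<Sum>w\<in>UNIV. msubst s (mderiv w ?q) * mderiv v (s w))"
  proof -
    have "mderiv v (msubst s ?q) = (\<Sum>A | size A \<le> Suc (size M). coeff q A \<cdot> mderiv v (\<Prod>w\<in>#A. s w))"
      by (simp add: poly_part_def msubst_sum msubst_csmul mderiv_sum msubst_monomial assms)
    also have "\<dots> = (\<Sum>A | size A \<le> Suc (size M). \<Sum>w\<in>UNIV.
        (coeff q A \<cdot> msubst s (mderiv w (\<Prod>w\<in>#A. mvar w))) * mderiv v (s w))"
      by (simp add: mderiv_prod_mset[OF assms] csmul_sum)
    also have "\<dots> = (\<Sum>w\<in>UNIV. \<Sum>A | size A \<le> Suc (size M).
        (coeff q A \<cdot> msubst s (mderiv w (\<Prod>w\<in>#A. mvar w))) * mderiv v (s w))"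
      by (rule sum.swap)
    also have "\<dots> = (\<Sum>w\<in>UNIV. msubst s (mderiv w ?q) * mderiv v (s w))"
      by (simp only: poly_part_def mderiv_sum mderiv_csmul msubst_sum msubst_csmul sum_distrib_right)
    finally show ?thesis .
  qed
  also have "coeff \<dots> M = coeff (\<Sum>w\<in>UNIV. msubst s (mderiv w q) * mderiv v (s w)) M"
    unfolding coeff_sum_mps
  proof (rule sum.cong)
    fix w :: 'v
    have "coeff (msubst s (mderiv w ?q)) A = coeff (msubst s (mderiv w q)) A" if "A \<subseteq># M" for A
      by (rule coeff_msubst_cong) (use size_mset_mono[OF that] in \<open>auto simp: coeff_mderiv q\<close>)
    then show "coeff (msubst s (mderiv w ?q) * mderiv v (s w)) M = coeff (msubst s (mderiv w q) * mderiv v (s w)) M"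
      unfolding coeff_times by (auto intro: sum.cong)
  qed simp
  finally show "coeff (mderiv v (msubst s q)) M = coeff (\<Sum>w\<in>UNIV. msubst s (mderiv w q) * mderiv v (s w)) M" .
qed

lemma wge_msubst:
  fixes s :: "'v::finite \<Rightarrow> 'w mps"
  assumes "\<And>v. wge \<omega> (\<omega>' v) (s v)" "wge \<omega>' j q"
  shows "wge \<omega> j (msubst s q)"
proof (rule wgeI)
  fix M assume M: "wt \<omega> M < j"
  have "coeff q A * coeff (\<Prod>v\<in>#A. s v) M = 0" for A
    using wge_prod_mset[of \<omega> \<omega>' s A, OF assms(1)] assms(2) M
    by (cases "wt \<omega>' A < j") (auto simp: wge_def)
  then show "coeff (msubst s q) M = 0"
    unfolding msubst_def by (auto intro: sum.neutral)
qed

text \<open>Monomial by monomial this is the telescoping of products. It controls how a composition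
  reacts to a change of the inner map, both for \<open>L\<close> and in the iteration for inverse
  maps.\<close>

lemma wge_msubst_diff:
  fixes s t :: "'v::finite \<Rightarrow> 'w mps"
  assumes "\<And>v. wge \<omega> (\<omega>' v) (s v)" "\<And>v. wge \<omega> (\<omega>' v) (t v)" "\<And>v. wge \<omega> (\<omega>' v + m) (s v - t v)"
    and "wge \<omega>' j q"
  shows "wge \<omega> (j + m) (msubst s q - msubst t q)"
proof (rule wgeI)
  fix M assume M: "wt \<omega> M < j + m"
  have "coeff q A * coeff (\<Prod>v\<in>#A. s v) M = coeff q A * coeff (\<Prod>v\<in>#A. t v) M" for A
    using wge_prod_mset_diff[of \<omega> \<omega>' s t m A, OF assms(1-3)] assms(4) M
    by (cases "wt \<omega>' A < j") (auto simp: wge_def)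
  then show "coeff (msubst s q - msubst t q) M = 0"
    unfolding msubst_def coeff_minus Mps_inverse[OF UNIV_I] by (simp only: diff_self)
qed

subsection \<open>Fixed points of contractions\<close>

text \<open>\<open>B i\<close> lists the prescribed coefficients of component \<open>i\<close>.
  Prescribing coefficients instead of a minimal weight makes it possible to exclude a single
  monomial such as \<open>u\<close>.\<close>

definition coincide :: "('i \<Rightarrow> 'v multiset set) \<Rightarrow> ('i \<Rightarrow> 'v mps) \<Rightarrow> ('i \<Rightarrow> 'v mps) \<Rightarrow> bool" where
  "coincide B x y \<longleftrightarrow> (\<forall>i. \<forall>M\<in>B i. coeff (x i) M = coeff (y i) M)"

text \<open>The distance of two families is the excess over the base weights \<open>w\<close>, so
  that components of different natural weights are handled together. By the first clause any two
  families in the domain agree below the base weights, which starts the induction with excess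
  0.\<close>

definition contraction ::
  "('v \<Rightarrow> nat) \<Rightarrow> ('i \<Rightarrow> nat) \<Rightarrow> ('i \<Rightarrow> 'v multiset set) \<Rightarrow> ('i \<Rightarrow> 'v mps) \<Rightarrow>
    (('i \<Rightarrow> 'v mps) \<Rightarrow> 'i \<Rightarrow> 'v mps) \<Rightarrow> bool" where
  "contraction \<omega> w B x0 \<Phi> \<longleftrightarrow>
     (\<forall>i M. wt \<omega> M < w i \<longrightarrow> M \<in> B i) \<and>
     (\<forall>x. coincide B x x0 \<longrightarrow> coincide B (\<Phi> x) x0) \<and>
     (\<forall>m x y. coincide B x x0 \<longrightarrow> coincide B y x0 \<longrightarrow> (\<forall>i. wge \<omega> (w i + m) (x i - y i)) \<longrightarrow>
        (\<forall>i. wge \<omega> (w i + Suc m) (\<Phi> x i - \<Phi> y i)))"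

lemma wge_diff_sym: "wge \<omega> k (x - y) \<Longrightarrow> wge \<omega> k (y - x)"
  using wge_minus by fastforce

lemma wge_diff_trans: "wge \<omega> k (x - y) \<Longrightarrow> wge \<omega> k (y - z) \<Longrightarrow> wge \<omega> k (x - z)"
  using wge_add by fastforce

context
  fixes \<omega> :: "'v \<Rightarrow> nat" and w :: "'i \<Rightarrow> nat" and B x0 \<Phi>
  assumes contr: "contraction \<omega> w B x0 \<Phi>"
begin

lemma coincide_iterate: "coincide B ((\<Phi> ^^ k) x0) x0"
  using contr by (induction k) (auto simp: contraction_def coincide_def)

lemma contraction_start:
  "coincide B x x0 \<Longrightarrow> coincide B y x0 \<Longrightarrow> wge \<omega> (w i) (x i - y i)"
  using contr by (auto simp: contraction_def coincide_def wge_def)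

lemma contraction_step:
  "coincide B x x0 \<Longrightarrow> coincide B y x0 \<Longrightarrow> (\<And>i. wge \<omega> (w i + m) (x i - y i)) \<Longrightarrow>
     wge \<omega> (w i + Suc m) (\<Phi> x i - \<Phi> y i)"
  using contr by (auto simp: contraction_def)

lemma contraction_iterate:
  assumes "coincide B x x0" "\<Phi> x = x"
  shows "wge \<omega> (w i + k) (x i - (\<Phi> ^^ k) x0 i)"
proof (induction k arbitrary: i)
  case 0
  then show ?case using contraction_start[OF assms(1), of x0 i] by (simp add: coincide_def)
next
  case (Suc k)
  then show ?case using contraction_step[OF assms(1) coincide_iterate[of k], where m = k and i = i] assms(2)
    by simp
qed

lemma contraction_fixpoint: "\<exists>!x. coincide B x x0 \<and> \<Phi> x = x"
proof -
  define X where "X k = (\<Phi> ^^ k) x0" for k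
  have X: "coincide B (X k) x0" for k
    unfolding X_def by (rule coincide_iterate)
  have step: "wge \<omega> (w i + k) (X (Suc k) i - X k i)" for i k
  proof (induction k arbitrary: i)
    case 0
    then show ?case using contraction_start[OF X X] by simp
  next
    case (Suc k)
    then have "wge \<omega> (w i + Suc k) (\<Phi> (X (Suc k)) i - \<Phi> (X k) i)"
      by (intro contraction_step X)
    then show ?case by (simp add: X_def)
  qed
  have mono: "wge \<omega> (w i + k) (X (k + l) i - X k i)" for i k l
  proof (induction l)
    case (Suc l)
    have "wge \<omega> (w i + k) (X (Suc (k + l)) i - X (k + l) i)"
      by (rule wge_mono[OF step]) simp
    then show ?case using Suc by (auto intro: wge_diff_trans)
  qed simp
  \<comment> \<open>The limit of the iterates: from number \<open>Suc (wt \<omega> M)\<close> on,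
    the coefficient of \<open>M\<close> no longer changes, whatever the base weight is.\<close>
  define x where "x i = Mps (\<lambda>M. coeff (X (Suc (wt \<omega> M)) i) M)" for i
  have x: "wge \<omega> (w i + k) (x i - X k i)" for i k
  proof (rule wgeI)
    fix M assume M: "wt \<omega> M < w i + k"
    have "coeff (X (Suc (wt \<omega> M)) i) M = coeff (X k i) M"
    proof (cases "k \<le> Suc (wt \<omega> M)")
      case True
      then obtain l where "Suc (wt \<omega> M) = k + l" using le_Suc_ex by blast
      with mono[of i k l] M show ?thesis by (auto simp: wge_def)
    next
      case False
      then obtain l where "k = Suc (wt \<omega> M) + l" using le_Suc_ex nat_le_linear by blast
      with wgeD[OF mono[of i "Suc (wt \<omega> M)" l], of M] show ?thesis by simp
    qed
    then show "coeff (x i - X k i) M = 0" by (simp add: x_def)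
  qed
  have Cx: "coincide B x x0"
    using X by (auto simp: coincide_def x_def)
  have "\<Phi> x i = x i" for i
  proof -
    have "wge \<omega> k (\<Phi> x i - x i)" for k
    proof -
      have "wge \<omega> (w i + Suc k) (\<Phi> x i - \<Phi> (X k) i)"
        by (intro contraction_step Cx X x)
      then have "wge \<omega> (w i + Suc k) (\<Phi> x i - x i)"
        using wge_diff_trans wge_diff_sym[OF x[of i "Suc k"]] by (fastforce simp: X_def)
      then show ?thesis by (rule wge_mono) simp
    qed
    then have "\<Phi> x i - x i = 0" by (rule wge_eq_0)
    then show ?thesis by simp
  qed
  then have "\<Phi> x = x" by blast
  moreover have "x = y" if "coincide B x x0 \<and> \<Phi> x = x" "coincide B y x0 \<and> \<Phi> y = y" for x y
  proof
    fix i
    have "wge \<omega> k (x i - y i)" for k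
      using wge_diff_trans[OF contraction_iterate wge_diff_sym[OF contraction_iterate], of x y i k] that
      by (auto intro: wge_mono)
    then have "x i - y i = 0" by (rule wge_eq_0)
    then show "x i = y i" by simp
  qed
  ultimately show ?thesis using Cx by blast
qed

end

subsection \<open>Inverse maps and inverse matrices\<close>

abbreviation (input) deg :: "'v \<Rightarrow> nat" where "deg \<equiv> \<lambda>_. Suc 0"

definition tangent :: "('v \<Rightarrow> 'v mps) \<Rightarrow> bool" where
  "tangent s \<longleftrightarrow> (\<forall>v. wge deg 2 (s v - mvar v))"

text \<open>For a map s = id + n, the equation that \<open>s\<close> after \<open>t\<close> is the
  identity reads t = id - n(t). If \<open>n\<close> has order 2, the right side improves agreement
  by one degree.\<close>

definition inv_step :: "('v::finite \<Rightarrow> 'v mps) \<Rightarrow> ('v \<Rightarrow> 'v mps) \<Rightarrow> 'v \<Rightarrow> 'v mps" where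
  "inv_step s t v = mvar v - msubst t (s v - mvar v)"

lemma tangent_nct: "tangent s \<Longrightarrow> no_constant_term (s v)"
  unfolding no_constant_term_iff_wge tangent_def
  by (metis One_nat_def Suc_1 add_diff_cancel_left' diff_add_cancel le_SucI le_numeral_extra(4) wge_add wge_mono wge_mvar)

lemma coincide_deg: "coincide (\<lambda>i. {M. size M < 1}) x mvar \<longleftrightarrow> (\<forall>v. no_constant_term (x v))"
  by (auto simp: coincide_def no_constant_term_def coeff_mvar)

lemma contraction_inv_step:
  fixes s :: "'v::finite \<Rightarrow> 'v mps"
  assumes "tangent s"
  shows "contraction deg (\<lambda>_. 1) (\<lambda>_. {M. size M < 1}) mvar (inv_step s)"
  unfolding contraction_def coincide_deg
proof (intro conjI allI impI)
  fix x :: "'v \<Rightarrow> 'v mps" and v assume "\<forall>v. no_constant_term (x v)"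
  then show "no_constant_term (inv_step s x v)"
    using assms by (simp add: inv_step_def no_constant_term_def coeff_msubst_empty coeff_mvar tangent_def wge_def)
next
  fix m v and x y :: "'v \<Rightarrow> 'v mps"
  assume x: "\<forall>v. no_constant_term (x v)" and y: "\<forall>v. no_constant_term (y v)"
    and "\<forall>v. wge deg (1 + m) (x v - y v)"
  then have "wge deg (2 + m) (msubst x (s v - mvar v) - msubst y (s v - mvar v))"
    using assms by (intro wge_msubst_diff[where \<omega>' = deg]) (auto simp: no_constant_term_iff_wge tangent_def)
  then have "wge deg (2 + m) (msubst y (s v - mvar v) - msubst x (s v - mvar v))"
    by (rule wge_diff_sym)
  then show "wge deg (1 + Suc m) (inv_step s x v - inv_step s y v)"
    by (simp add: inv_step_def)
qed auto

lemma inv_step_fixpoint: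
  assumes "nct t"
  shows "inv_step s t = t \<longleftrightarrow> (\<forall>v. msubst t (s v) = mvar v)"
  using assms by (auto simp: fun_eq_iff inv_step_def msubst_diff algebra_simps)

definition inv_map :: "('v::finite \<Rightarrow> 'v mps) \<Rightarrow> 'v \<Rightarrow> 'v mps" where
  "inv_map s = (THE t. coincide (\<lambda>i. {M. size M < 1}) t mvar \<and> inv_step s t = t)"

lemma inv_map_fixpoint:
  assumes "tangent s"
  shows "coincide (\<lambda>i. {M. size M < 1}) (inv_map s) mvar" "inv_step s (inv_map s) = inv_map s"
  using theI'[OF contraction_fixpoint[OF contraction_inv_step[OF assms]]] by (simp_all add: inv_map_def)

lemma inv_map_nct: "tangent s \<Longrightarrow> no_constant_term (inv_map s v)"
  using inv_map_fixpoint(1)[of s] unfolding coincide_deg by blast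

lemma msubst_inv_map_left: "tangent s \<Longrightarrow> msubst (inv_map s) (s v) = mvar v"
  using inv_map_fixpoint[of s] unfolding coincide_deg by (simp add: inv_step_fixpoint)

lemma inv_map_unique: "tangent s \<Longrightarrow> nct t \<Longrightarrow> (\<And>v. msubst t (s v) = mvar v) \<Longrightarrow> t = inv_map s"
  using contraction_fixpoint[OF contraction_inv_step[of s]] inv_map_nct msubst_inv_map_left
  by (metis coincide_deg inv_step_fixpoint)

lemma tangent_inv_map:
  assumes "tangent s"
  shows "tangent (inv_map s)"
  unfolding tangent_def
proof
  fix v
  have "wge deg 2 (msubst (inv_map s) (s v - mvar v))"
    using inv_map_nct[OF assms] assms
    by (intro wge_msubst[where \<omega>' = deg]) (auto simp: no_constant_term_iff_wge tangent_def)
  then have "wge deg 2 (mvar v - msubst (inv_map s) (s v - mvar v) - mvar v)"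
    by (auto dest: wge_minus)
  then show "wge deg 2 (inv_map s v - mvar v)"
    using inv_map_fixpoint(2)[OF assms] by (metis inv_step_def)
qed

text \<open>The iteration gives a one-sided inverse. That inverse is again tangent to the identity
  and has a one-sided inverse of its own, which can only be \<open>s\<close>.\<close>

lemma msubst_inv_map_right:
  assumes "tangent s"
  shows "msubst s (inv_map s v) = mvar v"
proof -
  have t: "tangent (inv_map s)" using assms by (rule tangent_inv_map)
  have "s = inv_map (inv_map s)"
  proof
    fix v
    have "msubst (inv_map (inv_map s)) (msubst (inv_map s) (s v)) = inv_map (inv_map s) v"
      by (simp add: msubst_inv_map_left[OF assms] inv_map_nct[OF t])
    moreover have "msubst (inv_map (inv_map s)) (msubst (inv_map s) (s v)) = s v"
      using t assms by (subst msubst_msubst) (auto simp: inv_map_nct msubst_inv_map_left)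
    ultimately show "s v = inv_map (inv_map s) v" by simp
  qed
  then show ?thesis using msubst_inv_map_left[OF t] by metis
qed

lemma inv_map_inv_map: "tangent s \<Longrightarrow> inv_map (inv_map s) = s"
  by (metis inv_map_unique msubst_inv_map_right tangent_inv_map tangent_nct)

lemma msubst_inverse:
  assumes "tangent s"
  shows "msubst s (msubst (inv_map s) q) = q" "msubst (inv_map s) (msubst s q) = q"
  using assms by (subst msubst_msubst; simp add: tangent_nct inv_map_nct msubst_inv_map_right msubst_inv_map_left)+

text \<open>The Neumann series as the fixed point of x = 1 - N x, with base weight 0 and nothing
  prescribed. The right inverse obtained is again 1 plus a matrix without constant terms, so it has
  a right inverse too, and the two-sided statement follows.\<close>

lemma mps_matrix_inverse:
  fixes N :: "'v mps ^ 'n::finite ^ 'n"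
  assumes N: "\<And>i j. no_constant_term (N $ i $ j)"
  shows "\<exists>K. (mat 1 + N) ** K = mat 1 \<and> K ** (mat 1 + N) = mat 1"
proof -
  have ex: "\<exists>K. (mat 1 + N) ** K = mat 1 \<and> (\<forall>i j. no_constant_term ((K - mat 1) $ i $ j))"
    if N: "\<And>i j. no_constant_term (N $ i $ j)" for N :: "'v mps ^ 'n::finite ^ 'n"
  proof -
    define \<Phi> where "\<Phi> x = (\<lambda>(j, k). (mat 1 :: 'v mps ^ 'n ^ 'n) $ j $ k - (\<Sum>l\<in>UNIV. N $ j $ l * x (l, k)))" for x
    have "contraction deg (\<lambda>_. 0) (\<lambda>_. {}) (\<lambda>_. 0) \<Phi>"
      unfolding contraction_def
    proof (intro conjI allI impI; clarsimp simp: coincide_def)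
      fix m j k and x y :: "'n \<times> 'n \<Rightarrow> 'v mps"
      assume xy: "\<forall>i j. wge deg m (x (i, j) - y (i, j))"
      have "wge deg (1 + m) (\<Sum>l\<in>UNIV. N $ j $ l * (y (l, k) - x (l, k)))"
        using N xy by (intro wge_sum wge_mult wge_diff_sym[of _ _ "x _"]) (auto simp: no_constant_term_iff_wge)
      then show "wge deg (Suc m) (\<Phi> x (j, k) - \<Phi> y (j, k))"
        by (simp add: \<Phi>_def sum_subtractf algebra_simps)
    qed
    then obtain x where x: "\<Phi> x = x" using contraction_fixpoint by blast
    then have eq: "x (j, k) = (mat 1 :: 'v mps ^ 'n ^ 'n) $ j $ k - (\<Sum>l\<in>UNIV. N $ j $ l * x (l, k))" for j k
      by (metis (mono_tags, lifting) \<Phi>_def case_prod_conv)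
    define K where "K = (\<chi> j k. x (j, k))"
    have "K + N ** K = mat 1"
      by (simp add: vec_eq_iff K_def matrix_matrix_mult_def) (metis eq diff_add_cancel)
    moreover have "(mat 1 + N) ** K = mat 1 ** K + N ** K"
      by (simp add: vec_eq_iff matrix_matrix_mult_def distrib_right sum.distrib)
    ultimately have "(mat 1 + N) ** K = mat 1"
      by simp
    moreover have "no_constant_term ((K - mat 1) $ i $ j)" for i j
    proof -
      have "no_constant_term (- (\<Sum>l\<in>UNIV. N $ i $ l * x (l, j)))"
        using N by (auto simp: no_constant_term_def coeff_sum_mps coeff_mult_empty)
      then show ?thesis using eq[of i j] by (simp add: K_def)
    qed
    ultimately show ?thesis by blast
  qed
  obtain K where K: "(mat 1 + N) ** K = mat 1" "\<And>i j. no_constant_term ((K - mat 1) $ i $ j)"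
    using ex[OF N] by blast
  obtain K' where "(mat 1 + (K - mat 1)) ** K' = mat 1"
    using ex[OF K(2)] by blast
  then have K': "K ** K' = mat 1" by simp
  have "K' = (mat 1 + N) ** K ** K'" using K(1) by simp
  also have "\<dots> = mat 1 + N" using K' by (simp add: matrix_mul_assoc[symmetric])
  finally show ?thesis using K(1) K' by blast
qed

section \<open>Inversion of the normalizing map\<close>

subsection \<open>Conjugation\<close>

lemma conj_var_conj_var [simp]: "conj_var (conj_var v) = v"
  by (cases v) auto

lemma image_conj_var_conj_var [simp]: "image_mset conj_var (image_mset conj_var M) = M"
  by (induction M) auto

lemma conj_var_eq_iff [simp]: "conj_var v = conj_var w \<longleftrightarrow> v = w"
  by (metis conj_var_conj_var)

lemma image_conj_var_eq_iff: "image_mset conj_var M = N \<longleftrightarrow> M = image_mset conj_var N"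
  by auto

lemma count_image_conj_var [simp]: "count (image_mset conj_var M) v = count M (conj_var v)"
  by (induction M) (auto simp: conj_var_eq_iff[of "conj_var _", unfolded conj_var_conj_var])

lemma coeff_sconj: "coeff (sconj q) M = cnj (coeff q (image_mset conj_var M))"
  by (simp add: sconj_def)

lemma sconj_sconj [simp]: "sconj (sconj q) = q"
  by (rule mps_eqI) (simp add: coeff_sconj)

lemma sconj_0 [simp]: "sconj 0 = 0"
  and sconj_1 [simp]: "sconj 1 = 1"
  and sconj_add: "sconj (p + q) = sconj p + sconj q"
  and sconj_diff: "sconj (p - q) = sconj p - sconj q"
  and sconj_minus: "sconj (- q) = - sconj q"
  and sconj_csmul: "sconj (c \<cdot> q) = cnj c \<cdot> sconj q"
  by (rule mps_eqI; simp add: coeff_sconj coeff_1)+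

lemma sconj_mvar: "sconj (mvar v) = mvar (conj_var v)"
  by (rule mps_eqI) (simp add: coeff_sconj coeff_mvar image_conj_var_eq_iff)

lemma sconj_sum: "sconj (\<Sum>i\<in>I. f i) = (\<Sum>i\<in>I. sconj (f i))"
  by (induction I rule: infinite_finite_induct) (auto simp: sconj_add)

lemma sconj_mult: "sconj (p * q) = sconj p * sconj q"
proof (rule mps_eqI)
  fix M
  show "coeff (sconj (p * q)) M = coeff (sconj p * sconj q) M"
    unfolding coeff_sconj coeff_mps_times
    by (simp add: case_prod_beta,
        rule sum.reindex_bij_witness[where i = "\<lambda>(A, B). (image_mset conj_var A, image_mset conj_var B)"
          and j = "\<lambda>(A, B). (image_mset conj_var A, image_mset conj_var B)"])
      (auto simp: coeff_sconj simp flip: image_mset_union)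
qed

lemma sconj_prod_mset: "sconj (\<Prod>v\<in>#A. s v) = (\<Prod>v\<in>#A. sconj (s v))"
  by (induction A) (auto simp: sconj_mult)

lemma sconj_mderiv: "sconj (mderiv v q) = mderiv (conj_var v) (sconj q)"
  by (rule mps_eqI) (simp add: coeff_sconj coeff_mderiv)

lemma sconj_msubst:
  "sconj (msubst s q) = msubst (\<lambda>v. sconj (s (conj_var v))) (sconj q)"
proof (rule mps_eqI)
  fix M
  have "coeff (sconj (msubst s q)) M =
      (\<Sum>A | size A \<le> size M. cnj (coeff q A) * coeff (\<Prod>v\<in>#A. sconj (s v)) M)"
    by (simp add: coeff_sconj msubst_def sconj_prod_mset[symmetric])
  also have "\<dots> = (\<Sum>A | size A \<le> size M. coeff (sconj q) A * coeff (\<Prod>v\<in>#A. sconj (s (conj_var v))) M)"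
    by (rule sum.reindex_bij_witness[where i = "image_mset conj_var" and j = "image_mset conj_var"])
      (auto simp: coeff_sconj image_mset.compositionality comp_def)
  finally show "coeff (sconj (msubst s q)) M = coeff (msubst (\<lambda>v. sconj (s (conj_var v))) (sconj q)) M"
    by (simp add: msubst_def)
qed

lemma wt_image_conj_var: "(\<And>v. \<omega> (conj_var v) = \<omega> v) \<Longrightarrow> wt \<omega> (image_mset conj_var M) = wt \<omega> M"
  by (induction M) auto

lemma wge_sconj: "(\<And>v. \<omega> (conj_var v) = \<omega> v) \<Longrightarrow> wge \<omega> k (sconj q) \<longleftrightarrow> wge \<omega> k q"
  unfolding wge_def coeff_sconj complex_cnj_zero_iff
  by (metis image_conj_var_conj_var wt_image_conj_var)

subsection \<open>Vector fields\<close>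

definition vfield :: "('v::finite \<Rightarrow> 'v mps) \<Rightarrow> 'v mps \<Rightarrow> 'v mps" where
  "vfield a q = (\<Sum>v\<in>UNIV. mderiv v q * a v)"

lemma vfield_mvar [simp]: "vfield a (mvar v) = a v"
  by (simp add: vfield_def mderiv_mvar if_distrib[of "\<lambda>x. x * _"] cong: if_cong)

lemma vfield_add: "vfield a (p + q) = vfield a p + vfield a q"
  by (simp add: vfield_def mderiv_add distrib_right sum.distrib)

text \<open>The chain rule for related vector fields: it suffices to know the relation on the
  coordinates.\<close>

lemma vfield_msubst:
  assumes "nct s" "\<And>v. msubst s (a v) = vfield b (s v)"
  shows "msubst s (vfield a q) = vfield b (msubst s q)"
proof -
  have "vfield b (msubst s q) = (\<Sum>w\<in>UNIV. \<Sum>v\<in>UNIV. msubst s (mderiv v q) * mderiv w (s v) * b w)"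
    by (simp add: vfield_def mderiv_msubst[OF assms(1)] sum_distrib_right)
  also have "\<dots> = (\<Sum>v\<in>UNIV. \<Sum>w\<in>UNIV. msubst s (mderiv v q) * mderiv w (s v) * b w)"
    by (rule sum.swap)
  also have "\<dots> = (\<Sum>v\<in>UNIV. msubst s (mderiv v q) * msubst s (a v))"
    by (simp add: assms(2) vfield_def sum_distrib_left mult.assoc)
  finally show ?thesis
    by (simp add: vfield_def msubst_sum msubst_mult assms(1))
qed

lemma vfield_inverse:
  assumes s: "tangent s"
    and eq: "\<And>v. vfield a (s v) = msubst s (b v)"
  shows "vfield b (inv_map s v) = msubst (inv_map s) (a v)"
proof -
  have "msubst s (vfield b (inv_map s v)) = vfield a (msubst s (inv_map s v))"
    using s eq by (intro vfield_msubst) (auto simp: tangent_nct)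
  then have "msubst s (vfield b (inv_map s v)) = a v"
    by (simp add: msubst_inv_map_right[OF s])
  then show ?thesis by (metis msubst_inverse(2)[OF s])
qed

text \<open>Turns a condition on the normalizing map into one on its inverse: fields related by
  \<open>s\<close> are related in the opposite direction by \<open>inv_map s\<close>.\<close>

lemma vfield_inverse_iff:
  assumes "tangent s"
  shows "(\<forall>v. vfield a (s v) = msubst s (b v)) \<longleftrightarrow>
    (\<forall>v. vfield b (inv_map s v) = msubst (inv_map s) (a v))"
  using vfield_inverse[OF assms, of a b] vfield_inverse[OF tangent_inv_map[OF assms], of b a]
  by (auto simp: inv_map_inv_map[OF assms])

lemma all_crvar_iff: "(\<forall>v. P v) \<longleftrightarrow> (\<forall>j. P (Z j)) \<and> (\<forall>j. P (Zb j)) \<and> P U"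
  by (metis crvar.exhaust)

lemma sum_crvar:
  fixes h :: "'n::finite crvar \<Rightarrow> 'c::comm_monoid_add"
  shows "(\<Sum>v\<in>UNIV. h v) = (\<Sum>j\<in>UNIV. h (Z j)) + (\<Sum>j\<in>UNIV. h (Zb j)) + h U"
proof -
  have "(\<Sum>v\<in>UNIV. h v) = h U + (\<Sum>v \<in> range Z \<union> range Zb. h v)"
    unfolding UNIV_crvar by (subst sum.insert) auto
  also have "(\<Sum>v \<in> range Z \<union> range Zb. h v) = (\<Sum>v \<in> range Z. h v) + (\<Sum>v \<in> range Zb. h v)"
    by (rule sum.union_disjoint) auto
  also have "(\<Sum>v \<in> range Z. h v) = (\<Sum>j\<in>UNIV. h (Z j))"
    by (subst sum.reindex) (auto simp: inj_def)
  also have "(\<Sum>v \<in> range Zb. h v) = (\<Sum>j\<in>UNIV. h (Zb j))"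
    by (subst sum.reindex) (auto simp: inj_def)
  finally show ?thesis by (simp add: ac_simps)
qed

section \<open>The Euler field and its lifts to fields of type (1,0)\<close>

definition eul :: "'n::finite cseries \<Rightarrow> 'n cseries" where
  "eul q = (\<Sum>j\<in>UNIV. mvar (Z j) * mderiv (Z j) q)"

text \<open>The \<open>u\<close>-component of the lift of the Euler field to the hypersurface given
  by \<open>\<phi>\<close>, that is, the w-part of the evaluation of
  \<open>induced \<phi>\<close>.\<close>

definition theta :: "'n::finite cseries \<Rightarrow> 'n cseries" where
  "theta \<phi> = \<i> \<cdot> (minverse (1 - \<i> \<cdot> mderiv U \<phi>) * eul \<phi>)"

text \<open>The field of type (1,0) with z-part \<open>X\<close>. The next definition is its
  analogue for the Euler field on the hypersurface.\<close>

fun liftfield :: "'n::finite cr_rep \<Rightarrow> ('n \<Rightarrow> 'n cseries) \<Rightarrow> 'n crvar \<Rightarrow> 'n cseries" where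
  "liftfield L X (Z k) = X k"
| "liftfield L X (Zb j) = (\<Sum>k\<in>UNIV. Lzb L $ j $ k * X k)"
| "liftfield L X U = (\<Sum>k\<in>UNIV. Lw L $ k * X k)"

fun eulfield :: "'n::finite cseries \<Rightarrow> 'n crvar \<Rightarrow> 'n cseries" where
  "eulfield \<phi> (Z k) = mvar (Z k)"
| "eulfield \<phi> (Zb j) = 0"
| "eulfield \<phi> U = theta \<phi>"

lemma vfield_eulfield: "vfield (eulfield \<phi>) q = eul q + theta \<phi> * mderiv U q"
  by (simp add: vfield_def sum_crvar eul_def mult.commute)

lemma vfield_liftfield: "vfield (liftfield L X) q = (\<Sum>k\<in>UNIV. dH L q $ k * X k)"
proof -
  have "(\<Sum>k\<in>UNIV. dH L q $ k * X k) = (\<Sum>k\<in>UNIV. mderiv (Z k) q * X k) +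
     (\<Sum>k\<in>UNIV. \<Sum>j\<in>UNIV. mderiv (Zb j) q * (Lzb L $ j $ k * X k)) +
     (\<Sum>k\<in>UNIV. mderiv U q * (Lw L $ k * X k))"
    by (simp add: dH_def distrib_right sum.distrib sum_distrib_right mult.assoc)
  also have "(\<Sum>k\<in>UNIV. \<Sum>j\<in>UNIV. mderiv (Zb j) q * (Lzb L $ j $ k * X k)) =
     (\<Sum>j\<in>UNIV. \<Sum>k\<in>UNIV. mderiv (Zb j) q * (Lzb L $ j $ k * X k))"
    by (rule sum.swap)
  finally show ?thesis by (simp add: vfield_def sum_crvar sum_distrib_left)
qed

lemma euler_eval_induced: "euler_eval (induced \<phi>) = (0, theta \<phi>)"
  by (simp add: euler_eval_def induced_def theta_def euler_def eul_def mconst_times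
      csmul_sum sum_distrib_left mult_ac)

lemma dH_mvar: "dH L (mvar (Z m)) = axis m 1" "dH L (mvar (Zb j)) = Lzb L $ j" "dH L (mvar U) = Lw L"
  by (simp_all add: dH_def vec_eq_iff mderiv_mvar axis_def if_distrib[of "\<lambda>x. x * _"] cong: if_cong)

lemma dH_add: "dH L (p + q) = dH L p + dH L q"
  by (simp add: dH_def vec_eq_iff mderiv_add distrib_right sum.distrib)

section \<open>The real map tangent to the identity and its inverse\<close>

definition admissible :: "'n::finite cseries ^ 'n \<Rightarrow> 'n cseries \<Rightarrow> bool" where
  "admissible f g \<longleftrightarrow> (\<forall>j. wge deg 2 (f $ j)) \<and> wge deg 2 g \<and> real_series g"

lemma tangent_shift: "admissible f g \<Longrightarrow> tangent (shift f g)"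
  by (auto simp: tangent_def all_crvar_iff[of "\<lambda>v. wge deg 2 (shift f g v - mvar v)"] admissible_def wge_sconj)

lemma formal_diffeo_admissible:
  assumes "admissible f g"
  shows "formal_diffeo f g"
proof -
  have "coeff (shift f g v) {#w#} = (if v = w then 1 else 0)" for v w
  proof -
    have "coeff (shift f g v - mvar v) {#w#} = 0"
      using tangent_shift[OF assms] by (auto simp: tangent_def wge_def)
    then show ?thesis by (auto simp: coeff_mvar)
  qed
  then have "(\<chi> v w. coeff (shift f g v) {#w#}) = (mat 1 :: complex ^ 'a crvar ^ 'a crvar)"
    by (simp add: vec_eq_iff mat_def)
  then show ?thesis
    using assms tangent_nct[OF tangent_shift[OF assms]]
    by (simp add: formal_diffeo_def admissible_def invertible_def)
qed

definition cinv :: "'n::finite cseries ^ 'n \<Rightarrow> 'n cseries \<Rightarrow> 'n cseries ^ 'n" where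
  "cinv f g = (\<chi> j. inv_map (shift f g) (Z j) - mvar (Z j))"

definition rinv :: "'n::finite cseries ^ 'n \<Rightarrow> 'n cseries \<Rightarrow> 'n cseries" where
  "rinv f g = inv_map (shift f g) U - mvar U"

lemma sconj_shift: "real_series g \<Longrightarrow> sconj (shift f g (conj_var v)) = shift f g v"
  by (cases v) (auto simp: sconj_add sconj_mvar real_series_def)

text \<open>The conjugate of the inverse map inverts the conjugate of the map, which is the map
  itself; uniqueness of the inverse then gives its reality.\<close>

lemma sconj_inv_map_shift:
  assumes "admissible f g"
  shows "sconj (inv_map (shift f g) (conj_var v)) = inv_map (shift f g) v"
proof -
  let ?S = "shift f g" and ?t = "\<lambda>v. sconj (inv_map (shift f g) (conj_var v))"
  have S: "tangent ?S" using assms by (rule tangent_shift)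
  have "?t = inv_map ?S"
  proof (rule inv_map_unique[OF S])
    show "nct ?t"
      using inv_map_nct[OF S] by (simp add: no_constant_term_def coeff_sconj)
    fix v
    have "msubst ?t (sconj (?S (conj_var v))) = sconj (msubst (inv_map ?S) (?S (conj_var v)))"
      by (simp add: sconj_msubst)
    also have "\<dots> = mvar v" by (simp add: msubst_inv_map_left[OF S] sconj_mvar)
    finally show "msubst ?t (?S v) = mvar v"
      using assms by (simp add: sconj_shift admissible_def)
  qed
  then show ?thesis by (rule fun_cong)
qed

lemma shift_cinv:
  assumes "admissible f g"
  shows "shift (cinv f g) (rinv f g) = inv_map (shift f g)"
proof
  fix v
  show "shift (cinv f g) (rinv f g) v = inv_map (shift f g) v"
    using sconj_inv_map_shift[OF assms, of v]
    by (cases v) (auto simp: cinv_def rinv_def sconj_diff sconj_mvar)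
qed

lemma admissible_cinv:
  assumes "admissible f g"
  shows "admissible (cinv f g) (rinv f g)"
  using tangent_inv_map[OF tangent_shift[OF assms]] sconj_inv_map_shift[OF assms, of U]
  by (auto simp: admissible_def cinv_def rinv_def tangent_def real_series_def sconj_diff sconj_mvar)

lemma shift_eq_iff: "shift f g = shift f' g' \<longleftrightarrow> f = f' \<and> g = g'"
  by (auto simp: fun_eq_iff all_crvar_iff vec_eq_iff)

lemma cinv_cinv:
  assumes "admissible f g"
  shows "cinv (cinv f g) (rinv f g) = f" "rinv (cinv f g) (rinv f g) = g"
  using shift_cinv[OF admissible_cinv[OF assms]] inv_map_inv_map[OF tangent_shift[OF assms]]
  by (auto simp: shift_cinv[OF assms] shift_eq_iff)

text \<open>\<open>rinv f g\<close> is minus the composition of \<open>g\<close> with the inverse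
  map, hence equals - g in order 2. Together with the factor 2 of a second derivative this turns
  \<open>r\<close> into the coefficient \<open>- r / 2\<close> of u^2.\<close>

lemma rinv_UU:
  assumes "admissible f g"
  shows "coeff (rinv f g) {#U, U#} = - coeff g {#U, U#}"
proof -
  let ?S = "shift f g"
  have S: "tangent ?S" using assms by (rule tangent_shift)
  have nct: "nct (inv_map ?S)" using inv_map_nct[OF S] by blast
  have "msubst (inv_map ?S) (mvar U + g) = mvar U"
    using msubst_inv_map_left[OF S, of U] by simp
  then have eq: "rinv f g = - msubst (inv_map ?S) g"
    by (simp add: msubst_add nct rinv_def algebra_simps eq_neg_iff_add_eq_0)
  have "wge deg (2 + 1) (msubst (inv_map ?S) g - msubst mvar g)"
    using tangent_inv_map[OF S] assms nct wge_mvar[of deg]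
    by (intro wge_msubst_diff[where \<omega>' = deg])
      (auto simp: tangent_def admissible_def no_constant_term_iff_wge numeral_2_eq_2)
  then show ?thesis by (simp add: eq wge_def)
qed

subsection \<open>The embedding equations\<close>

text \<open>\<open>X\<close> is the z-part of the lifted Euler field in the old coordinates, namely
  the derivative of z + F along it; no further unknown enters.\<close>

definition embedding_eqs ::
  "'n::finite cr_rep \<Rightarrow> 'n cseries ^ 'n \<Rightarrow> 'n cseries \<Rightarrow> 'n cseries \<Rightarrow> bool" where
  "embedding_eqs L F G \<phi> \<longleftrightarrow>
     (let X = \<lambda>k. mvar (Z k) + vfield (eulfield \<phi>) (F $ k) in
      (\<forall>j. vfield (eulfield \<phi>) (sconj (F $ j)) = (\<Sum>k\<in>UNIV. msubst (shift F G) (Lzb L $ j $ k) * X k)) \<and>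
      theta \<phi> + vfield (eulfield \<phi>) G = (\<Sum>k\<in>UNIV. msubst (shift F G) (Lw L $ k) * X k))"

text \<open>The vector field of type \<open>(1,0)\<close> over the Euler field in the new coordinates is
  \<open>eulfield \<phi>\<close>; in the old coordinates it is \<open>liftfield L X\<close> for some \<open>X\<close>.\<close>

lemma embedding_eqs_iff_field:
  assumes fg: "admissible f g"
  shows "embedding_eqs L (cinv f g) (rinv f g) \<phi> \<longleftrightarrow>
    (\<exists>X. \<forall>v. vfield (liftfield L X) (shift f g v) = msubst (shift f g) (eulfield \<phi> v))"
    (is "?L \<longleftrightarrow> ?R")
proof -
  let ?S = "shift f g" and ?V = "vfield (eulfield \<phi>)"
  have S: "tangent ?S" using fg by (rule tangent_shift)
  have nct: "nct (inv_map ?S)" using inv_map_nct[OF S] by blast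
  have inv: "inv_map ?S = shift (cinv f g) (rinv f g)" by (simp add: shift_cinv[OF fg])
  define F G where "F = cinv f g" and "G = rinv f g"
  define Y where "Y k = mvar (Z k) + ?V (F $ k)" for k
  have "?R \<longleftrightarrow> (\<exists>X. \<forall>v. ?V (inv_map ?S v) = msubst (inv_map ?S) (liftfield L X v))"
    by (simp only: vfield_inverse_iff[OF S])
  also have "\<dots> \<longleftrightarrow> (\<exists>X. (\<forall>k. Y k = msubst (inv_map ?S) (X k)) \<and>
     (\<forall>j. ?V (sconj (F $ j)) = (\<Sum>k\<in>UNIV. msubst (inv_map ?S) (Lzb L $ j $ k) * msubst (inv_map ?S) (X k))) \<and>
     theta \<phi> + ?V G = (\<Sum>k\<in>UNIV. msubst (inv_map ?S) (Lw L $ k) * msubst (inv_map ?S) (X k)))"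
    by (simp only: all_crvar_iff liftfield.simps msubst_sum msubst_mult[OF nct])
      (simp add: inv vfield_add Y_def F_def G_def)
  \<comment> \<open>The z-components of the field equation determine \<open>X\<close>, so the
    quantifier disappears; conversely \<open>X\<close> is obtained by transporting \<open>Y\<close>
    back.\<close>
  also have "\<dots> \<longleftrightarrow> (\<forall>j. ?V (sconj (F $ j)) = (\<Sum>k\<in>UNIV. msubst (inv_map ?S) (Lzb L $ j $ k) * Y k)) \<and>
     theta \<phi> + ?V G = (\<Sum>k\<in>UNIV. msubst (inv_map ?S) (Lw L $ k) * Y k)"
    (is "?A \<longleftrightarrow> ?B")
  proof
    show "?A \<Longrightarrow> ?B" by auto
    show "?B \<Longrightarrow> ?A"
      by (rule exI[of _ "\<lambda>k. msubst ?S (Y k)"]) (simp add: msubst_inverse[OF S])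
  qed
  also have "\<dots> \<longleftrightarrow> ?L"
    by (simp add: embedding_eqs_def Let_def inv Y_def F_def G_def)
  finally show ?thesis by simp
qed

text \<open>The matrix \<open>J\<close>, by which the map acts on the z-parts of (1,0) vectors, is 1
  plus terms without constant part, hence invertible. So \<open>L'\<close> is determined by
  \<open>L\<close> and the map, and its evaluation along the Euler field only involves the one
  vector X with J X = y.\<close>

lemma quasi_embedding_iff_field:
  assumes fg: "admissible f g" and L: "almost_cr L"
  shows "(\<exists>L'. almost_cr L' \<and> transforms_to f g L L' \<and> euler_eval L' = euler_eval (induced \<phi>)) \<longleftrightarrow>
    (\<exists>X. \<forall>v. vfield (liftfield L X) (shift f g v) = msubst (shift f g) (eulfield \<phi> v))"
    (is "?L \<longleftrightarrow> ?R")
proof -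
  let ?S = "shift f g"
  have S: "tangent ?S" using fg by (rule tangent_shift)
  have nct: "nct ?S" using tangent_nct[OF S] by blast
  have nct_dH: "no_constant_term (dH L q $ k)" if "wge deg 2 q" for q k
  proof -
    have "no_constant_term (mderiv v q)" for v
      using wge_mderiv[OF that, of v] by (simp add: no_constant_term_iff_wge)
    then show ?thesis
      using L by (simp add: dH_def no_constant_term_def coeff_sum_mps coeff_mult_empty almost_cr_def)
  qed
  define N where "N = (\<chi> m. dH L (f $ m))"
  define J where "J = (\<chi> m. axis m 1 + dH L (f $ m))"
  have J: "J = (\<chi> m. dH L (?S (Z m)))"
    by (simp add: J_def dH_add dH_mvar)
  have "J = mat 1 + N"
    by (auto simp: J_def N_def vec_eq_iff mat_def axis_def)
  moreover have "no_constant_term (N $ i $ j)" for i j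
    using fg by (auto simp: N_def admissible_def intro: nct_dH)
  ultimately obtain K where K: "J ** K = mat 1" "K ** J = mat 1"
    using mps_matrix_inverse by metis
  have tr: "transforms_to f g L L' \<longleftrightarrow>
      dH L (?S U) = (\<chi> m. msubst ?S (Lw L' $ m)) v* J \<and>
      (\<chi> j. dH L (?S (Zb j))) = (\<chi> j m. msubst ?S (Lzb L' $ j $ m)) ** J" for L'
    by (simp add: transforms_to_def Let_def J_def dH_add dH_mvar add.commute)
  have vf: "vfield (liftfield L X) q = (\<Sum>k\<in>UNIV. dH L q $ k * X k)" for X q
    by (rule vfield_liftfield)
  have vfJ: "vfield (liftfield L X) (?S (Z m)) = (J *v (\<chi> k. X k)) $ m" for X m
    by (simp add: vf J matrix_vector_mult_def)
  define y where "y = (\<chi> m. ?S (Z m))"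
  show ?thesis
  proof
    assume ?L
    then obtain L' where L': "transforms_to f g L L'" and ev: "euler_eval L' = (0, theta \<phi>)"
      by (auto simp: euler_eval_induced)
    \<comment> \<open>The z-part of the (1,0) field that the map sends to a field over the Euler
      field.\<close>
    define X where "X = K *v y"
    have JX: "J *v X = y"
      by (simp add: X_def matrix_vector_mul_assoc K)
    have "vfield (liftfield L (\<lambda>k. X $ k)) (?S v) = msubst ?S (eulfield \<phi> v)" for v
    proof (cases v)
      case (Z m)
      then show ?thesis using JX nct by (simp only: vfJ vec_lambda_eta) (simp add: y_def)
    next
      case (Zb j)
      have "vfield (liftfield L (\<lambda>k. X $ k)) (?S v) = ((\<chi> j. dH L (?S (Zb j))) *v X) $ j"
        by (simp add: vf matrix_vector_mult_def Zb)
      also have "\<dots> = ((\<chi> j m. msubst ?S (Lzb L' $ j $ m)) *v y) $ j"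
        using L' by (simp add: tr matrix_vector_mul_assoc[symmetric] JX)
      also have "\<dots> = msubst ?S ((Lzb L' *v euler) $ j)"
        using nct by (simp add: matrix_vector_mult_def msubst_sum msubst_mult euler_def y_def)
      finally show ?thesis using ev by (simp add: euler_eval_def Zb)
    next
      case U
      have "vfield (liftfield L (\<lambda>k. X $ k)) (?S v) = (\<Sum>k\<in>UNIV. ((\<chi> m. msubst ?S (Lw L' $ m)) v* J) $ k * X $ k)"
        using L' by (simp add: vf U tr)
      also have "\<dots> = (\<Sum>k\<in>UNIV. \<Sum>m\<in>UNIV. msubst ?S (Lw L' $ m) * J $ m $ k * X $ k)"
        by (simp add: vector_matrix_mult_def sum_distrib_left mult_ac)
      also have "\<dots> = (\<Sum>m\<in>UNIV. msubst ?S (Lw L' $ m) * (J *v X) $ m)"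
        by (subst sum.swap) (simp add: matrix_vector_mult_def sum_distrib_left mult_ac)
      also have "\<dots> = msubst ?S (\<Sum>m\<in>UNIV. Lw L' $ m * euler $ m)"
        using nct by (simp add: msubst_sum msubst_mult euler_def y_def JX)
      finally show ?thesis using ev by (simp add: euler_eval_def U)
    qed
    then show ?R by (intro exI[of _ "\<lambda>k. X $ k"] allI)
  next
    assume ?R
    then obtain X where X: "\<And>v. vfield (liftfield L X) (?S v) = msubst ?S (eulfield \<phi> v)"
      by blast
    define x where "x = (\<chi> k. X k)"
    have "(J *v x) $ m = y $ m" for m
      using vfJ[of X m] X[of "Z m"] nct by (simp add: x_def y_def)
    then have "J *v x = y" by (simp add: vec_eq_iff)
    then have Ky: "K *v y = x"
      by (metis K(2) matrix_vector_mul_assoc matrix_vector_mul_lid)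
    \<comment> \<open>The transformation rule solved for \<open>L'\<close>: multiplication by the
      inverse of \<open>J\<close>, then composition with the inverse map.\<close>
    define Az where "Az = (\<chi> j. dH L (?S (Zb j))) ** K"
    define Aw where "Aw = dH L (?S U) v* K"
    define L' where "L' = \<lparr>Lzb = (\<chi> j m. msubst (inv_map ?S) (Az $ j $ m)),
        Lw = (\<chi> m. msubst (inv_map ?S) (Aw $ m))\<rparr>"
    have Lz: "msubst ?S (Lzb L' $ j $ m) = Az $ j $ m" and Lw: "msubst ?S (Lw L' $ m) = Aw $ m" for j m
      by (simp_all add: L'_def msubst_inverse[OF S])
    have tg: "wge deg 2 (?S v - mvar v)" for v
      using S by (simp add: tangent_def)
    have dHU: "no_constant_term (dH L (?S U) $ k)" and dHZb: "no_constant_term (dH L (?S (Zb j)) $ k)" for j k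
      using nct_dH[OF tg[of U], of k] nct_dH[OF tg[of "Zb j"], of k] L
      by (auto simp: dH_add dH_mvar no_constant_term_def almost_cr_def)
    have "almost_cr L'"
      using dHU dHZb
      by (auto simp: almost_cr_def L'_def Az_def Aw_def no_constant_term_def coeff_msubst_empty
          matrix_matrix_mult_def vector_matrix_mult_def coeff_sum_mps coeff_mult_empty)
    moreover have "transforms_to f g L L'"
    proof -
      have "(\<chi> m. Aw $ m) = Aw" "(\<chi> j m. Az $ j $ m) = Az" by (simp_all add: vec_eq_iff)
      then show ?thesis
        by (simp add: tr Lz Lw)
          (simp add: Aw_def Az_def vector_matrix_mul_assoc matrix_mul_assoc[symmetric] K)
    qed
    moreover have "euler_eval L' = (0, theta \<phi>)"
    proof -
      have "msubst ?S ((Lzb L' *v euler) $ j) = 0" for j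
      proof -
        have "msubst ?S ((Lzb L' *v euler) $ j) = (Az *v y) $ j"
          using nct by (simp add: matrix_vector_mult_def msubst_sum msubst_mult euler_def y_def Lz)
        also have "\<dots> = ((\<chi> j. dH L (?S (Zb j))) *v x) $ j"
          by (simp add: Az_def matrix_vector_mul_assoc[symmetric] Ky)
        also have "\<dots> = vfield (liftfield L X) (?S (Zb j))"
          by (simp add: vf matrix_vector_mult_def x_def)
        finally show ?thesis by (simp only: X eulfield.simps msubst_0)
      qed
      then have "(Lzb L' *v euler) $ j = 0" for j
        by (metis msubst_0 msubst_inverse(2)[OF S])
      then have "Lzb L' *v euler = 0" by (simp add: vec_eq_iff)
      moreover have "msubst ?S (\<Sum>m\<in>UNIV. Lw L' $ m * euler $ m) = msubst ?S (theta \<phi>)"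
      proof -
        have "msubst ?S (\<Sum>m\<in>UNIV. Lw L' $ m * euler $ m) = (\<Sum>m\<in>UNIV. Aw $ m * y $ m)"
          using nct by (simp add: msubst_sum msubst_mult euler_def y_def Lw)
        also have "\<dots> = (\<Sum>m\<in>UNIV. \<Sum>k\<in>UNIV. dH L (?S U) $ k * K $ k $ m * y $ m)"
          by (simp add: Aw_def vector_matrix_mult_def sum_distrib_left mult_ac)
        also have "\<dots> = (\<Sum>k\<in>UNIV. dH L (?S U) $ k * (K *v y) $ k)"
          by (subst sum.swap) (simp add: matrix_vector_mult_def sum_distrib_left mult_ac)
        also have "\<dots> = vfield (liftfield L X) (?S U)"
          by (simp add: vf Ky x_def)
        finally show ?thesis by (simp only: X eulfield.simps)
      qed
      then have "(\<Sum>m\<in>UNIV. Lw L' $ m * euler $ m) = theta \<phi>"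
        by (metis msubst_inverse(2)[OF S])
      ultimately show ?thesis by (simp add: euler_eval_def)
    qed
    ultimately show ?L by (auto simp: euler_eval_induced)
  qed
qed

definition inverse_normalizing ::
  "'n::finite cr_rep \<Rightarrow> real \<Rightarrow> 'n cseries ^ 'n \<Rightarrow> 'n cseries \<Rightarrow> 'n cseries \<Rightarrow> bool" where
  "inverse_normalizing L r F G \<phi> \<longleftrightarrow>
     admissible F G \<and> real_series \<phi> \<and> wge deg 2 \<phi> \<and> chern_moser L \<phi> \<and>
     coeff G {#U, U#} = - of_real r / 2 \<and> embedding_eqs L F G \<phi>"

lemma normalizing_iff:
  assumes L: "almost_cr L"
  shows "normalizing L r f g \<phi> \<longleftrightarrow>
    admissible f g \<and> inverse_normalizing L r (cinv f g) (rinv f g) \<phi>"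
proof -
  have d: "deriv0 {#U, U#} q = 2 * coeff q {#U, U#}" for q :: "'a cseries"
    by (simp add: deriv0_def numeral_2_eq_2)
  have adm: "(\<forall>j. no_constant_term (f $ j) \<and> no_linear_terms (f $ j)) \<and>
     real_series g \<and> no_constant_term g \<and> no_linear_terms g \<longleftrightarrow> admissible f g"
    unfolding admissible_def no_linear_terms_iff_wge[symmetric] by blast
  show ?thesis
  proof (cases "admissible f g")
    case True
    have r: "deriv0 {#U, U#} g = of_real r \<longleftrightarrow> coeff (rinv f g) {#U, U#} = - of_real r / 2"
      by (auto simp: d rinv_UU[OF True] field_simps)
    show ?thesis
      unfolding normalizing_def inverse_normalizing_def quasi_CR_embedding_def
        quasi_embedding_iff_field[OF True L] embedding_eqs_iff_field[OF True, symmetric]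
        r no_linear_terms_iff_wge[symmetric]
      using True admissible_cinv[OF True] formal_diffeo_admissible[OF True] adm by blast
  next
    case False
    then show ?thesis using adm by (auto simp: normalizing_def)
  qed
qed

section \<open>The linearized problem\<close>

subsection \<open>Bidegrees\<close>

abbreviation du :: "'n cseries \<Rightarrow> 'n cseries" where "du \<equiv> mderiv U"

definition zd :: "'n crvar multiset \<Rightarrow> nat" where
  "zd M = size (filter_mset (\<lambda>v. v \<in> range Z) M)"

definition zbd :: "'n crvar multiset \<Rightarrow> nat" where
  "zbd M = size (filter_mset (\<lambda>v. v \<in> range Zb) M)"

fun cw :: "'n crvar \<Rightarrow> nat" where
  "cw (Z j) = 1" | "cw (Zb j) = 1" | "cw U = 2"

lemma cw_pos [simp]: "0 < cw v" "cw v \<noteq> 0"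
  by (cases v; simp)+

lemma cw_conj_var [simp]: "cw (conj_var v) = cw v"
  by (cases v) auto

lemma zd_simps [simp]:
  "zd {#} = 0" "zd (add_mset (Z j) M) = Suc (zd M)" "zd (add_mset (Zb j) M) = zd M"
  "zd (add_mset U M) = zd M" "zd (A + B) = zd A + zd B"
  by (auto simp: zd_def)

lemma zbd_simps [simp]:
  "zbd {#} = 0" "zbd (add_mset (Z j) M) = zbd M" "zbd (add_mset (Zb j) M) = Suc (zbd M)"
  "zbd (add_mset U M) = zbd M" "zbd (A + B) = zbd A + zbd B"
  by (auto simp: zbd_def)

lemma wt_cw: "wt cw M = zd M + zbd M + 2 * count M U"
proof (induction M)
  case (add v M)
  then show ?case by (cases v) auto
qed simp

lemma zd_conj [simp]: "zd (image_mset conj_var M) = zbd M"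
  and zbd_conj [simp]: "zbd (image_mset conj_var M) = zd M"
proof (induction M)
  case (add v M)
  { case 1 show ?case using add by (cases v) auto }
  { case 2 show ?case using add by (cases v) auto }
qed auto

lemma zd_diff1: "v \<in># M \<Longrightarrow> zd (M - {#v#}) = zd M - zd {#v#}"
  and zbd_diff1: "v \<in># M \<Longrightarrow> zbd (M - {#v#}) = zbd M - zbd {#v#}"
  by (metis add_diff_cancel_left' insert_DiffM2 union_commute zd_simps(5),
      metis add_diff_cancel_left' insert_DiffM2 union_commute zbd_simps(5))

lemma zd_0_iff: "zd M = 0 \<longleftrightarrow> (\<forall>j. Z j \<notin># M)"
  and zbd_0_iff: "zbd M = 0 \<longleftrightarrow> (\<forall>j. Zb j \<notin># M)"
proof (induction M)
  case (add v M)
  { case 1 show ?case using add by (cases v) auto }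
  { case 2 show ?case using add by (cases v) auto }
qed auto

lemma replicate_U:
  assumes "zd M = 0" "zbd M = 0"
  shows "M = replicate_mset (count M U) U"
proof (rule multiset_eqI)
  fix v
  show "count M v = count (replicate_mset (count M U) U) v"
    using assms by (cases v) (auto simp: zd_0_iff zbd_0_iff not_in_iff)
qed

lemma wge_sconj_cw [simp]: "wge cw k (sconj q) \<longleftrightarrow> wge cw k q"
  by (rule wge_sconj) simp

text \<open>All powers of \<open>u\<close> are kept, so that an equation in one bidegree is a
  differential equation in \<open>u\<close> for a polynomial in \<open>z\<close> and
  \<open>zb\<close>.\<close>

definition pr :: "nat \<Rightarrow> nat \<Rightarrow> 'n cseries \<Rightarrow> 'n cseries" where
  "pr a b q = Mps (\<lambda>M. if zd M = a \<and> zbd M = b then coeff q M else 0)"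

lemma coeff_pr: "coeff (pr a b q) M = (if zd M = a \<and> zbd M = b then coeff q M else 0)"
  by (simp add: pr_def)

lemma pr_0 [simp]: "pr a b 0 = 0"
  and pr_add: "pr a b (p + q) = pr a b p + pr a b q"
  and pr_diff: "pr a b (p - q) = pr a b p - pr a b q"
  and pr_minus: "pr a b (- q) = - pr a b q"
  and pr_csmul: "pr a b (x \<cdot> q) = x \<cdot> pr a b q"
  and pr_du: "pr a b (du q) = du (pr a b q)"
  and pr_sconj: "pr a b (sconj q) = sconj (pr b a q)"
  and pr_pr: "pr a b (pr a' b' q) = (if a = a' \<and> b = b' then pr a b q else 0)"
  by (rule mps_eqI; auto simp: coeff_pr coeff_mderiv coeff_sconj)+

lemma pr_sum: "pr a b (\<Sum>i\<in>I. f i) = (\<Sum>i\<in>I. pr a b (f i))"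
  by (induction I rule: infinite_finite_induct) (auto simp: pr_add)

lemma pr_mvar_Z:
  "pr (Suc a) b (mvar (Z j) * q) = mvar (Z j) * pr a b q" (is ?thesis1)
  "pr 0 b (mvar (Z j) * q) = 0" (is ?thesis2)
proof -
  have "coeff (pr a' b' (mvar (Z j) * q)) M = (if Z j \<in># M \<and> zd M = a' \<and> zbd M = b' then coeff q (M - {#Z j#}) else 0)" for M a' b'
    by (simp add: coeff_pr coeff_mvar_times)
  then show ?thesis1 ?thesis2
    by (auto simp: mps_eq_iff coeff_mvar_times coeff_pr dest!: multi_member_split)
qed

lemma pr_mvar_Zb:
  "pr a (Suc b) (mvar (Zb j) * q) = mvar (Zb j) * pr a b q" (is ?thesis1)
  "pr a 0 (mvar (Zb j) * q) = 0" (is ?thesis2)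
proof -
  have "coeff (pr a' b' (mvar (Zb j) * q)) M = (if Zb j \<in># M \<and> zd M = a' \<and> zbd M = b' then coeff q (M - {#Zb j#}) else 0)" for M a' b'
    by (simp add: coeff_pr coeff_mvar_times)
  then show ?thesis1 ?thesis2
    by (auto simp: mps_eq_iff coeff_mvar_times coeff_pr dest!: multi_member_split)
qed

lemma pr_mderiv_Z: "pr a b (mderiv (Z j) q) = mderiv (Z j) (pr (Suc a) b q)"
  and pr_mderiv_Zb: "pr a b (mderiv (Zb j) q) = mderiv (Zb j) (pr a (Suc b) q)"
  by (rule mps_eqI; auto simp: coeff_pr coeff_mderiv)+

lemma pr_eqI: "(\<And>a b. pr a b p = pr a b q) \<Longrightarrow> p = q"
  by (rule mps_eqI) (metis coeff_pr)

lemma wge_pr: "wge \<omega> k q \<Longrightarrow> wge \<omega> k (pr a b q)"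
  by (auto simp: wge_def coeff_pr)

lemma wge_prI: "(\<And>a b. wge \<omega> k (pr a b q)) \<Longrightarrow> wge \<omega> k q"
  unfolding wge_def coeff_pr by metis

lemma wge_du: "wge cw k q \<Longrightarrow> wge cw (k - 2) (du q)"
  using wge_mderiv[of cw k q U] by simp

lemma coeff_eul: "coeff (eul q) M = of_nat (zd M) * coeff q M"
proof -
  have "coeff (eul q) M = (\<Sum>j\<in>UNIV. of_nat (count M (Z j)) * coeff q M)"
    unfolding eul_def coeff_sum_mps
  proof (rule sum.cong)
    fix j
    show "coeff (mvar (Z j) * mderiv (Z j) q) M = of_nat (count M (Z j)) * coeff q M"
    proof (cases "Z j \<in># M")
      case True
      then show ?thesis by (auto simp: coeff_mvar_times coeff_mderiv dest!: multi_member_split)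
    next
      case False
      then have "count M (Z j) = 0" by (simp add: not_in_iff)
      with False show ?thesis by (simp add: coeff_mvar_times del: count_eq_zero_iff)
    qed
  qed simp
  also have "(\<Sum>j\<in>UNIV. of_nat (count M (Z j)) * coeff q M) = of_nat (zd M) * coeff q M"
  proof -
    have "zd M = (\<Sum>j\<in>UNIV. count M (Z j))"
    proof (induction M)
      case (add v M)
      have "count (add_mset v M) (Z j) = (if v = Z j then 1 else 0) + count M (Z j)" for j
        by simp
      then show ?case using add by (cases v) (simp_all add: sum.distrib del: count_add_mset)
    qed simp
    then show ?thesis by (simp add: sum_distrib_right)
  qed
  finally show ?thesis .
qed

lemma eul_add: "eul (p + q) = eul p + eul q"
  and eul_diff: "eul (p - q) = eul p - eul q"
  and eul_minus: "eul (- q) = - eul q"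
  and eul_csmul: "eul (x \<cdot> q) = x \<cdot> eul q"
  and eul_0 [simp]: "eul 0 = 0"
  by (rule mps_eqI; simp add: coeff_eul coeff_mderiv algebra_simps)+

lemma eul_sum: "eul (\<Sum>i\<in>I. f i) = (\<Sum>i\<in>I. eul (f i))"
  by (induction I rule: infinite_finite_induct) (auto simp: eul_add)

lemma eul_mult: "eul (p * q) = eul p * q + p * eul q"
  by (simp add: eul_def mderiv_mult sum.distrib sum_distrib_left sum_distrib_right algebra_simps)

lemma eul_mvar: "eul (mvar (Z j)) = mvar (Z j)" "eul (mvar (Zb j)) = 0" "eul (mvar U) = 0"
  by (rule mps_eqI; auto simp: coeff_eul coeff_mvar)+

lemma pr_eul: "pr a b (eul q) = of_nat a \<cdot> pr a b q"
  by (rule mps_eqI) (simp add: coeff_pr coeff_eul)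

lemma wge_eul: "wge \<omega> k q \<Longrightarrow> wge \<omega> k (eul q)"
  by (simp add: wge_def coeff_eul)

text \<open>The conjugate of the corresponding fact for \<open>eul\<close>.\<close>

lemma eulb_pr:
  fixes q :: "'n::finite cseries"
  shows "(\<Sum>j\<in>UNIV. mvar (Zb j) * mderiv (Zb j) (pr a b q)) = of_nat b \<cdot> pr a b q"
proof -
  have "sconj (\<Sum>j\<in>UNIV. mvar (Zb j) * mderiv (Zb j) (pr a b q)) = eul (pr b a (sconj q))"
    by (simp add: eul_def sconj_sum sconj_mult sconj_mvar sconj_mderiv pr_sconj)
  also have "\<dots> = of_nat b \<cdot> pr b a (sconj q)"
    by (rule mps_eqI) (simp add: coeff_eul coeff_pr)
  also have "\<dots> = sconj (of_nat b \<cdot> pr a b q)"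
    by (simp add: sconj_csmul pr_sconj)
  finally have "sconj (sconj (\<Sum>j\<in>UNIV. mvar (Zb j) * mderiv (Zb j) (pr a b q))) = sconj (sconj (of_nat b \<cdot> pr a b q))"
    by (rule arg_cong)
  then show ?thesis by (simp only: sconj_sconj)
qed

lemma eul_pr: "eul (pr a b q) = of_nat a \<cdot> pr a b q"
  by (rule mps_eqI) (simp add: coeff_eul coeff_pr)

lemma of_nat_times: "of_nat m * q = of_nat m \<cdot> q"
  by (induction m) (simp_all add: csmul_add_left distrib_right)

lemma csmul_eqD: "x \<cdot> p = q \<Longrightarrow> x \<noteq> 0 \<Longrightarrow> p = (1 / x) \<cdot> q"
  by auto

lemma wge_mvar_cw:
  "wge cw 1 (mvar (Z j))" "wge cw 1 (mvar (Zb j))" "wge cw 2 (mvar U)"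
  using wge_mvar[of cw "Z j"] wge_mvar[of cw "Zb j"] wge_mvar[of cw U] by auto

text \<open>The antiderivative in \<open>u\<close> that vanishes at u = 0.\<close>

definition intu :: "'n cseries \<Rightarrow> 'n cseries" where
  "intu q = Mps (\<lambda>M. if U \<in># M then coeff q (M - {#U#}) / of_nat (count M U) else 0)"

lemma du_intu [simp]: "du (intu q) = q"
  by (rule mps_eqI) (simp add: coeff_mderiv intu_def del: of_nat_Suc)

lemma pr_intu: "pr a b (intu q) = intu (pr a b q)"
  by (rule mps_eqI) (auto simp: coeff_pr intu_def zd_diff1 zbd_diff1)

lemma sconj_intu: "sconj (intu q) = intu (sconj q)"
proof (rule mps_eqI)
  fix M :: "'a crvar multiset"
  have "U \<in># image_mset conj_var M \<longleftrightarrow> U \<in># M"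
    by (metis conj_var.simps(3) count_eq_zero_iff count_image_conj_var)
  moreover have "image_mset conj_var (M - {#U#}) = image_mset conj_var M - {#U#}" if "U \<in># M"
    using that by (simp add: image_mset_Diff)
  ultimately show "coeff (sconj (intu q)) M = coeff (intu (sconj q)) M"
    by (simp add: coeff_sconj intu_def)
qed

section \<open>The Levi form, its trace and the model field\<close>

locale levi_tensors =
  fixes c d N :: "'n::finite \<Rightarrow> 'n \<Rightarrow> complex"
  assumes herm: "cnj (c j k) = c k j"
    and inv1: "(\<Sum>k\<in>UNIV. d j k * c l k) = (if j = l then 1 else 0)"
    and inv2: "(\<Sum>j\<in>UNIV. d j k * c j l) = (if k = l then 1 else 0)"
    and anti: "N j k = - N k j"
begin

definition h :: "'n cseries" where
  "h = (\<Sum>j\<in>UNIV. \<Sum>k\<in>UNIV. c j k \<cdot> (mvar (Zb j) * mvar (Z k)))"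

definition lev :: "('n \<Rightarrow> 'n cseries) \<Rightarrow> 'n cseries" where
  "lev v = (\<Sum>j\<in>UNIV. \<Sum>k\<in>UNIV. c j k \<cdot> (mvar (Zb j) * v k))"

definition levc :: "('n \<Rightarrow> 'n cseries) \<Rightarrow> 'n cseries" where
  "levc v = (\<Sum>j\<in>UNIV. \<Sum>k\<in>UNIV. c j k \<cdot> (mvar (Z k) * v j))"

text \<open>The value N(z, v) / 2. The half appears because \<open>N / 2\<close> is the
  antisymmetric part of the z-derivative of \<open>Lw\<close>.\<close>

definition be :: "('n \<Rightarrow> 'n cseries) \<Rightarrow> 'n cseries" where
  "be v = (\<Sum>j\<in>UNIV. \<Sum>k\<in>UNIV. (N j k / 2) \<cdot> (mvar (Z j) * v k))"

text \<open>Solves \<open>lev v = q\<close> when \<open>q\<close> is linear in \<open>zb\<close> and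
  \<open>v\<close> is free of \<open>zb\<close>.\<close>

definition unlev :: "'n cseries \<Rightarrow> 'n \<Rightarrow> 'n cseries" where
  "unlev q k = (\<Sum>j\<in>UNIV. d j k \<cdot> mderiv (Zb j) q)"

definition trc :: "'n cseries \<Rightarrow> 'n cseries" where
  "trc q = (\<Sum>j\<in>UNIV. \<Sum>k\<in>UNIV. d j k \<cdot> mderiv (Zb j) (mderiv (Z k) q))"

text \<open>The part of lowest weight of the lifted Euler field: if \<open>\<phi>\<close> starts
  with \<open>h\<close>, then \<open>theta \<phi>\<close> starts with \<open>\<i> h\<close>.
  Bidegree (a, b) is multiplied by a and also mapped to (a + 1, b + 1).\<close>

definition D :: "'n cseries \<Rightarrow> 'n cseries" where
  "D q = eul q + \<i> \<cdot> (h * du q)"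

lemma d_herm: "cnj (d j k) = d k j"
proof -
  have "cnj (d j k) = (\<Sum>m\<in>UNIV. (\<Sum>l\<in>UNIV. d k l * c m l) * cnj (d j m))"
    by (simp add: inv1 if_distrib[of "\<lambda>x. x * _"] cong: if_cong)
  also have "\<dots> = (\<Sum>l\<in>UNIV. d k l * cnj (\<Sum>m\<in>UNIV. d j m * c l m))"
    by (simp add: sum_distrib_left sum_distrib_right herm mult_ac) (rule sum.swap)
  also have "\<dots> = d k j"
    by (simp add: inv1 if_distrib cong: if_cong)
  finally show ?thesis .
qed

lemma sconj_h [simp]: "sconj h = h"
proof -
  have "sconj h = (\<Sum>j\<in>UNIV. \<Sum>k\<in>UNIV. c k j \<cdot> (mvar (Zb k) * mvar (Z j)))"
    by (simp add: h_def sconj_sum sconj_csmul sconj_mult sconj_mvar herm mult.commute)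
  then show ?thesis unfolding h_def by (subst sum.swap)
qed

lemma sconj_lev: "sconj (lev v) = levc (\<lambda>k. sconj (v k))"
proof -
  have "sconj (lev v) = (\<Sum>j\<in>UNIV. \<Sum>k\<in>UNIV. c k j \<cdot> (mvar (Z j) * sconj (v k)))"
    by (simp add: lev_def sconj_sum sconj_csmul sconj_mult sconj_mvar herm)
  then show ?thesis unfolding levc_def by (subst sum.swap)
qed

lemma du_h [simp]: "du h = 0"
  by (simp add: h_def mderiv_sum mderiv_mult mderiv_mvar)

lemma du_h_mult [simp]: "du (h * q) = h * du q"
  by (simp add: mderiv_mult)

lemma eul_h [simp]: "eul h = h"
  by (simp add: h_def eul_sum eul_csmul eul_mult eul_mvar)

lemma wge_h: "wge cw 2 h"
  unfolding h_def
  by (intro wge_sum wge_csmul wge_mult'[where j = 1 and k = 1] wge_mvar_cw) simp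

lemma wge_h_mult: "wge cw k q \<Longrightarrow> wge cw (k + 2) (h * q)"
  using wge_mult[OF wge_h, of k q] by (simp add: add.commute)

lemma wge_h_du: "wge cw k q \<Longrightarrow> wge cw k (h * du q)"
  by (rule wge_mono[OF wge_h_mult[OF wge_du]]) auto

lemma pr_h [simp]: "pr (Suc a) (Suc b) (h * q) = h * pr a b q"
  "pr 0 b (h * q) = 0" "pr a 0 (h * q) = 0"
proof -
  have *: "h * q = (\<Sum>j\<in>UNIV. \<Sum>k\<in>UNIV. c j k \<cdot> (mvar (Zb j) * (mvar (Z k) * q)))" for q
    by (simp add: h_def sum_distrib_right mult.assoc)
  show "pr (Suc a) (Suc b) (h * q) = h * pr a b q" "pr 0 b (h * q) = 0" "pr a 0 (h * q) = 0"
    unfolding * by (cases b; simp add: pr_sum pr_csmul pr_mvar_Z pr_mvar_Zb)+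
qed

lemma lev_simps:
  "lev (\<lambda>k. v k + w k) = lev v + lev w" "lev (\<lambda>k. v k - w k) = lev v - lev w"
  "lev (\<lambda>k. x \<cdot> v k) = x \<cdot> lev v" "lev (\<lambda>k. q * v k) = q * lev v" "lev (\<lambda>k. du (v k)) = du (lev v)"
  "lev (\<lambda>k. 0) = 0" "lev (\<lambda>k. - v k) = - lev v"
  by (simp_all add: lev_def csmul_add csmul_diff csmul_minus csmul_sum distrib_left right_diff_distrib sum.distrib sum_negf
      sum_subtractf sum_distrib_left mderiv_sum mderiv_mult mderiv_mvar mult_ac)

lemma levc_simps:
  "levc (\<lambda>k. v k + w k) = levc v + levc w" "levc (\<lambda>k. v k - w k) = levc v - levc w"
  "levc (\<lambda>k. x \<cdot> v k) = x \<cdot> levc v" "levc (\<lambda>k. q * v k) = q * levc v" "levc (\<lambda>k. du (v k)) = du (levc v)"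
  "levc (\<lambda>k. 0) = 0" "levc (\<lambda>k. - v k) = - levc v"
  by (simp_all add: levc_def csmul_add csmul_diff csmul_minus csmul_sum distrib_left right_diff_distrib sum.distrib sum_negf
      sum_subtractf sum_distrib_left mderiv_sum mderiv_mult mderiv_mvar mult_ac)

lemma be_simps:
  "be (\<lambda>k. v k + w k) = be v + be w" "be (\<lambda>k. v k - w k) = be v - be w"
  "be (\<lambda>k. x \<cdot> v k) = x \<cdot> be v" "be (\<lambda>k. q * v k) = q * be v" "be (\<lambda>k. du (v k)) = du (be v)"
  "be (\<lambda>k. 0) = 0" "be (\<lambda>k. - v k) = - be v"
  by (simp_all add: be_def csmul_add csmul_diff csmul_minus csmul_sum distrib_left right_diff_distrib sum.distrib sum_negf
      sum_subtractf sum_distrib_left mderiv_sum mderiv_mult mderiv_mvar mult_ac)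

lemma pr_lev: "pr a (Suc b) (lev v) = lev (\<lambda>k. pr a b (v k))" "pr a 0 (lev v) = 0"
  by (simp_all add: lev_def pr_sum pr_csmul pr_mvar_Zb)

lemma pr_be: "pr (Suc a) b (be v) = be (\<lambda>k. pr a b (v k))" "pr 0 b (be v) = 0"
  by (simp_all add: be_def pr_sum pr_csmul pr_mvar_Z)

lemma wge_lev: "(\<And>k. wge cw m (v k)) \<Longrightarrow> wge cw (Suc m) (lev v)"
  unfolding lev_def by (intro wge_sum wge_csmul wge_mult'[where j = 1 and k = m] wge_mvar_cw) auto

lemma wge_be: "(\<And>k. wge cw m (v k)) \<Longrightarrow> wge cw (Suc m) (be v)"
  unfolding be_def by (intro wge_sum wge_csmul wge_mult'[where j = 1 and k = m] wge_mvar_cw) auto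

lemma unlev_lev: "unlev (lev (\<lambda>k. pr a 0 (v k))) k = pr a 0 (v k)"
proof -
  have zero: "mderiv (Zb j) (pr a 0 q) = 0" for j q
    by (rule mps_eqI) (simp add: coeff_mderiv coeff_pr)
  have "mderiv (Zb j) (lev (\<lambda>k. pr a 0 (v k))) = (\<Sum>l\<in>UNIV. c j l \<cdot> pr a 0 (v l))" for j
  proof -
    have "mderiv (Zb j) (lev (\<lambda>k. pr a 0 (v k))) = (\<Sum>i\<in>UNIV. if i = j then (\<Sum>l\<in>UNIV. c i l \<cdot> pr a 0 (v l)) else 0)"
      unfolding lev_def mderiv_sum
      by (rule sum.cong) (auto simp: mderiv_mult mderiv_mvar zero)
    then show ?thesis by simp
  qed
  then have "unlev (lev (\<lambda>k. pr a 0 (v k))) k = (\<Sum>l\<in>UNIV. \<Sum>j\<in>UNIV. (d j k * c j l) \<cdot> pr a 0 (v l))"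
    by (simp add: unlev_def csmul_sum) (rule sum.swap)
  also have "\<dots> = (\<Sum>l\<in>UNIV. (if k = l then 1 else 0) \<cdot> pr a 0 (v l))"
    by (simp add: inv2[symmetric] mps_eq_iff coeff_sum_mps sum_distrib_right)
  also have "\<dots> = pr a 0 (v k)"
    by (simp add: if_distrib[of "\<lambda>x. x \<cdot> _"] cong: if_cong)
  finally show ?thesis .
qed

lemma lev_unlev: "lev (unlev (pr a (Suc 0) q)) = pr a (Suc 0) q"
proof -
  have "lev (unlev (pr a (Suc 0) q)) = (\<Sum>i\<in>UNIV. \<Sum>k\<in>UNIV. \<Sum>j\<in>UNIV.
     (c i k * d j k) \<cdot> (mvar (Zb i) * mderiv (Zb j) (pr a (Suc 0) q)))"
    by (simp add: lev_def unlev_def sum_distrib_left csmul_sum)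
  also have "\<dots> = (\<Sum>i\<in>UNIV. \<Sum>j\<in>UNIV. \<Sum>k\<in>UNIV.
     (c i k * d j k) \<cdot> (mvar (Zb i) * mderiv (Zb j) (pr a (Suc 0) q)))"
    by (rule sum.cong[OF refl], rule sum.swap)
  also have "\<dots> = (\<Sum>i\<in>UNIV. \<Sum>j\<in>UNIV.
     (if j = i then 1 else 0) \<cdot> (mvar (Zb i) * mderiv (Zb j) (pr a (Suc 0) q)))"
    by (simp add: inv1[symmetric] mps_eq_iff coeff_sum_mps sum_distrib_right mult.commute[of "c _ _"])
  also have "\<dots> = pr a (Suc 0) q"
    using eulb_pr[of a "Suc 0" q] by (simp add: if_distrib[of "\<lambda>x. x \<cdot> _"] cong: if_cong)
  finally show ?thesis .
qed

lemma unlev_simps: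
  "unlev (p + q) k = unlev p k + unlev q k" "unlev (p - q) k = unlev p k - unlev q k"
  "unlev (x \<cdot> q) k = x \<cdot> unlev q k" "unlev (du q) k = du (unlev q k)"
  by (simp_all add: unlev_def mderiv_add mderiv_diff csmul_add csmul_diff sum.distrib sum_subtractf
      csmul_sum mderiv_sum mult_ac mderiv_commute[of U])

lemma pr_unlev: "pr a b (unlev q k) = unlev (pr a (Suc b) q) k"
  by (simp add: unlev_def pr_sum pr_csmul pr_mderiv_Zb)

lemma wge_unlev: "wge cw k q \<Longrightarrow> wge cw (k - 1) (unlev q j)"
  unfolding unlev_def using wge_mderiv[of cw k q "Zb _"] by (intro wge_sum wge_csmul) auto

lemma trc_simps:
  "trc (p + q) = trc p + trc q" "trc (p - q) = trc p - trc q" "trc (x \<cdot> q) = x \<cdot> trc q"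
  "trc (du q) = du (trc q)" "trc 0 = 0" "trc (- q) = - trc q"
  by (simp_all add: trc_def mderiv_add mderiv_diff mderiv_minus csmul_minus sum_negf csmul_add csmul_diff sum.distrib sum_subtractf
      csmul_sum mderiv_sum mult_ac mderiv_commute[of U])

lemma pr_trc: "pr a b (trc q) = trc (pr (Suc a) (Suc b) q)"
  by (simp add: trc_def pr_sum pr_csmul pr_mderiv_Zb pr_mderiv_Z)

lemma sconj_trc: "sconj (trc q) = trc (sconj q)"
proof -
  have "sconj (trc q) = (\<Sum>j\<in>UNIV. \<Sum>k\<in>UNIV. d k j \<cdot> mderiv (Zb k) (mderiv (Z j) (sconj q)))"
    by (simp add: trc_def sconj_sum sconj_csmul sconj_mderiv d_herm mderiv_commute[of "Z _" "Zb _"])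
  then show ?thesis unfolding trc_def by (subst sum.swap)
qed

lemma wge_trc: "wge cw k q \<Longrightarrow> wge cw (k - 2) (trc q)"
  unfolding trc_def
  using wge_mderiv[of cw "k - 1" "mderiv (Z _) q" "Zb _"] wge_mderiv[of cw k q "Z _"]
  by (intro wge_sum wge_csmul) (auto simp: numeral_2_eq_2)

lemma trc_pr_a0 [simp]: "trc (pr a 0 q) = 0" and trc_pr_0b [simp]: "trc (pr 0 b q) = 0"
  unfolding trc_def by (rule sum.neutral; intro ballI sum.neutral; simp add: mps_eq_iff coeff_mderiv coeff_pr)+

text \<open>The product rule for a second-order operator. Both derivatives on \<open>h\<close> give
  the trace of the identity, the dimension; one derivative on \<open>h\<close> gives the two Euler
  fields, because \<open>d\<close> contracted with \<open>c\<close> is the identity.\<close>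

lemma trc_h_mult:
  "trc (h * q) = of_nat CARD('n) \<cdot> q + eul q + (\<Sum>j\<in>UNIV. mvar (Zb j) * mderiv (Zb j) q) + h * trc q"
proof -
  define Az where "Az j = (\<Sum>l\<in>UNIV. c j l \<cdot> mvar (Z l))" for j
  define Ab where "Ab k = (\<Sum>l\<in>UNIV. c l k \<cdot> mvar (Zb l))" for k
  have hz: "mderiv (Z k) h = Ab k" for k
  proof -
    have "mderiv (Z k) h = (\<Sum>j\<in>UNIV. \<Sum>l\<in>UNIV. if l = k then c j k \<cdot> mvar (Zb j) else 0)"
      unfolding h_def mderiv_sum
      by (intro sum.cong refl) (auto simp: mderiv_mult mderiv_mvar)
    then show ?thesis by (simp add: Ab_def)
  qed
  have hzb: "mderiv (Zb j) h = Az j" for j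
  proof -
    have "mderiv (Zb j) h = (\<Sum>k\<in>UNIV. \<Sum>l\<in>UNIV. if l = j then c j k \<cdot> mvar (Z k) else 0)"
      unfolding h_def mderiv_sum
      by (subst sum.swap, intro sum.cong refl) (auto simp: mderiv_mult mderiv_mvar)
    then show ?thesis by (simp add: Az_def)
  qed
  have Abz: "mderiv (Zb j) (Ab k) = c j k \<cdot> 1" for j k
    by (simp add: Ab_def mderiv_sum mderiv_mvar if_distrib[of "\<lambda>x. _ \<cdot> x"] cong: if_cong)
  have "trc (h * q) = (\<Sum>j\<in>UNIV. \<Sum>k\<in>UNIV. d j k \<cdot> (c j k \<cdot> q + Ab k * mderiv (Zb j) q +
     (Az j * mderiv (Z k) q + h * mderiv (Zb j) (mderiv (Z k) q))))"
    by (simp add: trc_def mderiv_mult mderiv_add hz hzb Abz)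
  also have "\<dots> = (\<Sum>j\<in>UNIV. \<Sum>k\<in>UNIV. (d j k * c j k) \<cdot> q) +
     (\<Sum>j\<in>UNIV. (\<Sum>k\<in>UNIV. d j k \<cdot> Ab k) * mderiv (Zb j) q) +
     (\<Sum>j\<in>UNIV. \<Sum>k\<in>UNIV. (d j k \<cdot> Az j) * mderiv (Z k) q) + h * trc q"
    by (simp add: csmul_add sum.distrib sum_distrib_right sum_distrib_left trc_def mult_ac)
  also have "(\<Sum>j\<in>UNIV. \<Sum>k\<in>UNIV. (d j k * c j k) \<cdot> q) = of_nat CARD('n) \<cdot> q"
  proof -
    have "(\<Sum>j\<in>UNIV. \<Sum>k\<in>UNIV. (d j k * c j k) \<cdot> q) = (\<Sum>j\<in>UNIV. (\<Sum>k\<in>UNIV. d j k * c j k) \<cdot> q)"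
      by (simp add: mps_eq_iff coeff_sum_mps sum_distrib_right)
    then show ?thesis by (simp add: inv1 of_nat_times)
  qed
  also have "(\<Sum>j\<in>UNIV. (\<Sum>k\<in>UNIV. d j k \<cdot> Ab k) * mderiv (Zb j) q) = (\<Sum>j\<in>UNIV. mvar (Zb j) * mderiv (Zb j) q)"
  proof -
    have "(\<Sum>k\<in>UNIV. d j k \<cdot> Ab k) = mvar (Zb j)" for j
    proof -
      have "(\<Sum>k\<in>UNIV. d j k \<cdot> Ab k) = (\<Sum>l\<in>UNIV. (\<Sum>k\<in>UNIV. d j k * c l k) \<cdot> mvar (Zb l))"
        by (simp add: Ab_def csmul_sum mps_eq_iff coeff_sum_mps sum_distrib_right, subst sum.swap) simp
      also have "\<dots> = mvar (Zb j)"
        by (simp add: inv1 if_distrib[of "\<lambda>x. x \<cdot> _"] cong: if_cong)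
      finally show ?thesis .
    qed
    then show ?thesis by simp
  qed
  also have "(\<Sum>j\<in>UNIV. \<Sum>k\<in>UNIV. (d j k \<cdot> Az j) * mderiv (Z k) q) = eul q"
  proof -
    have "(\<Sum>j\<in>UNIV. d j k \<cdot> Az j) = mvar (Z k)" for k
    proof -
      have "(\<Sum>j\<in>UNIV. d j k \<cdot> Az j) = (\<Sum>l\<in>UNIV. (\<Sum>j\<in>UNIV. d j k * c j l) \<cdot> mvar (Z l))"
        by (simp add: Az_def csmul_sum mps_eq_iff coeff_sum_mps sum_distrib_right, subst sum.swap) simp
      also have "\<dots> = mvar (Z k)"
        by (simp add: inv2 if_distrib[of "\<lambda>x. x \<cdot> _"] cong: if_cong)
      finally show ?thesis .
    qed
    then show ?thesis
      by (subst sum.swap) (simp only: sum_distrib_right[symmetric] eul_def)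
  qed
  finally show ?thesis by (simp add: algebra_simps)
qed

lemma trc_h_pr: "trc (h * pr a b q) = (of_nat CARD('n) + of_nat a + of_nat b) \<cdot> pr a b q + h * trc (pr a b q)"
  by (simp add: trc_h_mult eul_pr eulb_pr csmul_add_left)

lemma D_simps:
  "D (p + q) = D p + D q" "D (p - q) = D p - D q" "D (x \<cdot> q) = x \<cdot> D q" "D 0 = 0" "D (- q) = - D q"
  by (simp_all add: D_def eul_add eul_diff eul_csmul eul_minus mderiv_add mderiv_diff mderiv_minus csmul_add csmul_diff
      csmul_minus distrib_left right_diff_distrib mult.commute)

lemma pr_D: "pr (Suc a) (Suc b) (D q) = of_nat (Suc a) \<cdot> pr (Suc a) (Suc b) q + \<i> \<cdot> (h * du (pr a b q))"
  "pr 0 b (D q) = 0" "pr a 0 (D q) = of_nat a \<cdot> pr a 0 q"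
  by (simp_all add: D_def pr_add pr_csmul pr_eul pr_du)

lemma D_mult_pure:
  assumes "du p = 0"
  shows "D (p * q) = eul p * q + p * D q"
  using assms by (simp add: D_def eul_mult mderiv_mult algebra_simps)

lemma wge_D: "wge cw k q \<Longrightarrow> wge cw k (D q)"
  unfolding D_def by (intro wge_add wge_eul wge_csmul wge_h_du)

end

lemma sconj_eq_iff: "sconj p = sconj q \<longleftrightarrow> p = q"
  by (metis sconj_sconj)

lemma sconj_eq_0_iff [simp]: "sconj q = 0 \<longleftrightarrow> q = 0"
  using sconj_eq_iff[of q 0] by simp

section \<open>Real and imaginary parts, and weights under integration in u\<close>

definition imp :: "'n cseries \<Rightarrow> 'n cseries" where
  "imp q = (1 / (2 * \<i>)) \<cdot> (q - sconj q)"

definition rep :: "'n cseries \<Rightarrow> 'n cseries" where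
  "rep q = (1 / 2) \<cdot> (q + sconj q)"

lemma rep_imp: "q = rep q + \<i> \<cdot> imp q"
  by (rule mps_eqI) (simp add: rep_def imp_def coeff_sconj field_simps)

lemma sconj_rep [simp]: "sconj (rep q) = rep q"
  and sconj_imp [simp]: "sconj (imp q) = imp q"
  by (simp_all add: rep_def imp_def sconj_csmul sconj_add sconj_diff csmul_diff csmul_uminus add.commute)

lemma rep_add: "rep (p + q) = rep p + rep q"
  and rep_diff: "rep (p - q) = rep p - rep q"
  by (rule mps_eqI; simp add: rep_def sconj_add sconj_diff algebra_simps)+

lemma wge_imp: "wge cw k q \<Longrightarrow> wge cw k (imp q)"
  and wge_rep: "wge cw k q \<Longrightarrow> wge cw k (rep q)"
  unfolding imp_def rep_def by (intro wge_csmul wge_diff wge_add; simp)+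

text \<open>Integration regains the weight 2 lost by \<open>du\<close>. The terms free of
  \<open>u\<close> are the constants of integration and have to be controlled separately.\<close>

lemma wge_from_du:
  fixes q :: "'n cseries"
  assumes "wge cw (m - 2) (du q)" "\<And>M. U \<notin># M \<Longrightarrow> wt cw M < m \<Longrightarrow> coeff q M = 0"
  shows "wge cw m q"
proof (rule wgeI)
  fix M :: "'n crvar multiset" assume M: "wt cw M < m"
  show "coeff q M = 0"
  proof (cases "U \<in># M")
    case True
    then obtain A where A: "M = add_mset U A" by (auto dest: multi_member_split)
    then have "coeff (du q) A = 0" using assms(1) M by (auto intro: wgeD)
    then show ?thesis by (simp add: coeff_mderiv A del: of_nat_Suc)
  qed (use assms(2) M in auto)
qed

lemma coeff_pr_U_free:
  "U \<notin># M \<Longrightarrow> coeff (pr 0 0 q) M = (if M = {#} then coeff q {#} else 0)"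
  using replicate_U[of M] by (auto simp: coeff_pr not_in_iff)

lemma U_free_linear:
  assumes "U \<notin># M" "zd M = Suc 0" "zbd M = 0"
  shows "\<exists>j. M = {#Z j#}"
proof -
  obtain j A where A: "M = add_mset (Z j) A"
    using assms(2) zd_0_iff[of M] by (metis multi_member_split nat.distinct(1))
  then have "A = {#}" using assms replicate_U[of A] by (auto simp: not_in_iff)
  with A show ?thesis by simp
qed

lemmas push = distrib_left right_diff_distrib mderiv_add mderiv_diff mderiv_minus
  csmul_add csmul_diff csmul_minus csmul_uminus sconj_add sconj_diff sconj_minus sconj_csmul sconj_mult sconj_mderiv

lemma csmul_imaginary_diff: "(1 / (2 * \<i>)) \<cdot> ((\<i> * c) \<cdot> p - \<i> \<cdot> q) = (1 / 2) \<cdot> (c \<cdot> p - q)"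
  by (rule mps_eqI) (simp add: field_simps)

lemma numeral_times [simp]: "numeral m * (q :: 'v mps) = numeral m \<cdot> q"
  using of_nat_times[of "numeral m" q] by simp

section \<open>Normality, the homogeneous equations and the inversion of traces\<close>

context levi_tensors
begin

definition normal :: "'n cseries \<Rightarrow> bool" where
  "normal q \<longleftrightarrow> (\<forall>a. pr a 0 q = 0) \<and> du (pr (Suc 0) (Suc 0) q) = 0 \<and>
     (\<forall>a. pr (Suc (Suc a)) (Suc 0) q = 0) \<and>
     trc (pr 2 2 q) = 0 \<and> trc (trc (pr 3 2 q)) = 0 \<and> trc (trc (trc (pr 3 3 q))) = 0"

text \<open>The equations for the difference of two solutions of the linear problem, after a
  correction of \<open>W\<close> that leaves only \<open>N\<close> and the Levi form in
  them.\<close>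

definition hom :: "('n \<Rightarrow> 'n cseries) \<Rightarrow> 'n cseries \<Rightarrow> bool" where
  "hom F W \<longleftrightarrow> (\<forall>j. D (sconj (F j)) = 0) \<and> D W = be (\<lambda>k. D (F k) - F k)"

text \<open>The imaginary part of the original \<open>W\<close> in terms of the corrected one: the
  correction has imaginary part twice the real part of \<open>lev F\<close>.\<close>

definition phi :: "('n \<Rightarrow> 'n cseries) \<Rightarrow> 'n cseries \<Rightarrow> 'n cseries" where
  "phi F W = imp W + (lev F + sconj (lev F))"

lemma trc_h: "pr a b q = q \<Longrightarrow> trc (h * q) = (of_nat CARD('n) + of_nat a + of_nat b) \<cdot> q + h * trc q"
  using trc_h_pr[of a b q] by simp

lemma trc_eq_0: "pr a 0 q = q \<Longrightarrow> trc q = 0" "pr 0 b q = q \<Longrightarrow> trc q = 0"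
  by (metis trc_pr_a0, metis trc_pr_0b)

definition \<kappa>\<^sub>2 :: complex where "\<kappa>\<^sub>2 = (2 * of_nat CARD('n) + 4) * (of_nat CARD('n) + 1)"
definition \<kappa>\<^sub>3 :: complex where
  "\<kappa>\<^sub>3 = (3 * of_nat CARD('n) + 6) * (2 * of_nat CARD('n) + 2) * of_nat CARD('n)"

lemma kappa_nonzero: "\<kappa>\<^sub>2 \<noteq> 0" "\<kappa>\<^sub>3 \<noteq> 0"
proof -
  have "\<kappa>\<^sub>2 = of_nat ((2 * CARD('n) + 4) * (CARD('n) + 1))"
    "\<kappa>\<^sub>3 = of_nat ((3 * CARD('n) + 6) * (2 * CARD('n) + 2) * CARD('n))"
    by (simp_all add: \<kappa>\<^sub>2_def \<kappa>\<^sub>3_def algebra_simps)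
  then show "\<kappa>\<^sub>2 \<noteq> 0" "\<kappa>\<^sub>3 \<noteq> 0" by (simp_all only: of_nat_eq_0_iff) auto
qed

text \<open>With n the dimension, the commutator contributes n + a + b each time \<open>trc\<close>
  passes a factor \<open>h\<close>. Here the first trace gives (n + 3) + (n + 1) = 2 n + 4 and the
  second n + 1. For three factors on bidegree (0, 0) the sums are (n + 4) + (n + 2) + n = 3 n + 6,
  then 2 n + 2, then n.\<close>

lemma trc2_h2:
  assumes q: "pr (Suc 0) 0 q = q"
  shows "trc (trc (h * (h * q))) = \<kappa>\<^sub>2 \<cdot> q"
proof -
  have 1: "pr (Suc (Suc 0)) (Suc 0) (h * q) = h * q" using q by simp
  show ?thesis
    unfolding trc_h[OF 1] trc_simps trc_h[OF q] trc_eq_0(1)[OF q]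
    by (rule mps_eqI, simp add: trc_simps trc_h[OF q] trc_eq_0(1)[OF q] \<kappa>\<^sub>2_def)
      (simp add: algebra_simps)
qed

lemma trc3_h3:
  assumes q: "pr 0 0 q = q"
  shows "trc (trc (trc (h * (h * (h * q))))) = \<kappa>\<^sub>3 \<cdot> q"
proof -
  have 1: "pr (Suc 0) (Suc 0) (h * q) = h * q" using q by simp
  have 2: "pr (Suc (Suc 0)) (Suc (Suc 0)) (h * (h * q)) = h * (h * q)" using q by simp
  have t1: "trc (h * q) = of_nat CARD('n) \<cdot> q"
    by (simp add: trc_h[OF q] trc_eq_0(1)[OF q])
  have t2: "trc (h * (h * q)) = (2 * of_nat CARD('n) + 2) \<cdot> (h * q)"
    unfolding trc_h[OF 1] t1 by (rule mps_eqI) (simp add: algebra_simps)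
  have t3: "trc (h * (h * (h * q))) = (3 * of_nat CARD('n) + 6) \<cdot> (h * (h * q))"
    unfolding trc_h[OF 2] t2 by (rule mps_eqI) (simp add: algebra_simps)
  show ?thesis
    by (simp add: t1 t2 t3 trc_simps \<kappa>\<^sub>3_def)
qed

text \<open>On bidegree (1, 1) one has trc (h B) = (n + 2) B + h trc B. A second trace gives trc Y =
  (2 n + 2) trc B, so the trace of \<open>B\<close> is known, and then \<open>B\<close>. Both
  directions are used: one for estimates, the other for existence.\<close>

lemma trc_h_solve:
  assumes B: "pr (Suc 0) (Suc 0) B = B" and Y: "pr (Suc 0) (Suc 0) Y = Y"
  shows "trc (h * B) = Y \<longleftrightarrow>
    B = (1 / (of_nat CARD('n) + 2)) \<cdot> (Y - (1 / (2 * of_nat CARD('n) + 2)) \<cdot> (h * trc Y))"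
proof -
  let ?n = "of_nat CARD('n) :: complex"
  have n: "?n + 2 \<noteq> 0" "2 * ?n + 2 \<noteq> 0"
    using of_nat_eq_0_iff[where 'a=complex, of "CARD('n) + 2"]
      of_nat_eq_0_iff[where 'a=complex, of "2 * CARD('n) + 2"] by (simp_all add: add.commute)
  have t: "trc (h * B) = (?n + 2) \<cdot> B + h * trc B"
    unfolding trc_h[OF B] by (simp add: add.commute)
  have tt: "trc (h * trc q) = ?n \<cdot> trc q" if "pr (Suc 0) (Suc 0) q = q" for q
  proof -
    have "pr 0 0 (trc q) = trc q" using that by (simp add: pr_trc)
    from trc_h[OF this] trc_eq_0(1)[OF this] show ?thesis by simp
  qed
  show ?thesis
  proof
    assume Y: "trc (h * B) = Y"
    have "trc Y = (2 * ?n + 2) \<cdot> trc B"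
      unfolding Y[symmetric] t trc_simps tt[OF B] by (rule mps_eqI) (simp add: algebra_simps)
    then have "trc B = (1 / (2 * ?n + 2)) \<cdot> trc Y"
      using n by simp
    then have "(?n + 2) \<cdot> B = Y - (1 / (2 * ?n + 2)) \<cdot> (h * trc Y)"
      using Y t by (simp add: algebra_simps)
    then show "B = (1 / (?n + 2)) \<cdot> (Y - (1 / (2 * ?n + 2)) \<cdot> (h * trc Y))"
      using n csmul_eqD by blast
  next
    assume Beq: "B = (1 / (?n + 2)) \<cdot> (Y - (1 / (2 * ?n + 2)) \<cdot> (h * trc Y))"
    have "trc B = (1 / (?n + 2)) \<cdot> (trc Y - (?n / (2 * ?n + 2)) \<cdot> trc Y)"
      unfolding Beq trc_simps tt[OF Y] by simp
    also have "\<dots> = ((1 / (?n + 2)) * (1 - ?n / (2 * ?n + 2))) \<cdot> trc Y"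
      by (rule mps_eqI) (simp add: algebra_simps)
    also have "(1 / (?n + 2)) * (1 - ?n / (2 * ?n + 2)) = 1 / (2 * ?n + 2)"
    proof -
      have "1 - ?n / (2 * ?n + 2) = (?n + 2) / (2 * ?n + 2)"
        using n(2) by (simp add: field_simps)
      then show ?thesis using n(1) by simp
    qed
    finally have "trc B = (1 / (2 * ?n + 2)) \<cdot> trc Y" .
    moreover have "(?n + 2) \<cdot> B = Y - (1 / (2 * ?n + 2)) \<cdot> (h * trc Y)"
      using n unfolding Beq by simp
    ultimately show "trc (h * B) = Y"
      by (simp add: t)
  qed
qed

subsection \<open>Components of solutions of the homogeneous equations\<close>

context
  fixes F W
  assumes hom: "hom F W"
begin

text \<open>In bidegree (b + 1, 0) the operator \<open>D\<close> is multiplication by b + 1.\<close>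

lemma F_0: "pr 0 (Suc b) (F j) = 0"
proof -
  have "pr (Suc b) 0 (D (sconj (F j))) = 0" using hom by (simp add: hom_def)
  then have "of_nat (Suc b) \<cdot> sconj (pr 0 (Suc b) (F j)) = 0" by (simp add: pr_D pr_sconj)
  then have "sconj (pr 0 (Suc b) (F j)) = (1 / of_nat (Suc b)) \<cdot> 0"
    by (rule csmul_eqD) (simp del: of_nat_Suc)
  then show ?thesis by simp
qed

text \<open>\<open>D (sconj (F j)) = 0\<close>, conjugated and sorted by bidegree, is a recursion
  along each diagonal. Together with the vanishing of \<open>pr 0 (Suc b) (F j)\<close> it leaves
  only the components of \<open>F\<close> free of \<open>zb\<close> undetermined.\<close>

lemma F_Suc: "pr (Suc a) (Suc b) (F j) = (\<i> / of_nat (Suc b)) \<cdot> (h * du (pr a b (F j)))"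
proof -
  have "pr (Suc b) (Suc a) (D (sconj (F j))) = 0" using hom by (simp add: hom_def)
  then have "of_nat (Suc b) \<cdot> pr (Suc b) (Suc a) (sconj (F j)) = - (\<i> \<cdot> (h * du (pr b a (sconj (F j)))))"
    by (simp only: pr_D eq_neg_iff_add_eq_0)
  then have "sconj (of_nat (Suc b) \<cdot> pr (Suc b) (Suc a) (sconj (F j))) = sconj (- (\<i> \<cdot> (h * du (pr b a (sconj (F j))))))"
    by (rule arg_cong)
  then have "of_nat (Suc b) \<cdot> pr (Suc a) (Suc b) (F j) = \<i> \<cdot> (h * du (pr a b (F j)))"
    by (simp only: pr_sconj sconj_csmul sconj_mult sconj_minus sconj_h sconj_mderiv sconj_sconj conj_var.simps
        complex_cnj_i csmul_uminus minus_minus complex_cnj_of_nat)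
  from csmul_eqD[OF this] show ?thesis by (simp del: of_nat_Suc)
qed

lemma F_1: "pr (Suc a) (Suc 0) (F j) = \<i> \<cdot> (h * du (pr a 0 (F j)))"
  by (simp add: F_Suc)

lemma F_2: "pr (Suc (Suc a)) (Suc (Suc 0)) (F j) = (- 1 / 2) \<cdot> (h * (h * du (du (pr a 0 (F j)))))"
  by (simp add: F_Suc)

lemma W_b0: "pr (Suc a) 0 W = ((of_nat a - 1) / of_nat (Suc a)) \<cdot> be (\<lambda>k. pr a 0 (F k))"
proof -
  have "pr (Suc a) 0 (D W) = pr (Suc a) 0 (be (\<lambda>k. D (F k) - F k))"
    using hom by (simp add: hom_def)
  then have "of_nat (Suc a) \<cdot> pr (Suc a) 0 W = (of_nat a - 1) \<cdot> be (\<lambda>k. pr a 0 (F k))"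
    by (simp only: pr_D pr_be pr_diff be_simps csmul_diff_left csmul_1)
  from csmul_eqD[OF this] show ?thesis by (simp del: of_nat_Suc)
qed

lemma W_Suc0: "pr (Suc 0) (Suc b) W = (- \<i>) \<cdot> (h * du (pr 0 b W))"
proof -
  have "pr (Suc 0) (Suc b) (D W) = pr (Suc 0) (Suc b) (be (\<lambda>k. D (F k) - F k))"
    using hom by (simp add: hom_def)
  then have "pr (Suc 0) (Suc b) W + \<i> \<cdot> (h * du (pr 0 b W)) = 0"
    by (simp add: pr_D pr_be pr_diff be_simps F_0)
  then show ?thesis by (simp add: csmul_uminus eq_neg_iff_add_eq_0)
qed

text \<open>The recursion along diagonals for \<open>W\<close>. With the two preceding lemmas it
  leaves only the components \<open>pr 0 b W\<close> undetermined once \<open>F\<close> is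
  given.\<close>

lemma W_Suc_Suc: "pr (Suc (Suc a)) (Suc b) W = (1 / of_nat (Suc (Suc a))) \<cdot>
   (be (\<lambda>k. of_nat a \<cdot> pr (Suc a) (Suc b) (F k) + \<i> \<cdot> (h * du (pr a b (F k)))) - \<i> \<cdot> (h * du (pr (Suc a) b W)))"
proof -
  have "pr (Suc (Suc a)) (Suc b) (D W) = pr (Suc (Suc a)) (Suc b) (be (\<lambda>k. D (F k) - F k))"
    using hom by (simp add: hom_def)
  then have "of_nat (Suc (Suc a)) \<cdot> pr (Suc (Suc a)) (Suc b) W =
     be (\<lambda>k. of_nat a \<cdot> pr (Suc a) (Suc b) (F k) + \<i> \<cdot> (h * du (pr a b (F k)))) - \<i> \<cdot> (h * du (pr (Suc a) b W))"
    by (simp add: pr_D pr_be pr_diff be_simps mps_eq_iff algebra_simps)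
  from csmul_eqD[OF this] show ?thesis by (simp del: of_nat_Suc)
qed

abbreviation (input) "\<beta> a \<equiv> be (\<lambda>k. pr a 0 (F k))"
abbreviation (input) "\<Lambda> a \<equiv> lev (\<lambda>k. pr a 0 (F k))"
abbreviation (input) "w b \<equiv> pr 0 b W"

text \<open>The terms under \<open>be\<close> contribute a + 1 and the recursion down to bidegree (a
  + 1, 0) contributes - (a - 1) / (a + 1); their sum has the numerator (a + 1)(a + 1) - (a -
  1).\<close>

lemma W_1: "pr (Suc (Suc a)) (Suc 0) W =
   (\<i> * (of_nat a * of_nat a + of_nat a + 2) / (of_nat (Suc a) * of_nat (Suc (Suc a)))) \<cdot> (h * du (\<beta> a))"
proof -
  have nz: "(of_nat (Suc a) :: complex) \<noteq> 0" by (simp del: of_nat_Suc)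
  have "pr (Suc (Suc a)) (Suc 0) W = (1 / of_nat (Suc (Suc a)) *
     (of_nat a * \<i> + \<i> - \<i> * ((of_nat a - 1) / of_nat (Suc a)))) \<cdot> (h * du (\<beta> a))"
    by (rule mps_eqI, simp add: W_Suc_Suc W_b0 F_1 be_simps push del: of_nat_Suc)
      (simp add: algebra_simps add_divide_distrib diff_divide_distrib del: of_nat_Suc)
  also have "of_nat a * \<i> + \<i> - \<i> * ((of_nat a - 1) / of_nat (Suc a)) =
      \<i> * (of_nat a * of_nat a + of_nat a + 2) / of_nat (Suc a)"
    using nz by (simp add: field_simps)
  finally show ?thesis by (simp add: mult.commute)
qed

lemma W_32: "pr 3 2 W = (- 1 / 6) \<cdot> (h * (h * du (du (\<beta> 0))))"
proof -
  have "pr 3 2 W = pr (Suc (Suc (Suc 0))) (Suc (Suc 0)) W" by (simp add: eval_nat_numeral)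
  also have "\<dots> = (- 1 / 6) \<cdot> (h * (h * du (du (\<beta> 0))))"
    by (rule mps_eqI, simp add: W_Suc_Suc W_b0 F_Suc be_simps push)
  finally show ?thesis .
qed

lemma W_diag:
  "pr (Suc 0) (Suc 0) W = (- \<i>) \<cdot> (h * du (w 0))"
  "pr 2 2 W = (- 1 / 2) \<cdot> (h * (h * du (du (w 0))))"
  "pr 3 3 W = (\<i> / 6) \<cdot> (h * (h * (h * du (du (du (w 0))))))"
  "pr 2 3 W = (- 1 / 2) \<cdot> (h * (h * du (du (w (Suc 0)))))"
proof -
  show "pr (Suc 0) (Suc 0) W = (- \<i>) \<cdot> (h * du (w 0))"
    by (simp add: W_Suc0)
  show "pr 2 2 W = (- 1 / 2) \<cdot> (h * (h * du (du (w 0))))"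
    unfolding numeral_2_eq_2
    by (rule mps_eqI) (simp add: W_Suc_Suc W_Suc0 F_0 be_simps push)
  show "pr 3 3 W = (\<i> / 6) \<cdot> (h * (h * (h * du (du (du (w 0))))))"
    unfolding numeral_3_eq_3
    by (rule mps_eqI) (simp add: W_Suc_Suc W_Suc0 F_0 F_Suc be_simps push)
  show "pr 2 3 W = (- 1 / 2) \<cdot> (h * (h * du (du (w (Suc 0)))))"
    unfolding numeral_3_eq_3 numeral_2_eq_2
    by (rule mps_eqI) (simp add: W_Suc_Suc W_Suc0 F_0 F_Suc be_simps push)
qed

lemma pr_phi: "pr a b (phi F W) = (1 / (2 * \<i>)) \<cdot> (pr a b W - sconj (pr b a W)) + (pr a b (lev F) + sconj (pr b a (lev F)))"
  by (simp add: phi_def imp_def pr_add pr_csmul pr_diff pr_sconj)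

lemma phi_00: "pr 0 0 (phi F W) = (1 / (2 * \<i>)) \<cdot> (w 0 - sconj (w 0))"
  by (simp add: pr_phi pr_lev)

lemma phi_a0: "pr (Suc a) 0 (phi F W) =
   (1 / (2 * \<i>)) \<cdot> (((of_nat a - 1) / of_nat (Suc a)) \<cdot> \<beta> a - sconj (w (Suc a))) + (if a = 0 then sconj (\<Lambda> 0) else 0)"
  by (cases a) (simp_all add: pr_phi pr_lev W_b0 F_0 lev_simps del: of_nat_Suc)

lemma phi_a1: "pr (Suc (Suc a)) (Suc 0) (phi F W) =
   (1 / 2) \<cdot> (h * (((of_nat a * of_nat a + of_nat a + 2) / (of_nat (Suc a) * of_nat (Suc (Suc a)))) \<cdot> du (\<beta> a) - du (sconj (w (Suc a)))))
   + \<Lambda> (Suc (Suc a)) - (if a = 0 then \<i> \<cdot> (h * du (sconj (\<Lambda> 0))) else 0)"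
proof -
  let ?c = "(of_nat a * of_nat a + of_nat a + 2) / (of_nat (Suc a) * of_nat (Suc (Suc a))) :: complex"
  have W1: "pr (Suc (Suc a)) (Suc 0) W = (\<i> * ?c) \<cdot> (h * du (\<beta> a))"
    by (simp only: W_1 times_divide_eq_right)
  have "sconj (lev (\<lambda>k. pr (Suc 0) (Suc a) (F k))) = - (if a = 0 then \<i> \<cdot> (h * du (sconj (\<Lambda> 0))) else 0)"
    by (cases a) (simp_all add: F_Suc F_0 lev_simps sconj_csmul sconj_mult sconj_mderiv csmul_uminus)
  then have "pr (Suc (Suc a)) (Suc 0) (phi F W) = (1 / (2 * \<i>)) \<cdot> ((\<i> * ?c) \<cdot> (h * du (\<beta> a)) - \<i> \<cdot> (h * du (sconj (w (Suc a)))))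
     + \<Lambda> (Suc (Suc a)) - (if a = 0 then \<i> \<cdot> (h * du (sconj (\<Lambda> 0))) else 0)"
    unfolding pr_phi W1 W_Suc0 pr_lev by (simp add: sconj_csmul sconj_mult sconj_mderiv)
  also have "(1 / (2 * \<i>)) \<cdot> ((\<i> * ?c) \<cdot> (h * du (\<beta> a)) - \<i> \<cdot> (h * du (sconj (w (Suc a))))) =
    (1 / 2) \<cdot> (h * (?c \<cdot> du (\<beta> a) - du (sconj (w (Suc a)))))"
    unfolding csmul_imaginary_diff by (simp only: right_diff_distrib csmul_mult_right)
  finally show ?thesis .
qed

lemma phi_11: "pr (Suc 0) (Suc 0) (phi F W) = (\<Lambda> (Suc 0) + sconj (\<Lambda> (Suc 0))) - h * du (rep (w 0))"
  unfolding pr_phi W_diag pr_lev rep_def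
  by (rule mps_eqI, simp add: push)

lemma phi_22: "pr 2 2 (phi F W) = (\<i> / 4) \<cdot> (h * (h * du (du (w 0 - sconj (w 0))))) +
    \<i> \<cdot> (h * du (\<Lambda> (Suc 0) - sconj (\<Lambda> (Suc 0))))"
proof -
  have "pr 2 2 (lev F) = \<i> \<cdot> (h * du (\<Lambda> (Suc 0)))"
    unfolding numeral_2_eq_2 by (simp add: pr_lev F_Suc lev_simps)
  then show ?thesis unfolding pr_phi W_diag
    by (intro mps_eqI, simp add: push)
qed

lemma phi_33: "pr 3 3 (phi F W) = (1 / 6) \<cdot> (h * (h * (h * du (du (du (rep (w 0))))))) -
    (1 / 2) \<cdot> (h * (h * du (du (\<Lambda> (Suc 0) + sconj (\<Lambda> (Suc 0))))))"
proof -
  have "pr 3 3 (lev F) = (- 1 / 2) \<cdot> (h * (h * du (du (\<Lambda> (Suc 0)))))"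
    unfolding numeral_3_eq_3 by (simp add: pr_lev F_2[unfolded of_nat_numeral] lev_simps)
  then show ?thesis unfolding pr_phi W_diag rep_def
    by (intro mps_eqI, simp add: push)
qed

text \<open>The four terms stem from \<open>W\<close> in bidegrees (3, 2) and (2, 3) and from
  \<open>lev F\<close> in the same two. The trace condition on this component will determine
  \<open>pr 0 0 (F j)\<close>.\<close>

lemma phi_32: "pr 3 2 (phi F W) = (\<i> / 12) \<cdot> (h * (h * du (du (\<beta> 0)))) - (\<i> / 4) \<cdot> (h * (h * du (du (sconj (w (Suc 0))))))
   + \<i> \<cdot> (h * du (\<Lambda> (Suc (Suc 0)))) - (1 / 2) \<cdot> (h * (h * du (du (sconj (\<Lambda> 0)))))"
proof -
  have 1: "pr 3 2 (lev F) = \<i> \<cdot> (h * du (\<Lambda> (Suc (Suc 0))))"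
    unfolding numeral_3_eq_3 numeral_2_eq_2 by (simp add: pr_lev F_Suc lev_simps)
  have 2: "pr 2 3 (lev F) = (- 1 / 2) \<cdot> (h * (h * du (du (\<Lambda> 0))))"
    unfolding numeral_3_eq_3 numeral_2_eq_2 by (simp add: pr_lev F_2 lev_simps)
  show ?thesis unfolding pr_phi W_32 W_diag 1 2
    by (intro mps_eqI, simp add: push)
qed

end

end

lemma csmul_eq_0_iff: "x \<cdot> q = 0 \<longleftrightarrow> x = 0 \<or> q = 0"
  by (auto dest: csmul_eqD)

lemma csmul_diff_eq_0: "x \<noteq> 0 \<Longrightarrow> x \<cdot> (p - q) = 0 \<longleftrightarrow> p = q"
  and csmul_diff_eq_0': "x \<noteq> 0 \<Longrightarrow> x \<cdot> (p - q) = 0 \<longleftrightarrow> q = p"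
  by (auto simp: csmul_eq_0_iff)

lemma half_i: "1 / (2 * \<i>) \<noteq> 0"
  by simp

section \<open>Normality as a triangular system for the free components\<close>

context levi_tensors
begin

text \<open>The conditions on the components that make a perturbation of \<open>\<Phi>\<close> normal, solved step by
  step: they determine, in this order, the components of \<open>W\<close> and \<open>F\<close> of lowest degree in \<open>zb\<close>.\<close>

definition steps :: "'n cseries \<Rightarrow> ('n \<Rightarrow> 'n cseries) \<Rightarrow> 'n cseries \<Rightarrow> bool" where
  "steps \<Phi> F W \<longleftrightarrow>
     pr 0 0 W - sconj (pr 0 0 W) = (- 2 * \<i>) \<cdot> pr 0 0 \<Phi> \<and>
     (\<forall>a. sconj (pr 0 (Suc a) W) = (2 * \<i>) \<cdot> pr (Suc a) 0 \<Phi> +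
        ((of_nat a - 1) / of_nat (Suc a)) \<cdot> be (\<lambda>k. pr a 0 (F k)) +
        (if a = 0 then (2 * \<i>) \<cdot> sconj (lev (\<lambda>k. pr 0 0 (F k))) else 0)) \<and>
     (\<forall>a. lev (\<lambda>k. pr (Suc (Suc a)) 0 (F k)) = - pr (Suc (Suc a)) (Suc 0) \<Phi>
        + \<i> \<cdot> (h * du (pr (Suc a) 0 \<Phi>))
        - (2 / (of_nat (Suc a) * of_nat (Suc (Suc a)))) \<cdot> (h * du (be (\<lambda>k. pr a 0 (F k))))
        + (if a = 0 then (2 * \<i>) \<cdot> (h * du (sconj (lev (\<lambda>k. pr 0 0 (F k))))) else 0)) \<and>
     (let L1 = lev (\<lambda>k. pr (Suc 0) 0 (F k)); \<rho> = rep (pr 0 0 W) in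
        du (L1 + sconj L1) = h * du (du \<rho>) - du (pr (Suc 0) (Suc 0) \<Phi>) \<and>
        trc (h * ((- \<i>) \<cdot> du (L1 - sconj L1))) = trc (pr 2 2 \<Phi> + (1 / 2) \<cdot> (h * (h * du (du (pr 0 0 \<Phi>))))) \<and>
        \<kappa>\<^sub>3 \<cdot> du (du (du \<rho>)) = 3 \<cdot> trc (trc (trc (pr 3 3 \<Phi> + (1 / 2) \<cdot> (h * (h * du (du (pr (Suc 0) (Suc 0) \<Phi>)))))))) \<and>
     (\<kappa>\<^sub>2 * \<i> / 3) \<cdot> du (du ((- 2) \<cdot> be (\<lambda>k. pr 0 0 (F k)) + (6 * \<i>) \<cdot> sconj (lev (\<lambda>k. pr 0 0 (F k)))))
       = - trc (trc (pr 3 2 \<Phi> - \<i> \<cdot> (h * du (pr 2 1 \<Phi>)) - (1 / 2) \<cdot> (h * (h * du (du (pr 1 0 \<Phi>))))))"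

text \<open>Each condition is rewritten modulo earlier ones: bidegree (a + 2, 1) uses (a + 1, 0),
  bidegree (2, 2) uses (0, 0), bidegree (3, 3) uses (1, 1), and (3, 2) uses (1, 0) and (2, 1). The
  equivalences are therefore conditional and are assembled at the end in this order.\<close>

lemma normal_iff_steps:
  assumes hom: "hom F W"
  shows "normal (\<Phi> + phi F W) \<longleftrightarrow> steps \<Phi> F W"
proof -
  let ?\<psi> = "\<Phi> + phi F W"
  define w where "w b = pr 0 b W" for b
  define L where "L a = lev (\<lambda>k. pr a 0 (F k))" for a
  define B where "B a = be (\<lambda>k. pr a 0 (F k))" for a
  define \<rho> where "\<rho> = rep (pr 0 0 W)"
  have S0: "pr 0 0 ?\<psi> = 0 \<longleftrightarrow> w 0 - sconj (w 0) = (- 2 * \<i>) \<cdot> pr 0 0 \<Phi>" (is "_ \<longleftrightarrow> ?S0")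
  proof -
    have "pr 0 0 ?\<psi> = (1 / (2 * \<i>)) \<cdot> ((w 0 - sconj (w 0)) - (- 2 * \<i>) \<cdot> pr 0 0 \<Phi>)"
      unfolding pr_add phi_00[OF hom] w_def by (rule mps_eqI) (simp add: field_simps)
    then show ?thesis by (simp only: csmul_diff_eq_0[OF half_i])
  qed
  have S1: "pr (Suc a) 0 ?\<psi> = 0 \<longleftrightarrow> sconj (w (Suc a)) = (2 * \<i>) \<cdot> pr (Suc a) 0 \<Phi> +
        ((of_nat a - 1) / of_nat (Suc a)) \<cdot> B a + (if a = 0 then (2 * \<i>) \<cdot> sconj (L 0) else 0)"
    (is "_ \<longleftrightarrow> ?S1 a") for a
  proof -
    have "pr (Suc a) 0 ?\<psi> = (1 / (2 * \<i>)) \<cdot> ((2 * \<i>) \<cdot> pr (Suc a) 0 \<Phi> +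
        ((of_nat a - 1) / of_nat (Suc a)) \<cdot> B a + (if a = 0 then (2 * \<i>) \<cdot> sconj (L 0) else 0) - sconj (w (Suc a)))"
      unfolding pr_add phi_a0[OF hom] w_def[symmetric] B_def[symmetric] L_def[symmetric]
      by (rule mps_eqI) (simp add: field_simps del: of_nat_Suc)
    then show ?thesis by (simp only: csmul_diff_eq_0'[OF half_i])
  qed
  have S2: "pr (Suc (Suc a)) (Suc 0) ?\<psi> = 0 \<longleftrightarrow> L (Suc (Suc a)) = - pr (Suc (Suc a)) (Suc 0) \<Phi>
        + \<i> \<cdot> (h * du (pr (Suc a) 0 \<Phi>)) - (2 / (of_nat (Suc a) * of_nat (Suc (Suc a)))) \<cdot> (h * du (B a))
        + (if a = 0 then (2 * \<i>) \<cdot> (h * du (sconj (L 0))) else 0)" (is "_ \<longleftrightarrow> ?S2 a") if S1: "?S1 a" for a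
  proof -
    define \<alpha> :: complex where "\<alpha> = of_nat a"
    have nz: "\<alpha> + 1 \<noteq> 0" "\<alpha> + 2 \<noteq> 0"
      using of_nat_eq_0_iff[where 'a=complex, of "a + 1"] of_nat_eq_0_iff[where 'a=complex, of "a + 2"]
      by (simp_all add: \<alpha>_def add.commute)
    \<comment> \<open>Over the common denominator the numerators differ by a a + a + 2 - (a - 1)(a +
      2) = 4.\<close>
    have co: "(of_nat a * of_nat a + of_nat a + 2) / (of_nat (Suc a) * of_nat (Suc (Suc a))) - (of_nat a - 1) / of_nat (Suc a)
      = 2 * (2 / (of_nat (Suc a) * of_nat (Suc (Suc a))) :: complex)"
    proof -
      have "(\<alpha> * \<alpha> + \<alpha> + 2) / ((\<alpha> + 1) * (\<alpha> + 2)) - (\<alpha> - 1) / (\<alpha> + 1) = 2 * (2 / ((\<alpha> + 1) * (\<alpha> + 2)))"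
        using nz by (simp add: divide_simps) (simp add: algebra_simps)
      then show ?thesis by (simp add: \<alpha>_def add.commute)
    qed
    define k m where "k = ((of_nat a * of_nat a + of_nat a + 2) / (of_nat (Suc a) * of_nat (Suc (Suc a))) :: complex)"
      and "m = ((of_nat a - 1) / of_nat (Suc a) :: complex)"
    have km: "2 / (of_nat (Suc a) * of_nat (Suc (Suc a))) = (k - m) / 2"
      using co by (simp add: k_def m_def)
    have "pr (Suc (Suc a)) (Suc 0) ?\<psi> = L (Suc (Suc a)) - (- pr (Suc (Suc a)) (Suc 0) \<Phi>
        + \<i> \<cdot> (h * du (pr (Suc a) 0 \<Phi>)) - ((k - m) / 2) \<cdot> (h * du (B a))
        + (if a = 0 then (2 * \<i>) \<cdot> (h * du (sconj (L 0))) else 0))"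
      unfolding pr_add phi_a1[OF hom] w_def[symmetric] B_def[symmetric] L_def[symmetric] k_def[symmetric] S1 m_def[symmetric]
      by (rule mps_eqI, cases "a = 0"; simp add: push del: of_nat_Suc) (simp_all add: field_simps del: of_nat_Suc)
    then show ?thesis by (simp only: km eq_iff_diff_eq_0[symmetric])
  qed
  have S3: "du (pr (Suc 0) (Suc 0) ?\<psi>) = 0 \<longleftrightarrow>
     du (L (Suc 0) + sconj (L (Suc 0))) = h * du (du \<rho>) - du (pr (Suc 0) (Suc 0) \<Phi>)" (is "_ \<longleftrightarrow> ?S3")
  proof -
    have "du (pr (Suc 0) (Suc 0) ?\<psi>) = du (L (Suc 0) + sconj (L (Suc 0))) - (h * du (du \<rho>) - du (pr (Suc 0) (Suc 0) \<Phi>))"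
      unfolding pr_add phi_11[OF hom] L_def[symmetric] \<rho>_def by (simp add: push)
    then show ?thesis by (simp only: eq_iff_diff_eq_0[symmetric])
  qed
  have S4: "trc (pr 2 2 ?\<psi>) = 0 \<longleftrightarrow>
     trc (h * ((- \<i>) \<cdot> du (L (Suc 0) - sconj (L (Suc 0))))) = trc (pr 2 2 \<Phi> + (1 / 2) \<cdot> (h * (h * du (du (pr 0 0 \<Phi>)))))"
     (is "_ \<longleftrightarrow> ?S4") if S0: ?S0
  proof -
    have "pr 2 2 ?\<psi> = pr 2 2 \<Phi> + (1 / 2) \<cdot> (h * (h * du (du (pr 0 0 \<Phi>)))) - h * ((- \<i>) \<cdot> du (L (Suc 0) - sconj (L (Suc 0))))"
      unfolding pr_add phi_22[OF hom] L_def[symmetric] w_def[symmetric] S0 by (simp add: push)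
    then show ?thesis by (simp add: trc_simps) (metis eq_iff_diff_eq_0)
  qed
  have \<rho>0: "pr 0 0 (du (du (du \<rho>))) = du (du (du \<rho>))"
    by (simp add: \<rho>_def rep_def pr_du pr_csmul pr_add pr_sconj pr_pr)
  have S5: "trc (trc (trc (pr 3 3 ?\<psi>))) = 0 \<longleftrightarrow> \<kappa>\<^sub>3 \<cdot> du (du (du \<rho>)) =
     3 \<cdot> trc (trc (trc (pr 3 3 \<Phi> + (1 / 2) \<cdot> (h * (h * du (du (pr (Suc 0) (Suc 0) \<Phi>)))))))" (is "_ \<longleftrightarrow> ?S5") if S3: ?S3
  proof -
    have eq: "pr 3 3 ?\<psi> = (pr 3 3 \<Phi> + (1 / 2) \<cdot> (h * (h * du (du (pr (Suc 0) (Suc 0) \<Phi>))))) - (1 / 3) \<cdot> (h * (h * (h * du (du (du \<rho>)))))"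
      unfolding pr_add phi_33[OF hom] L_def[symmetric] \<rho>_def[symmetric] S3
      by (rule mps_eqI, simp add: push)
    have "trc (trc (trc (pr 3 3 ?\<psi>))) = trc (trc (trc (pr 3 3 \<Phi> + (1 / 2) \<cdot> (h * (h * du (du (pr (Suc 0) (Suc 0) \<Phi>)))))))
       - (1 / 3) \<cdot> (\<kappa>\<^sub>3 \<cdot> du (du (du \<rho>)))"
      unfolding eq trc_simps(2) trc_simps(3)[of "1/3"] trc3_h3[OF \<rho>0] ..
    also have "\<dots> = (1 / 3) \<cdot> (3 \<cdot> trc (trc (trc (pr 3 3 \<Phi> + (1 / 2) \<cdot> (h * (h * du (du (pr (Suc 0) (Suc 0) \<Phi>)))))))
       - \<kappa>\<^sub>3 \<cdot> du (du (du \<rho>)))"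
      by (simp add: csmul_diff)
    finally show ?thesis
      by (simp only: csmul_diff_eq_0'[of "1 / 3", simplified])
  qed
  have S6: "trc (trc (pr 3 2 ?\<psi>)) = 0 \<longleftrightarrow> (\<kappa>\<^sub>2 * \<i> / 3) \<cdot> du (du ((- 2) \<cdot> B 0 + (6 * \<i>) \<cdot> sconj (L 0)))
       = - trc (trc (pr 3 2 \<Phi> - \<i> \<cdot> (h * du (pr 2 1 \<Phi>)) - (1 / 2) \<cdot> (h * (h * du (du (pr 1 0 \<Phi>))))))" (is "_ \<longleftrightarrow> ?S6")
    if S1: "?S1 0" and S2: "?S2 0"
  proof -
    define X where "X = pr 3 2 \<Phi> - \<i> \<cdot> (h * du (pr 2 1 \<Phi>)) - (1 / 2) \<cdot> (h * (h * du (du (pr 1 0 \<Phi>))))"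
    define l where "l = du (du ((- 2) \<cdot> B 0 + (6 * \<i>) \<cdot> sconj (L 0)))"
    have 1: "pr (Suc 0) 0 l = l"
      by (simp add: l_def pr_du pr_add pr_csmul B_def L_def pr_be pr_sconj pr_lev pr_pr)
    have S1': "sconj (w (Suc 0)) = (2 * \<i>) \<cdot> pr 1 0 \<Phi> - B 0 + (2 * \<i>) \<cdot> sconj (L 0)"
      using S1 by (simp add: csmul_uminus)
    have S2': "L (Suc (Suc 0)) = - pr 2 1 \<Phi> + \<i> \<cdot> (h * du (pr 1 0 \<Phi>)) - h * du (B 0) + (2 * \<i>) \<cdot> (h * du (sconj (L 0)))"
      using S2 by (simp add: numeral_2_eq_2[symmetric])
    \<comment> \<open>The coefficients of \<open>B 0\<close> add up to i/12 + i/4 - i = - 2i/3,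
      those of the conjugate of \<open>L 0\<close> to 1/2 - 2 - 1/2 = - 2. Taking out i/3 leaves -2
      and 6 i, and -2 \<open>be\<close> is N(\<xi>, z) with \<xi> the value of
      \<open>pr 0 0 (F k)\<close>.\<close>
    have eq: "pr 3 2 ?\<psi> = X + (\<i> / 3) \<cdot> (h * (h * l))"
      unfolding pr_add phi_32[OF hom] L_def[symmetric] B_def[symmetric] w_def[symmetric] S1' S2' X_def l_def
      by (rule mps_eqI, simp add: push) (simp add: field_simps)
    have "trc (trc (pr 3 2 ?\<psi>)) = trc (trc X) + (\<kappa>\<^sub>2 * \<i> / 3) \<cdot> l"
      unfolding eq trc_simps(1,3) trc2_h2[OF 1] by (simp add: mult.commute)
    then show ?thesis unfolding X_def[symmetric] l_def[symmetric]
      by (metis add.commute eq_neg_iff_add_eq_0)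
  qed
  have all: "(\<forall>a. pr a 0 q = 0) \<longleftrightarrow> pr 0 0 q = 0 \<and> (\<forall>a. pr (Suc a) 0 q = 0)" for q :: "'n cseries"
    by (metis not0_implies_Suc)
  have st: "steps \<Phi> F W \<longleftrightarrow> ?S0 \<and> (\<forall>a. ?S1 a) \<and> (\<forall>a. ?S2 a) \<and> (?S3 \<and> ?S4 \<and> ?S5) \<and> ?S6"
    unfolding steps_def Let_def w_def L_def B_def \<rho>_def ..
  show ?thesis
    unfolding normal_def all st
  proof (intro iffI)
    assume a: "(pr 0 0 ?\<psi> = 0 \<and> (\<forall>a. pr (Suc a) 0 ?\<psi> = 0)) \<and> du (pr (Suc 0) (Suc 0) ?\<psi>) = 0 \<and>
      (\<forall>a. pr (Suc (Suc a)) (Suc 0) ?\<psi> = 0) \<and>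
      trc (pr 2 2 ?\<psi>) = 0 \<and> trc (trc (pr 3 2 ?\<psi>)) = 0 \<and> trc (trc (trc (pr 3 3 ?\<psi>))) = 0"
    have s0: ?S0 using a S0 by blast
    have s1: "\<forall>a. ?S1 a" using a S1 by blast
    have s2: "\<forall>a. ?S2 a" using a S2 s1 by blast
    have s3: ?S3 using a S3 by blast
    show "?S0 \<and> (\<forall>a. ?S1 a) \<and> (\<forall>a. ?S2 a) \<and> (?S3 \<and> ?S4 \<and> ?S5) \<and> ?S6"
      using s0 s1 s2 s3 S4[OF s0] S5[OF s3] S6[OF s1[rule_format] s2[rule_format]] a by blast
  next
    assume a: "?S0 \<and> (\<forall>a. ?S1 a) \<and> (\<forall>a. ?S2 a) \<and> (?S3 \<and> ?S4 \<and> ?S5) \<and> ?S6"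
    then have s0: ?S0 and s1: "\<forall>a. ?S1 a" and s2: "\<forall>a. ?S2 a" and s3: ?S3 by blast+
    show "(pr 0 0 ?\<psi> = 0 \<and> (\<forall>a. pr (Suc a) 0 ?\<psi> = 0)) \<and> du (pr (Suc 0) (Suc 0) ?\<psi>) = 0 \<and>
      (\<forall>a. pr (Suc (Suc a)) (Suc 0) ?\<psi> = 0) \<and>
      trc (pr 2 2 ?\<psi>) = 0 \<and> trc (trc (pr 3 2 ?\<psi>)) = 0 \<and> trc (trc (trc (pr 3 3 ?\<psi>))) = 0"
      using S0 S1 S2 S3 S4[OF s0] S5[OF s3] S6[OF s1[rule_format] s2[rule_format]] s0 s1 s2 s3 a by blast
  qed
qed

end

context levi_tensors
begin

subsection \<open>Solving the homogeneous equations\<close>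

text \<open>Solves D q = R by induction on the degree in \<open>z\<close>. No projection is applied:
  the iterate with index a is meaningful only in z-degree a, and \<open>Dsol\<close> reads it only
  there.\<close>

primrec Dstep :: "'n cseries \<Rightarrow> 'n cseries \<Rightarrow> nat \<Rightarrow> 'n cseries" where
  "Dstep X R 0 = X"
| "Dstep X R (Suc a) = (1 / of_nat (Suc a)) \<cdot> (R - \<i> \<cdot> (h * du (Dstep X R a)))"

definition Dsol :: "'n cseries \<Rightarrow> 'n cseries \<Rightarrow> 'n cseries" where
  "Dsol X R = Mps (\<lambda>M. coeff (Dstep X R (zd M)) M)"

lemma pr_Dsol: "pr a b (Dsol X R) = pr a b (Dstep X R a)"
  by (rule mps_eqI) (simp add: coeff_pr Dsol_def)

lemma pr_0_Dsol: "pr 0 b (Dsol X R) = pr 0 b X"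
  by (simp add: pr_Dsol)

text \<open>The hypothesis is the condition of solvability, as every term of a value of
  \<open>D\<close> contains some z. The terms of the solution free of z are arbitrary initial data
  \<open>X\<close>.\<close>

lemma D_Dsol:
  assumes "\<And>b. pr 0 b R = 0"
  shows "D (Dsol X R) = R"
proof (rule pr_eqI)
  fix a b
  show "pr a b (D (Dsol X R)) = pr a b R"
  proof (cases a)
    case 0
    then show ?thesis using assms by (simp add: pr_D)
  next
    case (Suc a')
    have "(of_nat (Suc a') :: complex) \<noteq> 0" by (simp del: of_nat_Suc)
    then show ?thesis
      by (cases b) (simp_all add: Suc pr_D pr_Dsol pr_csmul pr_diff pr_du del: of_nat_Suc)
  qed
qed

lemma wge_Dsol:
  assumes "wge cw k X" "wge cw k R"
  shows "wge cw k (Dsol X R)"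
proof (rule wge_prI)
  fix a b
  have "wge cw k (Dstep X R a)"
    by (induction a) (auto intro!: wge_csmul wge_diff wge_h_du assms simp del: of_nat_Suc)
  then show "wge cw k (pr a b (Dsol X R))" unfolding pr_Dsol by (rule wge_pr)
qed

text \<open>Exhibits the coefficients of the linear form met in bidegree (3, 2) as the expression in
  the definition of strong nondegeneracy. Antisymmetry of \<open>N\<close> absorbs the sign, and the
  half in \<open>be\<close> the factor 2.\<close>

lemma ell_eq: "(- 2) \<cdot> be v + (6 * \<i>) \<cdot> sconj (lev v) =
    (\<Sum>k\<in>UNIV. mvar (Z k) * (\<Sum>j\<in>UNIV. N j k \<cdot> v j + (6 * \<i> * c j k) \<cdot> sconj (v j)))"
proof -
  have "(- 2) \<cdot> be v = (\<Sum>j\<in>UNIV. \<Sum>k\<in>UNIV. N k j \<cdot> (mvar (Z j) * v k))"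
  proof -
    have "(- 2) \<cdot> (N j k / 2) \<cdot> q = N k j \<cdot> q" for j k and q :: "'n cseries"
      using anti[of k j] by simp
    then show ?thesis unfolding be_def csmul_sum by (intro sum.cong refl)
  qed
  moreover have "(6 * \<i>) \<cdot> sconj (lev v) = (\<Sum>k\<in>UNIV. \<Sum>j\<in>UNIV. (6 * \<i> * c j k) \<cdot> (mvar (Z k) * sconj (v j)))"
    unfolding sconj_lev levc_def csmul_sum csmul_csmul by (rule sum.swap)
  ultimately show ?thesis
    by (simp add: sum_distrib_left distrib_left sum.distrib)
qed

lemma mderiv_linear_form:
  fixes e :: "'n \<Rightarrow> 'n cseries"
  assumes "\<And>k. pr 0 0 (e k) = e k"
  shows "mderiv (Z k) (\<Sum>l\<in>UNIV. mvar (Z l) * e l) = e k"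
proof -
  have zero: "mderiv (Z k) (e l) = 0" for l
    by (subst assms[symmetric]) (simp add: mps_eq_iff coeff_mderiv coeff_pr)
  have "mderiv (Z k) (\<Sum>l\<in>UNIV. mvar (Z l) * e l) = (\<Sum>l\<in>UNIV. if l = k then e k else 0)"
    unfolding mderiv_sum by (intro sum.cong refl) (auto simp: mderiv_mult mderiv_mvar zero)
  then show ?thesis by simp
qed

lemma linear_form_mderiv:
  "pr (Suc 0) 0 (q :: 'n cseries) = q \<Longrightarrow> (\<Sum>k\<in>UNIV. mvar (Z k) * mderiv (Z k) q) = q"
  using eul_pr[of "Suc 0" 0 q] by (simp add: eul_def)

end

section \<open>Strong nondegeneracy and the weight estimate for homogeneous solutions\<close>

locale strong_levi_tensors = levi_tensors c d N
  for c d N :: "'n::finite \<Rightarrow> 'n \<Rightarrow> complex" +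
  fixes P Q :: "'n \<Rightarrow> 'n \<Rightarrow> complex"
  assumes solve: "(\<forall>k. \<mu> k = (\<Sum>j\<in>UNIV. N j k * \<xi> j + 6 * \<i> * c j k * cnj (\<xi> j))) \<longleftrightarrow>
    (\<forall>j. \<xi> j = (\<Sum>k\<in>UNIV. P j k * \<mu> k + Q j k * cnj (\<mu> k)))"
begin

text \<open>\<open>P\<close> and \<open>Q\<close> invert the real linear map of strong
  nondegeneracy. They may be applied to each power of \<open>u\<close> separately, because
  \<open>u\<close> is real and conjugation merely conjugates the coefficients.\<close>

lemma solve_series:
  fixes x e :: "'n \<Rightarrow> 'n cseries"
  assumes x: "\<And>j. pr 0 0 (x j) = x j" and e: "\<And>k. pr 0 0 (e k) = e k"
  shows "(\<forall>k. e k = (\<Sum>j\<in>UNIV. N j k \<cdot> x j + (6 * \<i> * c j k) \<cdot> sconj (x j))) \<longleftrightarrow>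
    (\<forall>j. x j = (\<Sum>k\<in>UNIV. P j k \<cdot> e k + Q j k \<cdot> sconj (e k)))" (is "?L \<longleftrightarrow> ?R")
proof -
  let ?S = "{M :: 'n crvar multiset. zd M = 0 \<and> zbd M = 0}"
  have eq: "p = q \<longleftrightarrow> (\<forall>M\<in>?S. coeff p M = coeff q M)" if "pr 0 0 p = p" "pr 0 0 q = q" for p q :: "'n cseries"
    using that unfolding mps_eq_iff coeff_pr by auto metis
  have cj: "coeff (sconj q) M = cnj (coeff q M)" if "M \<in> ?S" for M and q :: "'n cseries"
    using that replicate_U[of M] by (metis (mono_tags, lifting) coeff_sconj conj_var.simps(3) image_replicate_mset mem_Collect_eq)
  have "?L \<longleftrightarrow> (\<forall>k. \<forall>M\<in>?S. coeff (e k) M = (\<Sum>j\<in>UNIV. N j k * coeff (x j) M + 6 * \<i> * c j k * cnj (coeff (x j) M)))"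
    by (subst eq) (simp_all add: e x pr_sum pr_add pr_csmul pr_sconj coeff_sum_mps cj)
  also have "\<dots> \<longleftrightarrow> (\<forall>M\<in>?S. \<forall>k. coeff (e k) M = (\<Sum>j\<in>UNIV. N j k * coeff (x j) M + 6 * \<i> * c j k * cnj (coeff (x j) M)))"
    by blast
  also have "\<dots> \<longleftrightarrow> (\<forall>M\<in>?S. \<forall>j. coeff (x j) M = (\<Sum>k\<in>UNIV. P j k * coeff (e k) M + Q j k * cnj (coeff (e k) M)))"
    by (simp only: solve)
  also have "\<dots> \<longleftrightarrow> (\<forall>j. \<forall>M\<in>?S. coeff (x j) M = (\<Sum>k\<in>UNIV. P j k * coeff (e k) M + Q j k * cnj (coeff (e k) M)))"
    by blast
  also have "\<dots> \<longleftrightarrow> ?R"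
    by (subst eq) (simp_all add: e x pr_sum pr_add pr_csmul pr_sconj coeff_sum_mps cj)
  finally show ?thesis .
qed

text \<open>The constants of integration: 1 and u in \<open>F\<close>, the linear terms in z, and 1,
  u, u^2 in the real part of \<open>W\<close>. The coefficient of u^2 is required to vanish only if
  terms of its weight 4 are to be excluded.\<close>

definition initial :: "nat \<Rightarrow> ('n \<Rightarrow> 'n cseries) \<Rightarrow> 'n cseries \<Rightarrow> bool" where
  "initial m F W \<longleftrightarrow>
     (\<forall>k. coeff (F k) {#} = 0 \<and> coeff (F k) {#U#} = 0 \<and> (\<forall>j. coeff (F k) {#Z j#} = 0)) \<and>
     coeff (rep W) {#} = 0 \<and> coeff (rep W) {#U#} = 0 \<and> (4 < m \<longrightarrow> coeff (rep W) {#U, U#} = 0)"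

text \<open>The steps are solved in order by combinations of \<open>h\<close>, \<open>trc\<close>,
  \<open>du\<close> and integrations that are neutral for the weight. Components of \<open>F\<close>
  come out of \<open>lev F\<close> or of a linear form in z, which accounts for their having one
  weight less.\<close>

theorem hom_weight:
  assumes hom: "hom F W" and norm: "normal (\<Phi> + phi F W)" and \<Phi>: "wge cw (Suc m) \<Phi>"
    and init: "initial (Suc m) F W"
  shows "wge cw m (F k)" "wge cw (Suc m) W"
proof -
  have st: "steps \<Phi> F W" using norm unfolding normal_iff_steps[OF hom] .
  define L where "L a = lev (\<lambda>k. pr a 0 (F k))" for a
  define B where "B a = be (\<lambda>k. pr a 0 (F k))" for a
  define \<rho> where "\<rho> = rep (pr 0 0 W)"
  have pr\<Phi>: "wge cw (Suc m) (pr a b \<Phi>)" for a b using \<Phi> by (rule wge_pr)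
  have hh: "wge cw k (h * (h * du (du q)))" if "wge cw k q" for k q
    by (rule wge_mono[OF wge_h_mult[OF wge_h_mult[OF wge_du[OF wge_du[OF that]]]]]) auto
  have \<rho>: "wge cw (Suc m) \<rho>"
  proof -
    have "\<kappa>\<^sub>3 \<cdot> du (du (du \<rho>)) =
       3 \<cdot> trc (trc (trc (pr 3 3 \<Phi> + (1 / 2) \<cdot> (h * (h * du (du (pr (Suc 0) (Suc 0) \<Phi>)))))))"
      using st by (simp only: steps_def Let_def \<rho>_def)
    then have d3: "du (du (du \<rho>)) = (1 / \<kappa>\<^sub>3) \<cdot> 3 \<cdot>
        trc (trc (trc (pr 3 3 \<Phi> + (1 / 2) \<cdot> (h * (h * du (du (pr (Suc 0) (Suc 0) \<Phi>)))))))"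
      using kappa_nonzero csmul_eqD by blast
    have w3: "wge cw (Suc m - 2 - 2 - 2) (du (du (du \<rho>)))"
      unfolding d3 by (intro wge_csmul wge_trc wge_add hh pr\<Phi>)
    have pr\<rho>: "\<rho> = pr 0 0 (rep W)"
      by (simp add: \<rho>_def rep_def pr_csmul pr_add pr_sconj)
    have zero: "coeff \<rho> {#} = 0" "coeff \<rho> {#U#} = 0" "4 < Suc m \<longrightarrow> coeff \<rho> {#U, U#} = 0"
      using init by (auto simp: pr\<rho> coeff_pr initial_def)
    have free: "coeff (pr 0 0 q) M = 0" if "U \<notin># M" "wt cw M < k" "0 < k \<longrightarrow> coeff q {#} = 0" for q :: "'n cseries" and M k
      using that by (auto simp: coeff_pr_U_free)
    \<comment> \<open>A nonzero constant term would violate this only if 4 < Suc m, which is exactly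
      when \<open>initial\<close> prescribes the coefficient of u^2.\<close>
    have "wge cw (Suc m - 2 - 2) (du (du \<rho>))"
    proof (rule wge_from_du[OF w3])
      fix M :: "'n crvar multiset" assume M: "U \<notin># M" "wt cw M < Suc m - 2 - 2"
      have "coeff (du (du \<rho>)) M = coeff (pr 0 0 (du (du (rep W)))) M" by (simp add: pr\<rho> pr_du)
      also have "\<dots> = (if M = {#} then coeff (du (du (rep W))) {#} else 0)"
        by (rule coeff_pr_U_free[OF M(1)])
      also have "\<dots> = 0" using M zero(3) by (auto simp: pr\<rho> coeff_mderiv coeff_pr)
      finally show "coeff (du (du \<rho>)) M = 0" .
    qed
    then have "wge cw (Suc m - 2) (du \<rho>)"
    proof (rule wge_from_du)
      fix M :: "'n crvar multiset" assume M: "U \<notin># M"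
      have "coeff (du \<rho>) M = coeff (pr 0 0 (du (rep W))) M" by (simp add: pr\<rho> pr_du)
      also have "\<dots> = (if M = {#} then coeff (du (rep W)) {#} else 0)"
        by (rule coeff_pr_U_free[OF M])
      also have "\<dots> = 0" using zero(2) by (auto simp: pr\<rho> coeff_mderiv coeff_pr)
      finally show "coeff (du \<rho>) M = 0" .
    qed
    then show ?thesis
    proof (rule wge_from_du)
      fix M :: "'n crvar multiset" assume "U \<notin># M"
      then show "coeff \<rho> M = 0" using zero(1) unfolding pr\<rho> by (simp add: coeff_pr_U_free)
    qed
  qed
  have w0: "wge cw (Suc m) (pr 0 0 W)"
  proof -
    have 1: "pr 0 0 W - sconj (pr 0 0 W) = (- 2 * \<i>) \<cdot> pr 0 0 \<Phi>"
      using st by (simp only: steps_def)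
    have 2: "pr 0 0 W = \<rho> + (1 / 2) \<cdot> (pr 0 0 W - sconj (pr 0 0 W))"
      by (rule mps_eqI) (simp add: \<rho>_def rep_def field_simps)
    have "pr 0 0 W = \<rho> + (1 / 2) \<cdot> (- 2 * \<i>) \<cdot> pr 0 0 \<Phi>"
      using 2 unfolding 1 .
    moreover have "wge cw (Suc m) (\<rho> + (1 / 2) \<cdot> (- 2 * \<i>) \<cdot> pr 0 0 \<Phi>)"
      by (intro wge_add wge_csmul \<rho> pr\<Phi>)
    ultimately show ?thesis by (rule ssubst)
  qed
  have p1: "wge cw m (pr (Suc 0) 0 (F k))" for k
  proof -
    \<comment> \<open>Bidegree (1, 1) yields the sum of \<open>du (L (Suc 0))\<close> and its
      conjugate, bidegree (2, 2) their difference after inversion of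
      \<open>trc (h * _)\<close>.\<close>
    have S3: "du (L (Suc 0) + sconj (L (Suc 0))) = h * du (du \<rho>) - du (pr (Suc 0) (Suc 0) \<Phi>)"
      and S4: "trc (h * ((- \<i>) \<cdot> du (L (Suc 0) - sconj (L (Suc 0))))) = trc (pr 2 2 \<Phi> + (1 / 2) \<cdot> (h * (h * du (du (pr 0 0 \<Phi>)))))"
      using st by (simp_all add: steps_def Let_def \<rho>_def L_def)
    define Y where "Y = trc (pr 2 2 \<Phi> + (1 / 2) \<cdot> (h * (h * du (du (pr 0 0 \<Phi>)))))"
    have Y: "wge cw (Suc m - 2) Y"
      unfolding Y_def by (intro wge_trc wge_add hh pr\<Phi> wge_csmul)
    have prL: "pr (Suc 0) (Suc 0) (L (Suc 0)) = L (Suc 0)"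
      by (simp add: L_def pr_lev pr_pr)
    have prB: "pr (Suc 0) (Suc 0) ((- \<i>) \<cdot> du (L (Suc 0) - sconj (L (Suc 0)))) = (- \<i>) \<cdot> du (L (Suc 0) - sconj (L (Suc 0)))"
      by (simp add: pr_csmul pr_du pr_diff pr_sconj prL)
    have prY: "pr (Suc 0) (Suc 0) Y = Y"
      unfolding Y_def pr_trc numeral_2_eq_2 by (simp add: pr_add pr_pr pr_csmul pr_du)
    have "(- \<i>) \<cdot> du (L (Suc 0) - sconj (L (Suc 0))) =
       (1 / (of_nat CARD('n) + 2)) \<cdot> (Y - (1 / (2 * of_nat CARD('n) + 2)) \<cdot> (h * trc Y))"
      by (rule iffD1[OF trc_h_solve[OF prB prY] S4[folded Y_def]])
    moreover have "wge cw (Suc m - 2) (h * trc Y)"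
      by (rule wge_mono[OF wge_h_mult[OF wge_trc[OF Y]]]) auto
    ultimately have "wge cw (Suc m - 2) ((- \<i>) \<cdot> du (L (Suc 0) - sconj (L (Suc 0))))"
      using Y by (auto intro!: wge_csmul wge_diff)
    then have 1: "wge cw (Suc m - 2) (\<i> \<cdot> ((- \<i>) \<cdot> du (L (Suc 0) - sconj (L (Suc 0)))))"
      by (rule wge_csmul)
    have "wge cw (Suc m - 2) (h * du (du \<rho>))"
      by (rule wge_h_du[OF wge_du[OF \<rho>]])
    then have 2: "wge cw (Suc m - 2) (du (L (Suc 0) + sconj (L (Suc 0))))"
      unfolding S3 by (intro wge_diff wge_du pr\<Phi>)
    have dL: "du (L (Suc 0)) = (1 / 2) \<cdot> (du (L (Suc 0) + sconj (L (Suc 0))) + \<i> \<cdot> ((- \<i>) \<cdot> du (L (Suc 0) - sconj (L (Suc 0)))))"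
      by (simp add: mps_eq_iff mderiv_add mderiv_diff)
    have L1: "wge cw (Suc m - 2) (du (L (Suc 0)))"
      unfolding dL by (intro wge_csmul wge_add 1 2)
    have "pr (Suc 0) 0 (F k) = unlev (L (Suc 0)) k"
      unfolding L_def by (simp add: unlev_lev)
    then have "du (pr (Suc 0) 0 (F k)) = unlev (du (L (Suc 0))) k"
      by (simp add: unlev_simps)
    then have "wge cw (m - 2) (du (pr (Suc 0) 0 (F k)))"
      using wge_unlev[OF L1, of k] by (auto intro: wge_mono)
    then show ?thesis
    proof (rule wge_from_du)
      fix M :: "'n crvar multiset" assume "U \<notin># M"
      then show "coeff (pr (Suc 0) 0 (F k)) M = 0"
        using init U_free_linear[of M] by (auto simp: coeff_pr initial_def)
    qed
  qed
  have p0: "wge cw m (pr 0 0 (F k))" for k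
  proof -
    define X where "X = pr 3 2 \<Phi> - \<i> \<cdot> (h * du (pr 2 1 \<Phi>)) - (1 / 2) \<cdot> (h * (h * du (du (pr 1 0 \<Phi>))))"
    \<comment> \<open>Strong nondegeneracy recovers these second \<open>u\<close>-derivatives from
      the coefficients \<open>e k\<close>; two integrations then lead to
      \<open>pr 0 0 (F j)\<close>.\<close>
    define x where "x j = du (du (pr 0 0 (F j)))" for j
    define e where "e k = (\<Sum>j\<in>UNIV. N j k \<cdot> x j + (6 * \<i> * c j k) \<cdot> sconj (x j))" for k
    have X: "wge cw (Suc m) X"
      unfolding X_def by (intro wge_diff wge_csmul wge_h_du hh pr\<Phi>)
    have prx: "pr 0 0 (x j) = x j" for j by (simp add: x_def pr_du pr_pr)
    have pre: "pr 0 0 (e k) = e k" for k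
      by (simp add: e_def pr_sum pr_add pr_csmul pr_sconj prx)
    have l: "du (du ((- 2) \<cdot> be (\<lambda>k. pr 0 0 (F k)) + (6 * \<i>) \<cdot> sconj (lev (\<lambda>k. pr 0 0 (F k)))))
       = (\<Sum>k\<in>UNIV. mvar (Z k) * e k)"
    proof -
      have "du (du ((- 2) \<cdot> be (\<lambda>k. pr 0 0 (F k)) + (6 * \<i>) \<cdot> sconj (lev (\<lambda>k. pr 0 0 (F k)))))
         = (- 2) \<cdot> be x + (6 * \<i>) \<cdot> sconj (lev x)"
        unfolding x_def[abs_def] by (simp add: mderiv_add sconj_lev sconj_mderiv be_simps levc_simps)
      also have "\<dots> = (\<Sum>k\<in>UNIV. mvar (Z k) * e k)"
        unfolding e_def by (rule ell_eq)
      finally show ?thesis .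
    qed
    have "(\<kappa>\<^sub>2 * \<i> / 3) \<cdot> du (du ((- 2) \<cdot> be (\<lambda>k. pr 0 0 (F k)) + (6 * \<i>) \<cdot> sconj (lev (\<lambda>k. pr 0 0 (F k))))) = - trc (trc X)"
      using st by (simp only: steps_def X_def)
    then have "(\<kappa>\<^sub>2 * \<i> / 3) \<cdot> (\<Sum>k\<in>UNIV. mvar (Z k) * e k) = - trc (trc X)"
      unfolding l .
    then have e_sum: "(\<Sum>k\<in>UNIV. mvar (Z k) * e k) = (1 / (\<kappa>\<^sub>2 * \<i> / 3)) \<cdot> - trc (trc X)"
      by (rule csmul_eqD) (simp add: kappa_nonzero)
    have ek: "e k = mderiv (Z k) ((1 / (\<kappa>\<^sub>2 * \<i> / 3)) \<cdot> - trc (trc X))" for k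
      using mderiv_linear_form[of e k, OF pre] unfolding e_sum by (rule sym)
    have "wge cw (Suc m - 2 - 2 - cw (Z k)) (e k)" for k
      unfolding ek by (intro wge_mderiv wge_csmul wge_minus wge_trc X)
    then have we: "wge cw (m - 2 - 2) (e k)" for k
      by (rule wge_mono) simp
    have xj: "x j = (\<Sum>k\<in>UNIV. P j k \<cdot> e k + Q j k \<cdot> sconj (e k))" for j
      using solve_series[of x e, OF prx pre] e_def by blast
    have "wge cw (m - 2 - 2) (x j)" for j
      unfolding xj by (intro wge_sum wge_add wge_csmul) (simp_all only: wge_sconj_cw we)
    then have "wge cw (m - 2) (du (pr 0 0 (F k)))"
      unfolding x_def
    proof (rule wge_from_du)
      fix M :: "'n crvar multiset" assume "U \<notin># M"
      then show "coeff (du (pr 0 0 (F k))) M = 0"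
        using init coeff_pr_U_free[of M "du (F k)"] unfolding pr_du by (simp add: coeff_mderiv initial_def)
    qed
    then show ?thesis
    proof (rule wge_from_du)
      fix M :: "'n crvar multiset" assume "U \<notin># M"
      then show "coeff (pr 0 0 (F k)) M = 0"
        using init by (simp add: coeff_pr_U_free initial_def)
    qed
  qed
  have p: "wge cw m (pr a 0 (F k))" for a k
  proof (induction a arbitrary: k rule: less_induct)
    case (less a)
    show ?case
    proof (cases "a \<le> 1")
      case True
      then show ?thesis using p0 p1 by (cases a) auto
    next
      case False
      then obtain a' where a: "a = Suc (Suc a')"
        by (cases a; cases "a - 1"; simp)
      have "wge cw m (pr a' 0 (F k))" "wge cw m (pr 0 0 (F k))" for k
        using less a by simp_all
      then have "wge cw (Suc m) (be (\<lambda>k. pr a' 0 (F k)))" "wge cw (Suc m) (sconj (lev (\<lambda>k. pr 0 0 (F k))))"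
        by (simp_all add: wge_be wge_lev)
      moreover have "L a = - pr (Suc (Suc a')) (Suc 0) \<Phi>
        + \<i> \<cdot> (h * du (pr (Suc a') 0 \<Phi>))
        - (2 / (of_nat (Suc a') * of_nat (Suc (Suc a')))) \<cdot> (h * du (be (\<lambda>k. pr a' 0 (F k))))
        + (if a' = 0 then (2 * \<i>) \<cdot> (h * du (sconj (lev (\<lambda>k. pr 0 0 (F k))))) else 0)"
        using st unfolding steps_def L_def a by blast
      ultimately have "wge cw (Suc m) (L a)"
        by (auto intro!: wge_add wge_diff wge_minus wge_csmul wge_h_du pr\<Phi> simp del: of_nat_Suc)
      from wge_unlev[OF this, of k] show ?thesis
        unfolding L_def by (simp add: unlev_lev)
    qed
  qed
  have F: "wge cw m (pr a b (F k))" for a b k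
  proof (induction b arbitrary: a)
    case (Suc b)
    then show ?case
      by (cases a) (auto simp: F_0[OF hom] F_Suc[OF hom] intro!: wge_csmul wge_h_du simp del: of_nat_Suc)
  qed (rule p)
  then show "wge cw m (F k)" by (rule wge_prI)
  have Wb: "wge cw (Suc m) (pr 0 b W)" for b
  proof (cases b)
    case (Suc a)
    have "wge cw (Suc m) (sconj (pr 0 (Suc a) W))"
    proof -
      have "sconj (pr 0 (Suc a) W) = (2 * \<i>) \<cdot> pr (Suc a) 0 \<Phi> +
        ((of_nat a - 1) / of_nat (Suc a)) \<cdot> be (\<lambda>k. pr a 0 (F k)) +
        (if a = 0 then (2 * \<i>) \<cdot> sconj (lev (\<lambda>k. pr 0 0 (F k))) else 0)"
        using st unfolding steps_def by blast
      then show ?thesis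
        by (auto intro!: wge_add wge_csmul pr\<Phi> wge_be wge_lev p simp del: of_nat_Suc)
    qed
    then show ?thesis by (simp add: Suc)
  qed (simp add: w0)
  have "wge cw (Suc m) (pr a b W)" for a b
  proof (induction a arbitrary: b)
    case (Suc a)
    show ?case
    proof (cases b)
      case 0
      then show ?thesis by (auto simp: W_b0[OF hom] intro!: wge_csmul wge_be p simp del: of_nat_Suc)
    next
      case (Suc b')
      show ?thesis
      proof (cases a)
        case 0
        then show ?thesis unfolding Suc 0 W_Suc0[OF hom] by (intro wge_csmul wge_h_du Wb)
      next
        case (Suc a')
        show ?thesis unfolding \<open>b = Suc b'\<close> Suc W_Suc_Suc[OF hom]
          by (intro wge_csmul wge_diff wge_h_du wge_be wge_add F Suc.IH[unfolded Suc])
      qed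
    qed
  qed (rule Wb)
  then show "wge cw (Suc m) W" by (rule wge_prI)
qed

end

section \<open>Explicit solution of the homogeneous problem\<close>

context strong_levi_tensors
begin

text \<open>The real part of \<open>pr 0 0 W\<close>. Its third derivative is dictated by bidegree
  (3, 3), and all integrations start from 0 except for the free term in u^2.\<close>

definition \<rho>sol :: "'n cseries \<Rightarrow> real \<Rightarrow> 'n cseries" where
  "\<rho>sol \<Phi> r = (- of_real r / 2) \<cdot> (mvar U * mvar U) + intu (intu (intu ((3 / \<kappa>\<^sub>3) \<cdot>
     trc (trc (trc (pr 3 3 \<Phi> + (1 / 2) \<cdot> (h * (h * du (du (pr (Suc 0) (Suc 0) \<Phi>))))))))))"

definition Ysol :: "'n cseries \<Rightarrow> 'n cseries" where
  "Ysol \<Phi> = trc (pr 2 2 \<Phi> + (1 / 2) \<cdot> (h * (h * du (du (pr 0 0 \<Phi>)))))"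

definition Bsol :: "'n cseries \<Rightarrow> 'n cseries" where
  "Bsol \<Phi> = (1 / (of_nat CARD('n) + 2)) \<cdot> (Ysol \<Phi> - (1 / (2 * of_nat CARD('n) + 2)) \<cdot> (h * trc (Ysol \<Phi>)))"

definition form0 :: "'n cseries \<Rightarrow> 'n \<Rightarrow> 'n cseries" where
  "form0 \<Phi> k = mderiv (Z k) ((- 1 / (\<kappa>\<^sub>2 * \<i> / 3)) \<cdot>
     trc (trc (pr 3 2 \<Phi> - \<i> \<cdot> (h * du (pr 2 1 \<Phi>)) - (1 / 2) \<cdot> (h * (h * du (du (pr 1 0 \<Phi>)))))))"

text \<open>The components \<open>pr a 0 (F k)\<close> as the steps determine them. For a = 1 the
  derivative of \<open>lev\<close> is half the sum with its conjugate plus half the difference, and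
  the latter is \<open>\<i>\<close> times \<open>Bsol\<close>.\<close>

fun psol :: "'n cseries \<Rightarrow> real \<Rightarrow> nat \<Rightarrow> 'n \<Rightarrow> 'n cseries" where
  "psol \<Phi> r 0 = (\<lambda>j. intu (intu (\<Sum>k\<in>UNIV. P j k \<cdot> form0 \<Phi> k + Q j k \<cdot> sconj (form0 \<Phi> k))))"
| "psol \<Phi> r (Suc 0) = (\<lambda>k. intu (unlev ((1 / 2) \<cdot> (h * du (du (\<rho>sol \<Phi> r)) - du (pr (Suc 0) (Suc 0) \<Phi>)) + (\<i> / 2) \<cdot> Bsol \<Phi>) k))"
| "psol \<Phi> r (Suc (Suc a)) = unlev (- pr (Suc (Suc a)) (Suc 0) \<Phi>
        + \<i> \<cdot> (h * du (pr (Suc a) 0 \<Phi>))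
        - (2 / (of_nat (Suc a) * of_nat (Suc (Suc a)))) \<cdot> (h * du (be (psol \<Phi> r a)))
        + (if a = 0 then (2 * \<i>) \<cdot> (h * du (sconj (lev (psol \<Phi> r 0)))) else 0))"

fun wsol :: "'n cseries \<Rightarrow> real \<Rightarrow> nat \<Rightarrow> 'n cseries" where
  "wsol \<Phi> r 0 = \<rho>sol \<Phi> r - \<i> \<cdot> pr 0 0 \<Phi>"
| "wsol \<Phi> r (Suc a) = sconj ((2 * \<i>) \<cdot> pr (Suc a) 0 \<Phi> +
        ((of_nat a - 1) / of_nat (Suc a)) \<cdot> be (psol \<Phi> r a) +
        (if a = 0 then (2 * \<i>) \<cdot> sconj (lev (psol \<Phi> r 0)) else 0))"

text \<open>The prescribed components are glued by degree instead of being summed up. The equation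
  concerns the conjugate of \<open>F\<close>, so they enter \<open>Dsol\<close> conjugated, as its
  initial data.\<close>

definition hF :: "'n cseries \<Rightarrow> real \<Rightarrow> 'n \<Rightarrow> 'n cseries" where
  "hF \<Phi> r k = sconj (Dsol (sconj (Mps (\<lambda>M. coeff (psol \<Phi> r (zd M) k) M))) 0)"

definition hW :: "'n cseries \<Rightarrow> real \<Rightarrow> 'n cseries" where
  "hW \<Phi> r = Dsol (Mps (\<lambda>M. coeff (wsol \<Phi> r (zbd M)) M)) (be (\<lambda>k. D (hF \<Phi> r k) - hF \<Phi> r k))"

lemma lev_unlev': "pr a (Suc 0) q = q \<Longrightarrow> lev (unlev q) = q"
  using lev_unlev[of a q] by simp

lemma pr_mvar_U: "pr a b (mvar U * q) = mvar U * pr a b q"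
  by (rule mps_eqI) (auto simp: coeff_pr coeff_mvar_times zd_diff1 zbd_diff1)

lemma pr_mvar_UU: "pr 0 0 (mvar U * mvar U) = mvar U * mvar U"
  unfolding pr_mvar_U by (rule mps_eqI) (auto simp: coeff_pr coeff_mvar_times coeff_mvar)

lemma pr_\<rho>sol: "pr 0 0 (\<rho>sol \<Phi> r) = \<rho>sol \<Phi> r"
  by (simp add: \<rho>sol_def pr_add pr_csmul pr_mvar_UU pr_intu pr_trc numeral_3_eq_3 pr_pr pr_du)

lemma sconj_\<rho>sol: "sconj \<Phi> = \<Phi> \<Longrightarrow> sconj (\<rho>sol \<Phi> r) = \<rho>sol \<Phi> r"
proof -
  assume "sconj \<Phi> = \<Phi>"
  then have "sconj (pr a a \<Phi>) = pr a a \<Phi>" for a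
    by (metis pr_sconj)
  moreover have "cnj (3 / \<kappa>\<^sub>3) = 3 / \<kappa>\<^sub>3" by (simp add: \<kappa>\<^sub>3_def)
  ultimately show ?thesis
    by (simp add: \<rho>sol_def push sconj_mvar sconj_intu sconj_trc)
qed

lemma pr_Ysol: "pr (Suc 0) (Suc 0) (Ysol \<Phi>) = Ysol \<Phi>"
  unfolding Ysol_def pr_trc numeral_2_eq_2 by (simp add: pr_add pr_pr pr_csmul pr_du)

lemma pr_Bsol: "pr (Suc 0) (Suc 0) (Bsol \<Phi>) = Bsol \<Phi>"
proof -
  have "pr 0 0 (trc (Ysol \<Phi>)) = trc (Ysol \<Phi>)" by (simp only: pr_trc pr_Ysol)
  then show ?thesis by (simp add: Bsol_def pr_diff pr_csmul pr_Ysol)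
qed

lemma sconj_Bsol: "sconj \<Phi> = \<Phi> \<Longrightarrow> sconj (Bsol \<Phi>) = Bsol \<Phi>"
proof -
  assume "sconj \<Phi> = \<Phi>"
  then have "sconj (pr a a \<Phi>) = pr a a \<Phi>" for a
    by (metis pr_sconj)
  then show ?thesis by (simp add: Bsol_def Ysol_def push sconj_trc)
qed

lemma pr_form0: "pr 0 0 (form0 \<Phi> k) = form0 \<Phi> k"
  unfolding form0_def pr_mderiv_Z pr_csmul pr_trc numeral_3_eq_3 numeral_2_eq_2
  by (simp add: pr_diff pr_pr pr_csmul pr_du)

lemma pr_psol: "pr a 0 (psol \<Phi> r a k) = psol \<Phi> r a k"
proof (induction \<Phi> r a arbitrary: k rule: psol.induct)
  case (1 \<Phi> r)
  then show ?case by (simp add: pr_intu pr_sum pr_add pr_csmul pr_sconj pr_form0)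
next
  case (2 \<Phi> r)
  then show ?case
    by (simp add: pr_intu pr_unlev pr_add pr_diff pr_csmul pr_du pr_\<rho>sol pr_Bsol pr_pr)
next
  case (3 \<Phi> r a)
  have "(\<lambda>k. pr a 0 (psol \<Phi> r a k)) = psol \<Phi> r a" using 3 by blast
  then show ?case unfolding psol.simps(3) pr_unlev
    by (cases a)
      (simp_all add: pr_add pr_diff pr_minus pr_csmul pr_du pr_pr pr_be pr_sconj pr_lev del: of_nat_Suc psol.simps)
qed

lemma pr_wsol: "pr 0 b (wsol \<Phi> r b) = wsol \<Phi> r b"
  by (cases b; cases "b = 1")
    (simp_all add: pr_diff pr_csmul pr_pr pr_\<rho>sol pr_sconj pr_add pr_be pr_psol pr_lev del: of_nat_Suc psol.simps)

lemma pr_hF: "pr a 0 (hF \<Phi> r k) = psol \<Phi> r a k"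
proof -
  have "pr a 0 (hF \<Phi> r k) = pr a 0 (Mps (\<lambda>M. coeff (psol \<Phi> r (zd M) k) M))"
    by (simp add: hF_def pr_sconj pr_0_Dsol)
  also have "\<dots> = pr a 0 (psol \<Phi> r a k)"
    by (rule mps_eqI) (simp add: coeff_pr)
  finally show ?thesis by (simp only: pr_psol)
qed

lemma hom_solution: "hom (hF \<Phi> r) (hW \<Phi> r)"
proof -
  have "D (hW \<Phi> r) = be (\<lambda>k. D (hF \<Phi> r k) - hF \<Phi> r k)"
    unfolding hW_def by (rule D_Dsol) (simp add: pr_be)
  then show ?thesis by (simp add: hom_def) (simp add: hF_def D_Dsol)
qed

lemma pr_hW: "pr 0 b (hW \<Phi> r) = wsol \<Phi> r b"
proof -
  have "pr 0 b (hW \<Phi> r) = pr 0 b (Mps (\<lambda>M. coeff (wsol \<Phi> r (zbd M)) M))"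
    by (simp add: hW_def pr_0_Dsol)
  also have "\<dots> = pr 0 b (wsol \<Phi> r b)"
    by (rule mps_eqI) (simp add: coeff_pr)
  finally show ?thesis by (simp only: pr_wsol)
qed

lemma rep_hW:
  assumes "sconj \<Phi> = \<Phi>"
  shows "pr 0 0 (rep (hW \<Phi> r)) = \<rho>sol \<Phi> r" "rep (pr 0 0 (hW \<Phi> r)) = \<rho>sol \<Phi> r"
proof -
  have "sconj (pr 0 0 \<Phi>) = pr 0 0 \<Phi>" using assms by (metis pr_sconj)
  moreover from this show "rep (pr 0 0 (hW \<Phi> r)) = \<rho>sol \<Phi> r"
    unfolding pr_hW rep_def using sconj_\<rho>sol[OF assms] by (simp add: push mps_eq_iff)
  ultimately show "pr 0 0 (rep (hW \<Phi> r)) = \<rho>sol \<Phi> r"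
    by (simp add: rep_def pr_csmul pr_add pr_sconj)
qed

lemma lev_hF: "lev (\<lambda>k. pr a 0 (hF \<Phi> r k)) = lev (psol \<Phi> r a)"
  and be_hF: "be (\<lambda>k. pr a 0 (hF \<Phi> r k)) = be (psol \<Phi> r a)"
  by (simp_all add: pr_hF)

text \<open>Reality of \<open>\<Phi>\<close> ensures that the right sides in bidegrees (0, 0), (1,
  1), (2, 2) and (3, 3) are real, so that they can be used for real and imaginary parts
  separately.\<close>

lemma normal_solution:
  assumes "sconj \<Phi> = \<Phi>"
  shows "normal (\<Phi> + phi (hF \<Phi> r) (hW \<Phi> r))"
  unfolding normal_iff_steps[OF hom_solution] steps_def Let_def lev_hF be_hF rep_hW[OF assms]
proof (intro conjI allI)
  have c: "sconj (pr a a \<Phi>) = pr a a \<Phi>" for a using assms by (metis pr_sconj)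
  show "pr 0 0 (hW \<Phi> r) - sconj (pr 0 0 (hW \<Phi> r)) = (- 2 * \<i>) \<cdot> pr 0 0 \<Phi>"
    by (simp add: pr_hW push c sconj_\<rho>sol[OF assms] mps_eq_iff)
  show "sconj (pr 0 (Suc a) (hW \<Phi> r)) = (2 * \<i>) \<cdot> pr (Suc a) 0 \<Phi> +
        ((of_nat a - 1) / of_nat (Suc a)) \<cdot> be (psol \<Phi> r a) +
        (if a = 0 then (2 * \<i>) \<cdot> sconj (lev (psol \<Phi> r 0)) else 0)" for a
    unfolding pr_hW wsol.simps by (rule sconj_sconj)
  show "lev (psol \<Phi> r (Suc (Suc a))) = - pr (Suc (Suc a)) (Suc 0) \<Phi>
        + \<i> \<cdot> (h * du (pr (Suc a) 0 \<Phi>))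
        - (2 / (of_nat (Suc a) * of_nat (Suc (Suc a)))) \<cdot> (h * du (be (psol \<Phi> r a)))
        + (if a = 0 then (2 * \<i>) \<cdot> (h * du (sconj (lev (psol \<Phi> r 0)))) else 0)" (is "_ = ?R") for a
  proof -
    have "pr (Suc (Suc a)) (Suc 0) ?R = ?R"
      by (cases a)
        (simp_all add: pr_add pr_diff pr_minus pr_csmul pr_du pr_pr pr_be pr_sconj pr_lev pr_psol del: of_nat_Suc psol.simps)
    then show ?thesis unfolding psol.simps(3) by (rule lev_unlev')
  qed
  let ?L = "lev (psol \<Phi> r (Suc 0))" and ?R = "h * du (du (\<rho>sol \<Phi> r)) - du (pr (Suc 0) (Suc 0) \<Phi>)"
  have duL: "du ?L = (1 / 2) \<cdot> ?R + (\<i> / 2) \<cdot> Bsol \<Phi>"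
  proof -
    have "pr (Suc 0) (Suc 0) ((1 / 2) \<cdot> ?R + (\<i> / 2) \<cdot> Bsol \<Phi>) = (1 / 2) \<cdot> ?R + (\<i> / 2) \<cdot> Bsol \<Phi>"
      by (simp add: pr_add pr_diff pr_csmul pr_du pr_\<rho>sol pr_Bsol pr_pr)
    then have "lev (unlev ((1 / 2) \<cdot> ?R + (\<i> / 2) \<cdot> Bsol \<Phi>)) = (1 / 2) \<cdot> ?R + (\<i> / 2) \<cdot> Bsol \<Phi>"
      by (rule lev_unlev')
    then show ?thesis unfolding psol.simps lev_simps(5)[symmetric] du_intu .
  qed
  have cR: "sconj ?R = ?R" by (simp add: push c sconj_\<rho>sol[OF assms])
  have duLc: "du (sconj ?L) = (1 / 2) \<cdot> ?R - (\<i> / 2) \<cdot> Bsol \<Phi>"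
  proof -
    have "du (sconj ?L) = sconj (du ?L)" by (simp add: sconj_mderiv)
    then show ?thesis unfolding duL sconj_add sconj_csmul cR sconj_Bsol[OF assms] by (simp add: csmul_uminus)
  qed
  show "du (?L + sconj ?L) = ?R"
    unfolding mderiv_add duL duLc by (rule mps_eqI) simp
  have "(- \<i>) \<cdot> du (?L - sconj ?L) = Bsol \<Phi>"
    unfolding mderiv_diff duL duLc by (rule mps_eqI) (simp add: field_simps)
  then show "trc (h * ((- \<i>) \<cdot> du (?L - sconj ?L))) = trc (pr 2 2 \<Phi> + (1 / 2) \<cdot> (h * (h * du (du (pr 0 0 \<Phi>)))))"
    unfolding Ysol_def[symmetric] using trc_h_solve[OF pr_Bsol pr_Ysol] Bsol_def by simp
  show "\<kappa>\<^sub>3 \<cdot> du (du (du (\<rho>sol \<Phi> r))) = 3 \<cdot> trc (trc (trc (pr 3 3 \<Phi> + (1 / 2) \<cdot> (h * (h * du (du (pr (Suc 0) (Suc 0) \<Phi>)))))))"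
  proof -
    have "du (du (du (mvar U * mvar U))) = (0 :: 'n cseries)"
      by (simp add: mderiv_mult mderiv_mvar mderiv_add)
    then show ?thesis
      using kappa_nonzero unfolding \<rho>sol_def mderiv_add mderiv_csmul du_intu by simp
  qed
  let ?X = "pr 3 2 \<Phi> - \<i> \<cdot> (h * du (pr 2 1 \<Phi>)) - (1 / 2) \<cdot> (h * (h * du (du (pr 1 0 \<Phi>))))"
  show "(\<kappa>\<^sub>2 * \<i> / 3) \<cdot> du (du ((- 2) \<cdot> be (psol \<Phi> r 0) + (6 * \<i>) \<cdot> sconj (lev (psol \<Phi> r 0)))) = - trc (trc ?X)"
  proof -
    define x where "x j = du (du (psol \<Phi> r 0 j))" for j
    have prx: "pr 0 0 (x j) = x j" for j unfolding x_def pr_du pr_psol ..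
    have "x j = (\<Sum>k\<in>UNIV. P j k \<cdot> form0 \<Phi> k + Q j k \<cdot> sconj (form0 \<Phi> k))" for j
      by (simp add: x_def)
    then have e: "form0 \<Phi> k = (\<Sum>j\<in>UNIV. N j k \<cdot> x j + (6 * \<i> * c j k) \<cdot> sconj (x j))" for k
      using solve_series[of x "form0 \<Phi>", OF prx pr_form0] by blast
    have "du (du ((- 2) \<cdot> be (psol \<Phi> r 0) + (6 * \<i>) \<cdot> sconj (lev (psol \<Phi> r 0))))
      = (- 2) \<cdot> be x + (6 * \<i>) \<cdot> sconj (lev x)"
      unfolding x_def[abs_def] by (simp add: mderiv_add sconj_lev sconj_mderiv be_simps levc_simps del: psol.simps)
    also have "\<dots> = (\<Sum>k\<in>UNIV. mvar (Z k) * form0 \<Phi> k)"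
      unfolding ell_eq e[symmetric] ..
    also have "\<dots> = (- 1 / (\<kappa>\<^sub>2 * \<i> / 3)) \<cdot> trc (trc ?X)"
      unfolding form0_def
      by (rule linear_form_mderiv)
        (simp add: pr_trc pr_csmul pr_diff pr_pr pr_du numeral_3_eq_3 numeral_2_eq_2)
    finally have eq: "du (du ((- 2) \<cdot> be (psol \<Phi> r 0) + (6 * \<i>) \<cdot> sconj (lev (psol \<Phi> r 0)))) =
        (- 1 / (\<kappa>\<^sub>2 * \<i> / 3)) \<cdot> trc (trc ?X)" .
    have co: "(\<kappa>\<^sub>2 * \<i> / 3) * (- 1 / (\<kappa>\<^sub>2 * \<i> / 3)) = - 1"
      using kappa_nonzero by simp
    show ?thesis unfolding eq csmul_csmul co by (simp only: csmul_uminus csmul_1)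
  qed
qed

lemma hF_coeff: "coeff (hF \<Phi> r k) {#} = 0" "coeff (hF \<Phi> r k) {#U#} = 0" "coeff (hF \<Phi> r k) {#Z j#} = 0"
  using arg_cong[OF pr_hF[of 0 \<Phi> r k], of "\<lambda>q. coeff q {#}"]
    arg_cong[OF pr_hF[of 0 \<Phi> r k], of "\<lambda>q. coeff q {#U#}"]
    arg_cong[OF pr_hF[of "Suc 0" \<Phi> r k], of "\<lambda>q. coeff q {#Z j#}"]
  by (simp_all add: coeff_pr intu_def)

lemma rep_hW_coeff:
  assumes "sconj \<Phi> = \<Phi>"
  shows "coeff (rep (hW \<Phi> r)) {#} = 0" "coeff (rep (hW \<Phi> r)) {#U#} = 0"
    "coeff (rep (hW \<Phi> r)) {#U, U#} = - of_real r / 2"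
  using arg_cong[OF rep_hW(1)[OF assms, of r], of "\<lambda>q. coeff q {#}"]
    arg_cong[OF rep_hW(1)[OF assms, of r], of "\<lambda>q. coeff q {#U#}"]
    arg_cong[OF rep_hW(1)[OF assms, of r], of "\<lambda>q. coeff q {#U, U#}"]
  by (simp_all add: coeff_pr \<rho>sol_def intu_def coeff_mvar_times coeff_mvar)

end

subsection \<open>The inhomogeneous equations\<close>

definition bil :: "('n::finite \<Rightarrow> 'n \<Rightarrow> complex) \<Rightarrow> ('n \<Rightarrow> 'n cseries) \<Rightarrow> ('n \<Rightarrow> 'n cseries) \<Rightarrow> 'n cseries" where
  "bil M x y = (\<Sum>j\<in>UNIV. \<Sum>k\<in>UNIV. M j k \<cdot> (x j * y k))"

lemma bil_transpose: "bil M x y = bil (\<lambda>j k. M k j) y x"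
  unfolding bil_def by (subst sum.swap) (simp add: mult.commute)

lemma bil_add_left: "bil (\<lambda>j k. M j k + M' j k) x y = bil M x y + bil M' x y"
  and bil_scale: "bil (\<lambda>j k. a * M j k) x y = a \<cdot> bil M x y"
  and bil_diff: "bil M x (\<lambda>k. y k - y' k) = bil M x y - bil M x y'"
  by (simp_all add: bil_def csmul_add_left csmul_diff csmul_uminus csmul_sum sum.distrib sum_subtractf sum_negf right_diff_distrib)

lemma sconj_bil: "sconj (bil M x y) = bil (\<lambda>j k. cnj (M j k)) (\<lambda>j. sconj (x j)) (\<lambda>k. sconj (y k))"
  by (simp add: bil_def sconj_sum sconj_csmul sconj_mult)

lemma wge_bil:
  "(\<And>j. wge \<omega> l (x j)) \<Longrightarrow> (\<And>k. wge \<omega> m (y k)) \<Longrightarrow> wge \<omega> (l + m) (bil M x y)"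
  unfolding bil_def by (intro wge_sum wge_csmul wge_mult)

abbreviation (input) zz :: "'n \<Rightarrow> 'n cseries" where "zz \<equiv> \<lambda>j. mvar (Z j)"
abbreviation (input) zzb :: "'n \<Rightarrow> 'n cseries" where "zzb \<equiv> \<lambda>j. mvar (Zb j)"

locale linear_problem = strong_levi_tensors c d N P Q
  for c d N P Q :: "'n::finite \<Rightarrow> 'n \<Rightarrow> complex" +
  fixes A b :: "'n \<Rightarrow> 'n \<Rightarrow> complex"
  assumes N_eq: "N j k = A j k - A k j"
    and c_eq: "c j k = (b j k - cnj (b k j)) / (2 * \<i>)"
begin

text \<open>Symmetric part of \<open>A\<close>, and then the Hermitian part of \<open>b\<close>. The
  complementary parts are \<open>N / 2\<close> and \<open>\<i> c\<close>, the only ones to enter the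
  homogeneous equations.\<close>

definition as :: "'n \<Rightarrow> 'n \<Rightarrow> complex" where "as j k = (A j k + A k j) / 2"
definition bh :: "'n \<Rightarrow> 'n \<Rightarrow> complex" where "bh j k = (b j k + cnj (b k j)) / 2"

text \<open>The w-component of the embedding equations, linearized at lowest weight: the base point
  of \<open>Lw\<close> varies by \<open>F\<close> and the vector on which it is evaluated by
  \<open>D F\<close>.\<close>

definition T2 :: "('n \<Rightarrow> 'n cseries) \<Rightarrow> 'n cseries \<Rightarrow> 'n cseries" where
  "T2 F W = D W - (bil A zz (\<lambda>k. D (F k)) + bil b zzb (\<lambda>k. D (F k)))
      - (bil A F zz + bil b (\<lambda>j. sconj (F j)) zz)"

definition al :: "('n \<Rightarrow> 'n cseries) \<Rightarrow> 'n cseries" where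
  "al F = bil as zz F + bil bh zzb F"

text \<open>The correction of \<open>W\<close> that removes \<open>as\<close> and \<open>bh\<close>
  from the homogeneous equations. Its imaginary part is the one that distinguishes
  \<open>phi\<close> from \<open>imp\<close>.\<close>

definition Yop :: "('n \<Rightarrow> 'n cseries) \<Rightarrow> 'n cseries" where
  "Yop F = al F + sconj (al F) + \<i> \<cdot> (lev F + sconj (lev F))"

definition Bop :: "('n \<Rightarrow> 'n cseries) \<Rightarrow> 'n cseries" where
  "Bop e = bil (\<lambda>j k. cnj (as j k)) e zzb + bil b e zz"

lemma D_mvar_mult: "D (mvar (Z j) * q) = mvar (Z j) * q + mvar (Z j) * D q" "D (mvar (Zb j) * q) = mvar (Zb j) * D q"
  by (simp_all add: D_mult_pure mderiv_mvar eul_mvar)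

lemma D_sum: "D (\<Sum>i\<in>I. f i) = (\<Sum>i\<in>I. D (f i))"
  by (induction I rule: infinite_finite_induct) (auto simp: D_simps)

lemma D_bil:
  "D (bil M zz y) = bil M zz y + bil M zz (\<lambda>k. D (y k))"
  "D (bil M zzb y) = bil M zzb (\<lambda>k. D (y k))"
  by (simp_all add: bil_def D_sum D_simps D_mvar_mult csmul_add sum.distrib)

lemma D_bil_z:
  "D (bil M y zz) = bil M y zz + bil M (\<lambda>k. D (y k)) zz"
  "D (bil M y zzb) = bil M (\<lambda>k. D (y k)) zzb"
  unfolding bil_transpose[of M y] bil_transpose[of M "\<lambda>k. D (y k)"] by (rule D_bil)+

text \<open>By the product rule, \<open>D (Yop F)\<close> reproduces all terms with
  \<open>as\<close> and \<open>b\<close>. Its excess depends only on \<open>D (sconj (F j))\<close>,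
  which the first equation provides, and is compensated by \<open>Bop\<close>.\<close>

lemma T2_eq: "T2 F W = D (W - Yop F) - be (\<lambda>k. D (F k) - F k) + Bop (\<lambda>j. D (sconj (F j)))"
proof -
  let ?Fb = "\<lambda>j. sconj (F j)"
  have Aeq: "bil A zz y = bil as zz y + (1 / 2) \<cdot> bil N zz y" for y
  proof -
    have "A = (\<lambda>j k. as j k + (1 / 2) * N j k)" by (simp add: fun_eq_iff as_def N_eq field_simps)
    then have "bil A zz y = bil (\<lambda>j k. as j k + (1 / 2) * N j k) zz y" by (rule arg_cong)
    then show ?thesis unfolding bil_add_left bil_scale .
  qed
  have AF: "bil A F zz = bil as zz F - (1 / 2) \<cdot> bil N zz F"
  proof -
    have "(\<lambda>j k. A k j) = (\<lambda>j k. as j k + (- 1 / 2) * N j k)" by (simp add: fun_eq_iff as_def N_eq field_simps)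
    then have "bil A F zz = bil (\<lambda>j k. as j k + (- 1 / 2) * N j k) zz F"
      unfolding bil_transpose[of A F] by (rule arg_cong)
    then show ?thesis unfolding bil_add_left bil_scale by (simp add: csmul_uminus)
  qed
  have beq: "bil b x y = bil bh x y + \<i> \<cdot> bil c x y" for x y
  proof -
    have "b = (\<lambda>j k. bh j k + \<i> * c j k)" by (simp add: fun_eq_iff bh_def c_eq field_simps)
    then have "bil b x y = bil (\<lambda>j k. bh j k + \<i> * c j k) x y" by (rule arg_cong)
    then show ?thesis unfolding bil_add_left bil_scale .
  qed
  have bhc: "cnj (bh j k) = bh k j" for j k by (simp add: bh_def add.commute)
  have lev: "lev F = bil c zzb F" by (simp add: lev_def bil_def)
  have levc: "sconj (lev F) = bil c ?Fb zz"
    unfolding sconj_lev by (simp add: levc_def bil_def mult.commute)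
  have al: "sconj (al F) = bil (\<lambda>j k. cnj (as j k)) ?Fb zzb + bil bh ?Fb zz"
  proof -
    have "cnj (as j k) = cnj (as k j)" for j k by (simp add: as_def add.commute)
    then have "bil (\<lambda>j k. cnj (as j k)) zzb ?Fb = bil (\<lambda>j k. cnj (as j k)) ?Fb zzb"
      by (subst bil_transpose) metis
    moreover have "bil (\<lambda>j k. cnj (bh j k)) zz ?Fb = bil bh ?Fb zz"
      by (subst bil_transpose) (simp add: bhc)
    ultimately show ?thesis by (simp add: al_def sconj_add sconj_bil sconj_mvar)
  qed
  have be: "be y = (1 / 2) \<cdot> bil N zz y" for y by (simp add: be_def bil_def csmul_sum)
  show ?thesis
    unfolding T2_def Yop_def al levc
    unfolding al_def lev be Bop_def D_simps D_bil D_bil_z Aeq AF bil_diff beq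
    by (simp add: push algebra_simps)
qed

text \<open>A particular solution with zero initial data. Its failure to be normal is the
  perturbation \<open>\<Phi>\<close> passed to the homogeneous problem.\<close>

definition F0sol :: "('n \<Rightarrow> 'n cseries) \<Rightarrow> 'n \<Rightarrow> 'n cseries" where
  "F0sol R1 k = sconj (Dsol 0 (R1 k))"

definition W0sol :: "('n \<Rightarrow> 'n cseries) \<Rightarrow> 'n cseries \<Rightarrow> 'n cseries" where
  "W0sol R1 R2 = Dsol 0 (be (\<lambda>k. D (F0sol R1 k) - F0sol R1 k) + R2 - Bop R1)"

definition Fsol :: "('n \<Rightarrow> 'n cseries) \<Rightarrow> 'n cseries \<Rightarrow> real \<Rightarrow> 'n \<Rightarrow> 'n cseries" where
  "Fsol R1 R2 r k = F0sol R1 k + hF (phi (F0sol R1) (W0sol R1 R2)) r k"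

definition Wsol :: "('n \<Rightarrow> 'n cseries) \<Rightarrow> 'n cseries \<Rightarrow> real \<Rightarrow> 'n cseries" where
  "Wsol R1 R2 r = W0sol R1 R2 + hW (phi (F0sol R1) (W0sol R1 R2)) r + Yop (Fsol R1 R2 r)"

lemma pr_0_bil:
  assumes "\<And>j b. pr 0 b (e j) = 0"
  shows "pr 0 b' (bil M e zz) = 0" "pr 0 b' (bil M e zzb) = 0"
proof -
  show "pr 0 b' (bil M e zz) = 0"
    by (simp add: bil_def pr_sum pr_csmul pr_mvar_Z mult.commute[of "e _"])
  show "pr 0 b' (bil M e zzb) = 0"
    using assms by (cases b') (simp_all add: bil_def pr_sum pr_csmul pr_mvar_Zb mult.commute[of "e _"])
qed

lemma pr_00_Yop: "pr 0 0 (Yop F) = 0"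
  by (simp add: Yop_def al_def bil_def pr_add pr_csmul pr_sum pr_mvar_Z pr_mvar_Zb pr_sconj pr_lev)

lemma sconj_phi: "sconj (phi F W) = phi F W"
  by (simp add: phi_def sconj_add add.commute)

lemma phi_add: "phi (\<lambda>k. F k + F' k) (W + W') = phi F W + phi F' W'"
  by (rule mps_eqI) (simp add: phi_def imp_def lev_simps sconj_add add_divide_distrib diff_divide_distrib algebra_simps)

lemma imp_add: "imp (p + q) = imp p + imp q"
  and imp_Yop: "imp (Yop F) = lev F + sconj (lev F)"
  by (rule mps_eqI; simp add: Yop_def imp_def sconj_add sconj_csmul field_simps)+

lemma phi_eq_imp: "phi F (W - Yop F) = imp W"
  using imp_add[of "W - Yop F" "Yop F"] by (simp add: phi_def imp_Yop)

lemma coeff_rep_U: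
  assumes "zd M = 0" "zbd M = 0"
  shows "pr 0 0 q = 0 \<Longrightarrow> coeff (rep q) M = 0"
proof -
  assume q: "pr 0 0 q = 0"
  have "pr 0 0 (rep q) = 0" by (simp add: rep_def pr_csmul pr_add pr_sconj q)
  then have "coeff (pr 0 0 (rep q)) M = 0" by simp
  then show ?thesis using assms by (simp add: coeff_pr)
qed

lemma F0sol_coeff:
  "coeff (F0sol R1 k) {#} = 0" "coeff (F0sol R1 k) {#U#} = 0" "coeff (F0sol R1 k) {#Z j#} = 0"
  by (simp_all add: F0sol_def coeff_sconj Dsol_def)

lemma pr_00_W0sol: "pr 0 0 (W0sol R1 R2) = 0"
  by (simp add: W0sol_def pr_0_Dsol)

context
  fixes R1 :: "'n \<Rightarrow> 'n cseries" and R2 :: "'n cseries" and r :: real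
  assumes R1: "\<And>j b. pr 0 b (R1 j) = 0" and R2: "\<And>b. pr 0 b R2 = 0"
begin

lemma D_F0sol: "D (sconj (F0sol R1 j)) = R1 j"
  by (simp add: F0sol_def D_Dsol R1)

lemma D_W0sol: "D (W0sol R1 R2) = be (\<lambda>k. D (F0sol R1 k) - F0sol R1 k) + R2 - Bop R1"
  unfolding W0sol_def
  by (rule D_Dsol) (simp add: pr_add pr_diff pr_be R2 Bop_def pr_0_bil[OF R1])

lemma Fsol_eq: "D (sconj (Fsol R1 R2 r j)) = R1 j"
  using hom_solution by (simp add: Fsol_def sconj_add D_simps D_F0sol hom_def)

lemma Wsol_eq: "T2 (Fsol R1 R2 r) (Wsol R1 R2 r) = R2"
proof -
  have "D (hW \<Phi> r) = be (\<lambda>k. D (hF \<Phi> r k) - hF \<Phi> r k)" for \<Phi>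
    using hom_solution by (simp add: hom_def)
  then have "D (Wsol R1 R2 r - Yop (Fsol R1 R2 r)) = be (\<lambda>k. D (Fsol R1 R2 r k) - Fsol R1 R2 r k) + R2 - Bop R1"
    by (simp add: Wsol_def D_simps D_W0sol Fsol_def be_simps algebra_simps)
  then show ?thesis by (simp add: T2_eq Fsol_eq)
qed

lemma normal_Wsol: "normal (imp (Wsol R1 R2 r))"
proof -
  have "phi (Fsol R1 R2 r) (Wsol R1 R2 r - Yop (Fsol R1 R2 r)) =
     phi (F0sol R1) (W0sol R1 R2) + phi (hF (phi (F0sol R1) (W0sol R1 R2)) r) (hW (phi (F0sol R1) (W0sol R1 R2)) r)"
    unfolding phi_add[symmetric] Fsol_def[symmetric] by (simp add: Wsol_def)
  then show ?thesis
    unfolding phi_eq_imp[of "Fsol R1 R2 r" "Wsol R1 R2 r", symmetric]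
    using normal_solution[OF sconj_phi[of "F0sol R1" "W0sol R1 R2"], of r] by simp
qed

lemma initial_sol:
  assumes "m \<le> 4"
  shows "initial m (Fsol R1 R2 r) (Wsol R1 R2 r)"
    and "coeff (rep (Wsol R1 R2 r)) {#U, U#} = - of_real r / 2"
  using assms
  by (simp_all add: initial_def Fsol_def hF_coeff F0sol_coeff Wsol_def rep_add
      rep_hW_coeff[OF sconj_phi] coeff_rep_U pr_00_Yop pr_00_W0sol)

end

text \<open>Subtracting the particular solution leaves a homogeneous one with a perturbation of
  known weight. Applied to differences, the estimate gives uniqueness as well as the contraction
  property.\<close>

theorem linear_weight:
  assumes T1: "\<And>j. wge cw m (D (sconj (F j)))" and T2: "wge cw (Suc m) (T2 F W)"
    and norm: "normal (imp W)" and init: "initial (Suc m) F W"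
  shows "wge cw m (F k)" "wge cw (Suc m) W"
proof -
  define R1 where "R1 j = D (sconj (F j))" for j
  define R2 where "R2 = T2 F W"
  have R1: "pr 0 b (R1 j) = 0" for b j by (simp add: R1_def pr_D)
  have R2: "pr 0 b R2 = 0" for b
    unfolding R2_def T2_eq R1_def[symmetric] Bop_def
    by (simp add: pr_add pr_diff pr_D pr_be pr_0_bil[OF R1])
  have wF0: "wge cw m (F0sol R1 k)" for k
    unfolding F0sol_def wge_sconj_cw by (rule wge_Dsol) (simp_all add: R1_def T1)
  have wB: "wge cw (Suc m) (Bop R1)"
    unfolding Bop_def
    using wge_bil[of cw m R1 1 zzb] wge_bil[of cw m R1 1 zz] T1 wge_mvar_cw
    by (auto intro!: wge_add simp: R1_def[abs_def])
  have wW0: "wge cw (Suc m) (W0sol R1 R2)"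
    unfolding W0sol_def using T2 wB wF0
    by (auto intro!: wge_Dsol wge_diff wge_add wge_be wge_D simp: R2_def)
  define Fh where "Fh k = F k - F0sol R1 k" for k
  define Wh where "Wh = W - Yop F - W0sol R1 R2"
  have F_eq: "F = (\<lambda>k. F0sol R1 k + Fh k)" by (simp add: Fh_def)
  have hom: "hom Fh Wh"
  proof -
    have "D (sconj (F0sol R1 j)) = R1 j" for j by (rule D_F0sol[OF R1 R2])
    then have "D (sconj (Fh j)) = 0" for j
      by (simp add: Fh_def sconj_diff D_simps R1_def[of j])
    moreover have "D (W - Yop F) = be (\<lambda>k. D (F k) - F k) + R2 - Bop R1"
      unfolding R2_def T2_eq R1_def[abs_def] by simp
    then have "D Wh = be (\<lambda>k. D (Fh k) - Fh k)"
      unfolding Wh_def D_simps(2)[of "W - Yop F"] D_W0sol[OF R1 R2] Fh_def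
      by (simp add: be_simps D_simps algebra_simps)
    ultimately show ?thesis by (simp add: hom_def)
  qed
  have "phi (F0sol R1) (W0sol R1 R2) + phi Fh Wh = phi F (W - Yop F)"
    unfolding phi_add[symmetric] F_eq[symmetric] by (simp add: Wh_def)
  then have nh: "normal (phi (F0sol R1) (W0sol R1 R2) + phi Fh Wh)"
    using norm by (simp add: phi_eq_imp)
  have w\<Phi>: "wge cw (Suc m) (phi (F0sol R1) (W0sol R1 R2))"
    unfolding phi_def by (intro wge_add wge_imp wW0 wge_lev wF0) (simp add: wge_lev wF0)
  have ih: "initial (Suc m) Fh Wh"
    using init
    by (auto simp: initial_def Fh_def Wh_def F0sol_coeff rep_diff coeff_rep_U pr_00_Yop pr_00_W0sol)
  have wFh: "wge cw m (Fh k)" for k by (rule hom_weight[OF hom nh w\<Phi> ih])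
  have wWh: "wge cw (Suc m) Wh" by (rule hom_weight[OF hom nh w\<Phi> ih])
  show wF: "wge cw m (F k)" for k
    unfolding F_eq by (intro wge_add wF0 wFh)
  have wal: "wge cw (Suc m) (al F)"
    unfolding al_def using wge_bil[of cw 1 zz m F] wge_bil[of cw 1 zzb m F] wF wge_mvar_cw
    by (auto intro!: wge_add)
  have "wge cw (Suc m) (Yop F)"
    unfolding Yop_def by (intro wge_add wge_csmul wal) (simp_all add: wal wge_lev wF)
  then have "wge cw (Suc m) (Wh + W0sol R1 R2 + Yop F)"
    by (intro wge_add wWh wW0)
  then show "wge cw (Suc m) W" by (simp add: Wh_def)
qed

end

section \<open>The nonlinear problem\<close>

text \<open>The ideal generated by the variables z, in which equations for \<open>D\<close> are
  solvable. The right sides below belong to it because z, \<open>eul\<close> and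
  \<open>theta\<close> do.\<close>

definition zideal :: "'n cseries \<Rightarrow> bool" where
  "zideal q \<longleftrightarrow> (\<forall>b. pr 0 b q = 0)"

lemma zideal_iff: "zideal q \<longleftrightarrow> (\<forall>M. zd M = 0 \<longrightarrow> coeff q M = 0)"
  unfolding zideal_def mps_eq_iff coeff_pr by auto

lemma zideal_add: "zideal p \<Longrightarrow> zideal q \<Longrightarrow> zideal (p + q)"
  and zideal_diff: "zideal p \<Longrightarrow> zideal q \<Longrightarrow> zideal (p - q)"
  and zideal_csmul: "zideal p \<Longrightarrow> zideal (x \<cdot> p)"
  by (simp_all add: zideal_iff)

lemma zideal_mult: "zideal p \<Longrightarrow> zideal (p * q)" "zideal q \<Longrightarrow> zideal (p * q)"
  by (auto simp: zideal_iff coeff_mps_times intro!: sum.neutral)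

lemma zideal_sum: "(\<And>i. i \<in> I \<Longrightarrow> zideal (f i)) \<Longrightarrow> zideal (\<Sum>i\<in>I. f i)"
  by (simp add: zideal_iff coeff_sum_mps)

lemma zideal_eul: "zideal (eul q)"
  by (simp add: zideal_iff coeff_eul)

lemma zideal_mvar: "zideal (mvar (Z j))"
  by (auto simp: zideal_iff coeff_mvar)

lemma zideal_bil:
  "(\<And>j. zideal (x j)) \<Longrightarrow> zideal (bil M x y)" "(\<And>j. zideal (y j)) \<Longrightarrow> zideal (bil M x y)"
  by (simp_all add: bil_def zideal_sum zideal_csmul zideal_mult)

lemma zideal_theta: "zideal (theta \<phi>)"
  unfolding theta_def by (intro zideal_csmul zideal_mult(2) zideal_eul)

text \<open>The inverse is multiplied away. This linear equation replaces it when differences,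
  lowest terms and coefficients of \<open>theta\<close> are studied.\<close>

lemma theta_eq:
  assumes "coeff \<phi> {#U#} = 0"
  shows "theta \<phi> = \<i> \<cdot> eul \<phi> + \<i> \<cdot> (theta \<phi> * du \<phi>)"
proof -
  let ?q = "1 - \<i> \<cdot> du \<phi>"
  have "coeff ?q {#} \<noteq> 0" using assms by (simp add: coeff_1 coeff_mderiv)
  then have "?q * minverse ?q = 1" by (rule mult_minverse)
  then have "?q * theta \<phi> = \<i> \<cdot> eul \<phi>"
    by (simp add: theta_def mult.assoc[symmetric])
  then show ?thesis by (simp add: left_diff_distrib mult.commute algebra_simps)
qed

lemma wge_theta: "wge cw k \<phi> \<Longrightarrow> wge cw k (theta \<phi>)"
  unfolding theta_def by (intro wge_csmul wge_mult'[of cw 0 _ k] wge_eul) auto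

lemma wge_theta_diff:
  assumes "coeff \<phi> {#U#} = 0" "coeff \<psi> {#U#} = 0" "wge cw 2 \<phi>" "wge cw 2 \<psi>" "wge cw k (\<phi> - \<psi>)"
  shows "wge cw k (theta \<phi> - theta \<psi>)"
proof -
  let ?q = "1 - \<i> \<cdot> du \<psi>"
  have "coeff ?q {#} \<noteq> 0" using assms by (simp add: coeff_1 coeff_mderiv)
  then have q: "?q * minverse ?q = 1" by (rule mult_minverse)
  have "?q * (theta \<phi> - theta \<psi>) = \<i> \<cdot> eul (\<phi> - \<psi>) + \<i> \<cdot> (theta \<phi> * du (\<phi> - \<psi>))"
    using theta_eq[OF assms(1)] theta_eq[OF assms(2)]
    by (simp add: algebra_simps eul_diff mderiv_diff csmul_diff)
  then have "theta \<phi> - theta \<psi> = minverse ?q * (\<i> \<cdot> eul (\<phi> - \<psi>) + \<i> \<cdot> (theta \<phi> * du (\<phi> - \<psi>)))"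
    using q by (metis mult.assoc mult.commute mult.left_neutral)
  moreover have "wge cw k (theta \<phi> * du (\<phi> - \<psi>))"
    by (rule wge_mult'[OF wge_theta[OF assms(3)] wge_du[OF assms(5)]]) simp
  ultimately show ?thesis
    using assms(5) by (auto intro!: wge_mult'[of cw 0 _ k] wge_add wge_csmul wge_eul)
qed

text \<open>The derivative costs weight 2, but the only monomial of weight 2 containing u is u
  itself; excluding it saves one unit.\<close>

lemma wge_du_1: "wge cw 2 q \<Longrightarrow> coeff q {#U#} = 0 \<Longrightarrow> wge cw 1 (du q)"
  by (auto simp: wge_def coeff_mderiv wt_cw zd_0_iff zbd_0_iff)
    (metis Nat.add_0_right add_mset_commute count_empty gr0I multi_nonempty_split replicate_U replicate_mset_0 wt_cw zd_0_iff zbd_0_iff)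

section \<open>The embedding equations as a perturbation of the linear problem\<close>

locale nonlinear_problem = linear_problem c d N P Q A b
  for c d N P Q A b :: "'n::finite \<Rightarrow> 'n \<Rightarrow> complex" +
  fixes lz :: "'n \<Rightarrow> 'n \<Rightarrow> 'n cseries" and lw :: "'n \<Rightarrow> 'n cseries" and r :: real
  assumes lz: "no_constant_term (lz j k)" and lw: "no_constant_term (lw k)"
    and A_eq: "A j k = coeff (lw k) {#Z j#}" and b_eq: "b j k = coeff (lw k) {#Zb j#}"
begin

text \<open>\<open>Lw\<close> without its terms linear in z and zb. The term linear in u stays, as
  its weight is already 2.\<close>

definition quad :: "'n \<Rightarrow> 'n cseries" where
  "quad k = lw k - (\<Sum>j\<in>UNIV. A j k \<cdot> mvar (Z j) + b j k \<cdot> mvar (Zb j))"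

definition V :: "'n cseries \<Rightarrow> 'n cseries \<Rightarrow> 'n cseries" where
  "V W q = eul q + theta (imp W) * du q"

text \<open>The coefficient of \<open>\<partial>u\<close> in the difference of the field
  \<open>V\<close> and its model \<open>D\<close>.\<close>

definition defect :: "'n cseries \<Rightarrow> 'n cseries" where
  "defect W = theta (imp W) - \<i> \<cdot> h"

definition S :: "('n \<Rightarrow> 'n cseries) \<Rightarrow> 'n cseries \<Rightarrow> 'n crvar \<Rightarrow> 'n cseries" where
  "S F W = shift (\<chi> k. F k) (rep W)"

definition R1 :: "('n \<Rightarrow> 'n cseries) \<Rightarrow> 'n cseries \<Rightarrow> 'n \<Rightarrow> 'n cseries" where
  "R1 F W j = (\<Sum>k\<in>UNIV. msubst (S F W) (lz j k) * (mvar (Z k) + V W (F k))) - defect W * du (sconj (F j))"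

text \<open>The terms of weight 2 free of unknowns. They are accounted for by the quadratic part
  \<open>W2\<close> of the solution.\<close>

definition R0 :: "'n cseries" where
  "R0 = bil A zz zz + bil b zzb zz"

definition R3 :: "('n \<Rightarrow> 'n cseries) \<Rightarrow> 'n cseries \<Rightarrow> 'n cseries" where
  "R3 F W = (- \<i>) \<cdot> (defect W * du (imp W)) - defect W * du (rep W)
     + bil A zz (\<lambda>k. defect W * du (F k)) + bil b zzb (\<lambda>k. defect W * du (F k))
     + bil A F (\<lambda>k. V W (F k)) + bil b (\<lambda>j. sconj (F j)) (\<lambda>k. V W (F k))
     + (\<Sum>k\<in>UNIV. msubst (S F W) (quad k) * (mvar (Z k) + V W (F k)))"

definition W2 :: "'n cseries" where
  "W2 = (1 / 2) \<cdot> bil A zz zz + sconj ((1 / 2) \<cdot> bil A zz zz) + bil b zzb zz"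

text \<open>Enough for the substitution to be meaningful and for the right sides to have their
  weights. The term in u is excluded because its derivative would have weight 0.\<close>

definition mild :: "('n \<Rightarrow> 'n cseries) \<Rightarrow> 'n cseries \<Rightarrow> bool" where
  "mild F W \<longleftrightarrow> (\<forall>k. wge cw 2 (F k) \<and> coeff (F k) {#U#} = 0) \<and> wge cw 2 W \<and> coeff W {#U#} = 0"

lemma V_eq: "V W q = D q + defect W * du q"
  by (simp add: V_def D_def defect_def algebra_simps)

lemma wge_quad: "wge cw 2 (quad k)"
proof (rule wgeI)
  fix M :: "'n crvar multiset" assume M: "wt cw M < 2"
  then have "size M < 2" using size_le_wt[of cw M] by simp
  then consider "M = {#}" | v where "M = {#v#}"
    by (metis One_nat_def less_2_cases size_1_singleton_mset size_eq_0_iff_empty)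
  then show "coeff (quad k) M = 0"
  proof cases
    case 1
    then show ?thesis using lw by (simp add: quad_def no_constant_term_def coeff_sum_mps coeff_mvar)
  next
    case 2
    with M show ?thesis
      by (cases v) (simp_all add: quad_def coeff_sum_mps coeff_mvar A_eq b_eq sum.distrib if_distrib[of "\<lambda>x. _ * x"] cong: if_cong)
  qed
qed

context
  fixes F W
  assumes mild: "mild F W"
begin

lemma nct_S: "no_constant_term (S F W v)"
  and wge_S: "wge cw (cw v) (S F W v)"
proof -
  have F: "wge cw 1 (F k)" for k using mild by (auto simp: mild_def intro: wge_mono)
  show "wge cw (cw v) (S F W v)"
    using wge_rep[of 2 W] mild F wge_mvar_cw by (cases v) (auto simp: S_def mild_def intro!: wge_add)
  then show "no_constant_term (S F W v)" by (rule no_constant_term_wge) simp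
qed

lemma imp_mild: "wge cw 2 (imp W)" "coeff (imp W) {#U#} = 0" and rep_mild: "wge cw 2 (rep W)" "coeff (rep W) {#U#} = 0"
proof -
  show "wge cw 2 (imp W)" "wge cw 2 (rep W)" using mild by (auto simp: mild_def intro: wge_imp wge_rep)
  show "coeff (imp W) {#U#} = 0" "coeff (rep W) {#U#} = 0"
    using mild by (auto simp: mild_def imp_def rep_def coeff_sconj)
qed

lemma wge_mild:
  "wge cw 1 (du (F k))" "wge cw 1 (du (sconj (F k)))" "wge cw 1 (du (imp W))" "wge cw 1 (du (rep W))"
  "wge cw 2 (theta (imp W))" "wge cw 2 (defect W)" "wge cw 2 (V W (F k))"
proof -
  show 1: "wge cw 1 (du (F k))" using mild by (intro wge_du_1) (auto simp: mild_def)
  show "wge cw 1 (du (sconj (F k)))" using mild by (intro wge_du_1) (auto simp: mild_def coeff_sconj)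
  show "wge cw 1 (du (imp W))" "wge cw 1 (du (rep W))" by (intro wge_du_1 imp_mild rep_mild)+
  show 2: "wge cw 2 (theta (imp W))" by (intro wge_theta imp_mild)
  then show "wge cw 2 (defect W)" unfolding defect_def by (intro wge_diff wge_csmul wge_h)
  show "wge cw 2 (V W (F k))" unfolding V_def
    using mild wge_mult'[OF 2 1, of 2] by (auto simp: mild_def intro!: wge_add wge_eul)
qed

lemma wge_zV: "wge cw 1 (mvar (Z k) + V W (F k))"
  by (intro wge_add wge_mvar_cw wge_mono[OF wge_mild(7)]) simp

lemma wge_lz: "wge cw 1 (lz j k)"
proof (rule wgeI)
  fix M :: "'n crvar multiset" assume "wt cw M < 1"
  then have "M = {#}" using size_le_wt[of cw M] by simp
  then show "coeff (lz j k) M = 0" using lz by (simp add: no_constant_term_def)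
qed

lemma wge_R1: "wge cw 2 (R1 F W j)"
  unfolding R1_def
  by (intro wge_diff wge_sum wge_mult'[OF wge_msubst[OF wge_S wge_lz] wge_zV] wge_mult'[OF wge_mild(6,2)]) simp_all

lemma wge_R3: "wge cw 3 (R3 F W)"
proof -
  have F: "wge cw 2 (F k)" for k using mild by (auto simp: mild_def)
  have "wge cw 3 (defect W * du (F k))" for k
    by (rule wge_mult'[OF wge_mild(6,1)]) simp
  then have b1: "wge cw (1 + 3) (bil M zz (\<lambda>k. defect W * du (F k)))" "wge cw (1 + 3) (bil M zzb (\<lambda>k. defect W * du (F k)))" for M
    by (intro wge_bil wge_mvar_cw; simp)+
  have b2: "wge cw (2 + 2) (bil M F (\<lambda>k. V W (F k)))" "wge cw (2 + 2) (bil M (\<lambda>j. sconj (F j)) (\<lambda>k. V W (F k)))" for M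
    by (intro wge_bil wge_mild; simp add: F)+
  show ?thesis
    unfolding R3_def
    by (intro wge_diff wge_add wge_sum wge_csmul wge_mult'[OF wge_msubst[OF wge_S wge_quad] wge_zV]
        wge_mult'[OF wge_mild(6,3)] wge_mult'[OF wge_mild(6,4)] wge_mono[OF b1(1)] wge_mono[OF b1(2)]
        wge_mono[OF b2(1)] wge_mono[OF b2(2)]) simp_all
qed

lemma zideal_defect: "zideal (defect W)"
  unfolding defect_def by (intro zideal_diff zideal_theta zideal_csmul)
    (use pr_h(2)[of _ 1] in \<open>simp add: zideal_def\<close>)

lemma zideal_V: "zideal (V W q)"
  unfolding V_def by (intro zideal_add zideal_eul zideal_mult(1) zideal_theta)

lemma zideal_R1: "zideal (R1 F W j)"
  unfolding R1_def
  by (intro zideal_diff zideal_sum zideal_mult(2)[OF zideal_add[OF zideal_mvar zideal_V]] zideal_mult(1)[OF zideal_defect])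

lemma zideal_R3: "zideal (R3 F W)"
  unfolding R3_def
  by (intro zideal_diff zideal_add zideal_sum zideal_csmul zideal_mult(2)[OF zideal_add[OF zideal_mvar zideal_V]]
      zideal_mult(1)[OF zideal_defect] zideal_bil(1)[where x = zz] zideal_bil(2) zideal_V zideal_mvar)

lemma zideal_R0: "zideal R0"
  unfolding R0_def by (intro zideal_add zideal_bil(2) zideal_mvar)

text \<open>The equation for \<open>theta\<close> says that it is \<open>\<i>\<close> times
  \<open>V W (imp W)\<close>. Hence its sum with \<open>V W (rep W)\<close> is the field applied to
  \<open>W\<close>, and both real unknowns enter the differentiated part through \<open>W\<close>.
  The rest is a splitting of \<open>V\<close> into \<open>D\<close> and \<open>defect\<close>, and
  of \<open>Lw\<close> into linear part and \<open>quad\<close>.\<close>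

lemma embedding_eqs_iff:
  "(\<forall>j. vfield (eulfield (imp W)) (sconj (F j)) =
        (\<Sum>k\<in>UNIV. msubst (S F W) (lz j k) * (mvar (Z k) + vfield (eulfield (imp W)) (F k)))) \<and>
   theta (imp W) + vfield (eulfield (imp W)) (rep W) =
        (\<Sum>k\<in>UNIV. msubst (S F W) (lw k) * (mvar (Z k) + vfield (eulfield (imp W)) (F k))) \<longleftrightarrow>
   (\<forall>j. D (sconj (F j)) = R1 F W j) \<and> T2 F W = R0 + R3 F W"
proof -
  have V: "vfield (eulfield (imp W)) q = V W q" for q by (simp add: vfield_eulfield V_def)
  have nct: "nct (S F W)" using nct_S by blast
  have 1: "V W (sconj (F j)) = (\<Sum>k\<in>UNIV. msubst (S F W) (lz j k) * (mvar (Z k) + V W (F k))) \<longleftrightarrow>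
      D (sconj (F j)) = R1 F W j" for j
    unfolding R1_def V_eq[of W "sconj (F j)"] eq_diff_eq ..
  have lw: "msubst (S F W) (lw k) = (\<Sum>j\<in>UNIV. A j k \<cdot> (mvar (Z j) + F j) + b j k \<cdot> (mvar (Zb j) + sconj (F j)))
      + msubst (S F W) (quad k)" for k
    by (simp add: quad_def msubst_diff msubst_add msubst_sum msubst_csmul nct) (simp add: S_def)
  have bilsum: "(\<Sum>k\<in>UNIV. (\<Sum>j\<in>UNIV. A j k \<cdot> (mvar (Z j) + F j) + b j k \<cdot> (mvar (Zb j) + sconj (F j))) * y k)
     = bil A zz y + bil A F y + (bil b zzb y + bil b (\<lambda>j. sconj (F j)) y)" for y
  proof -
    have "bil M x y = (\<Sum>k\<in>UNIV. \<Sum>j\<in>UNIV. M j k \<cdot> (x j * y k))" for M x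
      unfolding bil_def by (rule sum.swap)
    then show ?thesis
      by (simp add: sum_distrib_right distrib_right csmul_add sum.distrib)
  qed
  have bil_plus: "bil M x (\<lambda>k. y k + y' k) = bil M x y + bil M x y'" for M x y y'
    by (simp add: bil_def distrib_left csmul_add sum.distrib)
  have th: "theta (imp W) = \<i> \<cdot> eul (imp W) + \<i> \<cdot> (theta (imp W) * du (imp W))"
    by (rule theta_eq) (rule imp_mild)
  have rhs: "(\<Sum>k\<in>UNIV. msubst (S F W) (lw k) * (mvar (Z k) + V W (F k))) =
     bil A zz (\<lambda>k. mvar (Z k) + V W (F k)) + bil A F (\<lambda>k. mvar (Z k) + V W (F k)) +
     (bil b zzb (\<lambda>k. mvar (Z k) + V W (F k)) + bil b (\<lambda>j. sconj (F j)) (\<lambda>k. mvar (Z k) + V W (F k))) +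
     (\<Sum>k\<in>UNIV. msubst (S F W) (quad k) * (mvar (Z k) + V W (F k)))"
    unfolding lw distrib_right sum.distrib bilsum[symmetric] by (simp add: distrib_right sum.distrib)
  have Dq: "D W = D (rep W) + \<i> \<cdot> D (imp W)"
    using arg_cong[OF rep_imp[of W], of D] by (simp only: D_simps)
  have VD: "bil M x (\<lambda>k. V W (F k)) = bil M x (\<lambda>k. D (F k)) + bil M x (\<lambda>k. defect W * du (F k))" for M x
    unfolding V_eq bil_plus ..
  have "theta (imp W) + V W (rep W) - (\<Sum>k\<in>UNIV. msubst (S F W) (lw k) * (mvar (Z k) + V W (F k))) =
    T2 F W - (R0 + R3 F W)"
  proof -
    have "theta (imp W) + V W (rep W) = D W + \<i> \<cdot> (defect W * du (imp W)) + defect W * du (rep W)"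
    proof -
      have "theta (imp W) + V W (rep W) = \<i> \<cdot> eul (imp W) + \<i> \<cdot> (theta (imp W) * du (imp W)) + V W (rep W)"
        by (rule arg_cong[where f = "\<lambda>x. x + V W (rep W)", OF th])
      also have "\<dots> = D W + \<i> \<cdot> (defect W * du (imp W)) + defect W * du (rep W)"
        unfolding Dq V_eq unfolding D_def[of "imp W"] defect_def
        by (simp add: algebra_simps csmul_add csmul_diff csmul_uminus)
      finally show ?thesis .
    qed
    then show ?thesis
      unfolding rhs bil_plus T2_def R0_def R3_def VD[of _ zz] VD[of _ zzb]
      by (simp add: algebra_simps csmul_uminus)
  qed
  then have 2: "theta (imp W) + V W (rep W) = (\<Sum>k\<in>UNIV. msubst (S F W) (lw k) * (mvar (Z k) + V W (F k))) \<longleftrightarrow>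
     T2 F W = R0 + R3 F W"
    by (rule diff_eq_diff_eq)
  show ?thesis unfolding V 1 2 ..
qed

end

end

section \<open>Estimates of the right sides and the contraction\<close>

lemma wge_mult_diff:
  assumes "wge \<omega> p (a - a')" "wge \<omega> q b" "wge \<omega> p' a'" "wge \<omega> q' (b - b')" "l \<le> p + q" "l \<le> p' + q'"
  shows "wge \<omega> l (a * b - a' * b')"
  unfolding mult_diff_split by (intro wge_add wge_mult'[OF assms(1,2)] wge_mult'[OF assms(3,4)] assms(5,6))

lemma wge_bil_diff:
  assumes "\<And>j. wge \<omega> p (x j - x' j)" "\<And>k. wge \<omega> q (y k)" "\<And>j. wge \<omega> p' (x' j)" "\<And>k. wge \<omega> q' (y k - y' k)"
    "l \<le> p + q" "l \<le> p' + q'"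
  shows "wge \<omega> l (bil M x y - bil M x' y')"
proof -
  have "bil M x y - bil M x' y' = (\<Sum>j\<in>UNIV. \<Sum>k\<in>UNIV. M j k \<cdot> (x j * y k - x' j * y' k))"
    by (simp add: bil_def csmul_diff sum_subtractf)
  then show ?thesis
    by (auto intro!: wge_sum wge_csmul wge_mult_diff[where a = "x _" and a' = "x' _"] assms)
qed

lemma bil_diff_left: "bil M (\<lambda>k. x k - x' k) y = bil M x y - bil M x' y"
  by (simp add: bil_transpose[of M _ y] bil_diff)

lemma wge_diff_diff:
  assumes "wge \<omega> k (a - a')" "wge \<omega> k (b - b')"
  shows "wge \<omega> k (a + b - (a' + b'))" "wge \<omega> k (a - b - (a' - b'))"
proof -
  have 1: "a + b - (a' + b') = (a - a') + (b - b')" and 2: "a - b - (a' - b') = (a - a') - (b - b')"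
    by (simp_all add: algebra_simps)
  show "wge \<omega> k (a + b - (a' + b'))" unfolding 1 by (rule wge_add[OF assms])
  show "wge \<omega> k (a - b - (a' - b'))" unfolding 2 by (rule wge_diff[OF assms])
qed

lemma wge_sum_diff:
  "(\<And>i. i \<in> I \<Longrightarrow> wge \<omega> k (f i - g i)) \<Longrightarrow> wge \<omega> k (sum f I - sum g I)"
  unfolding sum_subtractf[symmetric] by (rule wge_sum)

lemma wge_csmul_diff: "wge \<omega> k (a - b) \<Longrightarrow> wge \<omega> k (x \<cdot> a - x \<cdot> b)"
  unfolding csmul_diff[symmetric] by (rule wge_csmul)

lemma imp_diff: "imp (p - q) = imp p - imp q"
  by (rule mps_eqI) (simp add: imp_def sconj_diff diff_divide_distrib algebra_simps)

text \<open>The variables double as indices of the unknowns: \<open>Z k\<close> for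
  \<open>F k\<close> and \<open>U\<close> for \<open>W\<close>. The places \<open>Zb k\<close> hold
  0, where \<open>start_monomials\<close> fixes them. The base weights 2 and 3 differ by one as in
  the linear estimate.\<close>

fun pack :: "('n \<Rightarrow> 'n cseries) \<Rightarrow> 'n cseries \<Rightarrow> 'n crvar \<Rightarrow> 'n cseries" where
  "pack F W (Z k) = F k"
| "pack F W (Zb k) = 0"
| "pack F W U = W"

fun start_weight :: "'n crvar \<Rightarrow> nat" where
  "start_weight (Z k) = 2"
| "start_weight (Zb k) = 0"
| "start_weight U = 3"

fun start_monomials :: "'n crvar \<Rightarrow> 'n crvar multiset set" where
  "start_monomials (Z k) = insert {#U#} {M. wt cw M < 2}"
| "start_monomials (Zb k) = UNIV"
| "start_monomials U = {M. wt cw M < 3}"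

context linear_problem
begin

lemma T2_diff: "T2 (\<lambda>k. F k - F' k) (W - W') = T2 F W - T2 F' W'"
  by (simp add: T2_def D_simps bil_diff bil_diff_left sconj_diff)

lemma normal_diff: "normal p \<Longrightarrow> normal q \<Longrightarrow> normal (p - q)"
  by (simp add: normal_def pr_diff mderiv_diff trc_simps)

text \<open>Only bidegree (1, 1) is present, and \<open>h\<close> does not depend on u.\<close>

lemma normal_h: "normal h"
proof -
  have 1: "pr 0 0 (1 :: 'n cseries) = 1" "pr (Suc a) b (1 :: 'n cseries) = 0" for a b
    by (rule mps_eqI; auto simp: coeff_pr coeff_1)+
  have "pr (Suc a) (Suc b) h = h * pr a b 1" "pr a 0 h = 0" for a b
    using pr_h(1)[of a b 1] pr_h(3)[of a 1] by simp_all
  then show ?thesis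
    by (simp add: normal_def numeral_2_eq_2 numeral_3_eq_3 trc_simps 1)
qed

text \<open>The linear estimate holds for the difference in every weight: since the coefficients of
  u^2 agree, \<open>initial\<close> never obstructs.\<close>

lemma linear_unique:
  assumes "\<And>j. D (sconj (F j)) = D (sconj (F' j))" "T2 F W = T2 F' W'"
    "normal (imp W)" "normal (imp W')" "initial 3 F W" "initial 3 F' W'"
    "coeff (rep W) {#U, U#} = coeff (rep W') {#U, U#}"
  shows "F = F'" "W = W'"
proof -
  have i: "initial (Suc m) (\<lambda>k. F k - F' k) (W - W')" for m
    using assms(5-7) by (simp add: initial_def rep_diff)
  have n: "normal (imp (W - W'))"
    using normal_diff[OF assms(3,4)] by (simp add: imp_diff)
  have *: "wge cw m (F k - F' k)" "wge cw (Suc m) (W - W')" for m k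
    using linear_weight[of m "\<lambda>k. F k - F' k" "W - W'"] assms(1,2) i n
    by (simp_all add: sconj_diff D_simps T2_diff)
  have "F k - F' k = 0" for k using *(1) by (rule wge_eq_0)
  then show "F = F'" by (simp add: fun_eq_iff)
  have "W - W' = 0" by (rule wge_eq_0[of cw]) (metis *(2) wge_mono Suc_n_not_le_n nat_le_linear)
  then show "W = W'" by simp
qed

end

context nonlinear_problem
begin

text \<open>\<open>W2\<close> solves the problem in weight 2 with F = 0, and its imaginary part is
  the Levi form. The iteration thus starts from the hyperquadric Im w = h.\<close>

lemma W2_facts:
  "wge cw 2 W2" "wge deg 2 W2" "pr 0 0 W2 = 0" "imp W2 = h" "T2 (\<lambda>_. 0) W2 = R0"
proof -
  have w: "wge cw (1 + 1) (bil M zz zz)" "wge cw (1 + 1) (bil M zzb zz)" for M :: "'n \<Rightarrow> 'n \<Rightarrow> complex"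
    by (intro wge_bil wge_mvar_cw)+
  show "wge cw 2 W2"
    unfolding W2_def using w by (auto intro!: wge_add wge_csmul simp del: One_nat_def simp: numeral_2_eq_2[symmetric])
  have w: "wge deg (Suc 0 + Suc 0) (bil M zz zz)" "wge deg (Suc 0 + Suc 0) (bil M zzb zz)" for M :: "'n \<Rightarrow> 'n \<Rightarrow> complex"
    by (intro wge_bil wge_mvar[of deg])+
  show "wge deg 2 W2"
    unfolding W2_def using w
    by (intro wge_add wge_csmul, simp_all add: wge_sconj numeral_2_eq_2 wge_csmul)
  show "pr 0 0 W2 = 0"
    by (simp add: W2_def bil_def pr_add pr_csmul pr_sum pr_mvar_Z pr_mvar_Zb pr_sconj)
  have b: "bil b zzb zz - sconj (bil b zzb zz) = (2 * \<i>) \<cdot> h"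
  proof -
    have "sconj (bil b zzb zz) = bil (\<lambda>j k. cnj (b k j)) zzb zz"
      unfolding sconj_bil by (simp add: sconj_mvar) (rule bil_transpose)
    then have "bil b zzb zz - sconj (bil b zzb zz) = bil (\<lambda>j k. 2 * \<i> * c j k) zzb zz"
      by (simp add: bil_def sum_subtractf[symmetric] csmul_diff_left[symmetric] c_eq)
    then show ?thesis unfolding bil_scale by (simp add: bil_def h_def)
  qed
  have "W2 - sconj W2 = bil b zzb zz - sconj (bil b zzb zz)"
    unfolding W2_def sconj_add sconj_sconj by simp
  then show "imp W2 = h" unfolding imp_def b by simp
  have "eul (bil A zz zz) = bil A zz zz + bil A zz zz"
    by (simp add: bil_def eul_csmul eul_sum eul_mult eul_mvar csmul_add csmul_sum sum.distrib mult.commute)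
  then have "eul ((1 / 2) \<cdot> bil A zz zz) = bil A zz zz"
    by (simp add: eul_csmul mps_eq_iff)
  moreover have "eul (sconj ((1 / 2) \<cdot> bil A zz zz)) = 0"
    by (simp add: sconj_bil sconj_csmul sconj_mvar) (simp add: bil_def eul_csmul eul_sum eul_mult eul_mvar)
  moreover have "eul (bil b zzb zz) = bil b zzb zz"
    by (simp add: bil_def eul_csmul eul_sum eul_mult eul_mvar)
  ultimately have "eul W2 = R0" by (simp add: W2_def R0_def eul_add)
  moreover have "du W2 = 0"
    by (simp add: W2_def bil_def sconj_sum sconj_csmul sconj_mult sconj_mvar mderiv_add mderiv_sum mderiv_mult mderiv_mvar)
  ultimately show "T2 (\<lambda>_. 0) W2 = R0"
    by (simp add: T2_def D_def bil_def)
qed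

text \<open>Stronger than \<open>mild\<close>: as \<open>W\<close> agrees with \<open>W2\<close> in
  weight 2, \<open>imp W\<close> begins with \<open>h\<close>, which raises \<open>defect\<close>
  from weight 2 to weight 3.\<close>

definition dom :: "('n \<Rightarrow> 'n cseries) \<Rightarrow> 'n cseries \<Rightarrow> bool" where
  "dom F W \<longleftrightarrow> (\<forall>k. wge cw 2 (F k) \<and> coeff (F k) {#U#} = 0) \<and> wge cw 3 (W - W2)"

lemma coeff_W2_U: "coeff W2 {#U#} = 0" "coeff W2 {#} = 0"
  using W2_facts(3) by (auto simp: mps_eq_iff coeff_pr dest: spec[of _ "{#U#}"] spec[of _ "{#}"])

lemma dom_mild: "dom F W \<Longrightarrow> mild F W"
proof -
  assume d: "dom F W"
  have "wge cw 2 (W - W2 + W2)"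
    using d W2_facts(1) by (intro wge_add) (auto simp: dom_def intro: wge_mono)
  moreover have "coeff (W - W2) {#U#} = 0" using d by (auto simp: dom_def wge_def)
  ultimately show "mild F W" using d by (simp add: mild_def dom_def coeff_W2_U)
qed

text \<open>The linear estimate is applied to \<open>W - W2\<close>, for which \<open>R0\<close>
  cancels and normality persists.\<close>

lemma solution_dom:
  assumes "\<And>j. wge cw 2 (D (sconj (F j)))" "wge cw 3 (T2 F W - R0)" "normal (imp W)" "initial 3 F W"
  shows "dom F W"
proof -
  have T: "T2 F (W - W2) = T2 F W - R0"
    using T2_diff[of F "\<lambda>_. 0" W W2] by (simp add: W2_facts(5))
  have "normal (imp (W - W2))"
    using assms(3) normal_h by (simp add: imp_diff W2_facts(4) normal_diff)
  moreover have "initial 3 F (W - W2)"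
    using assms(4) by (simp add: initial_def rep_diff coeff_rep_U[OF _ _ W2_facts(3)])
  ultimately have "wge cw 2 (F k)" "wge cw 3 (W - W2)" for k
    using linear_weight[of 2 F "W - W2"] assms(1,2) by (simp_all add: T numeral_3_eq_3 numeral_2_eq_2)
  then show ?thesis using assms(4) by (simp add: dom_def initial_def)
qed

lemma wge_defect: "dom F W \<Longrightarrow> wge cw 3 (defect W)"
proof -
  assume d: "dom F W"
  note m = dom_mild[OF d]
  have "imp W - h = imp (W - W2)" by (simp add: imp_diff W2_facts(4))
  then have "wge cw 3 (imp W - h)" using d by (simp add: dom_def wge_imp)
  then have "wge cw 3 (eul (imp W - h))" by (rule wge_eul)
  then have 1: "wge cw 3 (eul (imp W) - h)" by (simp add: eul_diff)
  have "theta (imp W) = \<i> \<cdot> eul (imp W) + \<i> \<cdot> (theta (imp W) * du (imp W))"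
    by (rule theta_eq) (rule imp_mild[OF m])
  then have "defect W = \<i> \<cdot> (eul (imp W) - h) + \<i> \<cdot> (theta (imp W) * du (imp W))"
    unfolding defect_def by (simp add: csmul_diff)
  moreover have "wge cw 3 (theta (imp W) * du (imp W))"
    by (rule wge_mult'[OF wge_mild(5,3)[OF m]]) simp
  ultimately show ?thesis using 1 by (auto intro!: wge_add wge_csmul)
qed

text \<open>The critical terms are those with \<open>defect\<close>: a derivative \<open>du\<close>
  of \<open>F\<close> costs weight 2, so the factor has to have weight 3 for a gain of one. The
  remaining terms gain through another factor of positive weight.\<close>

lemma step_estimate:
  assumes d: "dom F W" "dom F' W'" and F: "\<And>k. wge cw (2 + m) (F k - F' k)" and W: "wge cw (3 + m) (W - W')"
  shows "wge cw (3 + m) (R1 F W j - R1 F' W' j)" "wge cw (4 + m) (R3 F W - R3 F' W')"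
proof -
  note mi = dom_mild[OF d(1)] dom_mild[OF d(2)]
  have rp: "wge cw (3 + m) (rep W - rep W')" and ip: "wge cw (3 + m) (imp W - imp W')"
    using W by (simp_all add: imp_diff[symmetric] rep_diff[symmetric] wge_imp wge_rep)
  have Fc: "wge cw (2 + m) (sconj (F k) - sconj (F' k))" for k
    unfolding sconj_diff[symmetric] wge_sconj_cw by (rule F)
  have dF: "wge cw m (du (F k) - du (F' k))" "wge cw m (du (sconj (F k)) - du (sconj (F' k)))" for k
    using wge_du[OF F[of k]] wge_du[OF Fc[of k]] by (simp_all add: mderiv_diff)
  have di: "wge cw (1 + m) (du (imp W) - du (imp W'))" and dr: "wge cw (1 + m) (du (rep W) - du (rep W'))"
    using wge_du[OF ip] wge_du[OF rp] by (simp_all add: mderiv_diff)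
  have th: "wge cw (3 + m) (theta (imp W) - theta (imp W'))"
    by (intro wge_theta_diff imp_mild[OF mi(1)] imp_mild[OF mi(2)] ip)
  then have de: "wge cw (3 + m) (defect W - defect W')" by (simp add: defect_def)
  have VF: "wge cw (2 + m) (V W (F k) - V W' (F' k))" for k
    unfolding V_def
    by (rule wge_diff_diff)
      (use wge_eul[OF F[of k]] in \<open>auto simp: eul_diff intro!: wge_mult_diff[OF th wge_mild(1)[OF mi(1)] wge_mild(5)[OF mi(2)] dF(1)]\<close>)
  have zV: "wge cw (2 + m) (mvar (Z k) + V W (F k) - (mvar (Z k) + V W' (F' k)))" for k
    using VF[of k] by simp
  have S: "wge cw (cw v + (1 + m)) (S F W v - S F' W' v)" for v
    using F Fc rp by (cases v) (simp_all add: S_def eval_nat_numeral)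
  have ms: "wge cw (l + (1 + m)) (msubst (S F W) q - msubst (S F' W') q)" if "wge cw l q" for l q
    using wge_S[OF mi(1)] wge_S[OF mi(2)] S that by (intro wge_msubst_diff[where \<omega>' = cw])
  have dF': "wge cw (3 + m) (defect W * du (F k) - defect W' * du (F' k))"
      "wge cw (3 + m) (defect W * du (sconj (F k)) - defect W' * du (sconj (F' k)))" for k
    by (rule wge_mult_diff[OF de wge_mild(1)[OF mi(1)] wge_defect[OF d(2)] dF(1)]; simp)
       (rule wge_mult_diff[OF de wge_mild(2)[OF mi(1)] wge_defect[OF d(2)] dF(2)]; simp)
  show "wge cw (3 + m) (R1 F W j - R1 F' W' j)"
    unfolding R1_def
    by (intro wge_diff_diff wge_sum_diff dF'
        wge_mult_diff[OF ms[OF wge_lz[OF mi(1)]] wge_zV[OF mi(1)] wge_msubst[OF wge_S[OF mi(2)] wge_lz[OF mi(1)]] zV]) simp_all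
  have F2: "wge cw 2 (F' k)" "wge cw 2 (sconj (F' k))" for k using d by (simp_all add: dom_def)
  have z0: "wge cw (3 + m) (mvar (Z k) - mvar (Z k) :: 'n cseries)" "wge cw (3 + m) (mvar (Zb k) - mvar (Zb k) :: 'n cseries)" for k
    by simp_all
  have dd: "wge cw 1 (defect W * du (F k))" for k
    by (rule wge_mult'[OF wge_mild(6)[OF mi(1)] wge_mild(1)[OF mi(1)]]) simp
  have p1: "wge cw (4 + m) (defect W * du (imp W) - defect W' * du (imp W'))"
    by (rule wge_mult_diff[OF de wge_mild(3)[OF mi(1)] wge_defect[OF d(2)] di]) simp_all
  have p2: "wge cw (4 + m) (defect W * du (rep W) - defect W' * du (rep W'))"
    by (rule wge_mult_diff[OF de wge_mild(4)[OF mi(1)] wge_defect[OF d(2)] dr]) simp_all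
  have p3: "wge cw (4 + m) (bil A zz (\<lambda>k. defect W * du (F k)) - bil A zz (\<lambda>k. defect W' * du (F' k)))"
    by (rule wge_bil_diff[OF z0(1) dd wge_mvar_cw(1) dF'(1)]) simp_all
  have p4: "wge cw (4 + m) (bil b zzb (\<lambda>k. defect W * du (F k)) - bil b zzb (\<lambda>k. defect W' * du (F' k)))"
    by (rule wge_bil_diff[OF z0(2) dd wge_mvar_cw(2) dF'(1)]) simp_all
  have p5: "wge cw (4 + m) (bil A F (\<lambda>k. V W (F k)) - bil A F' (\<lambda>k. V W' (F' k)))"
    by (rule wge_bil_diff[OF F wge_mild(7)[OF mi(1)] F2(1) VF]) simp_all
  have p6: "wge cw (4 + m) (bil b (\<lambda>j. sconj (F j)) (\<lambda>k. V W (F k)) - bil b (\<lambda>j. sconj (F' j)) (\<lambda>k. V W' (F' k)))"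
    by (rule wge_bil_diff[OF Fc wge_mild(7)[OF mi(1)] F2(2) VF]) simp_all
  have p7: "wge cw (4 + m) (msubst (S F W) (quad k) * (mvar (Z k) + V W (F k)) -
      msubst (S F' W') (quad k) * (mvar (Z k) + V W' (F' k)))" for k
    by (rule wge_mult_diff[OF ms[OF wge_quad] wge_zV[OF mi(1)] wge_msubst[OF wge_S[OF mi(2)] wge_quad] zV]) simp_all
  show "wge cw (4 + m) (R3 F W - R3 F' W')"
    unfolding R3_def by (intro wge_diff_diff wge_sum_diff wge_csmul_diff p1 p2 p3 p4 p5 p6 p7)
qed

definition step :: "('n crvar \<Rightarrow> 'n cseries) \<Rightarrow> 'n crvar \<Rightarrow> 'n cseries" where
  "step x = (let F = \<lambda>k. x (Z k); W = x U in
     pack (Fsol (R1 F W) (R0 + R3 F W) r) (Wsol (R1 F W) (R0 + R3 F W) r))"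

lemma coincide_iff_dom:
  "coincide start_monomials x (pack (\<lambda>_. 0) W2) \<longleftrightarrow> dom (\<lambda>k. x (Z k)) (x U) \<and> (\<forall>k. x (Zb k) = 0)"
  unfolding coincide_def dom_def
  by (subst all_crvar_iff) (auto simp: wge_def mps_eq_iff)

context
  fixes F W
  assumes mild: "mild F W"
begin

abbreviation (input) "F1 \<equiv> Fsol (R1 F W) (R0 + R3 F W) r"
abbreviation (input) "W1 \<equiv> Wsol (R1 F W) (R0 + R3 F W) r"

lemma step_solves:
  "D (sconj (F1 j)) = R1 F W j" "T2 F1 W1 = R0 + R3 F W" "normal (imp W1)" "initial 3 F1 W1"
  "coeff (rep W1) {#U, U#} = - of_real r / 2"
proof -
  have r1: "pr 0 b (R1 F W j) = 0" for b j
    using zideal_R1[OF mild] by (simp add: zideal_def)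
  have r2: "pr 0 b (R0 + R3 F W) = 0" for b
    using zideal_add[OF zideal_R0 zideal_R3] mild by (simp add: zideal_def)
  show "D (sconj (F1 j)) = R1 F W j" by (rule Fsol_eq[OF r1 r2])
  show "T2 F1 W1 = R0 + R3 F W" by (rule Wsol_eq[OF r1 r2])
  show "normal (imp W1)" by (rule normal_Wsol[OF r1 r2])
  show "initial 3 F1 W1" by (rule initial_sol(1)[OF r1 r2]) simp_all
  show "coeff (rep W1) {#U, U#} = - of_real r / 2" by (rule initial_sol(2)[OF r1 r2, of 3]) simp_all
qed

lemma dom_step: "dom F1 W1"
  by (rule solution_dom) (simp_all add: step_solves wge_R1[OF mild] wge_R3[OF mild])

end

text \<open>The linear estimate turns the gain in the right sides into a gain for the solutions. Two
  images have the same coefficient of u^2, fixed by \<open>r\<close>, so that \<open>initial\<close>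
  holds for their difference in every weight.\<close>

lemma contraction_step: "contraction cw start_weight start_monomials (pack (\<lambda>_. 0) W2) step"
  unfolding contraction_def coincide_iff_dom
proof (intro conjI allI impI)
  show "M \<in> start_monomials i" if "wt cw M < start_weight i" for i :: "'n crvar" and M
    using that by (cases i) auto
  show "dom (\<lambda>k. step x (Z k)) (step x U)" if "dom (\<lambda>k. x (Z k)) (x U) \<and> (\<forall>k. x (Zb k) = 0)" for x
    using dom_step[OF dom_mild, of "\<lambda>k. x (Z k)" "x U"] that by (simp add: step_def Let_def)
  show "step x (Zb k) = 0" for x k by (simp add: step_def Let_def)
next
  fix m x y i
  assume x: "dom (\<lambda>k. x (Z k)) (x U) \<and> (\<forall>k. x (Zb k) = 0)" and y: "dom (\<lambda>k. y (Z k)) (y U) \<and> (\<forall>k. y (Zb k) = 0)"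
    and xy: "\<forall>i. wge cw (start_weight i + m) (x i - y i)"
  define F F' W W' where "F k = x (Z k)" and "F' k = y (Z k)" and "W = x U" and "W' = y U" for k
  have d: "dom F W" "dom F' W'" using x y by (simp_all add: F_def[abs_def] F'_def[abs_def] W_def W'_def)
  have dF: "wge cw (2 + m) (F k - F' k)" for k using spec[OF xy, of "Z k"] by (simp add: F_def F'_def)
  have dW: "wge cw (3 + m) (W - W')" using spec[OF xy, of U] by (simp add: W_def W'_def)
  note s = step_solves[OF dom_mild[OF d(1)]] and s' = step_solves[OF dom_mild[OF d(2)]]
  note e = step_estimate[OF d dF dW]
  define G G' where "G = Fsol (R1 F W) (R0 + R3 F W) r" and "G' = Fsol (R1 F' W') (R0 + R3 F' W') r"
  define H H' where "H = Wsol (R1 F W) (R0 + R3 F W) r" and "H' = Wsol (R1 F' W') (R0 + R3 F' W') r"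
  have "wge cw (3 + m) (G k - G' k)" "wge cw (Suc (3 + m)) (H - H')" for k
  proof -
    have 1: "wge cw (3 + m) (D (sconj (G j - G' j)))" for j
      using e(1)[of j] by (simp add: sconj_diff D_simps s(1) s'(1) G_def G'_def)
    have 2: "wge cw (Suc (3 + m)) (T2 (\<lambda>k. G k - G' k) (H - H'))"
      using e(2) by (simp add: T2_diff s(2) s'(2) G_def G'_def H_def H'_def)
    have 3: "normal (imp (H - H'))"
      using normal_diff[OF s(3) s'(3)] by (simp add: imp_diff H_def H'_def)
    have 4: "initial (Suc (3 + m)) (\<lambda>k. G k - G' k) (H - H')"
      using s(4,5) s'(4,5) by (simp add: initial_def rep_diff G_def G'_def H_def H'_def)
    show "wge cw (3 + m) (G k - G' k)" "wge cw (Suc (3 + m)) (H - H')"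
      using linear_weight[OF 1 2 3 4] by simp_all
  qed
  then show "wge cw (start_weight i + Suc m) (step x i - step y i)"
    by (cases i) (simp_all add: step_def Let_def F_def[abs_def] F'_def[abs_def] W_def W'_def G_def G'_def H_def H'_def
        eval_nat_numeral)
qed

definition solution :: "('n \<Rightarrow> 'n cseries) \<Rightarrow> 'n cseries \<Rightarrow> bool" where
  "solution F W \<longleftrightarrow> (\<forall>k. wge deg 2 (F k)) \<and> wge deg 2 W \<and> normal (imp W) \<and>
     coeff (rep W) {#U, U#} = - of_real r / 2 \<and>
     (\<forall>j. D (sconj (F j)) = R1 F W j) \<and> T2 F W = R0 + R3 F W"

lemma deg_mild:
  assumes "\<forall>k. wge deg 2 (F k)" "wge deg 2 W"
  shows "mild F W" "initial 3 F W"
proof -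
  have w: "wge cw 2 q" if "wge deg 2 q" for q :: "'n cseries"
    using that le_less_trans[OF size_le_wt[of cw]] by (auto simp: wge_def)
  have c: "coeff q {#} = 0" "coeff q {#v#} = 0" if "wge deg 2 q" for q :: "'n cseries" and v
    using that by (auto simp: wge_def)
  show "mild F W" using assms w c by (simp add: mild_def)
  show "initial 3 F W" using assms c by (simp add: initial_def rep_def coeff_sconj)
qed

text \<open>A solution of order 2 lies in the domain by the linear estimate, and the step reproduces
  it by linear uniqueness. Conversely, the weights in the domain together with the excluded term u
  imply order 2.\<close>

lemma solution_iff:
  "solution F W \<longleftrightarrow> coincide start_monomials (pack F W) (pack (\<lambda>_. 0) W2) \<and> step (pack F W) = pack F W"
proof
  assume s: "solution F W"
  then have m: "mild F W" and i: "initial 3 F W" using deg_mild by (auto simp: solution_def)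
  have "dom F W"
    by (rule solution_dom) (use s i wge_R1[OF m] wge_R3[OF m] in \<open>simp_all add: solution_def\<close>)
  note st = step_solves[OF m]
  have s': "D (sconj (F j)) = R1 F W j" "T2 F W = R0 + R3 F W" "normal (imp W)"
      "coeff (rep W) {#U, U#} = - of_real r / 2" for j
    using s by (simp_all add: solution_def)
  have "Fsol (R1 F W) (R0 + R3 F W) r = F"
    by (rule linear_unique(1)[where W = "Wsol (R1 F W) (R0 + R3 F W) r" and W' = W]) (simp_all add: st i s')
  moreover have "Wsol (R1 F W) (R0 + R3 F W) r = W"
    by (rule linear_unique(2)[where F = "Fsol (R1 F W) (R0 + R3 F W) r" and F' = F]) (simp_all add: st i s')
  ultimately have "Fsol (R1 F W) (R0 + R3 F W) r = F" "Wsol (R1 F W) (R0 + R3 F W) r = W" .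
  then show "coincide start_monomials (pack F W) (pack (\<lambda>_. 0) W2) \<and> step (pack F W) = pack F W"
    using \<open>dom F W\<close> by (simp add: coincide_iff_dom step_def)
next
  assume "coincide start_monomials (pack F W) (pack (\<lambda>_. 0) W2) \<and> step (pack F W) = pack F W"
  then have d: "dom F W" and fx: "step (pack F W) = pack F W"
    by (simp_all add: coincide_iff_dom)
  have m: "mild F W" by (rule dom_mild[OF d])
  have eq: "Fsol (R1 F W) (R0 + R3 F W) r = F" "Wsol (R1 F W) (R0 + R3 F W) r = W"
    using fun_cong[OF fx, of "Z _"] fun_cong[OF fx, of U] by (auto simp: step_def fun_eq_iff)
  note st = step_solves[OF m, unfolded eq]
  have "wge deg 2 (F k)" for k
  proof -
    have "coeff (F k) {#v#} = 0" for v
      using d by (cases v) (auto simp: dom_def wge_def)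
    moreover have "coeff (F k) {#} = 0" using d by (auto simp: dom_def wge_def)
    ultimately show ?thesis
      by (simp add: no_linear_terms_iff_wge[symmetric] no_constant_term_def no_linear_terms_def)
  qed
  moreover have "wge deg 2 W"
  proof -
    have "coeff (W - W2) {#v#} = 0" for v
      using d by (cases v) (auto simp: dom_def wge_def)
    moreover have "coeff (W - W2) {#} = 0" using d by (auto simp: dom_def wge_def)
    ultimately have "wge deg 2 (W - W2)"
      by (simp only: no_linear_terms_iff_wge[symmetric] no_constant_term_def no_linear_terms_def) simp
    then have "wge deg 2 (W - W2 + W2)" by (rule wge_add) (rule W2_facts)
    then show ?thesis by simp
  qed
  ultimately show "solution F W" using st by (simp add: solution_def)
qed

theorem unique_solution: "\<exists>!x. solution (fst x) (snd x)"
proof -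
  have ex: "\<exists>!x. coincide start_monomials x (pack (\<lambda>_. 0) W2) \<and> step x = x"
    by (rule contraction_fixpoint[OF contraction_step])
  then obtain x where x: "coincide start_monomials x (pack (\<lambda>_. 0) W2)" "step x = x" by blast
  then have "x = pack (\<lambda>k. x (Z k)) (x U)"
    unfolding coincide_iff_dom by (auto simp: fun_eq_iff all_crvar_iff)
  then have "solution (\<lambda>k. x (Z k)) (x U)"
    using x by (simp add: solution_iff)
  moreover have "F = F' \<and> W = W'" if "solution F W" "solution F' W'" for F F' W W'
  proof -
    have "pack F W = pack F' W'" using that ex unfolding solution_iff by blast
    then show ?thesis by (auto simp: fun_eq_iff all_crvar_iff)
  qed
  ultimately show ?thesis by (intro ex1I[of _ "(\<lambda>k. x (Z k), x U)"]) (auto simp: prod_eq_iff)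
qed

end

section \<open>Existence and uniqueness\<close>

lemma rep_real: "sconj p = p \<Longrightarrow> sconj q = q \<Longrightarrow> rep (p + \<i> \<cdot> q) = p"
  and imp_real: "sconj p = p \<Longrightarrow> sconj q = q \<Longrightarrow> imp (p + \<i> \<cdot> q) = q"
  by (simp_all add: rep_def imp_def sconj_add sconj_csmul csmul_uminus csmul_add_left[symmetric] mps_eq_iff)

section \<open>The tensors of L at 0 and their inverses\<close>

definition Ac :: "'n::finite cr_rep \<Rightarrow> 'n \<Rightarrow> 'n \<Rightarrow> complex" where
  "Ac L j k = coeff (Lw L $ k) {#Z j#}"

definition bc :: "'n::finite cr_rep \<Rightarrow> 'n \<Rightarrow> 'n \<Rightarrow> complex" where
  "bc L j k = coeff (Lw L $ k) {#Zb j#}"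

definition cc :: "'n::finite cr_rep \<Rightarrow> 'n \<Rightarrow> 'n \<Rightarrow> complex" where
  "cc L j k = levi L (axis j 1) (axis k 1)"

definition Nc :: "'n::finite cr_rep \<Rightarrow> 'n \<Rightarrow> 'n \<Rightarrow> complex" where
  "Nc L j k = Nw L (axis j 1) (axis k 1)"

definition dc :: "'n::finite cr_rep \<Rightarrow> 'n \<Rightarrow> 'n \<Rightarrow> complex" where
  "dc L j k = matrix_inv (transpose (levi_matrix L)) $ j $ k"

text \<open>The complexification of the real linear map \<open>\<xi> \<mapsto> N(\<xi>, \<cdot>) + 6 \<i> \<L>(\<xi>, \<cdot>)\<close>; the two
  summands of the index type stand for \<open>\<xi>\<close> and its conjugate.\<close>

definition double_matrix :: "'n::finite cr_rep \<Rightarrow> complex ^ ('n + 'n) ^ ('n + 'n)" where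
  "double_matrix L = (\<chi> u v. case (u, v) of
      (Inl k, Inl j) \<Rightarrow> Nc L j k
    | (Inl k, Inr j) \<Rightarrow> 6 * \<i> * cc L j k
    | (Inr k, Inl j) \<Rightarrow> cnj (6 * \<i> * cc L j k)
    | (Inr k, Inr j) \<Rightarrow> cnj (Nc L j k))"

definition Pc :: "'n::finite cr_rep \<Rightarrow> 'n \<Rightarrow> 'n \<Rightarrow> complex" where
  "Pc L j k = matrix_inv (double_matrix L) $ Inl j $ Inl k"

definition Qc :: "'n::finite cr_rep \<Rightarrow> 'n \<Rightarrow> 'n \<Rightarrow> complex" where
  "Qc L j k = matrix_inv (double_matrix L) $ Inl j $ Inr k"

lemma Lw_zb_eq: "Lw_zb L \<xi> \<eta> = (\<Sum>k\<in>UNIV. \<Sum>j\<in>UNIV. bc L j k * cnj (\<xi> $ j) * \<eta> $ k)"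
  by (simp add: Lw_zb_def bc_def)

lemma Lw_z_eq: "Lw_z L \<xi> \<eta> = (\<Sum>k\<in>UNIV. \<Sum>j\<in>UNIV. Ac L j k * \<xi> $ j * \<eta> $ k)"
  by (simp add: Lw_z_def Ac_def)

lemma levi_eq_b: "levi L \<xi> \<eta> = (\<Sum>k\<in>UNIV. \<Sum>j\<in>UNIV. ((bc L j k - cnj (bc L k j)) / (2 * \<i>)) * cnj (\<xi> $ j) * \<eta> $ k)"
proof -
  have "cnj (Lw_zb L \<eta> \<xi>) = (\<Sum>k\<in>UNIV. \<Sum>j\<in>UNIV. cnj (bc L k j) * cnj (\<xi> $ j) * \<eta> $ k)"
    unfolding Lw_zb_eq by (subst sum.swap) (simp add: mult_ac)
  then show ?thesis
    by (simp add: levi_def Lw_zb_eq sum_subtractf[symmetric] sum_distrib_left sum_divide_distrib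
        diff_divide_distrib algebra_simps)
qed

lemma Nw_eq_A: "Nw L \<xi> \<eta> = (\<Sum>k\<in>UNIV. \<Sum>j\<in>UNIV. (Ac L j k - Ac L k j) * \<xi> $ j * \<eta> $ k)"
proof -
  have "Lw_z L \<eta> \<xi> = (\<Sum>k\<in>UNIV. \<Sum>j\<in>UNIV. Ac L k j * \<xi> $ j * \<eta> $ k)"
    unfolding Lw_z_eq by (subst sum.swap) (simp add: mult_ac)
  then show ?thesis by (simp add: Nw_def Lw_z_eq sum_subtractf[symmetric] algebra_simps)
qed

lemma sum_axis: "(\<Sum>k\<in>UNIV. g k * axis l (1::complex) $ k) = g l"
  by (simp add: axis_def if_distrib cong: if_cong)

lemma cnj_axis: "cnj (axis l 1 $ k) = (axis l 1 $ k :: complex)"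
  by (simp add: axis_def)

lemma cc_eq: "cc L j k = (bc L j k - cnj (bc L k j)) / (2 * \<i>)"
  by (simp only: cc_def levi_eq_b cnj_axis sum_distrib_right[symmetric] sum_axis)

lemma Nc_eq: "Nc L j k = Ac L j k - Ac L k j"
  by (simp only: Nc_def Nw_eq_A sum_distrib_right[symmetric] sum_axis)

lemma levi_eq: "levi L \<xi> \<eta> = (\<Sum>k\<in>UNIV. (\<Sum>j\<in>UNIV. cc L j k * cnj (\<xi> $ j)) * \<eta> $ k)"
  by (simp add: levi_eq_b cc_eq sum_distrib_right)

lemma Nw_eq: "Nw L \<xi> \<eta> = (\<Sum>k\<in>UNIV. (\<Sum>j\<in>UNIV. Nc L j k * \<xi> $ j) * \<eta> $ k)"
  by (simp add: Nw_eq_A Nc_eq sum_distrib_right)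

lemma cc_herm: "cnj (cc L j k) = cc L k j"
  by (simp add: cc_eq) (simp add: field_simps)

lemma invertible_iff_injective:
  fixes A :: "complex ^ 'm ^ 'm"
  assumes "\<And>x. A *v x = 0 \<Longrightarrow> x = 0"
  shows "A ** matrix_inv A = mat 1" "matrix_inv A ** A = mat 1"
proof -
  have "inj (\<lambda>x. A *v x)"
    using assms by (auto simp: inj_def) (metis matrix_vector_mult_diff_distrib right_minus_eq)
  then have "invertible A"
    using matrix_left_invertible_injective invertible_left_inverse by blast
  then show "A ** matrix_inv A = mat 1" "matrix_inv A ** A = mat 1"
    using someI_ex[of "\<lambda>B. A ** B = mat 1 \<and> B ** A = mat 1"]
    unfolding invertible_def matrix_inv_def by blast+
qed

context
  fixes L :: "'n::finite cr_rep"
  assumes nondeg: "strongly_nondegenerate L"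
begin

text \<open>The Levi form is antilinear in its first argument, so the conjugate of a kernel vector
  is a degenerate direction.\<close>

lemma levi_injective: "transpose (levi_matrix L) *v x = 0 \<Longrightarrow> x = 0"
proof -
  assume 0: "transpose (levi_matrix L) *v x = 0"
  define \<xi> where "\<xi> = (\<chi> j. cnj (x $ j))"
  have "levi L \<xi> \<eta> = 0" for \<eta>
  proof -
    have "(\<Sum>j\<in>UNIV. cc L j k * cnj (\<xi> $ j)) = (transpose (levi_matrix L) *v x) $ k" for k
      unfolding matrix_vector_mult_def by (simp add: transpose_def levi_matrix_def cc_def \<xi>_def)
    then have "(\<Sum>j\<in>UNIV. cc L j k * cnj (\<xi> $ j)) = 0" for k unfolding 0 by simp
    then show ?thesis by (simp add: levi_eq)
  qed
  then have "\<xi> = 0" using nondeg by (simp add: strongly_nondegenerate_def)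
  then show "x = 0" by (simp add: vec_eq_iff \<xi>_def)
qed

lemma dc_inverse:
  "(\<Sum>k\<in>UNIV. dc L j k * cc L l k) = (if j = l then 1 else 0)"
  "(\<Sum>j\<in>UNIV. dc L j k * cc L j l) = (if k = l then 1 else 0)"
proof -
  have inv: "transpose (levi_matrix L) ** matrix_inv (transpose (levi_matrix L)) = mat 1"
    "matrix_inv (transpose (levi_matrix L)) ** transpose (levi_matrix L) = mat 1"
    by (rule invertible_iff_injective, rule levi_injective, assumption)+
  have "(\<Sum>k\<in>UNIV. dc L j k * cc L l k) = (matrix_inv (transpose (levi_matrix L)) ** transpose (levi_matrix L)) $ j $ l"
    by (simp add: matrix_matrix_mult_def transpose_def levi_matrix_def cc_def dc_def)
  then show "(\<Sum>k\<in>UNIV. dc L j k * cc L l k) = (if j = l then 1 else 0)"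
    unfolding inv by (simp add: mat_def)
  have "(\<Sum>j\<in>UNIV. dc L j k * cc L j l) = (transpose (levi_matrix L) ** matrix_inv (transpose (levi_matrix L))) $ l $ k"
    by (simp add: matrix_matrix_mult_def transpose_def levi_matrix_def cc_def dc_def mult.commute)
  then show "(\<Sum>j\<in>UNIV. dc L j k * cc L j l) = (if k = l then 1 else 0)"
    unfolding inv by (auto simp: mat_def)
qed

lemma sum_Plus_UNIV:
  fixes g :: "'n + 'n \<Rightarrow> complex"
  shows "(\<Sum>v\<in>UNIV. g v) = (\<Sum>j\<in>UNIV. g (Inl j)) + (\<Sum>j\<in>UNIV. g (Inr j))"
  unfolding UNIV_Plus_UNIV[symmetric] by (subst sum.Plus) auto

lemma strong_injective:
  assumes "\<And>k. (\<Sum>j\<in>UNIV. Nc L j k * \<xi> j + 6 * \<i> * cc L j k * cnj (\<xi> j)) = 0"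
  shows "\<xi> j = 0"
proof -
  define x where "x = (\<chi> j. \<xi> j)"
  have "6 * \<i> * levi L x \<eta> + Nw L x \<eta> = 0" for \<eta>
  proof -
    have "6 * \<i> * levi L x \<eta> + Nw L x \<eta> =
      (\<Sum>k\<in>UNIV. (\<Sum>j\<in>UNIV. Nc L j k * \<xi> j + 6 * \<i> * cc L j k * cnj (\<xi> j)) * \<eta> $ k)"
      by (simp add: levi_eq Nw_eq x_def sum.distrib sum_distrib_left distrib_right algebra_simps)
    then show ?thesis by (simp add: assms)
  qed
  then have "x = 0" using nondeg by (simp add: strongly_nondegenerate_def)
  then show ?thesis by (simp add: vec_eq_iff x_def)
qed

lemma double_matrix_mult:
  "(double_matrix L *v x) $ Inl k = (\<Sum>j\<in>UNIV. Nc L j k * x $ Inl j + 6 * \<i> * cc L j k * x $ Inr j)"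
  "(double_matrix L *v x) $ Inr k = (\<Sum>j\<in>UNIV. cnj (6 * \<i> * cc L j k) * x $ Inl j + cnj (Nc L j k) * x $ Inr j)"
  by (simp_all add: matrix_vector_mult_def double_matrix_def sum_Plus_UNIV sum.distrib sum_subtractf sum_negf)

text \<open>The matrix commutes with the antilinear involution (p, q) \<mapsto> (conj q, conj p),
  whose fixed vectors are the pairs of a \<xi> and its conjugate. A kernel vector x yields two fixed
  ones, x and i x each plus its image, and these vanish by strong nondegeneracy.\<close>

lemma double_injective: "double_matrix L *v x = 0 \<Longrightarrow> x = 0"
proof -
  assume 0: "double_matrix L *v x = 0"
  have 1: "(\<Sum>j\<in>UNIV. Nc L j k * x $ Inl j) + (\<Sum>j\<in>UNIV. 6 * \<i> * cc L j k * x $ Inr j) = 0" for k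
    using double_matrix_mult(1)[of x k] by (simp add: 0 sum.distrib)
  have "cnj ((double_matrix L *v x) $ Inr k) = 0" for k by (simp add: 0)
  then have 2: "(\<Sum>j\<in>UNIV. 6 * \<i> * cc L j k * cnj (x $ Inl j)) + (\<Sum>j\<in>UNIV. Nc L j k * cnj (x $ Inr j)) = 0" for k
    unfolding double_matrix_mult(2) by (simp add: sum.distrib sum_subtractf sum_negf add.commute)
  have p: "x $ Inl j + cnj (x $ Inr j) = 0" for j
  proof (rule strong_injective)
    fix k
    show "(\<Sum>j\<in>UNIV. Nc L j k * (x $ Inl j + cnj (x $ Inr j)) + 6 * \<i> * cc L j k * cnj (x $ Inl j + cnj (x $ Inr j))) = 0"
      using arg_cong2[OF 1[of k] 2[of k], of "(+)"] by (simp add: distrib_left sum.distrib algebra_simps)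
  qed
  have m: "\<i> * x $ Inl j - \<i> * cnj (x $ Inr j) = 0" for j
  proof (rule strong_injective)
    fix k
    have "(\<Sum>j\<in>UNIV. Nc L j k * (\<i> * x $ Inl j - \<i> * cnj (x $ Inr j)) +
        6 * \<i> * cc L j k * cnj (\<i> * x $ Inl j - \<i> * cnj (x $ Inr j))) =
       \<i> * ((\<Sum>j\<in>UNIV. Nc L j k * x $ Inl j) + (\<Sum>j\<in>UNIV. 6 * \<i> * cc L j k * x $ Inr j)) -
       \<i> * ((\<Sum>j\<in>UNIV. 6 * \<i> * cc L j k * cnj (x $ Inl j)) + (\<Sum>j\<in>UNIV. Nc L j k * cnj (x $ Inr j)))"
      by (simp add: sum_distrib_left sum.distrib[symmetric] sum_subtractf[symmetric] distrib_left right_diff_distrib algebra_simps)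
    then show "(\<Sum>j\<in>UNIV. Nc L j k * (\<i> * x $ Inl j - \<i> * cnj (x $ Inr j)) +
        6 * \<i> * cc L j k * cnj (\<i> * x $ Inl j - \<i> * cnj (x $ Inr j))) = 0"
      unfolding 1 2 by simp
  qed
  have "x $ Inl j = cnj (x $ Inr j)" for j using m[of j] by simp
  then have "x $ Inr j = 0 \<and> x $ Inl j = 0" for j using p[of j] by simp
  then show "x = 0" by (simp add: vec_eq_iff) (metis sum.exhaust)
qed

lemma solve_double:
  "(\<forall>k. \<mu> k = (\<Sum>j\<in>UNIV. Nc L j k * \<xi> j + 6 * \<i> * cc L j k * cnj (\<xi> j))) \<longleftrightarrow>
    (\<forall>j. \<xi> j = (\<Sum>k\<in>UNIV. Pc L j k * \<mu> k + Qc L j k * cnj (\<mu> k)))" (is "?l \<longleftrightarrow> ?r")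
proof -
  define dbl :: "('n \<Rightarrow> complex) \<Rightarrow> complex ^ ('n + 'n)" where "dbl f = (\<chi> u. case u of Inl j \<Rightarrow> f j | Inr j \<Rightarrow> cnj (f j))" for f
  have inv: "double_matrix L ** matrix_inv (double_matrix L) = mat 1"
    "matrix_inv (double_matrix L) ** double_matrix L = mat 1"
    by (rule invertible_iff_injective, rule double_injective, assumption)+
  have P: "(matrix_inv (double_matrix L) *v dbl f) $ Inl j = (\<Sum>k\<in>UNIV. Pc L j k * f k + Qc L j k * cnj (f k))" for f j
    by (simp add: matrix_vector_mult_def sum_Plus_UNIV Pc_def Qc_def dbl_def sum.distrib)
  have M: "(double_matrix L *v dbl f) $ Inl k = (\<Sum>j\<in>UNIV. Nc L j k * f j + 6 * \<i> * cc L j k * cnj (f j))"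
    "(double_matrix L *v dbl f) $ Inr k = cnj (\<Sum>j\<in>UNIV. Nc L j k * f j + 6 * \<i> * cc L j k * cnj (f j))" for f k
    unfolding double_matrix_mult by (simp_all add: dbl_def add.commute)
  have eq: "dbl \<mu> = double_matrix L *v dbl f \<longleftrightarrow> (\<forall>k. \<mu> k = (\<Sum>j\<in>UNIV. Nc L j k * f j + 6 * \<i> * cc L j k * cnj (f j)))" for f
  proof
    assume "dbl \<mu> = double_matrix L *v dbl f"
    then have "dbl \<mu> $ Inl k = (double_matrix L *v dbl f) $ Inl k" for k by simp
    then show "\<forall>k. \<mu> k = (\<Sum>j\<in>UNIV. Nc L j k * f j + 6 * \<i> * cc L j k * cnj (f j))"
      unfolding M by (simp add: dbl_def)
  next
    assume a: "\<forall>k. \<mu> k = (\<Sum>j\<in>UNIV. Nc L j k * f j + 6 * \<i> * cc L j k * cnj (f j))"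
    have "dbl \<mu> $ u = (double_matrix L *v dbl f) $ u" for u
    proof (cases u)
      case (Inl k)
      then show ?thesis unfolding Inl M using a by (simp add: dbl_def)
    next
      case (Inr k)
      then show ?thesis unfolding Inr M using arg_cong[OF spec[OF a, of k], of cnj] by (simp add: dbl_def)
    qed
    then show "dbl \<mu> = double_matrix L *v dbl f" by (simp add: vec_eq_iff)
  qed
  show ?thesis
  proof
    assume ?l
    then have "dbl \<mu> = double_matrix L *v dbl \<xi>" using eq[of \<xi>] by blast
    then have "matrix_inv (double_matrix L) *v dbl \<mu> = dbl \<xi>"
      by (simp add: matrix_vector_mul_assoc inv)
    then have "(matrix_inv (double_matrix L) *v dbl \<mu>) $ Inl j = dbl \<xi> $ Inl j" for j by simp
    then show ?r unfolding P by (simp add: dbl_def)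
  next
    assume r: ?r
    define y where "y = matrix_inv (double_matrix L) *v dbl \<mu>"
    have My: "double_matrix L *v y = dbl \<mu>" by (simp add: y_def matrix_vector_mul_assoc inv)
    have yl: "y $ Inl j = \<xi> j" for j using r P by (simp add: y_def)
    \<comment> \<open>The image of \<open>y\<close> under the involution. It solves the same system,
      so \<open>y\<close> is invariant and its second half is the conjugate of the first.\<close>
    define y' where "y' = (\<chi> u. case u of Inl j \<Rightarrow> cnj (y $ Inr j) | Inr j \<Rightarrow> cnj (y $ Inl j))"
    have "double_matrix L *v y' = dbl \<mu>"
    proof -
      have "(double_matrix L *v y') $ u = dbl \<mu> $ u" for u
      proof (cases u)
        case (Inl k)
        have "(double_matrix L *v y') $ Inl k = cnj ((double_matrix L *v y) $ Inr k)"
          unfolding double_matrix_mult by (simp add: y'_def add.commute)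
        then show ?thesis by (simp add: Inl My dbl_def)
      next
        case (Inr k)
        have "(double_matrix L *v y') $ Inr k = cnj ((double_matrix L *v y) $ Inl k)"
          unfolding double_matrix_mult by (simp add: y'_def add.commute)
        then show ?thesis by (simp add: Inr My dbl_def)
      qed
      then show ?thesis by (simp add: vec_eq_iff)
    qed
    then have "double_matrix L *v (y - y') = 0" by (simp add: My matrix_vector_mult_diff_distrib)
    then have "y = y'" using double_injective by fastforce
    then have "y $ Inr j = y' $ Inr j" for j by simp
    then have "y = dbl \<xi>"
      by (auto simp: vec_eq_iff dbl_def yl y'_def split: sum.split)
    then show ?l using My eq[of \<xi>] by simp
  qed
qed

lemma nonlinear_problem:
  assumes "almost_cr L"
  shows "nonlinear_problem (cc L) (dc L) (Nc L) (Pc L) (Qc L) (Ac L) (bc L) (\<lambda>j k. Lzb L $ j $ k) (\<lambda>k. Lw L $ k)"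
proof unfold_locales
  show "cnj (cc L j k) = cc L k j" for j k by (rule cc_herm)
  show "(\<Sum>k\<in>UNIV. dc L j k * cc L l k) = (if j = l then 1 else 0)" for j l by (rule dc_inverse)
  show "(\<Sum>j\<in>UNIV. dc L j k * cc L j l) = (if k = l then 1 else 0)" for k l by (rule dc_inverse)
  show "Nc L j k = - Nc L k j" for j k by (simp add: Nc_eq)
  show "(\<forall>k. \<mu> k = (\<Sum>j\<in>UNIV. Nc L j k * \<xi> j + 6 * \<i> * cc L j k * cnj (\<xi> j))) \<longleftrightarrow>
    (\<forall>j. \<xi> j = (\<Sum>k\<in>UNIV. Pc L j k * \<mu> k + Qc L j k * cnj (\<mu> k)))" for \<mu> \<xi> by (rule solve_double)
  show "Nc L j k = Ac L j k - Ac L k j" for j k by (rule Nc_eq)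
  show "cc L j k = (bc L j k - cnj (bc L k j)) / (2 * \<i>)" for j k by (rule cc_eq)
  show "no_constant_term (Lzb L $ j $ k)" "no_constant_term (Lw L $ k)" for j k
    using assms by (simp_all add: almost_cr_def)
qed (simp_all add: Ac_def bc_def)

end

subsection \<open>The normal form as a solution of the nonlinear problem\<close>

text \<open>Single powers of u occur only in the stated normalization; quantified over all of them,
  its conditions become conditions on series in u.\<close>

definition upart :: "nat \<Rightarrow> 'n cseries \<Rightarrow> 'n cseries" where
  "upart c q = Mps (\<lambda>M. if count M U = c then coeff q M else 0)"

lemma coeff_upart: "coeff (upart c q) M = (if count M U = c then coeff q M else 0)"
  by (simp add: upart_def)

lemma multideriv_eq: "multideriv a b c q = (fact a * fact b * fact c) \<cdot> upart c (pr a b q)"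
  by (rule mps_eqI) (simp add: multideriv_def upart_def coeff_pr zd_def zbd_def)

lemma upart_all_0: "(\<forall>c. upart c q = 0) \<longleftrightarrow> q = 0"
  by (auto simp: mps_eq_iff coeff_upart)

lemma upart_Suc_all_0: "(\<forall>c. upart (Suc c) q = 0) \<longleftrightarrow> du q = 0"
proof -
  have "(\<forall>c. upart (Suc c) q = 0) \<longleftrightarrow> (\<forall>M. U \<in># M \<longrightarrow> coeff q M = 0)"
    unfolding mps_eq_iff coeff_upart coeff_0
    by (metis Suc_pred count_greater_zero_iff zero_less_Suc)
  also have "\<dots> \<longleftrightarrow> du q = 0"
    by (auto simp: mps_eq_iff coeff_mderiv simp del: of_nat_Suc) (metis insert_DiffM)
  finally show ?thesis .
qed

lemma upart_linear: "upart c (x \<cdot> q) = x \<cdot> upart c q" "upart c (p + q) = upart c p + upart c q" "upart c 0 = 0"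
  by (rule mps_eqI; simp add: coeff_upart)+

lemma upart_sum: "upart c (\<Sum>i\<in>I. f i) = (\<Sum>i\<in>I. upart c (f i))"
  by (induction I rule: infinite_finite_induct) (simp_all add: upart_linear)

lemma upart_mderiv: "upart c (mderiv (Z j) q) = mderiv (Z j) (upart c q)" "upart c (mderiv (Zb j) q) = mderiv (Zb j) (upart c q)"
  by (rule mps_eqI; simp add: coeff_upart coeff_mderiv)+

lemma tr_csmul: "tr L (x \<cdot> q) = x \<cdot> tr L q"
  by (simp add: tr_def mconst_times csmul_sum mult.commute)

lemma upart_tr: "upart c (tr L q) = tr L (upart c q)"
  by (simp add: tr_def mconst_times upart_sum upart_linear upart_mderiv)

context
  fixes L :: "'n::finite cr_rep"
  assumes L: "almost_cr L" "strongly_nondegenerate L"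
begin

interpretation nonlinear_problem "cc L" "dc L" "Nc L" "Pc L" "Qc L" "Ac L" "bc L" "\<lambda>j k. Lzb L $ j $ k" "\<lambda>k. Lw L $ k" r for r
  by (rule nonlinear_problem[OF L(2,1)])

lemma tr_eq: "tr L q = trc q"
  by (simp add: tr_def trc_def mconst_times dc_def)

lemma chern_moser_iff: "chern_moser L \<phi> \<longleftrightarrow> normal \<phi>"
proof -
  have f: "(fact a * fact b * fact c :: complex) \<noteq> 0" for a b c by simp
  have md: "(\<forall>c. multideriv a b c \<phi> = 0) \<longleftrightarrow> pr a b \<phi> = 0" for a b
    by (simp add: multideriv_eq csmul_eq_0_iff upart_all_0)
  have md1: "(\<forall>c. multideriv 1 1 (c + 1) \<phi> = 0) \<longleftrightarrow> du (pr (Suc 0) (Suc 0) \<phi>) = 0"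
    by (simp add: multideriv_eq csmul_eq_0_iff upart_Suc_all_0[symmetric] del: fact_Suc)
  have t: "(tr L ^^ i) (multideriv a b c \<phi>) = (fact a * fact b * fact c) \<cdot> upart c ((tr L ^^ i) (pr a b \<phi>))" for a b c i
    by (induction i) (simp_all add: multideriv_eq tr_csmul upart_tr)
  have tr: "(\<forall>c. (tr L ^^ i) (multideriv a b c \<phi>) = 0) \<longleftrightarrow> (tr L ^^ i) (pr a b \<phi>) = 0" for a b i
    unfolding t csmul_eq_0_iff using f by (simp add: upart_all_0)
  have "chern_moser L \<phi> \<longleftrightarrow> (\<forall>a. \<forall>c. multideriv a 0 c \<phi> = 0) \<and> (\<forall>c. multideriv 1 1 (c + 1) \<phi> = 0) \<and>
     (\<forall>a. \<forall>c. multideriv (a + 2) 1 c \<phi> = 0) \<and> (\<forall>c. (tr L ^^ 1) (multideriv 2 2 c \<phi>) = 0) \<and>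
     (\<forall>c. (tr L ^^ 2) (multideriv 3 2 c \<phi>) = 0) \<and> (\<forall>c. (tr L ^^ 3) (multideriv 3 3 c \<phi>) = 0)"
    unfolding chern_moser_def by (simp add: all_conj_distrib)
  also have "\<dots> \<longleftrightarrow> normal \<phi>"
    unfolding md md1 tr normal_def
    by (simp add: tr_eq eval_nat_numeral)
  finally show ?thesis .
qed

text \<open>The two real unknowns are encoded as real and imaginary part of one series.\<close>

lemma inverse_normalizing_iff:
  assumes "real_series G" "real_series \<phi>"
  shows "inverse_normalizing L r F G \<phi> \<longleftrightarrow> solution r (\<lambda>k. F $ k) (G + \<i> \<cdot> \<phi>)"
proof -
  let ?W = "G + \<i> \<cdot> \<phi>"
  have c: "sconj G = G" "sconj \<phi> = \<phi>" using assms by (simp_all add: real_series_def)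
  have rep: "rep ?W = G" and imp: "imp ?W = \<phi>"
    using rep_real[OF c] imp_real[OF c] by simp_all
  have deg: "wge deg 2 ?W \<longleftrightarrow> wge deg 2 G \<and> wge deg 2 \<phi>"
  proof
    assume w: "wge deg 2 ?W"
    then have w': "wge deg 2 (sconj ?W)" by (simp add: wge_sconj)
    have "wge deg 2 (rep ?W)" "wge deg 2 (imp ?W)"
      unfolding rep_def imp_def by (rule wge_csmul[OF wge_add[OF w w']], rule wge_csmul[OF wge_diff[OF w w']])
    then show "wge deg 2 G \<and> wge deg 2 \<phi>"
      by (simp only: rep imp)
  qed (auto intro: wge_add wge_csmul)
  have S: "S (\<lambda>k. F $ k) ?W = shift F G" by (simp add: S_def rep vec_lambda_eta)
  show ?thesis
  proof (cases "(\<forall>k. wge deg 2 (F $ k)) \<and> wge deg 2 ?W")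
    case True
    then have m: "mild (\<lambda>k. F $ k) ?W" by (intro deg_mild) auto
    have "embedding_eqs L F G \<phi> \<longleftrightarrow> (\<forall>j. D (sconj (F $ j)) = R1 (\<lambda>k. F $ k) ?W j) \<and> T2 (\<lambda>k. F $ k) ?W = R0 + R3 (\<lambda>k. F $ k) ?W"
      using embedding_eqs_iff[OF m] unfolding embedding_eqs_def Let_def S imp rep .
    then show ?thesis
      using True assms
      by (auto simp: inverse_normalizing_def solution_def admissible_def chern_moser_iff imp rep deg)
  next
    case False
    then show ?thesis by (auto simp: inverse_normalizing_def solution_def admissible_def deg)
  qed
qed

text \<open>Defined as the fixed point of the iteration, so that universality can be read off from
  the iterates.\<close>

definition nsol :: "real \<Rightarrow> 'n crvar \<Rightarrow> 'n cseries" where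
  "nsol r = (THE x. coincide start_monomials x (pack (\<lambda>_. 0) W2) \<and> step r x = x)"

lemma nsol: "coincide start_monomials (nsol r) (pack (\<lambda>_. 0) W2)" "step r (nsol r) = nsol r"
  using theI'[OF contraction_fixpoint[OF contraction_step]] unfolding nsol_def by blast+

lemma solution_nsol: "solution r F W \<longleftrightarrow> F = (\<lambda>k. nsol r (Z k)) \<and> W = nsol r U"
proof -
  have "solution r F W \<longleftrightarrow> pack F W = nsol r"
    unfolding solution_iff
    using contraction_fixpoint[OF contraction_step[of r]] nsol[of r] by metis
  also have "\<dots> \<longleftrightarrow> F = (\<lambda>k. nsol r (Z k)) \<and> W = nsol r U"
    using nsol(1)[of r] unfolding coincide_iff_dom by (auto simp: fun_eq_iff all_crvar_iff)
  finally show ?thesis .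
qed

text \<open>Inversion is an involution on admissible maps, so the unique solution for the inverse
  map corresponds to exactly one normalizing map.\<close>

theorem normalizing_iff_nsol:
  "normalizing L r f g \<phi> \<longleftrightarrow> f = cinv (\<chi> k. nsol r (Z k)) (rep (nsol r U)) \<and>
     g = rinv (\<chi> k. nsol r (Z k)) (rep (nsol r U)) \<and> \<phi> = imp (nsol r U)"
proof -
  define F G where "F = (\<chi> k. nsol r (Z k))" and "G = rep (nsol r U)"
  have s: "solution r (\<lambda>k. nsol r (Z k)) (nsol r U)" by (simp add: solution_nsol)
  have adm: "admissible F G"
    using s wge_sconj[of deg 2 "nsol r U"]
    by (auto simp: admissible_def F_def G_def solution_def real_series_def rep_def sconj_csmul sconj_add add.commute
        intro!: wge_csmul wge_add)
  have key: "admissible F' G' \<and> inverse_normalizing L r F' G' \<phi> \<longleftrightarrow> F' = F \<and> G' = G \<and> \<phi> = imp (nsol r U)" for F' G'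
  proof
    assume a: "admissible F' G' \<and> inverse_normalizing L r F' G' \<phi>"
    then have re: "real_series G'" "real_series \<phi>" by (auto simp: admissible_def inverse_normalizing_def)
    have "solution r (\<lambda>k. F' $ k) (G' + \<i> \<cdot> \<phi>)" using a inverse_normalizing_iff[OF re] by blast
    then have 1: "(\<lambda>k. F' $ k) = (\<lambda>k. nsol r (Z k))" and 2: "G' + \<i> \<cdot> \<phi> = nsol r U"
      by (simp_all add: solution_nsol)
    have "rep (G' + \<i> \<cdot> \<phi>) = G'" "imp (G' + \<i> \<cdot> \<phi>) = \<phi>"
      using re rep_real[of G' \<phi>] imp_real[of G' \<phi>] unfolding real_series_def by simp_all
    then show "F' = F \<and> G' = G \<and> \<phi> = imp (nsol r U)"
      using 1 by (auto simp: 2 F_def G_def vec_eq_iff fun_eq_iff)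
  next
    assume a: "F' = F \<and> G' = G \<and> \<phi> = imp (nsol r U)"
    have "inverse_normalizing L r F G (imp (nsol r U)) \<longleftrightarrow> solution r (\<lambda>k. F $ k) (G + \<i> \<cdot> imp (nsol r U))"
      by (rule inverse_normalizing_iff) (simp_all add: real_series_def G_def)
    then show "admissible F' G' \<and> inverse_normalizing L r F' G' \<phi>"
      using adm a s by (simp add: G_def F_def rep_imp[symmetric])
  qed
  show ?thesis
    unfolding normalizing_iff[OF L(1)] F_def[symmetric] G_def[symmetric]
    using key admissible_cinv cinv_cinv adm by metis
qed

theorem unique_normalization: "\<exists>!t. case t of (f, g, \<phi>) \<Rightarrow> normalizing L r f g \<phi>"
  unfolding normalizing_iff_nsol by auto

end

section \<open>Universality\<close>

subsection \<open>Functions given by polynomials\<close>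

text \<open>Polynomial dependence is established for functions of the parameter and turned into a
  formal polynomial at the end. \<open>\<rho> p\<close> assigns to each indeterminate its value at
  the parameter \<open>p\<close>.\<close>

inductive polyf :: "('p \<Rightarrow> 'x \<Rightarrow> complex) \<Rightarrow> ('p \<Rightarrow> complex) \<Rightarrow> bool" for \<rho> where
  polyf_const: "polyf \<rho> (\<lambda>_. x)"
| polyf_var: "polyf \<rho> (\<lambda>p. \<rho> p v)"
| polyf_add: "polyf \<rho> f \<Longrightarrow> polyf \<rho> g \<Longrightarrow> polyf \<rho> (\<lambda>p. f p + g p)"
| polyf_mult: "polyf \<rho> f \<Longrightarrow> polyf \<rho> g \<Longrightarrow> polyf \<rho> (\<lambda>p. f p * g p)"

lemma poly_eval_superset:
  assumes "finite X" "Poly_Mapping.keys P \<subseteq> X"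
  shows "poly_eval P \<rho> = (\<Sum>m\<in>X. Poly_Mapping.lookup P m * (\<Prod>x\<in>#m. \<rho> x))"
  unfolding poly_eval_def by (rule sum.mono_neutral_left) (use assms in \<open>auto simp: in_keys_iff\<close>)

lemma poly_eval_add: "poly_eval (P + Q) \<rho> = poly_eval P \<rho> + poly_eval Q \<rho>"
proof -
  let ?X = "Poly_Mapping.keys P \<union> Poly_Mapping.keys Q"
  have "poly_eval (P + Q) \<rho> = (\<Sum>m\<in>?X. Poly_Mapping.lookup (P + Q) m * (\<Prod>x\<in>#m. \<rho> x))"
    by (rule poly_eval_superset) (simp_all add: Poly_Mapping.keys_add)
  also have "\<dots> = poly_eval P \<rho> + poly_eval Q \<rho>"
    unfolding poly_eval_superset[of ?X P, simplified] poly_eval_superset[of ?X Q, simplified]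
    by (simp add: lookup_add distrib_right sum.distrib)
  finally show ?thesis .
qed

lemma poly_eval_sum: "poly_eval (\<Sum>i\<in>I. P i) \<rho> = (\<Sum>i\<in>I. poly_eval (P i) \<rho>)"
  by (induction I rule: infinite_finite_induct) (simp_all add: poly_eval_add, simp_all add: poly_eval_def)

lemma poly_eval_single: "poly_eval (Poly_Mapping.single m x) \<rho> = x * (\<Prod>v\<in>#m. \<rho> v)"
  by (simp add: poly_eval_def)

lemma poly_eval_mult: "\<exists>R. \<forall>\<rho>. poly_eval R \<rho> = poly_eval P \<rho> * poly_eval Q \<rho>"
proof (intro exI allI)
  fix \<rho> :: "'a \<Rightarrow> complex"
  show "poly_eval (\<Sum>m\<in>Poly_Mapping.keys P. \<Sum>l\<in>Poly_Mapping.keys Q.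
      Poly_Mapping.single (m + l) (Poly_Mapping.lookup P m * Poly_Mapping.lookup Q l)) \<rho> = poly_eval P \<rho> * poly_eval Q \<rho>"
    by (simp add: poly_eval_sum poly_eval_single) (simp add: poly_eval_def sum_product mult_ac)
qed

lemma polyf_poly_eval: "polyf \<rho> f \<Longrightarrow> \<exists>P. \<forall>p. f p = poly_eval P (\<rho> p)"
proof (induction rule: polyf.induct)
  case (polyf_const x)
  then show ?case by (intro exI[of _ "Poly_Mapping.single {#} x"]) (simp add: poly_eval_single)
next
  case (polyf_var v)
  then show ?case by (intro exI[of _ "Poly_Mapping.single {#v#} 1"]) (simp add: poly_eval_single)
next
  case (polyf_add f g)
  then show ?case by (metis poly_eval_add)
next
  case (polyf_mult f g)
  then show ?case by (metis poly_eval_mult)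
qed

lemma polyf_sum: "(\<And>i. i \<in> I \<Longrightarrow> polyf \<rho> (f i)) \<Longrightarrow> polyf \<rho> (\<lambda>p. \<Sum>i\<in>I. f i p)"
  by (induction I rule: infinite_finite_induct) (auto intro: polyf.intros)

lemma polyf_prod: "(\<And>i. i \<in> I \<Longrightarrow> polyf \<rho> (f i)) \<Longrightarrow> polyf \<rho> (\<lambda>p. \<Prod>i\<in>I. f i p)"
  by (induction I rule: infinite_finite_induct) (auto intro: polyf.intros)

lemma polyf_minus: "polyf \<rho> f \<Longrightarrow> polyf \<rho> (\<lambda>p. - f p)"
  using polyf_mult[OF polyf_const[of \<rho> "- 1"], of f] by simp

lemma polyf_det:
  fixes M :: "'p \<Rightarrow> complex ^ 'm ^ 'm"
  assumes "\<And>i j. polyf \<rho> (\<lambda>p. M p $ i $ j)"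
  shows "polyf \<rho> (\<lambda>p. det (M p))"
  unfolding det_def by (intro polyf_sum polyf_mult polyf_const polyf_prod assms)

abbreviation (input) jet :: "'n::finite cr_rep \<times> real \<Rightarrow> 'n jet_var \<Rightarrow> complex" where
  "jet p \<equiv> jet_value (fst p) (snd p)"

abbreviation (input) ten :: "'n::finite cr_rep \<times> real \<Rightarrow> 'n tensor_var \<Rightarrow> complex" where
  "ten p \<equiv> tensor_value (fst p)"

definition good :: "'n::finite cr_rep \<times> real \<Rightarrow> bool" where
  "good p \<longleftrightarrow> almost_cr (fst p) \<and> strongly_nondegenerate (fst p)"

definition denom :: "('n::finite cr_rep \<times> real \<Rightarrow> complex) \<Rightarrow> bool" where
  "denom q \<longleftrightarrow> polyf ten q \<and> (\<forall>p. good p \<longrightarrow> q p \<noteq> 0)"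

text \<open>Equality is demanded at good parameters only, since inverse matrices and fixed points
  have no controlled value elsewhere.\<close>

definition uni :: "('n::finite cr_rep \<times> real \<Rightarrow> complex) \<Rightarrow> bool" where
  "uni f \<longleftrightarrow> (\<exists>a q. polyf jet a \<and> denom q \<and> (\<forall>p. good p \<longrightarrow> f p = a p / q p))"

lemma deriv0_single: "deriv0 {#v#} q = coeff q {#v#}"
  by (simp add: deriv0_def)

lemma cc_jet: "cc (fst p) j k = (1 / (2 * \<i>)) * (jet p (DLw k {#Zb j#}) + (- 1) * jet p (DLw_cnj j {#Zb k#}))"
  by (simp add: cc_eq bc_def deriv0_single)

lemma Nc_jet: "Nc (fst p) j k = jet p (DLw k {#Z j#}) + (- 1) * jet p (DLw j {#Z k#})"
  by (simp add: Nc_eq Ac_def deriv0_single)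

lemma cnj_Nc_jet: "cnj (Nc (fst p) j k) = jet p (DLw_cnj k {#Z j#}) + (- 1) * jet p (DLw_cnj j {#Z k#})"
  by (simp add: Nc_eq Ac_def deriv0_single)

text \<open>Both tensors are linear in first derivatives of \<open>Lw\<close> and their conjugates.
  Denominators may therefore enter numerators when fractions are added.\<close>

lemma polyf_ten_jet: "polyf ten q \<Longrightarrow> polyf jet q"
proof (induction rule: polyf.induct)
  case (polyf_var v)
  show ?case
  proof (cases v)
    case (Levi j k)
    then show ?thesis unfolding Levi tensor_value.simps cc_def[symmetric] cc_jet by (intro polyf.intros)
  next
    case (Nij j k)
    then show ?thesis unfolding Nij tensor_value.simps Nc_def[symmetric] Nc_jet by (intro polyf.intros)
  next
    case (Nij_cnj j k)
    then show ?thesis unfolding Nij_cnj tensor_value.simps Nc_def[symmetric] cnj_Nc_jet by (intro polyf.intros)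
  qed
qed (auto intro: polyf.intros)

lemma polyf_cnj_jet: "polyf jet q \<Longrightarrow> polyf jet (\<lambda>p. cnj (q p))"
proof (induction rule: polyf.induct)
  case (polyf_var v)
  have "\<exists>v'. \<forall>p. cnj (jet p v) = jet p v'" for v :: "'a jet_var"
  proof (cases v)
    case Param
    then show ?thesis by (intro exI[of _ Param]) simp
  next
    case (DLzb j k M)
    then show ?thesis by (intro exI[of _ "DLzb_cnj j k M"]) simp
  next
    case (DLzb_cnj j k M)
    then show ?thesis by (intro exI[of _ "DLzb j k M"]) simp
  next
    case (DLw k M)
    then show ?thesis by (intro exI[of _ "DLw_cnj k M"]) simp
  next
    case (DLw_cnj k M)
    then show ?thesis by (intro exI[of _ "DLw k M"]) simp
  qed
  then obtain v' where v': "\<And>p. cnj (jet p v) = jet p v'" by blast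
  show ?case unfolding v' by (rule polyf.polyf_var)
qed (auto intro: polyf.intros)

text \<open>The Levi matrix is Hermitian, and the conjugates of \<open>N\<close> are among the
  indeterminates; so the conjugate of a denominator is again one.\<close>

lemma polyf_cnj_ten: "polyf ten q \<Longrightarrow> polyf ten (\<lambda>p. cnj (q p))"
proof (induction rule: polyf.induct)
  case (polyf_var v)
  have "\<exists>v'. \<forall>p. cnj (ten p v) = ten p v'" for v :: "'a tensor_var"
  proof (cases v)
    case (Levi j k)
    then show ?thesis by (intro exI[of _ "Levi k j"]) (simp add: cc_herm[unfolded cc_def])
  next
    case (Nij j k)
    then show ?thesis by (intro exI[of _ "Nij_cnj j k"]) simp
  next
    case (Nij_cnj j k)
    then show ?thesis by (intro exI[of _ "Nij j k"]) simp
  qed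
  then obtain v' where v': "\<And>p :: 'a cr_rep \<times> real. cnj (ten p v) = ten p v'" by blast
  show ?case unfolding v' by (rule polyf.polyf_var)
qed (auto intro: polyf.intros)

lemma denom_mult: "denom q \<Longrightarrow> denom q' \<Longrightarrow> denom (\<lambda>p. q p * q' p)"
  by (simp add: denom_def polyf_mult)

lemma denom_1: "denom (\<lambda>_. 1)"
  by (simp add: denom_def polyf_const)

lemma uni_polyf: "polyf jet f \<Longrightarrow> uni f"
  unfolding uni_def using denom_1 by (intro exI[of _ f] exI[of _ "\<lambda>_. 1"]) simp

lemma uni_const: "uni (\<lambda>_. x)"
  by (rule uni_polyf) (rule polyf_const)

lemma uni_jet: "uni (\<lambda>p. jet p v)"
  by (rule uni_polyf) (rule polyf_var)

lemma uni_cong: "(\<And>p. good p \<Longrightarrow> f p = g p) \<Longrightarrow> uni g \<Longrightarrow> uni f"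
  by (auto simp: uni_def)

lemma uni_add:
  assumes "uni f" "uni g"
  shows "uni (\<lambda>p. f p + g p)"
proof -
  obtain a q a' q' where f: "polyf jet a" "denom q" "\<And>p. good p \<Longrightarrow> f p = a p / q p"
    and g: "polyf jet a'" "denom q'" "\<And>p. good p \<Longrightarrow> g p = a' p / q' p"
    using assms unfolding uni_def by auto
  have "polyf jet (\<lambda>p. a p * q' p + a' p * q p)"
    using f g by (intro polyf.intros) (auto simp: denom_def polyf_ten_jet)
  moreover have "f p + g p = (a p * q' p + a' p * q p) / (q p * q' p)" if "good p" for p
  proof -
    have "q p \<noteq> 0" "q' p \<noteq> 0" using f(2) g(2) that unfolding denom_def by blast+
    then show ?thesis unfolding f(3)[OF that] g(3)[OF that] by (rule add_frac_eq)
  qed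
  ultimately show ?thesis
    unfolding uni_def using denom_mult[OF f(2) g(2)] by blast
qed

lemma uni_mult:
  assumes "uni f" "uni g"
  shows "uni (\<lambda>p. f p * g p)"
proof -
  obtain a q a' q' where f: "polyf jet a" "denom q" "\<And>p. good p \<Longrightarrow> f p = a p / q p"
    and g: "polyf jet a'" "denom q'" "\<And>p. good p \<Longrightarrow> g p = a' p / q' p"
    using assms unfolding uni_def by auto
  have "polyf jet (\<lambda>p. a p * a' p)" using f g by (intro polyf.intros)
  moreover have "f p * g p = (a p * a' p) / (q p * q' p)" if "good p" for p
    using f(3) g(3) that by simp
  ultimately show ?thesis
    unfolding uni_def using denom_mult[OF f(2) g(2)] by blast
qed

lemma uni_cnj:
  assumes "uni f"
  shows "uni (\<lambda>p. cnj (f p))"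
proof -
  obtain a q where f: "polyf jet a" "denom q" "\<And>p. good p \<Longrightarrow> f p = a p / q p"
    using assms unfolding uni_def by auto
  have "denom (\<lambda>p. cnj (q p))" using f(2) by (simp add: denom_def polyf_cnj_ten)
  with f polyf_cnj_jet[OF f(1)] show ?thesis
    unfolding uni_def by (intro exI[of _ "\<lambda>p. cnj (a p)"] exI[of _ "\<lambda>p. cnj (q p)"]) simp
qed

lemma uni_minus: "uni f \<Longrightarrow> uni (\<lambda>p. - f p)"
  using uni_mult[OF uni_const[of "- 1"], of f] by simp

lemma uni_diff: "uni f \<Longrightarrow> uni g \<Longrightarrow> uni (\<lambda>p. f p - g p)"
  using uni_add[OF _ uni_minus] by fastforce

lemma uni_divide_const: "uni f \<Longrightarrow> uni (\<lambda>p. f p / x)"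
  using uni_mult[OF _ uni_const[of "1 / x"], of f] by simp

lemma uni_if: "uni f \<Longrightarrow> uni g \<Longrightarrow> uni (\<lambda>p. if b then f p else g p)"
  by (cases b) simp_all

lemma uni_sum: "(\<And>i. i \<in> I \<Longrightarrow> uni (f i)) \<Longrightarrow> uni (\<lambda>p. \<Sum>i\<in>I. f i p)"
  by (induction I rule: infinite_finite_induct) (auto intro: uni_const uni_add)

text \<open>Cramer's rule: an entry of the inverse is a determinant divided by that of the matrix,
  which becomes the denominator.\<close>

lemma uni_matrix_inv:
  fixes M :: "'n::finite cr_rep \<times> real \<Rightarrow> complex ^ 'm ^ 'm"
  assumes M: "\<And>i j. polyf ten (\<lambda>p. M p $ i $ j)"
    and inv: "\<And>p. good p \<Longrightarrow> M p ** matrix_inv (M p) = mat 1"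
  shows "uni (\<lambda>p. matrix_inv (M p) $ i $ j)"
proof -
  have det: "det (M p) \<noteq> 0" if "good p" for p
    using arg_cong[OF inv[OF that], of det] by (auto simp: det_mul)
  define a where "a p = det (\<chi> i' l. if l = i then axis j 1 $ i' else M p $ i' $ l)" for p
  have eq: "matrix_inv (M p) $ i $ j = a p / det (M p)" if "good p" for p
  proof -
    have "M p *v (matrix_inv (M p) *v axis j 1) = axis j 1"
      by (simp add: matrix_vector_mul_assoc inv that)
    then have "matrix_inv (M p) *v axis j 1 = (\<chi> k. det (\<chi> i l. if l = k then axis j 1 $ i else M p $ i $ l) / det (M p))"
      using cramer[OF det[OF that]] by blast
    moreover have "(matrix_inv (M p) *v axis j 1) $ i = matrix_inv (M p) $ i $ j"
      by (simp add: matrix_vector_mult_def axis_def if_distrib cong: if_cong)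
    ultimately show ?thesis by (simp add: a_def)
  qed
  have "polyf ten a"
    unfolding a_def
  proof (rule polyf_det)
    show "polyf ten (\<lambda>p. (\<chi> i' l. if l = i then axis j 1 $ i' else M p $ i' $ l) $ i' $ l)" for i' l
      by (cases "l = i") (simp_all add: M polyf_const)
  qed
  then have "polyf jet a" by (rule polyf_ten_jet)
  moreover have "denom (\<lambda>p. det (M p))"
    unfolding denom_def using det by (auto intro: polyf_det M)
  ultimately show ?thesis
    unfolding uni_def using eq by blast
qed

lemma polyf_cc: "polyf ten (\<lambda>p. cc (fst p) j k)"
  using polyf_var[of ten "Levi j k"] by (simp add: cc_def)

lemma polyf_Nc: "polyf ten (\<lambda>p. Nc (fst p) j k)" "polyf ten (\<lambda>p. cnj (Nc (fst p) j k))"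
  using polyf_var[of ten "Nij j k"] polyf_var[of ten "Nij_cnj j k"] by (simp_all add: Nc_def)

lemma uni_cc: "uni (\<lambda>p. cc (fst p) j k)"
  by (rule uni_polyf[OF polyf_ten_jet[OF polyf_cc]])

lemma uni_Nc: "uni (\<lambda>p. Nc (fst p) j k)"
  by (rule uni_polyf[OF polyf_ten_jet[OF polyf_Nc(1)]])

lemma uni_Ac: "uni (\<lambda>p. Ac (fst p) j k)"
  using uni_jet[of "DLw k {#Z j#}"] by (simp add: Ac_def deriv0_single)

lemma uni_bc: "uni (\<lambda>p. bc (fst p) j k)"
  using uni_jet[of "DLw k {#Zb j#}"] by (simp add: bc_def deriv0_single)

lemma uni_dc: "uni (\<lambda>p. dc (fst p) j k)"
  unfolding dc_def
proof (rule uni_matrix_inv)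
  show "polyf ten (\<lambda>p. transpose (levi_matrix (fst p)) $ i $ j)" for i j :: 'a
    using polyf_cc[of j i] by (simp add: transpose_def levi_matrix_def cc_def)
  show "transpose (levi_matrix (fst p)) ** matrix_inv (transpose (levi_matrix (fst p))) = mat 1" if "good p" for p :: "'a cr_rep \<times> real"
    by (rule invertible_iff_injective, rule levi_injective) (use that in \<open>simp_all add: good_def\<close>)
qed

lemma uni_double_inv: "uni (\<lambda>p. matrix_inv (double_matrix (fst p)) $ u $ v)"
proof (rule uni_matrix_inv)
  show "polyf ten (\<lambda>p. double_matrix (fst p) $ i $ j)" for i j :: "'a + 'a"
    by (cases i; cases j)
      (auto simp: double_matrix_def intro!: polyf_Nc polyf_cc polyf_cnj_ten[OF polyf_cc] polyf_minus polyf_mult[OF polyf_const])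
  show "double_matrix (fst p) ** matrix_inv (double_matrix (fst p)) = mat 1" if "good p" for p :: "'a cr_rep \<times> real"
    by (rule invertible_iff_injective, rule double_injective) (use that in \<open>simp_all add: good_def\<close>)
qed

lemma uni_Pc: "uni (\<lambda>p. Pc (fst p) j k)" and uni_Qc: "uni (\<lambda>p. Qc (fst p) j k)"
  unfolding Pc_def Qc_def by (rule uni_double_inv)+

subsection \<open>Series with universal coefficients\<close>

definition useries :: "('n::finite cr_rep \<times> real \<Rightarrow> 'v mps) \<Rightarrow> bool" where
  "useries q \<longleftrightarrow> (\<forall>M. uni (\<lambda>p. coeff (q p) M))"

lemma useriesD: "useries q \<Longrightarrow> uni (\<lambda>p. coeff (q p) M)"
  by (simp add: useries_def)

text \<open>Mostly used to unfold constants of the locales, whose defining equations are available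
  at good parameters.\<close>

lemma useries_cong: "(\<And>p. good p \<Longrightarrow> f p = g p) \<Longrightarrow> useries g \<Longrightarrow> useries f"
  unfolding useries_def using uni_cong[of "\<lambda>p. coeff (f p) _" "\<lambda>p. coeff (g p) _"] by simp

lemma useries_const: "useries (\<lambda>_. q)"
  by (simp add: useries_def uni_const)

lemma useries_add: "useries f \<Longrightarrow> useries g \<Longrightarrow> useries (\<lambda>p. f p + g p)"
  by (simp add: useries_def uni_add)

lemma useries_diff: "useries f \<Longrightarrow> useries g \<Longrightarrow> useries (\<lambda>p. f p - g p)"
  by (simp add: useries_def uni_diff)

lemma useries_minus: "useries f \<Longrightarrow> useries (\<lambda>p. - f p)"
  by (simp add: useries_def uni_minus)

lemma useries_csmul: "uni x \<Longrightarrow> useries f \<Longrightarrow> useries (\<lambda>p. x p \<cdot> f p)"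
  by (simp add: useries_def uni_mult)

lemma useries_mult: "useries f \<Longrightarrow> useries g \<Longrightarrow> useries (\<lambda>p. f p * g p)"
  unfolding useries_def coeff_times by (intro allI uni_sum uni_mult) auto

lemma useries_sum: "(\<And>i. i \<in> I \<Longrightarrow> useries (f i)) \<Longrightarrow> useries (\<lambda>p. \<Sum>i\<in>I. f i p)"
  by (simp add: useries_def coeff_sum_mps uni_sum)

lemma useries_sconj: "useries f \<Longrightarrow> useries (\<lambda>p. sconj (f p))"
  by (simp add: useries_def coeff_sconj uni_cnj)

lemma useries_mderiv: "useries f \<Longrightarrow> useries (\<lambda>p. mderiv v (f p))"
  unfolding useries_def coeff_mderiv by (intro allI uni_mult uni_const) auto

lemma useries_pr: "useries f \<Longrightarrow> useries (\<lambda>p. pr a b (f p))"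
  by (simp add: useries_def coeff_pr uni_const uni_if)

lemma useries_eul: "useries f \<Longrightarrow> useries (\<lambda>p. eul (f p))"
  by (simp add: useries_def coeff_eul uni_const uni_mult)

lemma useries_intu: "useries f \<Longrightarrow> useries (\<lambda>p. intu (f p))"
  by (simp add: useries_def intu_def uni_const uni_divide_const uni_if)

lemma useries_Mps: "(\<And>a. useries (\<lambda>p. q p a)) \<Longrightarrow> useries (\<lambda>p. Mps (\<lambda>M. coeff (q p (g M)) M))"
  by (simp add: useries_def)

lemma useries_prod_mset: "(\<And>v. useries (\<lambda>p. s p v)) \<Longrightarrow> useries (\<lambda>p. \<Prod>v\<in>#A. s p v)"
  by (induction A) (simp_all add: useries_const useries_mult)

lemma useries_msubst:
  assumes "\<And>v. useries (\<lambda>p. s p v)" "useries f"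
  shows "useries (\<lambda>p. msubst (s p) (f p))"
  unfolding useries_def msubst_def Mps_inverse[OF UNIV_I]
  by (intro allI uni_sum uni_mult useriesD assms useries_prod_mset)

lemma useries_imp: "useries f \<Longrightarrow> useries (\<lambda>p. imp (f p))"
  and useries_rep: "useries f \<Longrightarrow> useries (\<lambda>p. rep (f p))"
  unfolding imp_def rep_def by (intro useries_csmul uni_const useries_diff useries_add useries_sconj; assumption)+

text \<open>Induction on the degree by the linear equation for \<open>theta\<close>: as
  \<open>du (\<phi> p)\<close> has no constant term, only coefficients of lower degree occur on the
  right.\<close>

lemma useries_theta:
  assumes \<phi>: "useries \<phi>" and 0: "\<And>p. good p \<Longrightarrow> coeff (\<phi> p) {#U#} = 0"
  shows "useries (\<lambda>p. theta (\<phi> p))"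
  unfolding useries_def
proof
  fix M
  show "uni (\<lambda>p. coeff (theta (\<phi> p)) M)"
  proof (induction M rule: measure_induct_rule[where f = size])
    case (less M)
    have "coeff (theta (\<phi> p)) M = \<i> * coeff (eul (\<phi> p)) M +
       \<i> * (\<Sum>A | A \<subseteq># M \<and> A \<noteq> {#}. coeff (du (\<phi> p)) A * coeff (theta (\<phi> p)) (M - A))" if "good p" for p
    proof -
      have 1: "coeff (theta (\<phi> p)) M = coeff (\<i> \<cdot> eul (\<phi> p) + \<i> \<cdot> (du (\<phi> p) * theta (\<phi> p))) M"
        using theta_eq[OF 0[OF that]] by (simp add: mult.commute)
      have 2: "coeff (du (\<phi> p) * theta (\<phi> p)) M =
          (\<Sum>A | A \<subseteq># M \<and> A \<noteq> {#}. coeff (du (\<phi> p)) A * coeff (theta (\<phi> p)) (M - A))"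
        unfolding coeff_times using 0[OF that]
        by (intro sum.mono_neutral_right) (auto simp: coeff_mderiv)
      show ?thesis unfolding 1 by (simp add: 2)
    qed
    moreover have "uni (\<lambda>p. \<i> * coeff (eul (\<phi> p)) M +
       \<i> * (\<Sum>A | A \<subseteq># M \<and> A \<noteq> {#}. coeff (du (\<phi> p)) A * coeff (theta (\<phi> p)) (M - A)))"
    proof (intro uni_add uni_mult uni_const uni_sum)
      show "uni (\<lambda>p. coeff (eul (\<phi> p)) M)" by (rule useriesD[OF useries_eul[OF \<phi>]])
      show "uni (\<lambda>p. coeff (du (\<phi> p)) A)" for A by (rule useriesD[OF useries_mderiv[OF \<phi>]])
      show "uni (\<lambda>p. coeff (theta (\<phi> p)) (M - A))" if "A \<in> {A. A \<subseteq># M \<and> A \<noteq> {#}}" for A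
        using that less[of "M - A"]
        by (auto simp: size_Diff_submset nonempty_has_size intro: diff_less dest: size_mset_mono)
    qed
    ultimately show ?case by (rule uni_cong)
  qed
qed

text \<open>A coefficient of the fixed point is the coefficient of an iterate whose number depends
  on the monomial alone. It thus arises by finitely many operations, the same for all
  parameters.\<close>

lemma useries_fixpoint:
  fixes \<omega> :: "'v \<Rightarrow> nat"
  assumes contr: "\<And>p. good p \<Longrightarrow> contraction \<omega> w B (x0 p) (\<Phi> p)"
    and x0: "\<And>i. useries (\<lambda>p. x0 p i)"
    and step: "\<And>x i. (\<And>i. useries (\<lambda>p. x p i)) \<Longrightarrow> (\<And>p. good p \<Longrightarrow> coincide B (x p) (x0 p)) \<Longrightarrow> useries (\<lambda>p. \<Phi> p (x p) i)"
    and fp: "\<And>p. good p \<Longrightarrow> coincide B (x p) (x0 p) \<and> \<Phi> p (x p) = x p"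
  shows "useries (\<lambda>p. x p i)"
proof -
  have it: "useries (\<lambda>p. ((\<Phi> p ^^ k) (x0 p)) i)" for k :: nat and i
  proof (induction k arbitrary: i)
    case (Suc k)
    have "useries (\<lambda>p. \<Phi> p ((\<Phi> p ^^ k) (x0 p)) i)"
      by (rule step) (rule Suc.IH, rule coincide_iterate[OF contr])
    then show ?case by simp
  qed (simp add: x0)
  show ?thesis
    unfolding useries_def
  proof
    fix M :: "'v multiset"
    let ?k = "Suc (wt \<omega> M)"
    have "coeff (x p i) M = coeff (((\<Phi> p ^^ ?k) (x0 p)) i) M" if "good p" for p
      using contraction_iterate[OF contr[OF that], where x = "x p" and k = ?k and i = i] fp[OF that] by (auto simp: wge_def)
    then show "uni (\<lambda>p. coeff (x p i) M)"
      using useriesD[OF it[of ?k i], of M] by (rule uni_cong)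
  qed
qed

subsection \<open>Universality of the normalization\<close>

lemma good_problem:
  assumes "good p"
  shows "nonlinear_problem (cc (fst p)) (dc (fst p)) (Nc (fst p)) (Pc (fst p)) (Qc (fst p)) (Ac (fst p)) (bc (fst p))
    (\<lambda>j k. Lzb (fst p) $ j $ k) (\<lambda>k. Lw (fst p) $ k)"
  using assms by (intro nonlinear_problem) (auto simp: good_def)

lemma good_locales:
  assumes "good p"
  shows "levi_tensors (cc (fst p)) (dc (fst p)) (Nc (fst p))"
    "strong_levi_tensors (cc (fst p)) (dc (fst p)) (Nc (fst p)) (Pc (fst p)) (Qc (fst p))"
    "linear_problem (cc (fst p)) (dc (fst p)) (Nc (fst p)) (Pc (fst p)) (Qc (fst p)) (Ac (fst p)) (bc (fst p))"
  using good_problem[OF assms]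
  by (simp_all add: nonlinear_problem_def linear_problem_def strong_levi_tensors_def)

lemmas lt = good_locales(1) and sl = good_locales(2) and lp = good_locales(3) and np = good_problem

lemma uni_of_real: "uni (\<lambda>p. of_real (snd p))"
  using uni_jet[of Param] by simp

lemma useries_Lzb: "useries (\<lambda>p. Lzb (fst p) $ j $ k)"
  and useries_Lw: "useries (\<lambda>p. Lw (fst p) $ k)"
proof -
  have c: "coeff q M = deriv0 M q / (\<Prod>v\<in>set_mset M. fact (count M v))" for q :: "'n cseries" and M
  proof -
    have "(\<Prod>v\<in>set_mset M. fact (count M v)) \<noteq> (0 :: complex)" by simp
    then show ?thesis by (simp add: deriv0_def)
  qed
  show "useries (\<lambda>p. Lzb (fst p) $ j $ k)"
    unfolding useries_def c using uni_jet[of "DLzb j k _"] by (simp add: uni_divide_const)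
  show "useries (\<lambda>p. Lw (fst p) $ k)"
    unfolding useries_def c using uni_jet[of "DLw k _"] by (simp add: uni_divide_const)
qed

lemma useries_if: "useries f \<Longrightarrow> useries g \<Longrightarrow> useries (\<lambda>p. if b then f p else g p)"
  by (cases b) simp_all

lemmas uni_intros = uni_const uni_of_real uni_cc uni_Nc uni_Ac uni_bc uni_dc uni_Pc uni_Qc
  uni_add uni_minus uni_diff uni_mult uni_divide_const uni_cnj

lemmas us = useries_const useries_add useries_diff useries_minus useries_csmul useries_mult useries_sum
  useries_sconj useries_mderiv useries_pr useries_eul useries_intu useries_imp useries_rep
  useries_Lzb useries_Lw

lemma useries_bil:
  "(\<And>j k. uni (\<lambda>p. M p j k)) \<Longrightarrow> (\<And>j. useries (\<lambda>p. x p j)) \<Longrightarrow> (\<And>k. useries (\<lambda>p. y p k)) \<Longrightarrow>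
     useries (\<lambda>p. bil (M p) (x p) (y p))"
  unfolding bil_def by (intro us)

lemma useries_h: "useries (\<lambda>p. levi_tensors.h (cc (fst p)))"
  by (rule useries_cong, rule levi_tensors.h_def[OF lt], assumption) (intro us uni_intros)

lemma useries_lev: "(\<And>k. useries (\<lambda>p. v p k)) \<Longrightarrow> useries (\<lambda>p. levi_tensors.lev (cc (fst p)) (v p))"
  by (rule useries_cong, rule levi_tensors.lev_def[OF lt], assumption) (intro us uni_intros)

lemma useries_be: "(\<And>k. useries (\<lambda>p. v p k)) \<Longrightarrow> useries (\<lambda>p. levi_tensors.be (Nc (fst p)) (v p))"
  by (rule useries_cong, rule levi_tensors.be_def[OF lt], assumption) (intro us uni_intros)

lemma useries_unlev: "useries q \<Longrightarrow> useries (\<lambda>p. levi_tensors.unlev (dc (fst p)) (q p) k)"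
  by (rule useries_cong, rule levi_tensors.unlev_def[OF lt], assumption) (intro us uni_intros)

lemma useries_trc: "useries q \<Longrightarrow> useries (\<lambda>p. levi_tensors.trc (dc (fst p)) (q p))"
  by (rule useries_cong, rule levi_tensors.trc_def[OF lt], assumption) (intro us uni_intros)

lemma useries_D: "useries q \<Longrightarrow> useries (\<lambda>p. levi_tensors.D (cc (fst p)) (q p))"
  by (rule useries_cong, rule levi_tensors.D_def[OF lt], assumption) (intro us uni_intros useries_h)

lemma useries_phi:
  "(\<And>k. useries (\<lambda>p. F p k)) \<Longrightarrow> useries W \<Longrightarrow> useries (\<lambda>p. levi_tensors.phi (cc (fst p)) (F p) (W p))"
  by (rule useries_cong, rule levi_tensors.phi_def[OF lt], assumption) (intro us useries_lev)

lemma useries_Dsol: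
  assumes "useries X" "useries R"
  shows "useries (\<lambda>p. levi_tensors.Dsol (cc (fst p)) (X p) (R p))"
proof (rule useries_cong, rule levi_tensors.Dsol_def[OF lt], assumption)
  have "useries (\<lambda>p. levi_tensors.Dstep (cc (fst p)) (X p) (R p) a)" for a
  proof (induction a)
    case 0
    show ?case by (rule useries_cong, rule levi_tensors.Dstep.simps(1)[OF lt], assumption) (rule assms)
  next
    case (Suc a)
    show ?case
      by (rule useries_cong, rule levi_tensors.Dstep.simps(2)[OF lt], assumption)
        (intro us uni_intros useries_h assms Suc)
  qed
  then show "useries (\<lambda>p. Mps (\<lambda>M. coeff (levi_tensors.Dstep (cc (fst p)) (X p) (R p) (zd M)) M))"
    by (rule useries_Mps)
qed

lemmas us1 = useries_h useries_lev useries_be useries_unlev useries_trc useries_D useries_phi useries_Dsol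

lemma useries_rsol: "useries \<Phi> \<Longrightarrow> useries (\<lambda>p. strong_levi_tensors.\<rho>sol (cc (fst p)) (dc (fst p)) (\<Phi> p) (snd p))"
  by (rule useries_cong, rule strong_levi_tensors.\<rho>sol_def[OF sl], assumption) (intro us us1 uni_intros)

lemma useries_Ysol: "useries \<Phi> \<Longrightarrow> useries (\<lambda>p. strong_levi_tensors.Ysol (cc (fst p)) (dc (fst p)) (\<Phi> p))"
  by (rule useries_cong, rule strong_levi_tensors.Ysol_def[OF sl], assumption) (intro us us1 uni_intros)

lemma useries_Bsol: "useries \<Phi> \<Longrightarrow> useries (\<lambda>p. strong_levi_tensors.Bsol (cc (fst p)) (dc (fst p)) (\<Phi> p))"
  by (rule useries_cong, rule strong_levi_tensors.Bsol_def[OF sl], assumption) (intro us us1 uni_intros useries_Ysol)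

lemma useries_form0: "useries \<Phi> \<Longrightarrow> useries (\<lambda>p. strong_levi_tensors.form0 (cc (fst p)) (dc (fst p)) (\<Phi> p) k)"
  by (rule useries_cong, rule strong_levi_tensors.form0_def[OF sl], assumption) (intro us us1 uni_intros)

lemma useries_psol:
  assumes \<Phi>: "useries \<Phi>"
  shows "useries (\<lambda>p. strong_levi_tensors.psol (cc (fst p)) (dc (fst p)) (Nc (fst p)) (Pc (fst p)) (Qc (fst p)) (\<Phi> p) (snd p) a k)"
proof (induction a arbitrary: k rule: less_induct)
  case (less a)
  consider "a = 0" | "a = Suc 0" | a' where "a = Suc (Suc a')" by (metis not0_implies_Suc)
  then show ?case
  proof cases
    case 1
    show ?thesis unfolding 1
      by (rule useries_cong, subst strong_levi_tensors.psol.simps(1)[OF sl], assumption, rule refl)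
        (intro us uni_intros useries_form0 \<Phi>)
  next
    case 2
    show ?thesis unfolding 2
      by (rule useries_cong, subst strong_levi_tensors.psol.simps(2)[OF sl], assumption, rule refl)
        (intro us us1 uni_intros useries_rsol useries_Bsol \<Phi>)
  next
    case (3 a')
    have IH: "useries (\<lambda>p. strong_levi_tensors.psol (cc (fst p)) (dc (fst p)) (Nc (fst p)) (Pc (fst p)) (Qc (fst p)) (\<Phi> p) (snd p) a' k)"
      "useries (\<lambda>p. strong_levi_tensors.psol (cc (fst p)) (dc (fst p)) (Nc (fst p)) (Pc (fst p)) (Qc (fst p)) (\<Phi> p) (snd p) 0 k)" for k
      using less 3 by simp_all
    show ?thesis unfolding 3
      by (rule useries_cong, subst strong_levi_tensors.psol.simps(3)[OF sl], assumption, rule refl)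
        (intro us us1 useries_if uni_intros \<Phi> IH)
  qed
qed

lemma useries_wsol:
  assumes \<Phi>: "useries \<Phi>"
  shows "useries (\<lambda>p. strong_levi_tensors.wsol (cc (fst p)) (dc (fst p)) (Nc (fst p)) (Pc (fst p)) (Qc (fst p)) (\<Phi> p) (snd p) b)"
proof (cases b)
  case 0
  show ?thesis unfolding 0
    by (rule useries_cong, rule strong_levi_tensors.wsol.simps(1)[OF sl], assumption)
      (intro us uni_intros useries_rsol \<Phi>)
next
  case (Suc a)
  show ?thesis unfolding Suc
    by (rule useries_cong, rule strong_levi_tensors.wsol.simps(2)[OF sl], assumption)
      (intro us us1 useries_if uni_intros \<Phi> useries_psol)
qed

lemma useries_hF:
  assumes \<Phi>: "useries \<Phi>"
  shows "useries (\<lambda>p. strong_levi_tensors.hF (cc (fst p)) (dc (fst p)) (Nc (fst p)) (Pc (fst p)) (Qc (fst p)) (\<Phi> p) (snd p) k)"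
  by (rule useries_cong, rule strong_levi_tensors.hF_def[OF sl], assumption)
    (intro us us1 useries_Mps[where g = zd and q = "\<lambda>p a. strong_levi_tensors.psol (cc (fst p)) (dc (fst p)) (Nc (fst p)) (Pc (fst p)) (Qc (fst p)) (\<Phi> p) (snd p) a k"] useries_psol \<Phi>)

lemma useries_hW:
  assumes \<Phi>: "useries \<Phi>"
  shows "useries (\<lambda>p. strong_levi_tensors.hW (cc (fst p)) (dc (fst p)) (Nc (fst p)) (Pc (fst p)) (Qc (fst p)) (\<Phi> p) (snd p))"
  by (rule useries_cong, rule strong_levi_tensors.hW_def[OF sl], assumption)
    (intro us us1 useries_Mps[where g = zbd and q = "\<lambda>p. strong_levi_tensors.wsol (cc (fst p)) (dc (fst p)) (Nc (fst p)) (Pc (fst p)) (Qc (fst p)) (\<Phi> p) (snd p)"] useries_wsol useries_hF \<Phi>)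

lemma uni_as: "uni (\<lambda>p. linear_problem.as (Ac (fst p)) j k)"
  by (rule uni_cong, rule linear_problem.as_def[OF lp], assumption) (intro uni_intros)

lemma uni_bh: "uni (\<lambda>p. linear_problem.bh (bc (fst p)) j k)"
  by (rule uni_cong, rule linear_problem.bh_def[OF lp], assumption) (intro uni_intros)

lemma useries_al: "(\<And>k. useries (\<lambda>p. F p k)) \<Longrightarrow> useries (\<lambda>p. linear_problem.al (Ac (fst p)) (bc (fst p)) (F p))"
  by (rule useries_cong, rule linear_problem.al_def[OF lp], assumption)
    (intro us useries_bil uni_as uni_bh)

lemma useries_Yop: "(\<And>k. useries (\<lambda>p. F p k)) \<Longrightarrow> useries (\<lambda>p. linear_problem.Yop (cc (fst p)) (Ac (fst p)) (bc (fst p)) (F p))"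
  by (rule useries_cong, rule linear_problem.Yop_def[OF lp], assumption)
    (intro us us1 uni_intros useries_al)

lemma useries_Bop: "(\<And>k. useries (\<lambda>p. F p k)) \<Longrightarrow> useries (\<lambda>p. linear_problem.Bop (Ac (fst p)) (bc (fst p)) (F p))"
  by (rule useries_cong, rule linear_problem.Bop_def[OF lp], assumption)
    (intro us useries_bil uni_intros uni_as)

lemma useries_F0sol:
  "(\<And>k. useries (\<lambda>p. R p k)) \<Longrightarrow> useries (\<lambda>p. linear_problem.F0sol (cc (fst p)) (R p) k)"
  by (rule useries_cong, rule linear_problem.F0sol_def[OF lp], assumption) (intro us us1)

lemma useries_W0sol:
  "(\<And>k. useries (\<lambda>p. R p k)) \<Longrightarrow> useries R' \<Longrightarrow>
    useries (\<lambda>p. linear_problem.W0sol (cc (fst p)) (Nc (fst p)) (Ac (fst p)) (bc (fst p)) (R p) (R' p))"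
  by (rule useries_cong, rule linear_problem.W0sol_def[OF lp], assumption)
    (intro us us1 useries_F0sol useries_Bop)

lemma useries_Fsol:
  "(\<And>k. useries (\<lambda>p. R p k)) \<Longrightarrow> useries R' \<Longrightarrow>
    useries (\<lambda>p. linear_problem.Fsol (cc (fst p)) (dc (fst p)) (Nc (fst p)) (Pc (fst p)) (Qc (fst p)) (Ac (fst p)) (bc (fst p)) (R p) (R' p) (snd p) k)"
  by (rule useries_cong, rule linear_problem.Fsol_def[OF lp], assumption)
    (intro us us1 useries_F0sol useries_W0sol useries_hF)

lemma useries_Wsol:
  "(\<And>k. useries (\<lambda>p. R p k)) \<Longrightarrow> useries R' \<Longrightarrow>
    useries (\<lambda>p. linear_problem.Wsol (cc (fst p)) (dc (fst p)) (Nc (fst p)) (Pc (fst p)) (Qc (fst p)) (Ac (fst p)) (bc (fst p)) (R p) (R' p) (snd p))"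
  by (rule useries_cong, rule linear_problem.Wsol_def[OF lp], assumption)
    (intro us us1 useries_F0sol useries_W0sol useries_hW useries_Yop useries_Fsol)

context
  fixes F :: "'n::finite cr_rep \<times> real \<Rightarrow> 'n \<Rightarrow> 'n cseries" and W :: "'n cr_rep \<times> real \<Rightarrow> 'n cseries"
  assumes F: "\<And>k. useries (\<lambda>p. F p k)" and W: "useries W"
    and W0: "\<And>p. good p \<Longrightarrow> coeff (imp (W p)) {#U#} = 0"
begin

lemma useries_th: "useries (\<lambda>p. theta (imp (W p)))"
  by (rule useries_theta) (intro us W, rule W0)

lemma useries_V: "useries (\<lambda>p. nonlinear_problem.V (W p) (F p k))"
  by (rule useries_cong, rule nonlinear_problem.V_def[OF np], assumption) (intro us useries_th F)

lemma useries_defect: "useries (\<lambda>p. nonlinear_problem.defect (cc (fst p)) (W p))"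
  by (rule useries_cong, rule nonlinear_problem.defect_def[OF np], assumption) (intro us uni_intros useries_th useries_h)

lemma useries_S: "useries (\<lambda>p. nonlinear_problem.S (F p) (W p) v)"
proof (rule useries_cong, subst nonlinear_problem.S_def[OF np], assumption, rule refl)
  show "useries (\<lambda>p. shift (\<chi> k. F p k) (rep (W p)) v)"
    by (cases v) (simp_all, (intro us F W)+)
qed

lemma useries_quad: "useries (\<lambda>p. nonlinear_problem.quad (Ac (fst p)) (bc (fst p)) (\<lambda>k. Lw (fst p) $ k) k)"
  by (rule useries_cong, rule nonlinear_problem.quad_def[OF np], assumption) (intro us uni_intros)

lemma useries_R1: "useries (\<lambda>p. nonlinear_problem.R1 (cc (fst p)) (\<lambda>j k. Lzb (fst p) $ j $ k) (F p) (W p) j)"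
  by (rule useries_cong, rule nonlinear_problem.R1_def[OF np], assumption)
    (intro us useries_defect useries_msubst useries_S useries_V F)

lemma useries_R0: "useries (\<lambda>p :: 'n cr_rep \<times> real. nonlinear_problem.R0 (Ac (fst p)) (bc (fst p)))"
  by (rule useries_cong, rule nonlinear_problem.R0_def[OF np], assumption) (intro us useries_bil uni_intros)

lemma useries_R3: "useries (\<lambda>p. nonlinear_problem.R3 (cc (fst p)) (Ac (fst p)) (bc (fst p)) (\<lambda>k. Lw (fst p) $ k) (F p) (W p))"
  by (rule useries_cong, rule nonlinear_problem.R3_def[OF np], assumption)
    (intro us useries_bil uni_intros useries_defect useries_msubst useries_S useries_V useries_quad F W)

end

lemma useries_W2: "useries (\<lambda>p. nonlinear_problem.W2 (Ac (fst p)) (bc (fst p)))"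
  by (rule useries_cong, rule nonlinear_problem.W2_def[OF np], assumption) (intro us useries_bil uni_intros)

lemma useries_pack: "(\<And>k. useries (\<lambda>p. F p k)) \<Longrightarrow> useries W \<Longrightarrow> useries (\<lambda>p. pack (F p) (W p) v)"
  by (cases v) (simp_all add: useries_const)

lemma useries_nsol:
  fixes v :: "'n::finite crvar"
  shows "useries (\<lambda>p. nsol (fst p) (snd p) v)"
proof (rule useries_fixpoint)
  let ?x0 = "\<lambda>p :: 'n cr_rep \<times> real. pack (\<lambda>_. 0) (nonlinear_problem.W2 (Ac (fst p)) (bc (fst p)))"
  let ?step = "\<lambda>p :: 'n cr_rep \<times> real. nonlinear_problem.step (cc (fst p)) (dc (fst p)) (Nc (fst p)) (Pc (fst p)) (Qc (fst p))
       (Ac (fst p)) (bc (fst p)) (\<lambda>j k. Lzb (fst p) $ j $ k) (\<lambda>k. Lw (fst p) $ k) (snd p)"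
  show "contraction cw start_weight start_monomials (?x0 p) (?step p)" if "good p" for p
    by (rule nonlinear_problem.contraction_step[OF np[OF that]])
  show "useries (\<lambda>p. ?x0 p i)" for i
    by (intro useries_pack useries_const useries_W2)
  show "coincide start_monomials (nsol (fst p) (snd p)) (?x0 p) \<and> ?step p (nsol (fst p) (snd p)) = nsol (fst p) (snd p)" if "good p" for p
    using nsol[of "fst p" "snd p"] that by (simp add: good_def)
  fix x :: "'n cr_rep \<times> real \<Rightarrow> 'n crvar \<Rightarrow> 'n cseries" and i
  assume x: "\<And>i. useries (\<lambda>p. x p i)" and C: "\<And>p. good p \<Longrightarrow> coincide start_monomials (x p) (?x0 p)"
  \<comment> \<open>In the domain the term u is absent from \<open>imp\<close>, so the series
    inverted in \<open>theta\<close> has constant term 1 and causes no denominator.\<close>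
  have W0: "coeff (imp (x p U)) {#U#} = 0" if "good p" for p
  proof -
    have "nonlinear_problem.dom (Ac (fst p)) (bc (fst p)) (\<lambda>k. x p (Z k)) (x p U)"
      using C[OF that] nonlinear_problem.coincide_iff_dom[OF np[OF that]] by blast
    then show ?thesis
      using nonlinear_problem.imp_mild(2)[OF np[OF that] nonlinear_problem.dom_mild[OF np[OF that]]] by blast
  qed
  show "useries (\<lambda>p. ?step p (x p) i)"
    by (rule useries_cong, subst nonlinear_problem.step_def[OF np], assumption, rule refl)
      (unfold Let_def, intro useries_pack useries_Fsol useries_Wsol useries_add
        useries_R1[where F = "\<lambda>p k. x p (Z k)" and W = "\<lambda>p. x p U"]
        useries_R3[where F = "\<lambda>p k. x p (Z k)" and W = "\<lambda>p. x p U"]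
        useries_R0[where F = "\<lambda>p k. x p (Z k)" and W = "\<lambda>p. x p U"] x W0)
qed

text \<open>The return from the inverse map to the normalizing map preserves universality, again
  because it is a fixed point of universal operations.\<close>

lemma useries_inv_map:
  fixes s :: "'n::finite cr_rep \<times> real \<Rightarrow> 'v::finite \<Rightarrow> 'v mps"
  assumes s: "\<And>v. useries (\<lambda>p. s p v)" and t: "\<And>p. good p \<Longrightarrow> tangent (s p)"
  shows "useries (\<lambda>p. inv_map (s p) v)"
proof (rule useries_fixpoint)
  show "contraction deg (\<lambda>_. 1) (\<lambda>_. {M. size M < 1}) mvar (inv_step (s p))" if "good p" for p
    by (rule contraction_inv_step[OF t[OF that]])
  show "useries (\<lambda>p. mvar i)" for i :: 'v by (rule useries_const)
  show "coincide (\<lambda>_. {M. size M < 1}) (inv_map (s p)) mvar \<and> inv_step (s p) (inv_map (s p)) = inv_map (s p)" if "good p" for p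
    using inv_map_fixpoint[OF t[OF that]] by simp
  show "useries (\<lambda>p. inv_step (s p) (x p) i)" if "\<And>i. useries (\<lambda>p. x p i)" for x :: "'n cr_rep \<times> real \<Rightarrow> 'v \<Rightarrow> 'v mps" and i
    unfolding inv_step_def by (intro useries_diff useries_const useries_msubst s that)
qed

definition normF :: "'n::finite cr_rep \<times> real \<Rightarrow> 'n cseries ^ 'n" where
  "normF p = (\<chi> k. nsol (fst p) (snd p) (Z k))"

definition normG :: "'n::finite cr_rep \<times> real \<Rightarrow> 'n cseries" where
  "normG p = rep (nsol (fst p) (snd p) U)"

lemma normalizing_iff_norm:
  assumes "good (L, r)"
  shows "normalizing L r f g \<phi> \<longleftrightarrow> f = cinv (normF (L, r)) (normG (L, r)) \<and>
     g = rinv (normF (L, r)) (normG (L, r)) \<and> \<phi> = imp (nsol L r U)"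
  using normalizing_iff_nsol[of L r f g \<phi>] assms by (simp add: good_def normF_def normG_def)

lemma admissible_norm:
  assumes "good p"
  shows "admissible (normF p) (normG p)"
proof -
  have "nonlinear_problem.solution (cc (fst p)) (dc (fst p)) (Ac (fst p)) (bc (fst p)) (\<lambda>j k. Lzb (fst p) $ j $ k) (\<lambda>k. Lw (fst p) $ k) (snd p)
      (\<lambda>k. nsol (fst p) (snd p) (Z k)) (nsol (fst p) (snd p) U)"
    using solution_nsol[of "fst p" "snd p"] assms by (simp add: good_def)
  note s = this[unfolded nonlinear_problem.solution_def[OF np[OF assms]]]
  have F: "wge deg 2 (nsol (fst p) (snd p) (Z k))" for k
    using s by (elim conjE allE)
  have W: "wge deg 2 (nsol (fst p) (snd p) U)"
    using s by (elim conjE)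
  have "wge deg 2 (sconj (nsol (fst p) (snd p) U))"
    using W by (simp add: wge_sconj)
  then have "wge deg 2 (rep (nsol (fst p) (snd p) U))"
    unfolding rep_def using W by (intro wge_csmul wge_add)
  then show ?thesis
    using F by (simp add: admissible_def normF_def normG_def real_series_def)
qed

lemma universal_norm:
  "uni (\<lambda>p. deriv0 M (cinv (normF p) (normG p) $ j))" "uni (\<lambda>p. deriv0 M (rinv (normF p) (normG p)))"
  "uni (\<lambda>p. deriv0 M (imp (nsol (fst p) (snd p) U)))"
proof -
  have d: "uni (\<lambda>p. deriv0 M (q p))" if "useries q" for q
    unfolding deriv0_def by (intro uni_mult uni_const useriesD[OF that])
  have s: "useries (\<lambda>p. shift (normF p) (normG p) v)" for v :: "'a crvar"
    by (cases v) (simp_all add: normF_def normG_def useries_add useries_const useries_sconj useries_rep useries_nsol)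
  have i: "useries (\<lambda>p. inv_map (shift (normF p) (normG p)) v)" for v :: "'a crvar"
    by (rule useries_inv_map[OF s]) (rule tangent_shift[OF admissible_norm])
  show "uni (\<lambda>p. deriv0 M (cinv (normF p) (normG p) $ j))"
    by (rule d) (simp add: cinv_def useries_diff useries_const i)
  show "uni (\<lambda>p. deriv0 M (rinv (normF p) (normG p)))"
    by (rule d) (simp add: rinv_def useries_diff useries_const i)
  show "uni (\<lambda>p. deriv0 M (imp (nsol (fst p) (snd p) U)))"
    by (rule d) (intro useries_imp useries_nsol)
qed

text \<open>By uniqueness every normalization of a good structure is the constructed one, for which
  a single fraction is available.\<close>

lemma universalI:
  assumes F: "uni (\<lambda>p. F (cinv (normF p) (normG p)) (rinv (normF p) (normG p)) (imp (nsol (fst p) (snd p) U)))"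
  shows "universal F"
proof -
  obtain a q where a: "polyf jet a" and q: "denom q"
    and eq: "\<And>p. good p \<Longrightarrow> F (cinv (normF p) (normG p)) (rinv (normF p) (normG p)) (imp (nsol (fst p) (snd p) U)) = a p / q p"
    using F unfolding uni_def by auto
  obtain P Q where P: "\<And>p. a p = poly_eval P (jet p)" and Q: "\<And>p. q p = poly_eval Q (ten p)"
    using polyf_poly_eval[OF a] polyf_poly_eval[of ten q] q unfolding denom_def by blast
  show ?thesis
    unfolding universal_def
  proof (intro exI[of _ P] exI[of _ Q] conjI allI impI)
    fix L :: "'a cr_rep" assume L: "almost_cr L" "strongly_nondegenerate L"
    then have g: "good (L, r)" for r by (simp add: good_def)
    show "poly_eval Q (tensor_value L) \<noteq> 0"
      using q Q[of "(L, 0)"] g[of 0] unfolding denom_def by (metis fst_conv)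
    fix r f g' \<phi> assume "normalizing L r f g' \<phi>"
    then show "F f g' \<phi> = poly_eval P (jet_value L r) / poly_eval Q (tensor_value L)"
      using eq[OF g[of r]] unfolding normalizing_iff_norm[OF g[of r]] P Q by simp
  qed
qed

theorem theorem8p1:
  shows "(\<forall>(L :: 'n::finite cr_rep) (r :: real).
            almost_cr L \<longrightarrow> strongly_nondegenerate L \<longrightarrow>
              (\<exists>!t. case t of (f, g, \<phi>) \<Rightarrow> normalizing L r f g \<phi>)) \<and>
         (\<forall>M :: 'n crvar multiset.
            (\<forall>j. universal (\<lambda>f (g :: 'n cseries) (\<phi> :: 'n cseries). deriv0 M (f $ j))) \<and>
            universal (\<lambda>(f :: 'n cseries ^ 'n) g (\<phi> :: 'n cseries). deriv0 M g) \<and>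
            universal (\<lambda>(f :: 'n cseries ^ 'n) (g :: 'n cseries) \<phi>. deriv0 M \<phi>))"
  by (intro conjI allI impI unique_normalization universalI universal_norm)

end
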